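(* Let $f(t)\in\mathbb{Z}[t,t^{-1}]$ be a Laurent polynomial. Then the following are equivalent. (i) There exists a long virtual knot $K$ with $F_{00}(K;t)=f(t)$. (ii) There exists a long virtual knot $K'$ with $F_{00}(K';t)=f(t)$ and $sg_1(K')\le 1$. (iii) $f(1)=0$ and $f(t)=f(t^{-1})$. The same equivalence holds with $F_{00}$ replaced by each of $F_{11}$, $H_{00}$, and $H_{11}$.
   Context: Long virtual knots. A long virtual knot diagram is an oriented immersed line in $\mathbb{R}^2$ that coincides with the $x$-axis outside a $2$-disk (oriented from $-\infty$ to $\infty$), each of whose double points is either a real crossing (with over/under information) or a virtual crossing. A long virtual knot is an equivalence class of such diagrams under the generalized (real, virtual and mixed) Reidemeister moves performed inside a $2$-disk. Let $\Sigma_g$ be a connected oriented closed surface of genus $g$. A surface realization $(\Sigma_g,D)$ of a diagram $D$ is an oriented closed-curve diagram with a basepoint on $\Sigma_g$, having only real crossings, such that traversing it from the basepoint one meets the same real crossings, in the same order and with the same over/under information and signs, as when traversing $D$ from $-\infty$ to $\infty$. A surface realization of $K$ is a surface realization of some diagram of $K$. The $1$-supporting genus is $sg_1(K)=\min\{g\mid(\Sigma_g,D)\text{ is a surface realization of }K\}$. Polynomials. Let $c_1,\dots,c_n$ be the real crossings of a diagram $D$ of $K$, with signs $\varepsilon_i\in\{\pm1\}$. Call $c_i$ of type $0$ if, traversing $D$ from $-\infty$, one passes $c_i$ first over and then under; otherwise of type $1$. Put $I_a(D)=\{i\mid c_i\text{ is of type }a\}$ and $\omega_a(D)=\sum_{i\in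 I_a(D)}\varepsilon_i$ for $a\in\{0,1\}$. On a surface realization $(\Sigma_g,D)$, orientation-respecting smoothing at $c_i$ yields two cycles; $\alpha_i$ is the one not containing the basepoint and $\beta_i$ the one containing it. A dot denotes the intersection number of cycles on $\Sigma_g$ (with a fixed standard sign convention). The following are invariants of $K$, for $a,b\in\{0,1\}$: $W_a(K;t)=\sum_{i\in I_a(D)}\varepsilon_i(t^{\alpha_i\cdot\beta_i}-1)$; $F_{ab}(K;t)=\sum_{i\in I_a(D),\,j\in I_b(D)}\varepsilon_i\varepsilon_j(t^{\alpha_i\cdot\alpha_j}-1)$; $H_{ab}(K;t)=\sum_{i\in I_a(D),\,j\in I_b(D)}\varepsilon_i\varepsilon_j(t^{\beta_i\cdot\beta_j}-1)-\omega_a(D)\,W_b(K;t)-\omega_b(D)\,W_a(K;t^{-1})$. *)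

theory Defs
  imports
    "HOL-Analysis.Analysis"
    "HOL-Library.Poly_Mapping"
    "HOL-Combinatorics.Orbits"
begin

section \<open>Long virtual knot diagrams in the plane\<close>

text \<open>
  The plane is the type of complex numbers. At a double point both parameters carry a label;
  labels at other parameters are irrelevant.
\<close>

datatype passage = Over | Under | Virtual

datatype long_diagram = Long_Diagram (curve: "real \<Rightarrow> complex") (passage: "real \<Rightarrow> passage")

definition double :: "long_diagram \<Rightarrow> real \<Rightarrow> real \<Rightarrow> bool" where
  "double D s t \<longleftrightarrow> s \<noteq> t \<and> curve D s = curve D t"

text \<open>The determinant of the velocity vectors at the parameters \<open>s\<close> and \<open>t\<close>.\<close>

definition vel_det :: "long_diagram \<Rightarrow> real \<Rightarrow> real \<Rightarrow> real" where
  "vel_det D s t =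
     Im (cnj (vector_derivative (curve D) (at s)) * vector_derivative (curve D) (at t))"

text \<open>
  Immersed means locally injective, and differentiability is required only at the double
  points, where the two strands have to cross transversally. Smooth and polygonal diagrams are
  both covered; as all arcs in the plane are tame, every diagram is equivalent to a smooth one.
\<close>

definition is_long_diagram :: "long_diagram \<Rightarrow> bool" where
  "is_long_diagram D \<longleftrightarrow>
     continuous_on UNIV (curve D) \<and>
     (\<exists>R>0. \<forall>t. R \<le> \<bar>t\<bar> \<longrightarrow> curve D t = of_real t) \<and>
     (\<forall>t. \<exists>e>0. inj_on (curve D) {t - e<..<t + e}) \<and>
     finite {(s, t). double D s t} \<and>
     (\<forall>s t u. double D s t \<and> double D s u \<longrightarrow> t = u) \<and>
     (\<forall>s t. double D s t \<longrightarrow>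
        curve D differentiable (at s) \<and> vel_det D s t \<noteq> 0 \<and>
        (passage D s, passage D t) \<in> {(Over, Under), (Under, Over), (Virtual, Virtual)})"

definition real_crossings :: "long_diagram \<Rightarrow> (real \<times> real) set" where
  "real_crossings D = {(s, t). s < t \<and> double D s t \<and> passage D s \<noteq> Virtual}"

definition sign_of :: "real \<Rightarrow> int" where
  "sign_of x = (if 0 < x then 1 else -1)"

text \<open>
  A real crossing is positive if (over direction, under direction) is a positive frame.
\<close>

definition crossing_sign :: "long_diagram \<Rightarrow> real \<times> real \<Rightarrow> int" where
  "crossing_sign D = (\<lambda>(s, t).
     if passage D s = Over then sign_of (vel_det D s t) else sign_of (vel_det D t s))"


section \<open>Generalized Reidemeister moves and long virtual knots\<close>

text \<open>
  Planar isotopy and change of parameter. A homeomorphism of the plane that is the identity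
  outside a disk is isotopic to the identity through such homeomorphisms (Alexander trick), so
  no isotopy is mentioned. It preserves orientation; as signs are defined through velocities,
  the last conjunct spells out that the frames at the double points keep their orientation.
\<close>

definition isotopic :: "long_diagram \<Rightarrow> long_diagram \<Rightarrow> bool" where
  "isotopic D D' \<longleftrightarrow> (\<exists>h h' \<phi>.
     homeomorphism UNIV UNIV h h' \<and> (\<exists>R. \<forall>z. R \<le> cmod z \<longrightarrow> h z = z) \<and>
     strict_mono \<phi> \<and> surj \<phi> \<and> curve D' = h \<circ> curve D \<circ> \<phi> \<and>
     (\<forall>s t. double D' s t \<longrightarrow>
        passage D' s = passage D (\<phi> s) \<and>
        sgn (vel_det D' s t) = sgn (vel_det D (\<phi> s) (\<phi> t))))"

text \<open>
  \<open>local_change arcs D D'\<close>: the two diagrams agree outside a closed disk \<open>B\<close>, and each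
  of them meets \<open>B\<close> exactly in the proper arcs parametrized by the intervals in \<open>arcs\<close>, with
  no double point on the boundary of \<open>B\<close>. The intervals may be listed in any order.
\<close>

definition open_arc :: "real \<times> real \<Rightarrow> real set" where
  "open_arc p = {fst p<..<snd p}"

definition closed_arc :: "real \<times> real \<Rightarrow> real set" where
  "closed_arc p = {fst p..snd p}"

definition local_change :: "(real \<times> real) list \<Rightarrow> long_diagram \<Rightarrow> long_diagram \<Rightarrow> bool" where
  "local_change arcs D D' \<longleftrightarrow>
     (\<forall>p\<in>set arcs. fst p < snd p) \<and>
     (\<forall>i<length arcs. \<forall>j<i. disjnt (closed_arc (arcs ! i)) (closed_arc (arcs ! j))) \<and>
     (\<exists>B. B homeomorphic cball (0::complex) 1 \<and>
        (\<forall>E\<in>{D, D'}.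
           curve E -` B = (\<Union>p\<in>set arcs. closed_arc p) \<and>
           curve E -` interior B = (\<Union>p\<in>set arcs. open_arc p) \<and>
           (\<forall>s t. double E s t \<longrightarrow> curve E s \<notin> frontier B))) \<and>
     (\<forall>t. t \<notin> (\<Union>p\<in>set arcs. open_arc p) \<longrightarrow> curve D' t = curve D t) \<and>
     (\<forall>s t. s \<notin> (\<Union>p\<in>set arcs. open_arc p) \<and> double D s t \<longrightarrow> passage D' s = passage D s)"

text \<open>Double points between two arcs, or (for \<open>p = q\<close>) of one arc; then both orders are listed.\<close>

definition meets :: "long_diagram \<Rightarrow> real \<times> real \<Rightarrow> real \<times> real \<Rightarrow> (real \<times> real) set" where
  "meets D p q = {(s, t). s \<in> open_arc p \<and> t \<in> open_arc q \<and> double D s t}"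

text \<open>
  In each move the diagram inside the disk is specified by its double points, which determines
  it up to a homeomorphism of the disk (and reflection). The relations are used symmetrically.

  First real and virtual move: a kink, with arbitrary crossing, is removed.
\<close>

definition move1 :: "long_diagram \<Rightarrow> long_diagram \<Rightarrow> bool" where
  "move1 D D' \<longleftrightarrow> (\<exists>p. local_change [p] D D' \<and>
     (\<exists>s t. meets D p p = {(s, t), (t, s)} \<and> s \<noteq> t) \<and> meets D' p p = {})"

text \<open>
  Second real and virtual move: two simple arcs crossing each other twice are separated; either
  both crossings are virtual, or one arc is over at both. The orientations of the two frames
  are automatically opposite.
\<close>

definition move2 :: "long_diagram \<Rightarrow> long_diagram \<Rightarrow> bool" where
  "move2 D D' \<longleftrightarrow> (\<exists>p q. local_change [p, q] D D' \<and>
     meets D p p = {} \<and> meets D q q = {} \<and>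
     (\<exists>s t s' t'. meets D p q = {(s, t), (s', t')} \<and> s \<noteq> s' \<and>
        passage D s = passage D s' \<and>
        sgn (vel_det D s t) = - sgn (vel_det D s' t')) \<and>
     meets D' p p = {} \<and> meets D' q q = {} \<and> meets D' p q = {})"

text \<open>
  Third real, third virtual and mixed move: three simple arcs \<open>p\<close>, \<open>q\<close>, \<open>r\<close>, any two of
  them crossing once, and the order of the two crossings is reversed along each arc. Here \<open>p\<close>
  denotes the arc that is moved across the crossing of \<open>q\<close> and \<open>r\<close>: it is either virtual at
  both of its crossings, the one of \<open>q\<close> and \<open>r\<close> being arbitrary, or over at both of them with
  \<open>q\<close> and \<open>r\<close> crossing really. In particular the two forbidden moves are excluded.
\<close>

definition move3 :: "long_diagram \<Rightarrow> long_diagram \<Rightarrow> bool" where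
  "move3 D D' \<longleftrightarrow> (\<exists>p q r. local_change [p, q, r] D D' \<and>
     (\<forall>E\<in>{D, D'}. meets E p p = {} \<and> meets E q q = {} \<and> meets E r r = {}) \<and>
     (\<exists>pq qp pr rp qr rq pq' qp' pr' rp' qr' rq'.
        meets D p q = {(pq, qp)} \<and> meets D p r = {(pr, rp)} \<and> meets D q r = {(qr, rq)} \<and>
        meets D' p q = {(pq', qp')} \<and> meets D' p r = {(pr', rp')} \<and> meets D' q r = {(qr', rq')} \<and>
        (pq < pr \<longleftrightarrow> pr' < pq') \<and> (qp < qr \<longleftrightarrow> qr' < qp') \<and> (rp < rq \<longleftrightarrow> rq' < rp') \<and>
        passage D' pq' = passage D pq \<and> passage D' pr' = passage D pr \<and>
        passage D' qr' = passage D qr \<and>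
        sgn (vel_det D' pq' qp') = sgn (vel_det D pq qp) \<and>
        sgn (vel_det D' pr' rp') = sgn (vel_det D pr rp) \<and>
        sgn (vel_det D' qr' rq') = sgn (vel_det D qr rq) \<and>
        (passage D pq = Virtual \<and> passage D pr = Virtual \<or>
         passage D pq = Over \<and> passage D pr = Over \<and> passage D qr \<noteq> Virtual)))"

definition moves :: "(long_diagram \<times> long_diagram) set" where
  "moves = {(D, D'). is_long_diagram D \<and> is_long_diagram D' \<and>
     (isotopic D D' \<or> move1 D D' \<or> move2 D D' \<or> move3 D D')}"

definition long_virtual_knots :: "long_diagram set set" where
  "long_virtual_knots = {D. is_long_diagram D} // (moves \<union> moves\<inverse>)\<^sup>*"


section \<open>Closed oriented surfaces\<close>

text \<open>
  A connected closed oriented surface is given by a cell decomposition, that is, by a finite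
  graph on the surface whose complement consists of open disks. \<open>darts\<close> are the oriented edges,
  \<open>opp\<close> reverses an edge, and \<open>rot d\<close> is the dart following \<open>d\<close> in counterclockwise order among
  those with the same initial vertex. The vertices, edges and faces are the orbits of \<open>rot\<close>,
  \<open>opp\<close> and \<open>rot \<circ> opp\<close>.
\<close>

datatype surface = Surface (darts: "nat set") (rot: "nat \<Rightarrow> nat") (opp: "nat \<Rightarrow> nat")

definition closed_surface :: "surface \<Rightarrow> bool" where
  "closed_surface S \<longleftrightarrow>
     finite (darts S) \<and> darts S \<noteq> {} \<and> rot S permutes darts S \<and> opp S permutes darts S \<and>
     (\<forall>d\<in>darts S. opp S d \<noteq> d \<and> opp S (opp S d) = d) \<and>
     (\<forall>d\<in>darts S. \<forall>e\<in>darts S. (d, e) \<in> ({(x, rot S x) |x. True} \<union> {(x, opp S x) |x. True})\<^sup>*)"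

definition euler_char :: "surface \<Rightarrow> int" where
  "euler_char S =
     int (card (orbit (rot S) ` darts S)) - int (card (orbit (opp S) ` darts S)) +
     int (card (orbit (rot S \<circ> opp S) ` darts S))"

definition has_genus :: "surface \<Rightarrow> nat \<Rightarrow> bool" where
  "has_genus S g \<longleftrightarrow> euler_char S = 2 - 2 * int g"

definition vertex :: "surface \<Rightarrow> nat \<Rightarrow> nat set" where
  "vertex S d = orbit (rot S) d"

text \<open>
  A closed edge walk is a cyclic list of darts; it visits the initial vertex of \<open>w ! i\<close> at time
  \<open>i\<close>, leaving it along \<open>w ! i\<close> after arriving on the reverse of \<open>incoming S w i\<close>.
\<close>

definition closed_walk :: "surface \<Rightarrow> nat list \<Rightarrow> bool" where
  "closed_walk S w \<longleftrightarrow> w \<noteq> [] \<and> set w \<subseteq> darts S \<and>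
     (\<forall>i<length w. vertex S (opp S (w ! i)) = vertex S (w ! (Suc i mod length w)))"

definition incoming :: "surface \<Rightarrow> nat list \<Rightarrow> nat \<Rightarrow> nat" where
  "incoming S w i = opp S (w ! ((i + length w - 1) mod length w))"

text \<open>The darts met when turning counterclockwise from \<open>d\<close> before reaching \<open>e\<close>.\<close>

definition sector :: "surface \<Rightarrow> nat \<Rightarrow> nat \<Rightarrow> nat set" where
  "sector S d e = {(rot S ^^ k) d |k. 0 < k \<and> (\<forall>l\<in>{1..k}. (rot S ^^ l) d \<noteq> e)}"

text \<open>The darts leaving a walk to the left when it is at time \<open>i\<close>.\<close>

definition left_darts :: "surface \<Rightarrow> nat list \<Rightarrow> nat \<Rightarrow> nat set" where
  "left_darts S w i = sector S (w ! i) (incoming S w i)"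

text \<open>
  Intersection number of two closed walks: the first one is pushed off the graph to its left,
  where it runs transversally to the edges and meets exactly the left darts, each of which
  crosses it from right to left. A crossing of \<open>v\<close> and \<open>w\<close> counts positive if
  (direction of \<open>v\<close>, direction of \<open>w\<close>) is a positive frame; \<open>flow S w d\<close> is the number of
  times \<open>w\<close> runs along \<open>d\<close>, counted with sign.
\<close>

definition flow :: "surface \<Rightarrow> nat list \<Rightarrow> nat \<Rightarrow> int" where
  "flow S w d = int (count_list w d) - int (count_list w (opp S d))"

definition intersection :: "surface \<Rightarrow> nat list \<Rightarrow> nat list \<Rightarrow> int" where
  "intersection S v w = (\<Sum>i<length v. \<Sum>d\<in>left_darts S v i. flow S w d)"


section \<open>Surface realizations\<close>

text \<open>
  A closed curve diagram on a surface, with all crossings real. The curve is a closed walk in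
  the graph of the cell decomposition (which may contain further vertices and edges), its
  basepoint is the initial vertex, and times are the indices of \<open>walk\<close>.
\<close>

datatype surface_curve = Surface_Curve (walk: "nat list") (over_times: "nat set")

definition curve_crossings :: "surface \<Rightarrow> surface_curve \<Rightarrow> (nat \<times> nat) set" where
  "curve_crossings S C = {(i, j). i < j \<and> j < length (walk C) \<and>
     vertex S (walk C ! i) = vertex S (walk C ! j)}"

definition surface_diagram :: "surface \<Rightarrow> surface_curve \<Rightarrow> bool" where
  "surface_diagram S C \<longleftrightarrow>
     closed_surface S \<and> closed_walk S (walk C) \<and>
     (\<forall>i<length (walk C). walk C ! i \<noteq> incoming S (walk C) i) \<and>
     (\<forall>(i, j)\<in>curve_crossings S C.
        0 < i \<and>
        (\<forall>k<length (walk C). vertex S (walk C ! k) = vertex S (walk C ! i) \<longrightarrow> k \<in> {i, j}) \<and>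
        distinct [walk C ! i, incoming S (walk C) i, walk C ! j, incoming S (walk C) j] \<and>
        (walk C ! j \<in> left_darts S (walk C) i) \<noteq>
          (incoming S (walk C) j \<in> left_darts S (walk C) i) \<and>
        (i \<in> over_times C) \<noteq> (j \<in> over_times C))"

definition surf_sign :: "surface \<Rightarrow> surface_curve \<Rightarrow> nat \<times> nat \<Rightarrow> int" where
  "surf_sign S C = (\<lambda>(i, j).
     (if i \<in> over_times C then 1 else -1) *
     (if walk C ! j \<in> left_darts S (walk C) i then 1 else -1))"

text \<open>
  \<open>(S, C)\<close> is a surface realization of the diagram \<open>D\<close> if the parameters of real crossings of
  \<open>D\<close> correspond in order to the times at which \<open>C\<close> passes its crossings, preserving the
  pairing, the over/under information and the signs.
\<close>

definition realizes :: "surface \<Rightarrow> surface_curve \<Rightarrow> long_diagram \<Rightarrow> bool" where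
  "realizes S C D \<longleftrightarrow> surface_diagram S C \<and>
     (\<exists>\<rho>. strict_mono_on (fst ` real_crossings D \<union> snd ` real_crossings D) \<rho> \<and>
        map_prod \<rho> \<rho> ` real_crossings D = curve_crossings S C \<and>
        (\<forall>(s, t)\<in>real_crossings D.
           (passage D s = Over \<longleftrightarrow> \<rho> s \<in> over_times C) \<and>
           crossing_sign D (s, t) = surf_sign S C (\<rho> s, \<rho> t)))"

definition surface_realization :: "long_diagram set \<Rightarrow> surface \<Rightarrow> surface_curve \<Rightarrow> bool" where
  "surface_realization K S C \<longleftrightarrow> (\<exists>D\<in>K. realizes S C D)"

definition sg1 :: "long_diagram set \<Rightarrow> nat" where
  "sg1 K = (LEAST g. \<exists>S C. surface_realization K S C \<and> has_genus S g)"


section \<open>Laurent polynomials and the intersection polynomials\<close>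

text \<open>The Laurent polynomials are the group ring of the integers over the integers.\<close>

type_synonym laurent = "(int, int) poly_mapping"

definition t_pow :: "int \<Rightarrow> laurent" where
  "t_pow k = Poly_Mapping.single k 1"

definition eval_one :: "laurent \<Rightarrow> int" where
  "eval_one f = (\<Sum>k\<in>Poly_Mapping.keys f. Poly_Mapping.lookup f k)"

text \<open>The substitution of the inverse of \<open>t\<close> for \<open>t\<close>.\<close>

definition t_inverse :: "laurent \<Rightarrow> laurent" where
  "t_inverse f = Poly_Mapping.map_key uminus f"

text \<open>Crossings of type 0 (first over, then under) and of type 1.\<close>

definition crossings_of_type :: "surface \<Rightarrow> surface_curve \<Rightarrow> nat \<Rightarrow> (nat \<times> nat) set" where
  "crossings_of_type S C a =
     {c \<in> curve_crossings S C. (if fst c \<in> over_times C then 0 else 1) = a}"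

definition omega :: "surface \<Rightarrow> surface_curve \<Rightarrow> nat \<Rightarrow> int" where
  "omega S C a = (\<Sum>c\<in>crossings_of_type S C a. surf_sign S C c)"

text \<open>
  The two cycles of the smoothing at a crossing; \<open>beta_cycle\<close> contains the basepoint.
\<close>

definition alpha_cycle :: "surface_curve \<Rightarrow> nat \<times> nat \<Rightarrow> nat list" where
  "alpha_cycle C = (\<lambda>(i, j). take (j - i) (drop i (walk C)))"

definition beta_cycle :: "surface_curve \<Rightarrow> nat \<times> nat \<Rightarrow> nat list" where
  "beta_cycle C = (\<lambda>(i, j). drop j (walk C) @ take i (walk C))"

definition W_diagram :: "nat \<Rightarrow> surface \<Rightarrow> surface_curve \<Rightarrow> laurent" where
  "W_diagram a S C = (\<Sum>c\<in>crossings_of_type S C a.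
     of_int (surf_sign S C c) *
     (t_pow (intersection S (alpha_cycle C c) (beta_cycle C c)) - 1))"

definition F_diagram :: "nat \<Rightarrow> nat \<Rightarrow> surface \<Rightarrow> surface_curve \<Rightarrow> laurent" where
  "F_diagram a b S C =
     (\<Sum>c\<in>crossings_of_type S C a. \<Sum>d\<in>crossings_of_type S C b.
        of_int (surf_sign S C c * surf_sign S C d) *
        (t_pow (intersection S (alpha_cycle C c) (alpha_cycle C d)) - 1))"

definition H_diagram :: "nat \<Rightarrow> nat \<Rightarrow> surface \<Rightarrow> surface_curve \<Rightarrow> laurent" where
  "H_diagram a b S C =
     (\<Sum>c\<in>crossings_of_type S C a. \<Sum>d\<in>crossings_of_type S C b.
        of_int (surf_sign S C c * surf_sign S C d) *
        (t_pow (intersection S (beta_cycle C c) (beta_cycle C d)) - 1))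
     - of_int (omega S C a) * W_diagram b S C
     - of_int (omega S C b) * t_inverse (W_diagram a S C)"

text \<open>
  The polynomials of a long virtual knot: the common value on all its surface realizations.
\<close>

definition F_poly :: "nat \<Rightarrow> nat \<Rightarrow> long_diagram set \<Rightarrow> laurent" where
  "F_poly a b K = (THE f. \<exists>S C. surface_realization K S C \<and> f = F_diagram a b S C)"

definition H_poly :: "nat \<Rightarrow> nat \<Rightarrow> long_diagram set \<Rightarrow> laurent" where
  "H_poly a b K = (THE f. \<exists>S C. surface_realization K S C \<and> f = H_diagram a b S C)"

end

theory Submission
  imports Defs "HOL-Complex_Analysis.Complex_Analysis"
begin

text \<open>
  All the intersection numbers of a diagram can be computed from its Gauss diagram, that is, from
  the order of the crossings along the curve and their frames: \<open>\<alpha>\<^sub>c \<cdot> \<alpha>\<^sub>d\<close> is a signed count of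
  the chords that cross the chords \<open>c\<close> and \<open>d\<close>. So the polynomials are given by diagrams in the
  plane, where their invariance is checked move by move. Only the third move needs an input from
  the plane: virtual crossings included, every loop of a plane curve crosses the rest of the
  curve algebraically zero times, because winding numbers are locally constant. The polynomials
  are palindromic with value 0 at \<open>t = 1\<close> because the intersection form is antisymmetric.

  Every Gauss diagram is the one of a polygon with vertices on a parabola, with the superfluous
  crossings virtual, so that it suffices to find diagrams on the torus. There a long zigzag in an
  annulus is crossed by a run, and a further crossing \<open>d\<close> has a loop winding once around the
  torus. The crossings \<open>c\<close> of the run with row \<open>j\<close> of the zigzag satisfy \<open>\<alpha>\<^sub>c \<cdot> \<alpha>\<^sub>d = j\<close> and have
  pairwise intersection number 0, and both signs occur in each row. Choosing the over strands,
  one selects any number of them, together with \<open>d\<close>, as the crossings of the required type. The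
  selected ones contribute \<open>\<plusminus>(t\<^sup>j + t\<^sup>-\<^sup>j - 2)\<close> each to \<open>F\<close>, and these polynomials span.
\<close>

text \<open>The obstacle in the third move is that \<open>local_change\<close> describes a disk only
  by its double points. The frames of a triangle and the orders of the crossings along its three
  arcs could a priori be combined at will, but the indices survive only if they match, and nothing
  in the Gauss diagram of the real crossings enforces this. The match is extracted by comparison:
  with virtual crossings included, the signed count of each of the three loops is 0 before and after
  the move, while reversing the orders changes this count unless frames and orders fit. As a diagram
  is only continuous away from its double points, the count rests on winding numbers.

  For H the loops are replaced by their complements: row \<open>j\<close> of a zigzag with
  \<open>B\<close> rows contributes \<plusminus>(\<open>t^(B - j) + t^(j - B) - 2\<close>), and an
  unwanted multiple of \<open>t^B + t^(-B) - 2\<close> is left over, one more than the sum of the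
  selected signs. Row \<open>B\<close> itself contributes 0 and can therefore be used to bring this
  sum to -1.\<close>

section \<open>Gauss diagrams\<close>

text \<open>Twice the indicator function of the interval between the ends of a chord, where the ends
  count half. This symmetric choice makes \<open>pairing\<close> antisymmetric and four times an
  intersection number; the constant function 2 stands for the whole curve.\<close>

definition chi :: "'a::linorder \<times> 'a \<Rightarrow> 'a \<Rightarrow> int" where
  "chi c u = (if u = fst c \<or> u = snd c then 1 else if fst c < u \<and> u < snd c then 2 else 0)"

text \<open>Bilinear extension of the intersection number. \<open>f\<close> and \<open>g\<close> are
  weights along the curve; at a crossing the earlier strand with weight \<open>f\<close> and the
  later one with weight \<open>g\<close> meet in a frame of sign \<open>l\<close>, and exchanging
  the roles reverses the frame.\<close>

definition pairing ::
  "('a \<times> 'a) set \<Rightarrow> ('a \<times> 'a \<Rightarrow> int) \<Rightarrow> ('a \<Rightarrow> int) \<Rightarrow> ('a \<Rightarrow> int) \<Rightarrow> int" where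
  "pairing X l f g = (\<Sum>e\<in>X. l e * (f (fst e) * g (snd e) - f (snd e) * g (fst e)))"

text \<open>The division removes a factor 2 for each \<open>chi\<close>. It is exact for the Gauss
  diagram of a curve on a surface, where four times an intersection number is divided.\<close>

definition chord_index :: "('a::linorder \<times> 'a) set \<Rightarrow> ('a \<times> 'a \<Rightarrow> int) \<Rightarrow> 'a \<times> 'a \<Rightarrow> 'a \<times> 'a \<Rightarrow> int" where
  "chord_index X l c d = pairing X l (chi c) (chi d) div 4"

definition total_index :: "('a::linorder \<times> 'a) set \<Rightarrow> ('a \<times> 'a \<Rightarrow> int) \<Rightarrow> 'a \<times> 'a \<Rightarrow> int" where
  "total_index X l d = pairing X l (\<lambda>_. 2) (chi d) div 4"

text \<open>\<open>l\<close> belongs to the frame (earlier direction, later direction), whereas the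
  sign of a crossing takes the over direction first.\<close>

definition chord_sign :: "('a \<times> 'a \<Rightarrow> int) \<Rightarrow> ('a \<times> 'a \<Rightarrow> bool) \<Rightarrow> 'a \<times> 'a \<Rightarrow> int" where
  "chord_sign l ov c = (if ov c then l c else - l c)"

definition of_type :: "('a \<times> 'a) set \<Rightarrow> ('a \<times> 'a \<Rightarrow> bool) \<Rightarrow> nat \<Rightarrow> ('a \<times> 'a) set" where
  "of_type X ov a = {c \<in> X. (if ov c then 0 else 1) = a}"

text \<open>The kernel \<open>G\<close> stands for a summand of F or of H, so that every move is
  checked once for all four polynomials. It sees the index of the two chords and their total
  indices.\<close>

definition gauss_poly :: "(int \<Rightarrow> int \<Rightarrow> int \<Rightarrow> laurent) \<Rightarrow> nat \<Rightarrow> nat \<Rightarrow>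
    ('a::linorder \<times> 'a) set \<Rightarrow> ('a \<times> 'a \<Rightarrow> int) \<Rightarrow> ('a \<times> 'a \<Rightarrow> bool) \<Rightarrow> laurent" where
  "gauss_poly G a b X l ov = (\<Sum>c\<in>of_type X ov a. \<Sum>d\<in>of_type X ov b.
     of_int (chord_sign l ov c * chord_sign l ov d) *
     G (chord_index X l c d) (total_index X l c) (total_index X l d))"

text \<open>An isolated chord, as removed by the first move, has index 0 with every chord and total
  index 0.\<close>

definition admissible :: "(int \<Rightarrow> int \<Rightarrow> int \<Rightarrow> laurent) \<Rightarrow> bool" where
  "admissible G \<longleftrightarrow> (\<forall>x. G 0 0 x = 0 \<and> G 0 x 0 = 0)"

lemma pairing_swap: "pairing X l g f = - pairing X l f g"
  by (simp add: pairing_def sum_negf[symmetric] algebra_simps)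

lemma pairing_self [simp]: "pairing X l f f = 0"
  by (simp add: pairing_def algebra_simps)

lemma pairing_cong:
  assumes "\<And>e. e \<in> X \<Longrightarrow> l e = l' e"
    "\<And>e. e \<in> X \<Longrightarrow> f (fst e) = f' (fst e) \<and> f (snd e) = f' (snd e)"
    "\<And>e. e \<in> X \<Longrightarrow> g (fst e) = g' (fst e) \<and> g (snd e) = g' (snd e)"
  shows "pairing X l f g = pairing X l' f' g'"
  using assms by (simp add: pairing_def)

lemma pairing_insert:
  assumes "finite X" "e \<notin> X"
  shows "pairing (insert e X) l f g =
    l e * (f (fst e) * g (snd e) - f (snd e) * g (fst e)) + pairing X l f g"
  using assms by (simp add: pairing_def)

text \<open>The third move reverses orders of ends, so a correspondence of chords cannot always come
  from an order isomorphism. For this reason the hypotheses compare values of pairings.\<close>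

lemma gauss_poly_bij:
  assumes bij: "bij_betw h X X'"
    and l: "\<And>c. c \<in> X \<Longrightarrow> l' (h c) = l c"
    and ov: "\<And>c. c \<in> X \<Longrightarrow> ov' (h c) = ov c"
    and n: "\<And>c d. c \<in> X \<Longrightarrow> d \<in> X \<Longrightarrow>
      pairing X' l' (chi (h c)) (chi (h d)) = pairing X l (chi c) (chi d)"
    and m: "\<And>d. d \<in> X \<Longrightarrow> pairing X' l' (\<lambda>_. 2) (chi (h d)) = pairing X l (\<lambda>_. 2) (chi d)"
  shows "gauss_poly G a b X' l' ov' = gauss_poly G a b X l ov"
proof -
  have bt: "bij_betw h (of_type X ov a) (of_type X' ov' a)" for a
    using bij ov unfolding bij_betw_def of_type_def
    by (auto simp: inj_on_def image_iff)
  have sub: "c \<in> X" if "c \<in> of_type X ov a" for c a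
    using that by (simp add: of_type_def)
  show ?thesis
    unfolding gauss_poly_def
    by (subst sum.reindex_bij_betw[OF bt, symmetric])
      (rule sum.cong[OF refl], subst sum.reindex_bij_betw[OF bt, symmetric],
        rule sum.cong[OF refl],
        simp add: chord_sign_def chord_index_def total_index_def n m l ov sub)
qed

lemma gauss_poly_cong:
  assumes "\<And>c. c \<in> X \<Longrightarrow> l' c = l c" "\<And>c. c \<in> X \<Longrightarrow> ov' c = ov c"
  shows "gauss_poly G a b X l' ov' = gauss_poly G a b X l ov"
  by (rule gauss_poly_bij[where h=id]) (use assms in \<open>auto intro!: pairing_cong\<close>)

lemma chi_strict_mono:
  assumes "strict_mono_on T h" "fst c \<in> T" "snd c \<in> T" "u \<in> T"
  shows "chi (map_prod h h c) (h u) = chi c u"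
proof -
  have "h u = h v \<longleftrightarrow> u = v" "h u < h v \<longleftrightarrow> u < v" "h v < h u \<longleftrightarrow> v < u"  if "v \<in> T" for v
    using assms(1,4) that
    by (auto simp: strict_mono_on_eqD strict_mono_on_less)
  then show ?thesis using assms by (simp add: chi_def)
qed

lemma gauss_poly_order_iso:
  assumes mono: "strict_mono_on T h" and T: "fst ` X \<union> snd ` X \<subseteq> T"
    and X': "X' = map_prod h h ` X"
    and l: "\<And>c. c \<in> X \<Longrightarrow> l' (map_prod h h c) = l c"
    and ov: "\<And>c. c \<in> X \<Longrightarrow> ov' (map_prod h h c) = ov c"
  shows "gauss_poly G a b X' l' ov' = gauss_poly G a b X l ov"
proof (rule gauss_poly_bij)
  have inj: "inj_on h T" using mono by (rule strict_mono_on_imp_inj_on)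
  have injX: "inj_on (map_prod h h) X"
    using T by (intro inj_onI prod_eqI; simp add: map_prod_def split_beta)
      (metis UnI1 UnI2 imageI inj inj_onD subsetD)+
  then show "bij_betw (map_prod h h) X X'" using X' by (simp add: bij_betw_def)
  have c: "chi (map_prod h h c) (h (fst e)) = chi c (fst e) \<and>
      chi (map_prod h h c) (h (snd e)) = chi c (snd e)" if "c \<in> X" "e \<in> X" for c e
    using that T by (intro conjI chi_strict_mono[OF mono]) auto
  show "pairing X' l' (chi (map_prod h h c)) (chi (map_prod h h d)) = pairing X l (chi c) (chi d)"
    if "c \<in> X" "d \<in> X" for c d
    unfolding X' pairing_def using that
    by (subst sum.reindex[OF injX]) (simp add: l c)
  show "pairing X' l' (\<lambda>_. 2) (chi (map_prod h h d)) = pairing X l (\<lambda>_. 2) (chi d)"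
    if "d \<in> X" for d
    unfolding X' pairing_def using that
    by (subst sum.reindex[OF injX]) (simp add: l c)
qed (use l ov in auto)

section \<open>The first and the second move on Gauss diagrams\<close>

lemma chi_eq_on_gap:
  assumes "fst c < snd c" "\<not> (min s s' \<le> fst c \<and> fst c \<le> max s s')"
    "\<not> (min s s' \<le> snd c \<and> snd c \<le> max s s')"
  shows "chi c s = chi c s'"
  using assms by (auto simp: chi_def min_def max_def split: if_splits)

lemma finite_of_type: "finite X \<Longrightarrow> finite (of_type X ov a)"
  by (simp add: of_type_def)

text \<open>Between the ends of \<open>k\<close> there is no other end. So every other
  \<open>chi\<close> agrees at both ends of \<open>k\<close>, which makes the determinant of
  \<open>k\<close> vanish and keeps the old indices, and \<open>chi k\<close> is 0 at all other
  ends, which makes the indices of \<open>k\<close> vanish.\<close>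

lemma gauss_poly_insert_isolated:
  fixes k :: "'a::linorder \<times> 'a"
  assumes fin: "finite X" and k: "k \<notin> X" "fst k < snd k" and G: "admissible G"
    and X: "\<And>c. c \<in> X \<Longrightarrow> fst c < snd c \<and> (\<forall>u\<in>{fst c, snd c}. u < fst k \<or> snd k < u)"
  shows "gauss_poly G a b (insert k X) l ov = gauss_poly G a b X l ov"
proof -
  have const: "chi c (fst k) = chi c (snd k)" if "c \<in> X" for c
    using X[OF that] k by (intro chi_eq_on_gap) (auto simp: min_def max_def)
  have zero: "chi k (fst c) = 0 \<and> chi k (snd c) = 0" if "c \<in> X" for c
    using X[OF that] k by (auto simp: chi_def)
  have kk: "chi k (fst k) = 1" "chi k (snd k) = 1" by (auto simp: chi_def)
  have z: "pairing X l (chi k) f = 0" "pairing X l f (chi k) = 0" for f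
    by (simp_all add: pairing_def zero)
  have n: "chord_index (insert k X) l c d = chord_index X l c d" if "c \<in> X" "d \<in> X" for c d
    using that by (simp add: chord_index_def pairing_insert fin k const)
  have m: "total_index (insert k X) l c = total_index X l c" if "c \<in> X" for c
    using that by (simp add: total_index_def pairing_insert fin k const)
  have n0: "chord_index (insert k X) l k c = 0" "chord_index (insert k X) l c k = 0"
    if "c \<in> insert k X" for c
    using that by (auto simp: chord_index_def pairing_insert fin k const z kk)
  have m0: "total_index (insert k X) l k = 0"
    by (simp add: total_index_def pairing_insert fin k z kk)
  have G0: "G 0 0 x = 0" "G 0 x 0 = 0" for x using G by (auto simp: admissible_def)
  have ot: "of_type (insert k X) ov a =
    (if (if ov k then 0 else 1) = a then insert k (of_type X ov a) else of_type X ov a)" for a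
    by (auto simp: of_type_def)
  have kn: "k \<notin> of_type X ov a" for a using k by (simp add: of_type_def)
  have sub: "c \<in> X" if "c \<in> of_type X ov a" for c a
    using that by (simp add: of_type_def)
  show ?thesis
    unfolding gauss_poly_def ot
    by (auto simp: kn finite_of_type[OF fin] n0 m0 G0 n m sub intro!: sum.cong)
qed

lemma chi_side_cong:
  assumes "u < fst c \<and> u < fst d \<or> fst c < u \<and> fst d < u"
    "u < snd c \<and> u < snd d \<or> snd c < u \<and> snd d < u"
  shows "chi c u = chi d u"
proof -
  have "u \<noteq> fst c" "u \<noteq> fst d" "fst c < u \<longleftrightarrow> fst d < u" using assms(1) by auto
  moreover have "u \<noteq> snd c" "u \<noteq> snd d" "u < snd c \<longleftrightarrow> u < snd d" using assms(2) by auto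
  ultimately show ?thesis by (simp add: chi_def)
qed

text \<open>Other chords do not distinguish \<open>k\<close> from \<open>k'\<close>, so by the
  opposite frames the two determinants cancel in the old indices. The indices of \<open>k\<close>
  and \<open>k'\<close> with any chord agree, and their chord signs are opposite, so their rows and
  columns cancel.\<close>

lemma gauss_poly_insert_cancelling:
  fixes k k' :: "'a::linorder \<times> 'a"
  assumes fin: "finite X" and k: "k \<notin> X" "k' \<notin> X" "k \<noteq> k'"
    and l: "l k' = - l k" and ov: "ov k' = ov k"
    and s: "fst k \<noteq> fst k'" and t: "snd k \<noteq> snd k'"
    and sep: "max (fst k) (fst k') < min (snd k) (snd k')"
    and X: "\<And>c. c \<in> X \<Longrightarrow> fst c < snd c \<and> (\<forall>u\<in>{fst c, snd c}.
        \<not> (min (fst k) (fst k') \<le> u \<and> u \<le> max (fst k) (fst k')) \<and>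
        \<not> (min (snd k) (snd k') \<le> u \<and> u \<le> max (snd k) (snd k')))"
  shows "gauss_poly G a b (insert k (insert k' X)) l ov = gauss_poly G a b X l ov"
proof -
  let ?Y = "insert k (insert k' X)"
  have const: "chi c (fst k) = chi c (fst k')" "chi c (snd k) = chi c (snd k')" if "c \<in> X" for c
    using X[OF that] by (intro chi_eq_on_gap; simp)+
  have chiX: "chi k (fst c) = chi k' (fst c) \<and> chi k (snd c) = chi k' (snd c)" if "c \<in> X" for c
  proof -
    have "chi k u = chi k' u" if "u \<in> {fst c, snd c}" for u
    proof -
      have "u < fst k \<and> u < fst k' \<or> fst k < u \<and> fst k' < u"
        "u < snd k \<and> u < snd k' \<or> snd k < u \<and> snd k' < u"
        using conjunct2[OF X[OF \<open>c \<in> X\<close>]] that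
        by (meson linorder_not_le max.coboundedI1 max.coboundedI2 min.coboundedI1 min.coboundedI2)+
      then show ?thesis by (rule chi_side_cong)
    qed
    then show ?thesis by simp
  qed
  have kk: "chi k (fst k) = 1" "chi k (snd k) = 1" "chi k' (fst k') = 1" "chi k' (snd k') = 1"
    by (auto simp: chi_def)
  \<comment> \<open>Both kinds of bigon, with parallel and with antiparallel arcs, are covered: on
    each arc one of the two chords sees the end of the other inside (value 2) and is itself seen
    outside (value 0).\<close>
  have kk': "chi k' (fst k) = 2 - chi k (fst k')" "chi k' (snd k) = 2 - chi k (snd k')"
    using s t sep by (auto simp: chi_def min_def max_def split: if_splits)
  have k01: "(chi k (fst k') = 0 \<or> chi k (fst k') = 2) \<and> (chi k (snd k') = 0 \<or> chi k (snd k') = 2)"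
    using s t sep by (auto simp: chi_def min_def max_def split: if_splits)
  note ins = pairing_insert fin k l
  have eqX: "pairing X l (chi k) f = pairing X l (chi k') f"
     "pairing X l f (chi k) = pairing X l f (chi k')" for f
    by (rule pairing_cong; simp add: chiX)+
  have n: "chord_index ?Y l c d = chord_index X l c d" if "c \<in> X" "d \<in> X" for c d
    using that by (simp add: chord_index_def ins const)
  have m: "total_index ?Y l c = total_index X l c" if "c \<in> X" for c
    using that by (simp add: total_index_def ins const algebra_simps)
  have n': "chord_index ?Y l k d = chord_index ?Y l k' d" "chord_index ?Y l d k = chord_index ?Y l d k'"
    if d: "d \<in> ?Y" for d
  proof -
    have "pairing ?Y l (chi k) (chi d) = pairing ?Y l (chi k') (chi d)"
    proof (cases "d \<in> X")
      case True
      then show ?thesis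
        by (simp add: ins const kk kk' eqX) (simp add: algebra_simps)
    next
      case False
      then have "d = k \<or> d = k'" using d by auto
      then show ?thesis
        using k01 by (auto simp: ins kk kk' eqX)
    qed
    then show "chord_index ?Y l k d = chord_index ?Y l k' d"
      "chord_index ?Y l d k = chord_index ?Y l d k'"
      by (simp_all add: chord_index_def pairing_swap[of _ _ "chi d"])
  qed
  have m': "total_index ?Y l k = total_index ?Y l k'"
    by (simp add: total_index_def ins kk kk' eqX) (simp add: algebra_simps)
  have ot: "of_type ?Y ov a =
    (if (if ov k then 0 else 1) = a then insert k (insert k' (of_type X ov a)) else of_type X ov a)" for a
    using ov by (auto simp: of_type_def)
  have kn: "k \<notin> of_type X ov a" "k' \<notin> of_type X ov a" for a using k by (auto simp: of_type_def)
  have sub: "c \<in> X" if "c \<in> of_type X ov a" for c a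
    using that by (simp add: of_type_def)
  have sg: "chord_sign l ov k' = - chord_sign l ov k"
    using l ov by (simp add: chord_sign_def)
  define g where "g = (\<lambda>c d. of_int (chord_sign l ov c * chord_sign l ov d) *
     G (chord_index ?Y l c d) (total_index ?Y l c) (total_index ?Y l d))"
  have g1: "g k' d = - g k d" and g2: "g d k' = - g d k" if "d \<in> ?Y" for d
    unfolding g_def sg m' n'[OF that] by simp_all
  have row: "(\<Sum>d\<in>of_type ?Y ov b. g c d) = (\<Sum>d\<in>of_type X ov b. g c d)" if "c \<in> ?Y" for c
    unfolding ot using k kn that by (simp add: finite_of_type[OF fin] g2)
  have subY: "c \<in> ?Y" if "c \<in> of_type ?Y ov a" for c a
    using that by (simp add: of_type_def)
  have "gauss_poly G a b ?Y l ov = (\<Sum>c\<in>of_type ?Y ov a. \<Sum>d\<in>of_type ?Y ov b. g c d)"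
    by (simp only: gauss_poly_def g_def)
  also have "\<dots> = (\<Sum>c\<in>of_type ?Y ov a. \<Sum>d\<in>of_type X ov b. g c d)"
    by (rule sum.cong[OF refl], rule row, rule subY)
  also have "\<dots> = (\<Sum>c\<in>of_type X ov a. \<Sum>d\<in>of_type X ov b. g c d)"
    unfolding ot using k kn by (simp add: finite_of_type[OF fin] g1 sub sum_negf)
  also have "\<dots> = gauss_poly G a b X l ov"
    unfolding gauss_poly_def g_def using sub by (intro sum.cong refl) (simp add: n m)
  finally show ?thesis .
qed

section \<open>The third move on Gauss diagrams\<close>

lemma chi_triangle:
  fixes x12 :: "'a::linorder"
  assumes "a1 < x12" "x12 < b1" "a1 < x13" "x13 < b1"
    "a2 < x21" "x21 < b2" "a2 < x23" "x23 < b2"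
    "a3 < x31" "x31 < b3" "a3 < x32" "x32 < b3"
    "b1 \<le> a2" "b2 \<le> a3"
    "x12 \<noteq> x13" "x21 \<noteq> x23" "x31 \<noteq> x32"
    "o1 = (if x12 < x13 then 1 else -1)" "o2 = (if x21 < x23 then 1 else -1)"
    "o3 = (if x31 < x32 then 1 else -1)"
  shows "chi (x12, x21) x12 = 1" "chi (x12, x21) x21 = 1" "chi (x12, x21) x13 = 1 + o1"
    "chi (x12, x21) x23 = 1 - o2" "chi (x12, x21) x31 = 0" "chi (x12, x21) x32 = 0"
    "chi (x13, x31) x13 = 1" "chi (x13, x31) x31 = 1" "chi (x13, x31) x12 = 1 - o1"
    "chi (x13, x31) x21 = 2" "chi (x13, x31) x23 = 2" "chi (x13, x31) x32 = 1 - o3"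
    "chi (x23, x32) x23 = 1" "chi (x23, x32) x32 = 1" "chi (x23, x32) x12 = 0"
    "chi (x23, x32) x13 = 0" "chi (x23, x32) x21 = 1 - o2" "chi (x23, x32) x31 = 1 + o3"
  using assms by (auto simp: chi_def)

lemma chi_outside_gap:
  fixes a b :: "'a::linorder"
  assumes "fst c \<le> a \<or> b \<le> fst c" "snd c \<le> a \<or> b \<le> snd c" "a < x" "x < b" "a < y" "y < b"
  shows "chi c x = chi c y"
  using assms by (auto simp: chi_def)

lemma gap_side:
  fixes a b :: "'a::linorder"
  assumes "u \<le> a \<or> b \<le> u" "a < x" "x < b" "a < x'" "x' < b"
  shows "u < x \<and> u < x' \<or> x < u \<and> x' < u"
  using assms by (elim disjE) auto

lemma chi_endpoint_in_gap:
  fixes a b :: "'a::linorder"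
  assumes "u \<le> a1 \<or> b1 \<le> u" "u \<le> a2 \<or> b2 \<le> u" "a1 < x" "x < b1" "a1 < x'" "x' < b1"
   "a2 < y" "y < b2" "a2 < y'" "y' < b2"
  shows "chi (x, y) u = chi (x', y') u"
proof -
  show ?thesis
    by (rule chi_side_cong; unfold fst_conv snd_conv)
      (rule gap_side[OF assms(1,3-6)], rule gap_side[OF assms(2,7-10)])
qed

text \<open>\<open>x12\<close> is the time on the first arc of its crossing with the second one, and
  so on; \<open>y\<close> are the times after the move. The sign \<open>o1\<close> records the order
  on the first arc, which makes each value of \<open>chi\<close> affine in the \<open>o\<close>s.
  The remaining chords \<open>Z\<close> are kept general, since the setting is needed once with all
  double points and once with the real ones.\<close>

locale triangle_move =
  fixes a1 b1 a2 b2 a3 b3 x12 x13 x21 x23 x31 x32 y12 y13 y21 y23 y31 y32 :: "'a::linorder"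
    and Z :: "('a \<times> 'a) set" and l l' :: "'a \<times> 'a \<Rightarrow> int" and o1 o2 o3 l12 l13 l23 :: int
  assumes x: "a1 < x12" "x12 < b1" "a1 < x13" "x13 < b1"
    "a2 < x21" "x21 < b2" "a2 < x23" "x23 < b2"
    "a3 < x31" "x31 < b3" "a3 < x32" "x32 < b3"
    and y: "a1 < y12" "y12 < b1" "a1 < y13" "y13 < b1"
    "a2 < y21" "y21 < b2" "a2 < y23" "y23 < b2"
    "a3 < y31" "y31 < b3" "a3 < y32" "y32 < b3"
    and ab: "b1 \<le> a2" "b2 \<le> a3"
    and ne: "x12 \<noteq> x13" "x21 \<noteq> x23" "x31 \<noteq> x32" "y12 \<noteq> y13" "y21 \<noteq> y23" "y31 \<noteq> y32"
    and rev: "x12 < x13 \<longleftrightarrow> y13 < y12" "x21 < x23 \<longleftrightarrow> y23 < y21" "x31 < x32 \<longleftrightarrow> y32 < y31"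
    and o_def: "o1 = (if x12 < x13 then 1 else -1)" "o2 = (if x21 < x23 then 1 else -1)"
    "o3 = (if x31 < x32 then 1 else -1)"
    and finZ: "finite Z"
    and Z: "\<And>c u. c \<in> Z \<Longrightarrow> u \<in> {fst c, snd c} \<Longrightarrow>
        (u \<le> a1 \<or> b1 \<le> u) \<and> (u \<le> a2 \<or> b2 \<le> u) \<and> (u \<le> a3 \<or> b3 \<le> u)"
    and lZ: "\<And>c. c \<in> Z \<Longrightarrow> l' c = l c"
    and lx: "l (x12, x21) = l12" "l (x13, x31) = l13" "l (x23, x32) = l23"
    and ly: "l' (y12, y21) = l12" "l' (y13, y31) = l13" "l' (y23, y32) = l23"
begin

definition "tri_x = {(x12, x21), (x13, x31), (x23, x32)}"
definition "tri_y = {(y12, y21), (y13, y31), (y23, y32)}"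

lemmas chi_x = chi_triangle[OF x ab ne(1-3) o_def]

text \<open>Reversed orders negate all \<open>o\<close>s, so a single table of values of
  \<open>chi\<close> serves before and after the move.\<close>

lemma o_y: "- o1 = (if y12 < y13 then 1 else -1)" "- o2 = (if y21 < y23 then 1 else -1)"
    "- o3 = (if y31 < y32 then 1 else -1)"
  using rev ne by (auto simp: o_def)

lemmas chi_y = chi_triangle[OF y ab ne(4-6) o_y]

lemma x_notin: "(x12, x21) \<notin> Z" "(x13, x31) \<notin> Z" "(x23, x32) \<notin> Z"
    "(y12, y21) \<notin> Z" "(y13, y31) \<notin> Z" "(y23, y32) \<notin> Z"
proof -
  have "(u, v) \<notin> Z" if "a1 < u \<and> u < b1 \<or> a2 < u \<and> u < b2" for u v
    using Z[of "(u, v)" u] that by auto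
  then show "(x12, x21) \<notin> Z" "(x13, x31) \<notin> Z" "(x23, x32) \<notin> Z"
    "(y12, y21) \<notin> Z" "(y13, y31) \<notin> Z" "(y23, y32) \<notin> Z"
    using x y by blast+
qed

lemma distinct_x: "(x12, x21) \<noteq> (x13, x31)" "(x12, x21) \<noteq> (x23, x32)" "(x13, x31) \<noteq> (x23, x32)"
    "(y12, y21) \<noteq> (y13, y31)" "(y12, y21) \<noteq> (y23, y32)" "(y13, y31) \<noteq> (y23, y32)"
  using x y ab by auto

lemma pairing_x: "pairing (Z \<union> tri_x) l f g = pairing Z l f g +
   l12 * (f x12 * g x21 - f x21 * g x12) + l13 * (f x13 * g x31 - f x31 * g x13) +
   l23 * (f x23 * g x32 - f x32 * g x23)"
  using x_notin distinct_x finZ by (simp add: tri_x_def pairing_insert lx)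

lemma pairing_y: "pairing (Z \<union> tri_y) l' f g = pairing Z l f g +
   l12 * (f y12 * g y21 - f y21 * g y12) + l13 * (f y13 * g y31 - f y31 * g y13) +
   l23 * (f y23 * g y32 - f y32 * g y23)"
proof -
  have "pairing Z l' f g = pairing Z l f g" by (rule pairing_cong) (auto simp: lZ)
  then show ?thesis using x_notin distinct_x finZ by (simp add: tri_y_def pairing_insert ly)
qed

lemma chi_Z:
  assumes "e \<in> Z" "u \<in> {fst e, snd e}"
  shows "chi (y12, y21) u = chi (x12, x21) u" "chi (y13, y31) u = chi (x13, x31) u"
    "chi (y23, y32) u = chi (x23, x32) u"
proof -
  have u: "u \<le> a1 \<or> b1 \<le> u" "u \<le> a2 \<or> b2 \<le> u" "u \<le> a3 \<or> b3 \<le> u"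
    using Z[OF assms] by auto
  show "chi (y12, y21) u = chi (x12, x21) u"
    using u(1,2) x y by (rule_tac chi_endpoint_in_gap[of u a1 b1 a2 b2])
  show "chi (y13, y31) u = chi (x13, x31) u"
    using u(1,3) x y by (rule_tac chi_endpoint_in_gap[of u a1 b1 a3 b3])
  show "chi (y23, y32) u = chi (x23, x32) u"
    using u(2,3) x y by (rule_tac chi_endpoint_in_gap[of u a2 b2 a3 b3])
qed

text \<open>If the signed count of points of each chord vanishes before and after the move, as it
  does for the double points of a curve in the plane, the triangle closes up.\<close>

lemma closing_condition:
  assumes "\<And>d. d \<in> tri_x \<Longrightarrow> pairing (Z \<union> tri_x) l (\<lambda>_. 2) (chi d) = 0"
    and "\<And>d. d \<in> tri_y \<Longrightarrow> pairing (Z \<union> tri_y) l' (\<lambda>_. 2) (chi d) = 0"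
  shows "l13 * o1 = l23 * o2" "l12 * o1 = l23 * o3" "l12 * o2 = l13 * o3"
proof -
  \<comment> \<open>The ends of \<open>Z\<close> lie outside the arcs, so \<open>Z\<close> drops out
    of the comparison. What remains for each chord of the triangle is one equation between the signs
    of the other two.\<close>
  have Zeq: "pairing Z l (\<lambda>_. 2) (chi (x12, x21)) = pairing Z l (\<lambda>_. 2) (chi (y12, y21))"
    "pairing Z l (\<lambda>_. 2) (chi (x13, x31)) = pairing Z l (\<lambda>_. 2) (chi (y13, y31))"
    "pairing Z l (\<lambda>_. 2) (chi (x23, x32)) = pairing Z l (\<lambda>_. 2) (chi (y23, y32))"
    by (auto intro!: pairing_cong simp: chi_Z)
  have "pairing (Z \<union> tri_x) l (\<lambda>_. 2) (chi (x12, x21)) =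
        pairing (Z \<union> tri_y) l' (\<lambda>_. 2) (chi (y12, y21))"
    "pairing (Z \<union> tri_x) l (\<lambda>_. 2) (chi (x13, x31)) =
        pairing (Z \<union> tri_y) l' (\<lambda>_. 2) (chi (y13, y31))"
    "pairing (Z \<union> tri_x) l (\<lambda>_. 2) (chi (x23, x32)) =
        pairing (Z \<union> tri_y) l' (\<lambda>_. 2) (chi (y23, y32))"
    using assms by (simp_all add: tri_x_def tri_y_def)
  then show "l13 * o1 = l23 * o2" "l12 * o1 = l23 * o3" "l12 * o2 = l13 * o3"
    unfolding pairing_x pairing_y Zeq chi_x chi_y by (simp_all add: algebra_simps)
qed

lemma gauss_poly_triangle:
  assumes closing: "l13 * o1 = l23 * o2" "l12 * o1 = l23 * o3" "l12 * o2 = l13 * o3"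
    and ov: "\<And>c. c \<in> Z \<Longrightarrow> ov' c = ov c" "ov' (y12, y21) = ov (x12, x21)"
      "ov' (y13, y31) = ov (x13, x31)" "ov' (y23, y32) = ov (x23, x32)"
  shows "gauss_poly G a b (Z \<union> tri_y) l' ov' = gauss_poly G a b (Z \<union> tri_x) l ov"
proof -
  define h where "h c = (if c = (x12, x21) then (y12, y21) else if c = (x13, x31) then (y13, y31)
    else if c = (x23, x32) then (y23, y32) else c)" for c
  have hx: "h (x12, x21) = (y12, y21)" "h (x13, x31) = (y13, y31)" "h (x23, x32) = (y23, y32)"
    using distinct_x by (auto simp: h_def)
  have hZ: "h c = c" if "c \<in> Z" for c using x_notin that by (auto simp: h_def)
  have bij: "bij_betw h (Z \<union> tri_x) (Z \<union> tri_y)"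
  proof (rule bij_betw_combine)
    show "bij_betw h Z Z" using hZ by (simp add: bij_betw_def inj_on_def)
    show "bij_betw h tri_x tri_y"
      using distinct_x unfolding bij_betw_def inj_on_def tri_x_def tri_y_def by (auto simp: hx)
    show "Z \<inter> tri_y = {}" using x_notin by (auto simp: tri_y_def)
  qed
  have o: "o1 \<in> {1, -1}" "o2 \<in> {1, -1}" "o3 \<in> {1, -1}" by (auto simp: o_def)
  \<comment> \<open>The \<open>o\<close>s are units, so the three signs are determined up to a
    common factor.\<close>
  then have closing': "l23 = l13 * o1 * o2" "l12 = l13 * o3 * o2" using closing by auto
  have gap: "chi c u = chi c v" if "c \<in> Z" "(a, b) \<in> {(a1, b1), (a2, b2), (a3, b3)}"
    "a < u" "u < b" "a < v" "v < b" for c a b u v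
    using Z[OF that(1), of "fst c"] Z[OF that(1), of "snd c"] that(2-)
    by (intro chi_outside_gap[of c a b]) auto
  have arc: "chi c y12 = chi c x12" "chi c x13 = chi c x12" "chi c y13 = chi c x12"
     "chi c y21 = chi c x21" "chi c x23 = chi c x21" "chi c y23 = chi c x21"
     "chi c y31 = chi c x31" "chi c x32 = chi c x31" "chi c y32 = chi c x31" if "c \<in> Z" for c
    by (rule gap[OF that, of a1 b1] gap[OF that, of a2 b2] gap[OF that, of a3 b3];
      simp add: x y)+
  have Zcong: "pairing Z l (chi (h c)) f = pairing Z l (chi c) f"
      "pairing Z l f (chi (h c)) = pairing Z l f (chi c)" if "c \<in> Z \<union> tri_x" for c f
    using that by (auto intro!: pairing_cong simp: tri_x_def hx hZ chi_Z)
  \<comment> \<open>\<open>chi d\<close> is constant on each of the three arcs. The change of the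
    pairing is a linear combination of these three constants, and its coefficients vanish by
    \<open>closing'\<close>.\<close>
  have mixed: "pairing (Z \<union> tri_y) l' (chi (h c)) (chi (h d)) = pairing (Z \<union> tri_x) l (chi c) (chi d)"
    if c: "c \<in> tri_x" and d: "d \<in> Z" for c d
  proof -
    have c': "c \<in> Z \<union> tri_x" using c by simp
    note expand = pairing_x pairing_y Zcong[OF c'] hZ[OF d] arc[OF d]
    consider "c = (x12, x21)" | "c = (x13, x31)" | "c = (x23, x32)"
      using c by (auto simp: tri_x_def)
    then show ?thesis
    proof cases
      case 1
      show ?thesis unfolding expand unfolding 1 hx chi_x chi_y using o
        by (simp, elim disjE; use closing' in \<open>simp add: algebra_simps\<close>)
    next
      case 2
      show ?thesis unfolding expand unfolding 2 hx chi_x chi_y using o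
        by (simp, elim disjE; use closing' in \<open>simp add: algebra_simps\<close>)
    next
      case 3
      show ?thesis unfolding expand unfolding 3 hx chi_x chi_y using o
        by (simp, elim disjE; use closing' in \<open>simp add: algebra_simps\<close>)
    qed
  qed
  have A: "pairing (Z \<union> tri_y) l' (chi (h c)) (chi (h d)) = pairing (Z \<union> tri_x) l (chi c) (chi d)"
    if c: "c \<in> Z \<union> tri_x" and d: "d \<in> Z \<union> tri_x" for c d
  proof -
    consider "c \<in> Z" "d \<in> Z" | "c \<in> tri_x" "d \<in> Z" | "c \<in> Z" "d \<in> tri_x" | "c \<in> tri_x" "d \<in> tri_x"
      using c d by blast
    then show ?thesis
    proof cases
      case 1
      then show ?thesis unfolding pairing_x pairing_y by (simp add: Zcong hZ arc)
    next
      case 2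
      then show ?thesis by (rule mixed)
    next
      case 3
      then show ?thesis using mixed[of d c] by (simp add: pairing_swap[of _ _ "chi d"] pairing_swap[of _ _ "chi (h d)"])
    next
      case 4
      show ?thesis unfolding pairing_x pairing_y Zcong[OF c] Zcong[OF d]
        using 4 o
        by (simp add: tri_x_def; elim disjE; use closing' in \<open>simp add: hx chi_x chi_y\<close>)
    qed
  qed
  have B: "pairing (Z \<union> tri_y) l' (\<lambda>_. 2) (chi (h d)) = pairing (Z \<union> tri_x) l (\<lambda>_. 2) (chi d)"
    if d: "d \<in> Z \<union> tri_x" for d
  proof (cases "d \<in> Z")
    case True
    then show ?thesis unfolding pairing_x pairing_y by (simp add: Zcong hZ arc)
  next
    case False
    then have "d \<in> tri_x" using d by simp
    then show ?thesis unfolding pairing_x pairing_y Zcong[OF d] using o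
      by (simp add: tri_x_def; elim disjE; use closing' in \<open>simp add: hx chi_x chi_y\<close>)
  qed
  show ?thesis
    by (rule gauss_poly_bij[OF bij _ _ A B])
      (auto simp: tri_x_def hx lx ly ov hZ lZ)
qed

end

section \<open>Signed double points of curves in the plane\<close>

text \<open>The hypothesis says that the path avoids the ray from \<open>z\<close> in direction
  \<open>c\<close>. On the complement of this ray a single branch of the logarithm exists, and the
  winding number is the difference of its values at the ends; the path need not be closed.\<close>

lemma winding_number_slit:
  assumes p: "path p" and slit: "\<And>t. t \<in> {0..1} \<Longrightarrow> (z - p t) / c \<notin> \<real>\<^sub>\<le>\<^sub>0" and c: "c \<noteq> 0"
  shows "winding_number p z =
    (Ln ((z - pathfinish p) / c) - Ln ((z - pathstart p) / c)) / (2 * of_real pi * \<i>)"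
proof -
  \<comment> \<open>The summand \<open>Ln (- c)\<close> undoes the rotation that moves the slit to
    the branch cut, so \<open>q\<close> is a logarithm of \<open>p t - z\<close>.\<close>
  define q where "q t = Ln ((z - p t) / c) + Ln (- c)" for t
  have q: "path q"
    unfolding path_def q_def
    using p slit c by (intro continuous_intros) (auto simp: path_def)
  have "exp (q t) = p t - z" if "t \<in> {0..1}" for t
  proof -
    have "(z - p t) / c \<noteq> 0" using slit[OF that] by force
    then show ?thesis using c by (simp add: q_def exp_add)
  qed
  then have eq: "winding_number (exp \<circ> q) 0 = winding_number (\<lambda>t. p t - z) 0"
    by (intro winding_number_cong) auto
  have "winding_number p z = winding_number (exp \<circ> q) 0"
    by (subst winding_number_offset) (simp add: eq)
  also have "\<dots> = (pathfinish q - pathstart q) / (2 * of_real pi * \<i>)"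
    by (rule winding_number_compose_exp[OF q])
  finally show ?thesis
    by (simp add: q_def pathfinish_def pathstart_def)
qed

lemma Ln_uminus:
  assumes "Im w \<noteq> 0"
  shows "Ln (- w) = Ln w - (if 0 < Im w then 1 else -1) * of_real pi * \<i>"
proof -
  have "w \<noteq> 0" using assms by auto
  then show ?thesis using assms by (subst Ln_minus) (auto simp: mult.commute)
qed

text \<open>The tangent cone condition: the path stays close to its tangent line through the point
  \<open>p\<close>, while \<open>z\<close> lies off a wider double cone. The jump of the winding number is therefore
  computed with one branch of the logarithm on each side.\<close>

lemma slit_avoids_cone:
  assumes "\<bar>Im a\<bar> \<le> k * \<bar>Re a\<bar>" "0 < Im w" "\<bar>Re w\<bar> \<le> K * Im w" "0 \<le> k" "k * K < 1"
  shows "(w - a) / \<i> \<notin> \<real>\<^sub>\<le>\<^sub>0"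
proof
  assume "(w - a) / \<i> \<in> \<real>\<^sub>\<le>\<^sub>0"
  then have "Im ((w - a) / \<i>) = 0" "Re ((w - a) / \<i>) \<le> 0"
    by (auto simp: complex_nonpos_Reals_iff)
  then have re: "Re w = Re a" and im: "Im w \<le> Im a" by auto
  have "\<bar>Re w\<bar> \<le> K * Im w" by fact
  then have "k * \<bar>Re w\<bar> \<le> k * (K * Im w)" by (rule mult_left_mono) fact
  moreover have "k * (K * Im w) < Im w"
    using mult_strict_right_mono[OF \<open>k * K < 1\<close> \<open>0 < Im w\<close>] by (simp add: mult.assoc)
  ultimately show False using assms(1) im unfolding re by linarith
qed

text \<open>Serves to normalize a crossing: after division by the velocity the strand is tangent to
  the real axis at 0.\<close>

lemma winding_number_affine:
  assumes p: "path p" and z: "z \<notin> path_image p" and v: "v \<noteq> 0"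
  shows "winding_number (\<lambda>t. (p t - b) / v) ((z - b) / v) = winding_number p z"
proof -
  have "winding_number (\<lambda>t. (p t - b) / v) ((z - b) / v) =
    winding_number (\<lambda>t. (p t - b) / v - (z - b) / v) 0"
    by (rule winding_number_offset)
  also have "(\<lambda>t. (p t - b) / v - (z - b) / v) = (\<lambda>t. (1 / v) * (p t - z) + 0)"
    using v by (auto simp: field_simps)
  also have "winding_number \<dots> 0 = winding_number (\<lambda>t. p t - z) 0"
  proof -
    obtain q where q: "path q" and d: "pathfinish q - pathstart q = 2 * of_real pi * \<i> * winding_number p z"
      and e: "\<And>t. t \<in> {0..1} \<Longrightarrow> p t = z + exp (q t)"
      using winding_number_as_continuous_log[OF p z] by metis
    define r where "r t = q t + Ln (1 / v)" for t
    have r: "path r" unfolding r_def path_def using q by (intro continuous_intros) (simp add: path_def)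
    have "winding_number (\<lambda>t. (1 / v) * (p t - z) + 0) 0 = winding_number (exp \<circ> r) 0"
      using v by (intro winding_number_cong) (auto simp: r_def exp_add e)
    also have "\<dots> = winding_number p z"
      using d by (simp add: winding_number_compose_exp[OF r] r_def pathfinish_def pathstart_def)
    finally show ?thesis by (simp add: winding_number_offset[of p z])
  qed
  also have "\<dots> = winding_number p z" by (rule winding_number_offset[symmetric])
  finally show ?thesis .
qed

text \<open>For points above the path the slit points up, for points below it points down. Both
  expressions for the winding number extend continuously to 0, although 0 may lie on the path, and
  the jump is the difference of the two branches there.\<close>

lemma winding_number_cone_jump:
  assumes p: "path p" and cone: "\<And>t. t \<in> {0..1} \<Longrightarrow> \<bar>Im (p t)\<bar> \<le> k * \<bar>Re (p t)\<bar>"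
    and ends: "Re (pathstart p) < 0" "0 < Re (pathfinish p)"
    and k: "0 \<le> k" "k * K < 1"
    and zs: "\<forall>\<^sub>F h in F. 0 < Im (z h) \<and> \<bar>Re (z h)\<bar> \<le> K * Im (z h)" "(z \<longlongrightarrow> 0) F"
    and ws: "\<forall>\<^sub>F h in F. Im (w h) < 0 \<and> \<bar>Re (w h)\<bar> \<le> K * - Im (w h)" "(w \<longlongrightarrow> 0) F"
  shows "((\<lambda>h. winding_number p (z h) - winding_number p (w h)) \<longlongrightarrow> 1) F"
proof -
  define A where "A = pathstart p"
  define B where "B = pathfinish p"
  have up: "winding_number p u =
      (Ln ((u - B) / \<i>) - Ln ((u - A) / \<i>)) / (2 * of_real pi * \<i>)"
    if "0 < Im u" "\<bar>Re u\<bar> \<le> K * Im u" for u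
    unfolding A_def B_def
    by (rule winding_number_slit[OF p]) (use slit_avoids_cone[OF cone that k] in auto)
  have down: "winding_number p u =
      (Ln ((u - B) / (- \<i>)) - Ln ((u - A) / (- \<i>))) / (2 * of_real pi * \<i>)"
    if "Im u < 0" "\<bar>Re u\<bar> \<le> K * - Im u" for u
    unfolding A_def B_def
  proof (rule winding_number_slit[OF p])
    fix t :: real assume "t \<in> {0..1}"
    with cone that k have "(- u - - p t) / \<i> \<notin> \<real>\<^sub>\<le>\<^sub>0"
      by (intro slit_avoids_cone[of _ k _ K]) auto
    moreover have "(- u - - p t) / \<i> = (u - p t) / (- \<i>)" by (simp add: field_simps)
    ultimately show "(u - p t) / (- \<i>) \<notin> \<real>\<^sub>\<le>\<^sub>0" by metis
  qed auto
  have AB: "Im ((0 - B) / \<i>) > 0" "Im ((0 - A) / \<i>) < 0"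
    using ends by (auto simp: A_def B_def)
  have nn: "(0 - B) / \<i> \<notin> \<real>\<^sub>\<le>\<^sub>0" "(0 - A) / \<i> \<notin> \<real>\<^sub>\<le>\<^sub>0"
    "(0 - B) / (-\<i>) \<notin> \<real>\<^sub>\<le>\<^sub>0" "(0 - A) / (-\<i>) \<notin> \<real>\<^sub>\<le>\<^sub>0"
    using AB by (auto simp: complex_nonpos_Reals_iff)
  let ?L = "\<lambda>u c. (Ln ((u - B) / c) - Ln ((u - A) / c)) / (2 * of_real pi * \<i>)"
  have "((\<lambda>h. ?L (z h) \<i> - ?L (w h) (-\<i>)) \<longlongrightarrow> ?L 0 \<i> - ?L 0 (-\<i>)) F"
    by (intro tendsto_intros zs ws nn) auto
  \<comment> \<open>The end of the path lies to the right of 0 and its start to the left, so the two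
    changes of branch are half turns of opposite sense, which add up to a full turn in the
    difference.\<close>
  moreover have "?L 0 \<i> - ?L 0 (-\<i>) = 1"
  proof -
    have "Ln ((0 - B) / (-\<i>)) = Ln ((0 - B) / \<i>) - of_real pi * \<i>"
      "Ln ((0 - A) / (-\<i>)) = Ln ((0 - A) / \<i>) + of_real pi * \<i>"
      using Ln_uminus[of "(0 - B) / \<i>"] Ln_uminus[of "(0 - A) / \<i>"] AB by auto
    then show ?thesis by (simp add: field_simps del: divide_i)
  qed
  moreover have "\<forall>\<^sub>F h in F. ?L (z h) \<i> - ?L (w h) (-\<i>) = winding_number p (z h) - winding_number p (w h)"
    using zs(1) ws(1) by eventually_elim (simp add: up down)
  ultimately show ?thesis using tendsto_cong by force
qed

lemma difference_quotient_tendsto: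
  fixes f :: "real \<Rightarrow> complex"
  assumes "(f has_vector_derivative d) (at x)" "v \<noteq> 0"
  shows "((\<lambda>h. (f (x + h) - f x) / v / of_real h) \<longlongrightarrow> d / v) (at 0)"
proof -
  have "((\<lambda>h. norm (f (x + h) - f x - h *\<^sub>R d) / norm h) \<longlongrightarrow> 0) (at 0)"
    using assms(1) by (simp add: has_vector_derivative_def has_derivative_at)
  moreover have "\<forall>\<^sub>F h in at 0. norm (f (x + h) - f x - h *\<^sub>R d) / norm h =
      norm ((f (x + h) - f x) / of_real h - d)"
  proof -
    have "norm (f (x + h) - f x - h *\<^sub>R d) / norm h = norm ((f (x + h) - f x) / of_real h - d)"
      if "h \<noteq> 0" for h
    proof -
      have "(f (x + h) - f x) / of_real h - d = (f (x + h) - f x - h *\<^sub>R d) / of_real h"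
        using that by (simp add: scaleR_conv_of_real diff_divide_distrib)
      then show ?thesis by (simp add: norm_divide)
    qed
    then show ?thesis by (auto simp: eventually_at intro: exI[of _ 1])
  qed
  ultimately have "((\<lambda>h. norm ((f (x + h) - f x) / of_real h - d)) \<longlongrightarrow> 0) (at 0)"
    using tendsto_cong by force
  then have "((\<lambda>h. (f (x + h) - f x) / of_real h) \<longlongrightarrow> d) (at 0)"
    by (rule Lim_null[THEN iffD2, OF tendsto_norm_zero_cancel])
  then have "((\<lambda>h. (f (x + h) - f x) / of_real h / v) \<longlongrightarrow> d / v) (at 0)"
    by (rule tendsto_divide) (use assms(2) in auto)
  moreover have "a / of_real h / v = a / v / of_real h" for a h
    by (metis divide_divide_eq_left mult.commute)
  ultimately show ?thesis by (simp only:)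
qed

lemma eventually_in_cone:
  assumes lim: "((\<lambda>h. f h / of_real h) \<longlongrightarrow> q) (at (0::real))" and q: "0 < Im q" "\<bar>Re q\<bar> < K * Im q"
  shows "\<forall>\<^sub>F h in at_right 0. 0 < Im (f h) \<and> \<bar>Re (f h)\<bar> \<le> K * Im (f h)"
    and "\<forall>\<^sub>F h in at_right 0. Im (f (- h)) < 0 \<and> \<bar>Re (f (- h))\<bar> \<le> K * - Im (f (- h))"
proof -
  have "open ({w. 0 < Im w} \<inter> {w. \<bar>Re w\<bar> < K * Im w})"
    by (intro open_Int open_Collect_less continuous_intros)
  then have ev: "\<forall>\<^sub>F h in at 0. 0 < Im (f h / of_real h) \<and> \<bar>Re (f h / of_real h)\<bar> < K * Im (f h / of_real h)"
    using topological_tendstoD[OF lim, of "{w. 0 < Im w} \<inter> {w. \<bar>Re w\<bar> < K * Im w}"] q by auto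
  then obtain e where e: "0 < e" "\<And>h. h \<noteq> 0 \<Longrightarrow> \<bar>h\<bar> < e \<Longrightarrow>
      0 < Im (f h / of_real h) \<and> \<bar>Re (f h / of_real h)\<bar> < K * Im (f h / of_real h)"
    unfolding eventually_at by (auto simp: dist_real_def)
  have "0 < Im (f h) \<and> \<bar>Re (f h)\<bar> \<le> K * Im (f h)" if "0 < h" "h < e" for h
    using e(2)[of h] that by (simp add: abs_divide divide_strict_right_mono field_simps)
  then show "\<forall>\<^sub>F h in at_right 0. 0 < Im (f h) \<and> \<bar>Re (f h)\<bar> \<le> K * Im (f h)"
    unfolding eventually_at_right_field using e(1) by (intro exI[of _ e]) auto
  have "Im (f (- h)) < 0 \<and> \<bar>Re (f (- h))\<bar> \<le> K * - Im (f (- h))" if "0 < h" "h < e" for h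
    using e(2)[of "- h"] that by (simp add: abs_divide field_simps)
  then show "\<forall>\<^sub>F h in at_right 0. Im (f (- h)) < 0 \<and> \<bar>Re (f (- h))\<bar> \<le> K * - Im (f (- h))"
    unfolding eventually_at_right_field using e(1) by (intro exI[of _ e]) auto
qed

lemma cone_scale:
  assumes "h \<noteq> 0" "0 < Re (q / of_real h)" "\<bar>Im (q / of_real h)\<bar> < k * \<bar>Re (q / of_real h)\<bar>"
  shows "\<bar>Im q\<bar> \<le> k * \<bar>Re q\<bar> \<and> (h < 0 \<longrightarrow> Re q < 0) \<and> (0 < h \<longrightarrow> 0 < Re q)"
proof -
  have "\<bar>Im q\<bar> / \<bar>h\<bar> < (k * \<bar>Re q\<bar>) / \<bar>h\<bar>"
    using assms(3) by (simp add: abs_divide)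
  then have "\<bar>Im q\<bar> < k * \<bar>Re q\<bar>" using assms(1) by (simp add: divide_less_cancel)
  moreover have "0 < Re q / h" using assms(2) by simp
  ultimately show ?thesis by (auto simp: zero_less_divide_iff)
qed

text \<open>Only a short piece of \<open>g\<close> around \<open>y\<close> matters: the other two
  pieces stay away from the crossing, so their winding numbers are continuous there. As the pieces
  are not closed, their winding numbers are not locally constant, and the jump appears as a
  limit.\<close>

lemma winding_number_crossing_jump:
  fixes g :: "real \<Rightarrow> complex" and c :: "real \<Rightarrow> complex"
  assumes g: "path g" and y: "0 < y" "y < 1"
    and uniq: "\<And>t. t \<in> {0..1} \<Longrightarrow> g t = g y \<Longrightarrow> t = y"
    and dg: "(g has_vector_derivative v) (at y)"
    and cx: "c x = g y" and dc: "(c has_vector_derivative u) (at x)"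
    and det: "0 < Im (cnj v * u)"
    and off: "\<forall>\<^sub>F h in at 0. c (x + h) \<notin> path_image g"
  shows "((\<lambda>h. winding_number g (c (x + h)) - winding_number g (c (x - h))) \<longlongrightarrow> 1) (at_right 0)"
proof -
  define P where "P = g y"
  have v: "v \<noteq> 0" using det by auto
  have "u / v = cnj v * u / of_real ((cmod v)\<^sup>2)"
    by (simp add: complex_div_cnj[of u v] mult.commute)
  then have im: "0 < Im (u / v)"
    using det v by (simp add: complex_norm_square[symmetric] del: of_real_power)
  \<comment> \<open>\<open>K\<close> is chosen so that the direction \<open>u / v\<close> of the
    crossing strand lies in the open cone \<open>|Re| < K Im\<close>. The cone around the tangent of
    \<open>g\<close> is then taken so narrow that \<open>k * K\<close> equals 1/2.\<close>
  define K where "K = \<bar>Re (u / v)\<bar> / Im (u / v) + 1"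
  have K: "\<bar>Re (u / v)\<bar> < K * Im (u / v)" "1 \<le> K"
    using im by (auto simp: K_def field_simps)
  define k where "k = 1 / (2 * K)"
  have k: "0 < k" "k * K < 1" using K by (auto simp: k_def)
  have "open ({w. 0 < Re w} \<inter> {w. \<bar>Im w\<bar> < k * \<bar>Re w\<bar>})"
    by (intro open_Int open_Collect_less continuous_intros)
  then have "\<forall>\<^sub>F h in at 0. (g (y + h) - g y) / v / of_real h \<in> {w. 0 < Re w} \<inter> {w. \<bar>Im w\<bar> < k * \<bar>Re w\<bar>}"
    using difference_quotient_tendsto[OF dg v] v k(1) by (intro topological_tendstoD) auto
  then obtain e where e: "0 < e" and cone: "\<And>h. h \<noteq> 0 \<Longrightarrow> \<bar>h\<bar> < e \<Longrightarrow>
      0 < Re ((g (y + h) - g y) / v / of_real h) \<and>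
      \<bar>Im ((g (y + h) - g y) / v / of_real h)\<bar> < k * \<bar>Re ((g (y + h) - g y) / v / of_real h)\<bar>"
    unfolding eventually_at by (auto simp: dist_real_def)
  define r where "r = min (e / 2) (min (y / 2) ((1 - y) / 2))"
  have "0 < r" "r \<le> e / 2" "r \<le> y / 2" "r \<le> (1 - y) / 2"
    using e y by (auto simp: r_def min_def)
  moreover have "e / 2 < e" "y / 2 < y" "(1 - y) / 2 < 1 - y" using e y by auto
  ultimately have r: "0 < r" "r < e" "r < y" "r < 1 - y" by linarith+
  define A where "A = y - r"
  define B where "B = y + r"
  have AB: "A \<in> {0..1}" "B \<in> {0..1}" "0 \<le> A" "A < y" "y < B" "B \<le> 1" using r by (auto simp: A_def B_def)
  let ?m = "\<lambda>t. (subpath A B g t - P) / v"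
  have m: "path (subpath A B g)" using g AB by (intro path_subpath) auto
  have cone': "\<bar>Im ((g t - P) / v)\<bar> \<le> k * \<bar>Re ((g t - P) / v)\<bar> \<and>
     (t < y \<longrightarrow> Re ((g t - P) / v) < 0) \<and> (y < t \<longrightarrow> 0 < Re ((g t - P) / v))" if "t \<in> {A..B}" for t
  proof (cases "t = y")
    case True
    then show ?thesis by (simp add: P_def)
  next
    case False
    have "\<bar>t - y\<bar> < e" using that r by (auto simp: A_def B_def)
    then have c: "0 < Re ((g t - P) / v / of_real (t - y)) \<and>
      \<bar>Im ((g t - P) / v / of_real (t - y))\<bar> < k * \<bar>Re ((g t - P) / v / of_real (t - y))\<bar>"
    proof -
      have "t - y \<noteq> 0" "y + (t - y) = t" using False by auto
      with cone[OF this(1) \<open>\<bar>t - y\<bar> < e\<close>] show ?thesis unfolding P_def by (simp only: )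
    qed
    from cone_scale[OF _ conjunct1[OF c] conjunct2[OF c]] False show ?thesis by simp
  qed
  have sub: "subpath A B g t = g (A + (B - A) * t)" "A + (B - A) * t \<in> {A..B}" if "t \<in> {0..1}" for t
  proof -
    have "0 \<le> (B - A) * t" "(B - A) * t \<le> (B - A) * 1"
      using that AB by (intro mult_nonneg_nonneg mult_left_mono; auto)+
    then show "subpath A B g t = g (A + (B - A) * t)" "A + (B - A) * t \<in> {A..B}"
      by (auto simp: subpath_def add.commute)
  qed
  have mid: "((\<lambda>h. winding_number ?m ((c (x + h) - P) / v) - winding_number ?m ((c (x + - h) - P) / v))
      \<longlongrightarrow> 1) (at_right 0)"
  proof (rule winding_number_cone_jump)
    show "path ?m" using m unfolding path_def by (intro continuous_intros) (use v in auto)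
    show "\<bar>Im (?m t)\<bar> \<le> k * \<bar>Re (?m t)\<bar>" if "t \<in> {0..1}" for t
      using cone'[OF sub(2)[OF that]] sub(1)[OF that] by simp
    show "Re (pathstart ?m) < 0" "0 < Re (pathfinish ?m)"
      using cone'[of A] cone'[of B] AB by (auto simp: pathstart_def pathfinish_def subpath_def)
    show "0 \<le> k" "k * K < 1" using k by auto
    have "((\<lambda>h. (c (x + h) - P) / v / of_real h) \<longlongrightarrow> u / v) (at 0)"
      using difference_quotient_tendsto[OF dc v] by (simp add: P_def cx)
    from eventually_in_cone[OF this im K(1)]
    show "\<forall>\<^sub>F h in at_right 0. 0 < Im ((c (x + h) - P) / v) \<and>
            \<bar>Re ((c (x + h) - P) / v)\<bar> \<le> K * Im ((c (x + h) - P) / v)"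
      and "\<forall>\<^sub>F h in at_right 0. Im ((c (x + - h) - P) / v) < 0 \<and>
            \<bar>Re ((c (x + - h) - P) / v)\<bar> \<le> K * - Im ((c (x + - h) - P) / v)" .
    have cont: "isCont c x" using dc by (rule has_vector_derivative_continuous)
    have "((\<lambda>h. (c (x + s * h) - P) / v) \<longlongrightarrow> (c (x + s * 0) - P) / v) (at_right 0)" for s
      using cont v by (intro tendsto_intros isCont_tendsto_compose[of _ c]) auto
    from this[of 1] this[of "-1"]
    show "((\<lambda>h. (c (x + h) - P) / v) \<longlongrightarrow> 0) (at_right 0)"
      "((\<lambda>h. (c (x + - h) - P) / v) \<longlongrightarrow> 0) (at_right 0)"
      by (simp_all add: P_def cx)
  qed
  have cont: "isCont c x" using dc by (rule has_vector_derivative_continuous)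
  have clim: "((\<lambda>h. c (x + h)) \<longlongrightarrow> P) (at_right 0)" "((\<lambda>h. c (x - h)) \<longlongrightarrow> P) (at_right 0)"
  proof -
    have "((\<lambda>h. c (x + s * h)) \<longlongrightarrow> c (x + s * 0)) (at_right 0)" for s
      using cont by (intro tendsto_intros isCont_tendsto_compose[of _ c]) auto
    from this[of 1] this[of "-1"] show "((\<lambda>h. c (x + h)) \<longlongrightarrow> P) (at_right 0)"
      "((\<lambda>h. c (x - h)) \<longlongrightarrow> P) (at_right 0)" by (simp_all add: P_def cx)
  qed
  \<comment> \<open>By \<open>uniq\<close> a piece that does not contain the parameter
    \<open>y\<close> misses the point \<open>P\<close>.\<close>
  have outer: "((\<lambda>h. winding_number (subpath a b g) (c (x + h)) - winding_number (subpath a b g) (c (x - h)))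
      \<longlongrightarrow> 0) (at_right 0)" if "a \<in> {0..1}" "b \<in> {0..1}" "a \<le> b" "y \<notin> {a..b}" for a b
  proof -
    have p: "path (subpath a b g)" using g that by (intro path_subpath) auto
    have "P \<notin> path_image (subpath a b g)"
    proof
      assume "P \<in> path_image (subpath a b g)"
      then obtain r where r: "r \<in> {a..b}" "g r = g y"
        using \<open>a \<le> b\<close> by (auto simp: path_image_subpath P_def)
      then have "r = y" using that by (intro uniq) auto
      then show False using r \<open>y \<notin> {a..b}\<close> by simp
    qed
    then have "isCont (winding_number (subpath a b g)) P"
      by (rule continuous_at_winding_number[OF p])
    then have "((\<lambda>h. winding_number (subpath a b g) (c (x + h)) - winding_number (subpath a b g) (c (x - h)))
      \<longlongrightarrow> winding_number (subpath a b g) P - winding_number (subpath a b g) P) (at_right 0)"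
      by (intro tendsto_diff isCont_tendsto_compose[of P "winding_number (subpath a b g)"] clim)
    then show ?thesis by simp
  qed
  have split: "winding_number g z = winding_number (subpath 0 A g) z +
     winding_number ?m ((z - P) / v) + winding_number (subpath B 1 g) z" if z: "z \<notin> path_image g" for z
  proof -
    have "z \<notin> path_image (subpath A B g)"
      using z path_image_subpath_subset AB by blast
    from winding_number_affine[OF m this v]
    have "winding_number ?m ((z - P) / v) = winding_number (subpath A B g) z" .
    then show ?thesis
      using winding_number_subpath_combine[OF g z, of 0 A B] winding_number_subpath_combine[OF g z, of 0 B 1] AB
      by simp
  qed
  have ev: "\<forall>\<^sub>F h in at_right 0. c (x + h) \<notin> path_image g \<and> c (x - h) \<notin> path_image g"
  proof -
    obtain d where d: "0 < d" "\<And>h. h \<noteq> 0 \<Longrightarrow> \<bar>h\<bar> < d \<Longrightarrow> c (x + h) \<notin> path_image g"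
      using off unfolding eventually_at by (auto simp: dist_real_def)
    show ?thesis
      unfolding eventually_at_right_field using d(1) d(2)[of "_"] d(2)[of "- _"]
      by (intro exI[of _ d]) auto
  qed
  have "((\<lambda>h. (winding_number (subpath 0 A g) (c (x + h)) - winding_number (subpath 0 A g) (c (x - h))) +
     (winding_number ?m ((c (x + h) - P) / v) - winding_number ?m ((c (x + - h) - P) / v)) +
     (winding_number (subpath B 1 g) (c (x + h)) - winding_number (subpath B 1 g) (c (x - h))))
     \<longlongrightarrow> 0 + 1 + 0) (at_right 0)"
    using AB by (intro tendsto_add mid outer) auto
  moreover have "\<forall>\<^sub>F h in at_right 0.
     (winding_number (subpath 0 A g) (c (x + h)) - winding_number (subpath 0 A g) (c (x - h))) +
     (winding_number ?m ((c (x + h) - P) / v) - winding_number ?m ((c (x + - h) - P) / v)) +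
     (winding_number (subpath B 1 g) (c (x + h)) - winding_number (subpath B 1 g) (c (x - h))) =
     winding_number g (c (x + h)) - winding_number g (c (x - h))"
    using ev by eventually_elim (simp add: split)
  ultimately show ?thesis using tendsto_cong by force
qed

lemma locally_constant_interval:
  fixes W :: "real \<Rightarrow> 'a"
  assumes "\<And>x. x \<in> {a..b} \<Longrightarrow> \<forall>\<^sub>F y in at x. W y = W x" "a \<le> b"
  shows "W a = W b"
proof (rule connected_local_const[of "{a..b}"])
  show "\<forall>x\<in>{a..b}. \<forall>\<^sub>F y in at x within {a..b}. W x = W y"
  proof
    fix x assume "x \<in> {a..b}"
    then have "\<forall>\<^sub>F y in at x. W x = W y"
      using assms(1)[of x] by (auto elim: eventually_mono)
    then show "\<forall>\<^sub>F y in at x within {a..b}. W x = W y"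
      by (meson at_le filter_leD subset_UNIV)
  qed
qed (use assms in auto)

text \<open>Removal of the last jump. Close to it the function is constant on either side, so the
  limit that defines the jump is the limit of a constant.\<close>

lemma telescoping_jumps:
  fixes W :: "real \<Rightarrow> 'a::{ab_group_add, t2_space}" and J :: "real set"
  assumes J: "finite J" "J \<subseteq> {a<..<b}" and ab: "a < b"
    and const: "\<And>x. x \<in> {a..b} - J \<Longrightarrow> \<forall>\<^sub>F y in at x. W y = W x"
    and jump: "\<And>x. x \<in> J \<Longrightarrow> ((\<lambda>h. W (x + h) - W (x - h)) \<longlongrightarrow> j x) (at_right 0)"
  shows "W b - W a = (\<Sum>x\<in>J. j x)"
  using assms
proof (induction "card J" arbitrary: J b)
  case 0
  then have J: "J = {}" by simp
  then show ?case using locally_constant_interval[of a b W] 0 by simp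
next
  case (Suc n)
  define x where "x = Max J"
  have ne: "J \<noteq> {}" using Suc.hyps(2) by auto
  have x: "x \<in> J" "\<And>y. y \<in> J \<Longrightarrow> y \<le> x" using Suc.prems(1) ne by (auto simp: x_def)
  have "Max (insert a (J - {x})) < x"
    using x Suc.prems(1,2) by (subst Max_less_iff) (auto simp: less_le)
  then obtain b' where b': "Max (insert a (J - {x})) < b'" "b' < x"
    using dense by blast
  have b'J: "a < b'" "J - {x} \<subseteq> {a<..<b'}"
    using b' Suc.prems(1,2) by (subst (asm) Max_less_iff; force)+
  have xb: "x < b" using x(1) Suc.prems(2) by auto
  have 1: "W b' - W a = (\<Sum>y\<in>J - {x}. j y)"
  proof (rule Suc.hyps(1))
    show "n = card (J - {x})" using Suc.hyps(2) x(1) Suc.prems(1) by simp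
    show "\<forall>\<^sub>F y in at z. W y = W z" if "z \<in> {a..b'} - (J - {x})" for z
      using that b' xb by (intro Suc.prems(4)) auto
  qed (use Suc.prems b'J in auto)
  have "W y = W b'" if "b' < y" "y < x" for y
  proof (rule locally_constant_interval[symmetric])
    show "\<forall>\<^sub>F u in at z. W u = W z" if "z \<in> {b'..y}" for z
      using that \<open>y < x\<close> b'J xb by (intro Suc.prems(4)) force
  qed (use that in auto)
  moreover have "W y = W b" if "x < y" "y < b" for y
  proof (rule locally_constant_interval)
    show "\<forall>\<^sub>F u in at z. W u = W z" if "z \<in> {y..b}" for z
      using that \<open>x < y\<close> b' b'J x(2)[of z] by (intro Suc.prems(4)) force
  qed (use that in auto)
  ultimately have "\<forall>\<^sub>F h in at_right 0. W (x + h) - W (x - h) = W b - W b'"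
    unfolding eventually_at_right_field
    by (intro exI[of _ "min (x - b') (b - x)"]) (use b' xb in auto)
  then have "((\<lambda>h. W (x + h) - W (x - h)) \<longlongrightarrow> W b - W b') (at_right 0)"
    by (rule tendsto_eventually)
  then have "W b - W b' = j x"
    using Suc.prems(5)[OF x(1)] by (rule tendsto_unique[OF trivial_limit_at_right_real])
  moreover have "(\<Sum>y\<in>J. j y) = j x + (\<Sum>y\<in>J - {x}. j y)"
    using Suc.prems(1) x(1) by (rule sum.remove)
  ultimately show ?case using 1 by (simp add: algebra_simps)
qed

lemma vector_derivative_functional_near:
  fixes c :: "real \<Rightarrow> complex"
  assumes "(c has_vector_derivative v) (at x)" "Im (cnj w * v) > 0"
  shows "\<exists>e>0. \<forall>h. 0 < h \<and> h < e \<longrightarrow>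
     0 < Im (cnj w * (c (x + h) - c x)) \<and> Im (cnj w * (c (x - h) - c x)) < 0"
proof -
  have "((\<lambda>y. Im (cnj w * (c y - c x))) has_real_derivative Im (cnj w * v)) (at x)"
  proof -
    have "((\<lambda>y. cnj w * (c y - c x)) has_vector_derivative cnj w * v) (at x)"
      using assms(1) by (auto intro!: derivative_eq_intros)
    from bounded_linear.has_vector_derivative[OF bounded_linear_Im this]
    show ?thesis by (simp only: has_real_derivative_iff_has_vector_derivative)
  qed
  from DERIV_pos_inc_right[OF this assms(2)] DERIV_pos_inc_left[OF this assms(2)]
  obtain d1 d2 where "0 < d1" "0 < d2"
    "\<And>h. 0 < h \<Longrightarrow> h < d1 \<Longrightarrow> Im (cnj w * (c x - c x)) < Im (cnj w * (c (x + h) - c x))"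
    "\<And>h. 0 < h \<Longrightarrow> h < d2 \<Longrightarrow> Im (cnj w * (c (x - h) - c x)) < Im (cnj w * (c x - c x))"
    by metis
  then show ?thesis by (intro exI[of _ "min d1 d2"]) auto
qed

section \<open>Loops of a diagram in the plane, with all double points counted\<close>

definition double_points :: "long_diagram \<Rightarrow> (real \<times> real) set" where
  "double_points D = {(s, t). s < t \<and> double D s t}"

definition frame_sign :: "long_diagram \<Rightarrow> real \<times> real \<Rightarrow> int" where
  "frame_sign D c = sign_of (vel_det D (fst c) (snd c))"

lemma double_sym: "double D s t \<longleftrightarrow> double D t s"
  by (auto simp: double_def)

lemma vel_det_swap: "vel_det D t s = - vel_det D s t"
  by (simp add: vel_det_def)

lemma long_diagramD:
  assumes "is_long_diagram D"
  shows "continuous_on UNIV (curve D)" "finite {(s, t). double D s t}"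
    "double D s t \<Longrightarrow> double D s u \<Longrightarrow> t = u"
    "double D s t \<Longrightarrow> (curve D has_vector_derivative vector_derivative (curve D) (at s)) (at s)"
    "double D s t \<Longrightarrow> vel_det D s t \<noteq> 0"
    "double D s t \<Longrightarrow> (passage D s, passage D t) \<in> {(Over, Under), (Under, Over), (Virtual, Virtual)}"
    "\<exists>R>0. \<forall>t. R \<le> \<bar>t\<bar> \<longrightarrow> curve D t = of_real t"
  using assms unfolding is_long_diagram_def vector_derivative_works[symmetric] by metis+

lemma finite_double_points: "is_long_diagram D \<Longrightarrow> finite (double_points D)"
  by (rule finite_subset[OF _ long_diagramD(2)]) (auto simp: double_points_def)

locale planar_loop =
  fixes D :: long_diagram and s t :: real
  assumes D: "is_long_diagram D" and st: "s < t" "double D s t"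
begin

definition loop :: "real \<Rightarrow> complex" where "loop r = curve D (s + (t - s) * r)"
definition wind :: "real \<Rightarrow> complex" where "wind x = winding_number loop (curve D x)"
definition meet :: "real set" where "meet = {x. x \<notin> {s..t} \<and> (\<exists>y\<in>{s<..<t}. double D x y)}"
definition partner :: "real \<Rightarrow> real" where "partner x = (THE y. double D x y)"

lemma partner: "double D x y \<Longrightarrow> partner x = y"
  unfolding partner_def using long_diagramD(3)[OF D] by blast

lemma isCont_curve: "isCont (curve D) x"
  using long_diagramD(1)[OF D] by (simp add: continuous_on_eq_continuous_at)

lemma path_loop: "path loop"
  unfolding path_def loop_def
  by (intro continuous_on_compose2[OF long_diagramD(1)[OF D]] continuous_intros) auto

lemma closed_loop: "pathfinish loop = pathstart loop"
  using st by (simp add: pathstart_def pathfinish_def loop_def double_def)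

lemma image_loop: "path_image loop = curve D ` {s..t}"
proof -
  have "(\<lambda>r. s + (t - s) * r) ` {0..1} = {s..t}"
    using st image_affinity_atLeastAtMost[of "t - s" s 0 "1::real"] by (simp add: add.commute)
  then show ?thesis unfolding path_image_def loop_def by (metis image_image)
qed

lemma not_in_loop: "curve D x \<notin> path_image loop" if "x \<notin> {s..t}" "x \<notin> meet"
proof
  assume "curve D x \<in> path_image loop"
  then obtain y where y: "y \<in> {s..t}" "curve D x = curve D y" by (auto simp: image_loop)
  then have xy: "double D x y" using that by (auto simp: double_def)
  have "y \<noteq> s" "y \<noteq> t"
    using xy st long_diagramD(3)[OF D] that(1)
    by (metis double_sym atLeastAtMost_iff order.refl less_imp_le)+
  then show False using xy y that by (auto simp: meet_def)
qed

lemma finite_meet: "finite meet"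
  by (rule finite_subset[OF _ finite_imageI[OF long_diagramD(2)[OF D], of fst]])
    (force simp: meet_def)

lemma wind_locally_constant:
  assumes "x \<notin> {s..t}" "x \<notin> meet"
  shows "\<forall>\<^sub>F y in at x. wind y = wind x"
proof -
  have "open (- path_image loop)" using path_loop by (simp add: closed_path_image open_Compl)
  then obtain e where e: "0 < e" "ball (curve D x) e \<subseteq> - path_image loop"
    using not_in_loop[OF assms] open_contains_ball by (metis ComplI)
  have "\<forall>\<^sub>F y in at x. curve D y \<in> ball (curve D x) e"
    using isCont_curve[of x] e(1) unfolding isCont_def
    by (intro topological_tendstoD) auto
  then show ?thesis
  proof (rule eventually_mono)
    fix y assume "curve D y \<in> ball (curve D x) e"
    then show "wind y = wind x"
      unfolding wind_def using e
      by (intro winding_number_eq[OF path_loop closed_loop, of _ "ball (curve D x) e"]) auto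
  qed
qed

lemma eventually_not_in_loop:
  assumes "x \<notin> {s..t}"
  shows "\<forall>\<^sub>F h in at 0. curve D (x + h) \<notin> path_image loop"
proof -
  have "open (- ({s..t} \<union> (meet - {x})))"
    using finite_meet by (intro open_Compl closed_Un closed_atLeastAtMost finite_imp_closed) auto
  then have "\<forall>\<^sub>F y in at x. y \<in> - ({s..t} \<union> (meet - {x}))"
    using assms by (intro eventually_at_in_open') auto
  then have "\<forall>\<^sub>F y in at x. curve D y \<notin> path_image loop"
    using eventually_neq_at_within[of x x UNIV]
    by eventually_elim (use not_in_loop in auto)
  then show ?thesis
    by (subst (asm) at_to_0) (simp add: eventually_filtermap add.commute)
qed

lemma wind_jump:
  assumes "x \<in> meet"
  shows "((\<lambda>h. wind (x + h) - wind (x - h)) \<longlongrightarrow> of_int (frame_sign D (partner x, x))) (at_right 0)"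
proof -
  obtain y where y: "s < y" "y < t" "double D x y" and x: "x \<notin> {s..t}"
    using assms by (auto simp: meet_def)
  define r where "r = (y - s) / (t - s)"
  have r: "0 < r" "r < 1" using y st by (auto simp: r_def field_simps)
  have ry: "s + (t - s) * r = y" using st by (simp add: r_def)
  define v where "v = vector_derivative (curve D) (at y)"
  define u where "u = vector_derivative (curve D) (at x)"
  have yx: "double D y x" using y by (simp add: double_sym)
  have dy: "(curve D has_vector_derivative v) (at y)" and dx: "(curve D has_vector_derivative u) (at x)"
    using long_diagramD(4)[OF D] yx y by (auto simp: v_def u_def)
  have dl: "(loop has_vector_derivative (t - s) *\<^sub>R v) (at r)"
  proof -
    have "((\<lambda>r. s + (t - s) * r) has_vector_derivative (t - s)) (at r)"
      by (auto intro!: derivative_eq_intros simp flip: has_real_derivative_iff_has_vector_derivative)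
    from vector_diff_chain_at[OF this, of "curve D" v] show ?thesis
      using dy ry by (simp add: loop_def[abs_def] o_def)
  qed
  have lx: "loop r = curve D x" using y ry by (simp add: loop_def double_def)
  have uniq: "q = r" if "q \<in> {0..1}" "loop q = loop r" for q
  proof -
    have "0 \<le> (t - s) * q" "(t - s) * q \<le> t - s"
      using that st mult_left_le[of q "t - s"] by auto
    then have q: "s + (t - s) * q \<in> {s..t}"
      unfolding atLeastAtMost_iff by (intro conjI) linarith+
    moreover have "curve D x = curve D (s + (t - s) * q)"
      using that(2) unfolding lx by (simp add: loop_def)
    ultimately have "double D x (s + (t - s) * q)"
      using x by (auto simp: double_def)
    then have "s + (t - s) * q = y" using long_diagramD(3)[OF D y(3)] by blast
    then have "s + (t - s) * q = s + (t - s) * r" by (simp only: ry)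
    then show ?thesis using st by auto
  qed
  have det: "vel_det D y x = Im (cnj v * u)" by (simp add: vel_det_def u_def v_def)
  have det0: "vel_det D y x \<noteq> 0" using long_diagramD(5)[OF D yx] .
  have px: "partner x = y" using y by (rule_tac partner)
  show ?thesis
  proof (cases "0 < vel_det D y x")
    case True
    then have "0 < Im (cnj ((t - s) *\<^sub>R v) * u)"
      using det st mult_pos_pos[of "t - s" "Im (cnj v * u)"] by (simp add: algebra_simps)
    from winding_number_crossing_jump[OF path_loop r uniq dl lx[symmetric] dx this
        eventually_not_in_loop[OF x]]
    show ?thesis using True by (simp add: wind_def px frame_sign_def sign_of_def)
  next
    case False
    \<comment> \<open>Running through the rest of the curve backwards makes the frame positive and
      negates the jump.\<close>
    then have "0 < Im (cnj ((t - s) *\<^sub>R v) * - u)"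
      using det det0 st mult_pos_pos[of "t - s" "- Im (cnj v * u)"] by (simp add: algebra_simps)
    moreover have "((\<lambda>q. curve D (2 * x - q)) has_vector_derivative - u) (at x)"
    proof -
      have "((\<lambda>q. 2 * x - q) has_vector_derivative - 1) (at x)"
        by (auto intro!: derivative_eq_intros simp flip: has_real_derivative_iff_has_vector_derivative)
      from vector_diff_chain_at[OF this, of "curve D" u] show ?thesis
        using dx by (simp add: o_def)
    qed
    moreover have "\<forall>\<^sub>F h in at 0. curve D (2 * x - (x + h)) \<notin> path_image loop"
    proof -
      have "\<forall>\<^sub>F h in filtermap uminus (at 0). curve D (x + h) \<notin> path_image loop"
        using eventually_not_in_loop[OF x] filtermap_at_minus[of "0::real"] by simp
      then show ?thesis by (simp add: eventually_filtermap)
    qed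
    ultimately have "((\<lambda>h. winding_number loop (curve D (2 * x - (x + h))) -
        winding_number loop (curve D (2 * x - (x - h)))) \<longlongrightarrow> 1) (at_right 0)"
      using winding_number_crossing_jump[OF path_loop r uniq dl, of "\<lambda>q. curve D (2 * x - q)" x "- u"]
      by (simp add: lx)
    from tendsto_minus[OF this] show ?thesis
      using False by (simp add: wind_def px frame_sign_def sign_of_def algebra_simps)
  qed
qed

text \<open>At the crossing itself the two ends of the rest of the curve lie in the same local
  component of the complement of the loop: a linear functional separates them from the loop.\<close>

lemma wind_corner: "\<exists>e>0. \<forall>h. 0 < h \<and> h < e \<longrightarrow> wind (s - h) = wind (t + h)"
proof -
  define P where "P = curve D s"
  define vs where "vs = vector_derivative (curve D) (at s)"
  define vt where "vt = vector_derivative (curve D) (at t)"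
  \<comment> \<open>The line through \<open>P\<close> spanned by \<open>vs + vt\<close> separates
    the two ends of the loop from the two ends of the rest. The sign of \<open>w\<close> puts the
    rest on the side where the functional is positive.\<close>
  define w where "w = (if 0 < vel_det D s t then vs + vt else - (vs + vt))"
  have ts: "double D t s" using st by (simp add: double_sym)
  have Pt: "P = curve D t" using st by (simp add: P_def double_def)
  have ds: "(curve D has_vector_derivative vs) (at s)" and dt: "(curve D has_vector_derivative vt) (at t)"
    using long_diagramD(4)[OF D] ts st by (auto simp: vs_def vt_def)
  have "vel_det D s t \<noteq> 0" using long_diagramD(5)[OF D] st by blast
  then have "0 < Im (cnj (- w) * vs)" "0 < Im (cnj w * vt)"
    by (auto simp: w_def vel_det_def vs_def vt_def algebra_simps)
  from vector_derivative_functional_near[OF ds this(1)] vector_derivative_functional_near[OF dt this(2)]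
  obtain d1 d2 where d: "0 < d1" "0 < d2"
    and s1: "\<And>h. 0 < h \<Longrightarrow> h < d1 \<Longrightarrow>
       Im (cnj w * (curve D (s + h) - P)) < 0 \<and> 0 < Im (cnj w * (curve D (s - h) - P))"
    and t1: "\<And>h. 0 < h \<Longrightarrow> h < d2 \<Longrightarrow>
       0 < Im (cnj w * (curve D (t + h) - P)) \<and> Im (cnj w * (curve D (t - h) - P)) < 0"
    unfolding P_def[symmetric] Pt[symmetric] by (simp add: algebra_simps) metis
  let ?M = "curve D ` {s + d1 / 2..t - d2 / 2}"
  have "compact ?M"
    by (intro compact_continuous_image continuous_on_subset[OF long_diagramD(1)[OF D]]) auto
  moreover have "P \<notin> ?M"
  proof
    assume "P \<in> ?M"
    then obtain y where y: "s + d1 / 2 \<le> y" "y \<le> t - d2 / 2" "P = curve D y" by auto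
    then have "double D s y" using d by (auto simp: double_def P_def)
    then have "y = t" using st(2) by (rule long_diagramD(3)[OF D])
    then show False using y d by simp
  qed
  ultimately obtain q where q: "0 < q" "ball P q \<subseteq> - ?M"
    using open_contains_ball by (metis ComplI compact_imp_closed open_Compl)
  have "\<exists>e>0. \<forall>x. \<bar>x - a\<bar> < e \<longrightarrow> curve D x \<in> ball P q" if "curve D a = P" for a
    using isCont_curve[of a] q(1) unfolding continuous_at_eps_delta that dist_real_def
    by (auto simp: dist_commute)
  from this[of s] this[of t] obtain e1 e2 where e: "0 < e1" "0 < e2"
    "\<And>x. \<bar>x - s\<bar> < e1 \<Longrightarrow> curve D x \<in> ball P q" "\<And>x. \<bar>x - t\<bar> < e2 \<Longrightarrow> curve D x \<in> ball P q"
    using Pt P_def by metis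
  \<comment> \<open>A half disk that meets the two ends of the rest but not the loop: near the
    crossing the loop has negative values of the functional, and further along it stays in
    \<open>?M\<close>, outside the disk.\<close>
  define S where "S = ball P q \<inter> {z. inner (\<i> * w) P < inner (\<i> * w) z}"
  have S: "z \<in> S \<longleftrightarrow> z \<in> ball P q \<and> 0 < Im (cnj w * (z - P))" for z
    by (auto simp: S_def inner_complex_def algebra_simps)
  have conn: "connected S" unfolding S_def
    by (intro convex_connected convex_Int convex_ball convex_halfspace_gt)
  have disj: "S \<inter> path_image loop = {}"
  proof -
    have "curve D y \<notin> S" if "y \<in> {s..t}" for y
    proof -
      consider "y = s \<or> y = t" | "s < y" "y < s + d1" | "t - d2 < y" "y < t" | "s + d1 / 2 \<le> y" "y \<le> t - d2 / 2"
        using \<open>y \<in> {s..t}\<close> d by fastforce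
      then show ?thesis
      proof cases
        case 1
        then show ?thesis using Pt by (auto simp: S P_def)
      next
        case 2
        then show ?thesis using s1[of "y - s"] by (simp add: S)
      next
        case 3
        then show ?thesis using t1[of "t - y"] by (simp add: S)
      next
        case 4
        then show ?thesis using q by (auto simp: S)
      qed
    qed
    then show ?thesis by (auto simp: image_loop)
  qed
  have "wind (s - h) = wind (t + h)" if h: "0 < h" "h < Min {d1, d2, e1, e2}" for h
    unfolding wind_def
  proof (rule winding_number_eq[OF path_loop closed_loop _ _ conn disj])
    show "curve D (s - h) \<in> S" "curve D (t + h) \<in> S"
      using h s1[of h] t1[of h] e(3)[of "s - h"] e(4)[of "t + h"] by (auto simp: S simp del: mem_ball)
  qed
  then show ?thesis using d e by (intro exI[of _ "Min {d1, d2, e1, e2}"]) auto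
qed

lemma wind_far: "\<exists>R>0. \<forall>x. R \<le> \<bar>x\<bar> \<longrightarrow> wind x = 0"
proof -
  obtain B where B: "\<And>z. B \<le> norm z \<Longrightarrow> winding_number loop z = 0"
    using winding_number_zero_at_infinity[OF path_loop closed_loop] by auto
  obtain R where "R > 0" "\<And>x. R \<le> \<bar>x\<bar> \<Longrightarrow> curve D x = of_real x"
    using long_diagramD(7)[OF D] by blast
  then show ?thesis using B by (intro exI[of _ "max R B"]) (auto simp: wind_def)
qed

text \<open>Along the curve with the loop left out, the winding number starts and ends at 0, and it
  takes the same value just before and just after the omitted loop. Hence its jumps before
  \<open>s\<close> and after \<open>t\<close> add up to 0.\<close>

lemma sum_jumps: "(\<Sum>x\<in>meet. frame_sign D (partner x, x)) = 0"
proof -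
  obtain R where R: "0 < R" "\<And>x. R \<le> \<bar>x\<bar> \<Longrightarrow> wind x = 0" using wind_far by blast
  obtain e where e: "0 < e" "\<And>h. 0 < h \<Longrightarrow> h < e \<Longrightarrow> wind (s - h) = wind (t + h)"
    using wind_corner by blast
  define L where "L = Max (insert R ((\<lambda>x. \<bar>x\<bar> + 1) ` (insert s (insert t meet))))"
  have L: "R \<le> L" "\<And>x. x \<in> insert s (insert t meet) \<Longrightarrow> \<bar>x\<bar> + 1 \<le> L"
    unfolding L_def using finite_meet by (intro Max_ge; force)+
  \<comment> \<open>A margin around the omitted loop that contains no jump and in which
    \<open>wind_corner\<close> applies; \<open>L\<close> above lies beyond all jumps.\<close>
  define m where "m = Min (insert (min e 1) ((\<lambda>x. if x < s then s - x else x - t) ` meet))"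
  have "m \<le> min e 1" unfolding m_def using finite_meet by (intro Min_le) auto
  moreover have "0 < m" unfolding m_def using finite_meet e(1)
    by (subst Min_gr_iff) (auto simp: meet_def)
  ultimately have mpos: "0 < m" "m \<le> e" "m \<le> 1" by auto
  have mm: "x \<in> meet \<Longrightarrow> m \<le> (if x < s then s - x else x - t)" for x
    unfolding m_def using finite_meet by (intro Min_le) auto
  define h where "h = m / 2"
  have h: "0 < h" "h < e" "h < 1" "h < m" using mpos by (auto simp: h_def)
  let ?j = "\<lambda>x. complex_of_int (frame_sign D (partner x, x))"
  have 1: "wind (s - h) - wind (- L) = (\<Sum>x\<in>meet \<inter> {..<s}. ?j x)"
  proof (rule telescoping_jumps)
    show "meet \<inter> {..<s} \<subseteq> {- L<..<s - h}"
      using L(2) mm h by (force simp: abs_less_iff)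
    show "- L < s - h" using L(2)[of s] h by auto
    show "\<forall>\<^sub>F y in at x. wind y = wind x" if "x \<in> {- L..s - h} - meet \<inter> {..<s}" for x
      using that h by (intro wind_locally_constant) auto
  qed (use finite_meet wind_jump in auto)
  have 2: "wind L - wind (t + h) = (\<Sum>x\<in>meet \<inter> {t<..}. ?j x)"
  proof (rule telescoping_jumps)
    show "meet \<inter> {t<..} \<subseteq> {t + h<..<L}"
      using L(2) mm h st by (force simp: abs_less_iff)
    show "t + h < L" using L(2)[of t] h by auto
    show "\<forall>\<^sub>F y in at x. wind y = wind x" if "x \<in> {t + h..L} - meet \<inter> {t<..}" for x
      using that h st by (intro wind_locally_constant) auto
  qed (use finite_meet wind_jump in auto)
  have "meet = (meet \<inter> {..<s}) \<union> (meet \<inter> {t<..})" by (auto simp: meet_def)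
  then have "(\<Sum>x\<in>meet. ?j x) = (\<Sum>x\<in>meet \<inter> {..<s}. ?j x) + (\<Sum>x\<in>meet \<inter> {t<..}. ?j x)"
    by (subst sum.union_disjoint[symmetric]) (use finite_meet st in auto)
  also have "\<dots> = (wind (s - h) - wind (- L)) + (wind L - wind (t + h))" by (simp only: 1 2)
  also have "\<dots> = 0"
    using R(2)[of L] R(2)[of "- L"] L(1) R(1) e(2)[OF h(1,2)] by simp
  finally have "complex_of_int (\<Sum>x\<in>meet. frame_sign D (partner x, x)) = 0" by simp
  then show ?thesis using of_int_eq_0_iff by blast
qed

text \<open>Only double points with exactly one end inside the loop contribute to the pairing, each
  with a factor 4. For those met before the loop, the frame in order of time is the opposite of the
  frame with the loop first, which matches the sign of the determinant. The total is four times the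
  sum of the jumps.\<close>

theorem planar_index: "pairing (double_points D) (frame_sign D) (\<lambda>_. 2) (chi (s, t)) = 0"
proof -
  let ?X = "double_points D"
  have fin: "finite ?X" using D by (rule finite_double_points)
  have uq: "u \<notin> {s, t} \<and> v \<notin> {s, t}" if "(u, v) \<in> ?X" "(u, v) \<noteq> (s, t)" for u v
  proof -
    have uv: "u < v" "double D u v" "double D v u" using that double_sym by (auto simp: double_points_def)
    have ts: "double D t s" using st by (simp add: double_sym)
    have "u = s \<Longrightarrow> v = t" by (metis long_diagramD(3)[OF D] uv(2,3) st(2) ts)
    moreover have "v = s \<Longrightarrow> u = t" by (metis long_diagramD(3)[OF D] uv(2,3) st(2) ts)
    moreover have "u = t \<Longrightarrow> v = s" by (metis long_diagramD(3)[OF D] uv(2,3) st(2) ts)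
    moreover have "v = t \<Longrightarrow> u = s" by (metis long_diagramD(3)[OF D] uv(2,3) st(2) ts)
    ultimately have "u \<noteq> s \<and> u \<noteq> t \<and> v \<noteq> s \<and> v \<noteq> t"
      using that(2) uv(1) st(1) by (metis less_asym)
    then show ?thesis by simp
  qed
  let ?A = "{e \<in> ?X. fst e \<notin> {s..t} \<and> snd e \<in> {s<..<t}}"
  let ?B = "{e \<in> ?X. snd e \<notin> {s..t} \<and> fst e \<in> {s<..<t}}"
  have eq: "frame_sign D e * (2 * chi (s, t) (snd e) - 2 * chi (s, t) (fst e)) =
     (if e \<in> ?A then 4 * frame_sign D e else 0) - (if e \<in> ?B then 4 * frame_sign D e else 0)"
    if "e \<in> ?X" for e
  proof (cases "e = (s, t)")
    case True
    then show ?thesis by (simp add: chi_def)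
  next
    case False
    then show ?thesis using uq[of "fst e" "snd e"] that
      by (auto simp: chi_def)
  qed
  have "pairing ?X (frame_sign D) (\<lambda>_. 2) (chi (s, t)) =
      4 * ((\<Sum>e\<in>?A. frame_sign D e) - (\<Sum>e\<in>?B. frame_sign D e))"
  proof -
    have "pairing ?X (frame_sign D) (\<lambda>_. 2) (chi (s, t)) =
      (\<Sum>e\<in>?X. (if e \<in> ?A then 4 * frame_sign D e else 0) - (if e \<in> ?B then 4 * frame_sign D e else 0))"
      unfolding pairing_def using eq by (intro sum.cong) (auto simp: mult.commute)
    also have "\<dots> = (\<Sum>e\<in>?A. 4 * frame_sign D e) - (\<Sum>e\<in>?B. 4 * frame_sign D e)"
      unfolding sum_subtractf
      using sum.inter_restrict[OF fin, of "\<lambda>e. 4 * frame_sign D e" ?A]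
        sum.inter_restrict[OF fin, of "\<lambda>e. 4 * frame_sign D e" ?B]
      by (simp add: Int_absorb1 Collect_mono_iff cong: conj_cong)
    finally show ?thesis by (simp add: sum_distrib_left algebra_simps)
  qed
  moreover have "(\<Sum>e\<in>?A. frame_sign D e) = - (\<Sum>x\<in>meet \<inter> {..<s}. frame_sign D (partner x, x))"
    unfolding sum_negf[symmetric]
  proof (rule sum.reindex_bij_witness[of _ "\<lambda>x. (x, partner x)" fst])
    fix e assume e: "e \<in> ?A"
    then have de: "double D (fst e) (snd e)" by (auto simp: double_points_def)
    show "(fst e, partner (fst e)) = e" using partner[OF de] by simp
    show "fst e \<in> meet \<inter> {..<s}" using e de by (auto simp: meet_def double_points_def)
    show "- frame_sign D (partner (fst e), fst e) = frame_sign D e"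
      using partner[OF de] long_diagramD(5)[OF D de] vel_det_swap[of D "snd e" "fst e"]
      by (auto simp: frame_sign_def sign_of_def)
  next
    fix x assume "x \<in> meet \<inter> {..<s}"
    then show "(x, partner x) \<in> ?A" by (auto simp: meet_def double_points_def partner)
  qed auto
  moreover have "(\<Sum>e\<in>?B. frame_sign D e) = (\<Sum>x\<in>meet \<inter> {t<..}. frame_sign D (partner x, x))"
  proof (rule sum.reindex_bij_witness[of _ "\<lambda>x. (partner x, x)" snd])
    fix e assume e: "e \<in> ?B"
    then have de: "double D (snd e) (fst e)" by (auto simp: double_points_def double_sym)
    show "(partner (snd e), snd e) = e" using partner[OF de] by simp
    show "snd e \<in> meet \<inter> {t<..}" using e de by (auto simp: meet_def double_points_def)
    show "frame_sign D (partner (snd e), snd e) = frame_sign D e" using partner[OF de] by simp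
  next
    fix x assume x: "x \<in> meet \<inter> {t<..}"
    then obtain y where y: "y \<in> {s<..<t}" "double D x y" by (auto simp: meet_def)
    then have "double D y x" by (simp add: double_sym)
    then show "(partner x, x) \<in> ?B" using x y partner[OF y(2)] by (auto simp: double_points_def)
  qed auto
  moreover have "(\<Sum>x\<in>meet. frame_sign D (partner x, x)) =
     (\<Sum>x\<in>meet \<inter> {..<s}. frame_sign D (partner x, x)) + (\<Sum>x\<in>meet \<inter> {t<..}. frame_sign D (partner x, x))"
  proof -
    have "meet = (meet \<inter> {..<s}) \<union> (meet \<inter> {t<..})" by (auto simp: meet_def)
    then show ?thesis
      by (subst sum.union_disjoint[symmetric]) (use finite_meet st in auto)
  qed
  ultimately show ?thesis using sum_jumps by simp
qed

end

section \<open>Invariance under the generalized Reidemeister moves\<close>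

definition over_first :: "long_diagram \<Rightarrow> real \<times> real \<Rightarrow> bool" where
  "over_first D c \<longleftrightarrow> passage D (fst c) = Over"

definition diagram_poly :: "(int \<Rightarrow> int \<Rightarrow> int \<Rightarrow> laurent) \<Rightarrow> nat \<Rightarrow> nat \<Rightarrow> long_diagram \<Rightarrow> laurent" where
  "diagram_poly G a b D = gauss_poly G a b (real_crossings D) (frame_sign D) (over_first D)"

lemma real_crossings_double_points:
  "real_crossings D = {c \<in> double_points D. passage D (fst c) \<noteq> Virtual}"
  by (auto simp: real_crossings_def double_points_def)

lemma finite_real_crossings: "is_long_diagram D \<Longrightarrow> finite (real_crossings D)"
  by (simp add: real_crossings_double_points finite_double_points)

lemma sign_of_cong: "sgn x = sgn y \<Longrightarrow> sign_of x = sign_of y"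
  by (auto simp: sign_of_def sgn_if split: if_splits)

lemma diagram_poly_isotopic:
  assumes "isotopic D D'"
  shows "diagram_poly G a b D' = diagram_poly G a b D"
proof -
  obtain h h' f where h: "homeomorphism UNIV UNIV h h'" and f: "strict_mono f" "surj f"
    and c: "curve D' = h \<circ> curve D \<circ> f"
    and d: "\<And>s t. double D' s t \<Longrightarrow> passage D' s = passage D (f s) \<and>
        sgn (vel_det D' s t) = sgn (vel_det D (f s) (f t))"
    using assms unfolding isotopic_def by blast
  have "inj h" using h by (metis homeomorphism_apply1 UNIV_I injI)
  moreover have "inj f" using f(1) by (rule strict_mono_imp_inj_on)
  ultimately have dbl: "double D' s t \<longleftrightarrow> double D (f s) (f t)" for s t
    by (auto simp: double_def c inj_eq)
  have lt: "f s < f t \<longleftrightarrow> s < t" for s t using f(1) by (rule strict_mono_less)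
  have pas: "passage D' s = passage D (f s)" if "double D' s t" for s t using d[OF that] by simp
  have "real_crossings D = map_prod f f ` real_crossings D'"
  proof -
    have "c \<in> map_prod f f ` real_crossings D'" if "c \<in> real_crossings D" for c
    proof -
      obtain s t where "c = (f s, f t)" using f(2) by (metis surj_pair surjD)
      then show ?thesis using that dbl lt pas by (force simp: real_crossings_def)
    qed
    then show ?thesis using dbl lt pas by (auto simp: real_crossings_def)
  qed
  then show ?thesis
    unfolding diagram_poly_def
    by (intro gauss_poly_order_iso[of UNIV f, symmetric])
      (use f d in \<open>auto simp: real_crossings_def frame_sign_def over_first_def intro!: sign_of_cong\<close>)
qed

section \<open>Diagrams that agree outside a disk\<close>

locale local_move =
  fixes arcs :: "(real \<times> real) list" and D D' :: long_diagram
  assumes change: "local_change arcs D D'" and D: "is_long_diagram D" and D': "is_long_diagram D'"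
begin

definition inside :: "real set" where "inside = (\<Union>p\<in>set arcs. open_arc p)"

definition outer :: "(real \<times> real) set" where "outer = {c \<in> double_points D. fst c \<notin> inside}"

lemma arc_less: "p \<in> set arcs \<Longrightarrow> fst p < snd p"
  using change by (auto simp: local_change_def)

lemma disc: obtains B :: "complex set" where "closed B"
  "\<And>E. E \<in> {D, D'} \<Longrightarrow> curve E -` B = (\<Union>p\<in>set arcs. closed_arc p)"
  "\<And>E. E \<in> {D, D'} \<Longrightarrow> curve E -` interior B = inside"
  "\<And>E s t. E \<in> {D, D'} \<Longrightarrow> double E s t \<Longrightarrow> curve E s \<notin> frontier B"
proof -
  obtain B where B: "B homeomorphic cball (0::complex) 1"
    "\<forall>E\<in>{D, D'}. curve E -` B = (\<Union>p\<in>set arcs. closed_arc p) \<and>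
       curve E -` interior B = (\<Union>p\<in>set arcs. open_arc p) \<and>
       (\<forall>s t. double E s t \<longrightarrow> curve E s \<notin> frontier B)"
    using change unfolding local_change_def by (elim conjE exE) blast
  have "closed B" using B(1) homeomorphic_compactness compact_cball compact_imp_closed by blast
  with that[of B] B(2) show ?thesis by (simp add: inside_def)
qed

lemma curve_eq: "t \<notin> inside \<Longrightarrow> curve D' t = curve D t"
  using change by (simp add: local_change_def inside_def)

lemma passage_eq: "s \<notin> inside \<Longrightarrow> double D s t \<Longrightarrow> passage D' s = passage D s"
  using change unfolding local_change_def inside_def by blast

lemma double_inside:
  assumes "E \<in> {D, D'}" "double E s t" "s \<in> inside"
  shows "t \<in> inside"
proof -
  obtain B where B: "curve E -` interior B = inside" using assms(1) disc by metis
  have "curve E s \<in> interior B" using assms(3) unfolding B[symmetric] by simp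
  then show ?thesis using assms(2) unfolding B[symmetric] by (simp add: double_def)
qed

lemma double_outside: "s \<notin> inside \<Longrightarrow> double D' s t \<longleftrightarrow> double D s t"
  using double_inside[of _ t s] curve_eq double_sym
  by (metis double_def insertCI)

text \<open>Coincidence outside the open arcs alone says nothing about derivatives at the ends of
  arcs. As double points avoid the boundary of the disk, the parameter has a neighbourhood outside
  the closed arcs, on which both curves agree.\<close>

lemma velocity_eq:
  assumes "double D s t" "s \<notin> inside"
  shows "vector_derivative (curve D') (at s) = vector_derivative (curve D) (at s)"
proof -
  obtain B where B: "closed B" "curve D -` B = (\<Union>p\<in>set arcs. closed_arc p)"
    "curve D -` interior B = inside" "curve D s \<notin> frontier B"
    using disc assms(1) by (metis insertCI)
  let ?C = "\<Union>p\<in>set arcs. closed_arc p"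
  have "s \<notin> ?C"
    using B assms(2) unfolding B(2)[symmetric] B(3)[symmetric] frontier_def
    by (auto simp: closure_closed)
  moreover have "open (- ?C)" by (auto simp: closed_arc_def intro!: open_Compl closed_UN)
  ultimately have "\<forall>\<^sub>F x in nhds s. x \<in> - ?C" by (intro eventually_nhds_in_open) auto
  then have "\<forall>\<^sub>F x in nhds s. x \<in> UNIV \<longrightarrow> curve D' x = curve D x"
  proof (rule eventually_mono)
    fix x assume "x \<in> - ?C"
    then have "x \<notin> inside" by (fastforce simp: inside_def open_arc_def closed_arc_def)
    then show "x \<in> UNIV \<longrightarrow> curve D' x = curve D x" using curve_eq by simp
  qed
  then show ?thesis by (rule vector_derivative_cong_eq) auto
qed

lemma outer_eq: "{c \<in> double_points D'. fst c \<notin> inside} = outer"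
  using double_outside by (auto simp: outer_def double_points_def)

lemma outer_data:
  assumes "c \<in> outer"
  shows "frame_sign D' c = frame_sign D c" "passage D' (fst c) = passage D (fst c)"
    "snd c \<notin> inside" "fst c \<notin> inside" "fst c < snd c"
proof -
  have c: "double D (fst c) (snd c)" "double D (snd c) (fst c)" "fst c \<notin> inside"
    using assms by (auto simp: outer_def double_points_def double_sym)
  then show s: "snd c \<notin> inside" "fst c \<notin> inside" "fst c < snd c"
    using double_inside[of D "snd c" "fst c"] assms by (auto simp: outer_def double_points_def)
  show "frame_sign D' c = frame_sign D c"
    using velocity_eq c s by (simp add: frame_sign_def vel_det_def)
  show "passage D' (fst c) = passage D (fst c)" using passage_eq c by blast
qed

lemma outer_gap:
  assumes "c \<in> outer" "u \<in> {fst c, snd c}" "p \<in> set arcs"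
  shows "u \<le> fst p \<or> snd p \<le> u"
  using outer_data(3,4)[OF assms(1)] assms(2,3) by (force simp: inside_def open_arc_def)

lemma finite_outer: "finite outer"
  using finite_double_points[OF D] by (simp add: outer_def)

definition inner :: "long_diagram \<Rightarrow> (real \<times> real) set" where
  "inner E = {c \<in> double_points E. fst c \<in> inside}"

lemma double_points_split:
  "double_points D = outer \<union> inner D" "double_points D' = outer \<union> inner D'"
  using outer_eq by (auto simp: outer_def inner_def)

lemma outer_inner_disjoint: "outer \<inter> inner E = {}"
  by (auto simp: outer_def inner_def)

lemma inner_meets:
  assumes "E \<in> {D, D'}"
  shows "inner E = {(s, t). s < t \<and> (\<exists>p\<in>set arcs. \<exists>q\<in>set arcs. (s, t) \<in> meets E p q)}"
  using double_inside[OF assms]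
  by (fastforce simp: inner_def double_points_def meets_def inside_def)

definition outer_real :: "(real \<times> real) set" where
  "outer_real = {c \<in> outer. passage D (fst c) \<noteq> Virtual}"

lemma real_split:
  "real_crossings D = outer_real \<union> {c \<in> inner D. passage D (fst c) \<noteq> Virtual}"
  "real_crossings D' = outer_real \<union> {c \<in> inner D'. passage D' (fst c) \<noteq> Virtual}"
  using outer_data(2)
  by (auto simp: real_crossings_double_points double_points_split outer_real_def)

lemma gauss_poly_outer:
  "gauss_poly G a b outer_real (frame_sign D') (over_first D') =
   gauss_poly G a b outer_real (frame_sign D) (over_first D)"
  by (rule gauss_poly_cong) (auto simp: outer_data outer_real_def over_first_def)

lemma arcs_disjoint:
  assumes "i < length arcs" "j < i" "arcs ! i = p" "arcs ! j = q"
  shows "snd p < fst q \<or> snd q < fst p"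
proof -
  have "disjnt (closed_arc p) (closed_arc q)"
  proof -
    have "\<forall>i<length arcs. \<forall>j<i. disjnt (closed_arc (arcs ! i)) (closed_arc (arcs ! j))"
      using change unfolding local_change_def by (elim conjE)
    then show ?thesis using assms by metis
  qed
  moreover have "fst p < snd p" "fst q < snd q"
    using arc_less nth_mem[of i arcs] nth_mem[of j arcs] assms by auto
  ultimately have "\<not> (fst q \<le> snd p \<and> fst p \<le> snd q)"
  proof (intro notI)
    assume *: "disjnt (closed_arc p) (closed_arc q)" "fst p < snd p" "fst q < snd q"
      "fst q \<le> snd p \<and> fst p \<le> snd q"
    then have "max (fst p) (fst q) \<in> closed_arc p" "max (fst p) (fst q) \<in> closed_arc q"
      by (auto simp: closed_arc_def)
    then show False using *(1) by (meson disjnt_iff)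
  qed
  then show ?thesis by auto
qed

end

lemma diagram_poly_move1:
  assumes m: "move1 D D'" and D: "is_long_diagram D" and D': "is_long_diagram D'" and G: "admissible G"
  shows "diagram_poly G a b D' = diagram_poly G a b D"
proof -
  obtain p s0 t0 where lc: "local_change [p] D D'" and m: "meets D p p = {(s0, t0), (t0, s0)}" "s0 \<noteq> t0"
    and m': "meets D' p p = {}"
    using m unfolding move1_def by blast
  interpret local_move "[p]" D D' using lc D D' by unfold_locales
  obtain s t where st: "s < t" "meets D p p = {(s, t), (t, s)}"
    using m by (metis insert_commute linorder_neqE)
  have i: "inner D = {(s, t)}" "inner D' = {}"
    using st m' by (auto simp: inner_meets)
  have "(s, t) \<in> meets D p p" using st by simp
  then have p: "fst p < s" "t < snd p" by (auto simp: meets_def open_arc_def)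
  have X': "real_crossings D' = outer_real" using real_split(2) i by simp
  show ?thesis
  proof (cases "passage D s = Virtual")
    case True
    then have "real_crossings D = outer_real" using real_split(1) i by auto
    then show ?thesis using X' gauss_poly_outer by (simp add: diagram_poly_def)
  next
    case False
    then have X: "real_crossings D = insert (s, t) outer_real" using real_split(1) i by auto
    have "gauss_poly G a b (insert (s, t) outer_real) (frame_sign D) (over_first D) =
        gauss_poly G a b outer_real (frame_sign D) (over_first D)"
    proof (rule gauss_poly_insert_isolated)
      show "finite outer_real" using finite_outer by (simp add: outer_real_def)
      show "(s, t) \<notin> outer_real" using outer_inner_disjoint[of D] i by (auto simp: outer_real_def)
      show "fst c < snd c \<and> (\<forall>u\<in>{fst c, snd c}. u < fst (s, t) \<or> snd (s, t) < u)"
        if "c \<in> outer_real" for c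
        using outer_gap[of c _ p] outer_data(5)[of c] that p by (force simp: outer_real_def)
    qed (use st G in auto)
    then show ?thesis using X X' gauss_poly_outer by (simp add: diagram_poly_def)
  qed
qed

lemma passage_cases:
  assumes "is_long_diagram D" "double D s t"
  obtains "passage D s = Over" "passage D t = Under" | "passage D s = Under" "passage D t = Over"
    | "passage D s = Virtual" "passage D t = Virtual"
  using long_diagramD(6)[OF assms] by auto

lemma diagram_poly_move2:
  assumes m: "move2 D D'" and D: "is_long_diagram D" and D': "is_long_diagram D'"
  shows "diagram_poly G a b D' = diagram_poly G a b D"
proof -
  obtain p0 q0 u v u' v' where lc: "local_change [p0, q0] D D'"
    and e: "meets D p0 p0 = {}" "meets D q0 q0 = {}"
      "meets D' p0 p0 = {}" "meets D' q0 q0 = {}" "meets D' p0 q0 = {}"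
    and uv: "meets D p0 q0 = {(u, v), (u', v')}" "u \<noteq> u'" "passage D u = passage D u'"
      "sgn (vel_det D u v) = - sgn (vel_det D u' v')"
    using m unfolding move2_def by blast
  interpret local_move "[p0, q0]" D D' using lc D D' by unfold_locales
  have mc: "meets E x y = (\<lambda>(s, t). (t, s)) ` meets E y x" for E x y
    by (force simp: meets_def double_sym)
  have duv: "double D u v" "double D u' v'" using uv(1) by (auto simp: meets_def set_eq_iff)
  have v: "v \<noteq> v'" using long_diagramD(3)[OF D, of v u u'] duv uv(2) by (auto simp: double_sym)
  have pv: "passage D v = passage D v'"
    using passage_cases[OF D duv(1)] passage_cases[OF D duv(2)] uv(3) by (metis passage.distinct(1,3,5))
  have vs: "sgn (vel_det D v u) = - sgn (vel_det D v' u')"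
    using uv(4) by (simp add: vel_det_swap[of D v] vel_det_swap[of D v'] sgn_minus)
  \<comment> \<open>The move is symmetric in its two arcs; from here on they are named in order of
    time, so that the pairs of parameters are chords.\<close>
  have "snd q0 < fst p0 \<or> snd p0 < fst q0" using arcs_disjoint[of 1 0] by simp
  then obtain p q s t s' t' where pq: "snd p < fst q" "{p, q} = {p0, q0}"
    and st: "meets D p q = {(s, t), (s', t')}" "s \<noteq> s'" "t \<noteq> t'" "passage D s = passage D s'"
      "sgn (vel_det D s t) = - sgn (vel_det D s' t')"
    and d: "double D s t" "double D s' t'"
    and e': "meets D p p = {}" "meets D q q = {}" "meets D' p p = {}" "meets D' q q = {}"
      "meets D' p q = {}"
  proof (elim disjE)
    assume "snd p0 < fst q0"
    then show thesis using that[of p0 q0 u v u' v'] uv v e duv by auto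
  next
    assume "snd q0 < fst p0"
    then show thesis using that[of q0 p0 v u v' u'] uv v e duv pv vs mc[of D q0 p0] mc[of D' q0 p0]
      by (auto simp: double_sym)
  qed
  have mem: "(s, t) \<in> meets D p q" "(s', t') \<in> meets D p q" using st by auto
  then have pos: "fst p < s" "s < snd p" "fst p < s'" "s' < snd p"
    "fst q < t" "t < snd q" "fst q < t'" "t' < snd q" by (auto simp: meets_def open_arc_def)
  have arcs: "set [p0, q0] = {p, q}" using pq by auto
  have qp: "meets D q p = {(t, s), (t', s')}" "meets D' q p = {}"
    using mc[of D q p] mc[of D' q p] st e' by auto
  have lt: "s < t" "s' < t'" using pos pq by auto
  have i: "inner D = {(s, t), (s', t')}" "inner D' = {}"
    using lt by (auto simp: inner_meets arcs[simplified] e' st(1) qp)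
  have X': "real_crossings D' = outer_real" using real_split(2) i by simp
  show ?thesis
  proof (cases "passage D s = Virtual")
    case True
    then have "real_crossings D = outer_real" using real_split(1) i st by auto
    then show ?thesis using X' gauss_poly_outer by (simp add: diagram_poly_def)
  next
    case False
    then have X: "real_crossings D = insert (s, t) (insert (s', t') outer_real)"
      using real_split(1) i st by auto
    have "gauss_poly G a b (insert (s, t) (insert (s', t') outer_real)) (frame_sign D) (over_first D) =
        gauss_poly G a b outer_real (frame_sign D) (over_first D)"
    proof (rule gauss_poly_insert_cancelling)
      show "finite outer_real" using finite_outer by (simp add: outer_real_def)
      show "(s, t) \<notin> outer_real" "(s', t') \<notin> outer_real"
        using outer_inner_disjoint[of D] i by (auto simp: outer_real_def)
      show "frame_sign D (s', t') = - frame_sign D (s, t)"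
        using st(5) long_diagramD(5)[OF D d(1)] long_diagramD(5)[OF D d(2)]
        by (auto simp: frame_sign_def sign_of_def sgn_if split: if_splits)
      show "fst c < snd c \<and> (\<forall>u\<in>{fst c, snd c}.
          \<not> (min (fst (s, t)) (fst (s', t')) \<le> u \<and> u \<le> max (fst (s, t)) (fst (s', t'))) \<and>
          \<not> (min (snd (s, t)) (snd (s', t')) \<le> u \<and> u \<le> max (snd (s, t)) (snd (s', t'))))"
        if "c \<in> outer_real" for c
      proof (intro conjI ballI)
        have c: "c \<in> outer" using that by (simp add: outer_real_def)
        show "fst c < snd c" using outer_data(5)[OF c] .
        fix u assume u: "u \<in> {fst c, snd c}"
        have "u \<le> fst p \<or> snd p \<le> u" "u \<le> fst q \<or> snd q \<le> u"
          using outer_gap[OF c u, of p] outer_gap[OF c u, of q] unfolding arcs by simp_all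
        then show "\<not> (min (fst (s, t)) (fst (s', t')) \<le> u \<and> u \<le> max (fst (s, t)) (fst (s', t')))"
          "\<not> (min (snd (s, t)) (snd (s', t')) \<le> u \<and> u \<le> max (snd (s, t)) (snd (s', t')))"
          using pos by (auto simp: min_le_iff_disj le_max_iff_disj)
      qed
    qed (use st pos pq in \<open>auto simp: over_first_def\<close>)
    then show ?thesis using X X' gauss_poly_outer by (simp add: diagram_poly_def)
  qed
qed

text \<open>The case of a third move with a single real crossing. Its ends move only within arcs
  that contain no end of another real crossing, so the Gauss diagram does not change.\<close>

lemma (in local_move) diagram_poly_single_chord:
  assumes p: "p \<in> set arcs" "q \<in> set arcs"
    and x: "x \<in> open_arc p" "y \<in> open_arc p" "x' \<in> open_arc q" "y' \<in> open_arc q" "snd p < fst q"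
    and real: "real_crossings D = insert (x, x') outer_real" "real_crossings D' = insert (y, y') outer_real"
    and same: "frame_sign D' (y, y') = frame_sign D (x, x')" "over_first D' (y, y') = over_first D (x, x')"
  shows "diagram_poly G a b D' = diagram_poly G a b D"
proof -
  define h where "h u = (if u = x then y else if u = x' then y' else u)" for u
  have pos: "fst p < x" "x < snd p" "fst p < y" "y < snd p" "fst q < x'" "x' < snd q" "fst q < y'" "y' < snd q"
    using x by (auto simp: open_arc_def)
  have hx: "h x = y" "h x' = y'" using pos x(5) by (auto simp: h_def)
  define T where "T = {x, x'} \<union> (fst ` outer_real \<union> snd ` outer_real)"
  have gp: "u \<le> fst p \<or> snd p \<le> u" "u \<le> fst q \<or> snd q \<le> u"
    if "u \<in> fst ` outer_real \<union> snd ` outer_real" for u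
    using that outer_gap p by (fastforce simp: outer_real_def)+
  have hT: "h u = u" if "u \<in> fst ` outer_real \<union> snd ` outer_real" for u
    using gp[OF that] pos by (auto simp: h_def)
  have mono: "strict_mono_on T h"
  proof (rule strict_mono_onI)
    fix u v assume "u \<in> T" "v \<in> T" "u < v"
    then consider "u \<in> {x, x'}" "v \<in> {x, x'}" | "u \<in> {x, x'}" "v \<in> fst ` outer_real \<union> snd ` outer_real"
      | "v \<in> {x, x'}" "u \<in> fst ` outer_real \<union> snd ` outer_real"
      | "u \<in> fst ` outer_real \<union> snd ` outer_real" "v \<in> fst ` outer_real \<union> snd ` outer_real"
      unfolding T_def by blast
    then show "h u < h v"
    proof cases
      case 1
      then show ?thesis using \<open>u < v\<close> pos x(5) hx by auto
    next
      case 2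
      then show ?thesis using gp[OF 2(2)] hT[OF 2(2)] \<open>u < v\<close> pos x(5) hx by auto
    next
      case 3
      then show ?thesis using gp[OF 3(2)] hT[OF 3(2)] \<open>u < v\<close> pos x(5) hx by auto
    next
      case 4
      then show ?thesis using hT \<open>u < v\<close> by simp
    qed
  qed
  have fix_outer: "map_prod h h c = c" if "c \<in> outer_real" for c
    using that hT by (simp add: prod_eq_iff)
  show ?thesis
    unfolding diagram_poly_def
  proof (rule gauss_poly_order_iso[OF mono])
    show "fst ` real_crossings D \<union> snd ` real_crossings D \<subseteq> T" by (auto simp: real T_def)
    show "real_crossings D' = map_prod h h ` real_crossings D"
      using fix_outer by (simp add: real hx)
    fix c assume "c \<in> real_crossings D"
    then consider "c = (x, x')" | "c \<in> outer_real" by (auto simp: real)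
    then have "frame_sign D' (map_prod h h c) = frame_sign D c \<and>
      over_first D' (map_prod h h c) = over_first D c"
    proof cases
      case 1
      then show ?thesis using same by (simp add: hx)
    next
      case 2
      then show ?thesis using outer_data(1,2)[of c]
        unfolding fix_outer[OF 2] by (simp add: over_first_def outer_real_def)
    qed
    then show "frame_sign D' (map_prod h h c) = frame_sign D c"
      "over_first D' (map_prod h h c) = over_first D c" by auto
  qed
qed

definition same_crossing :: "long_diagram \<Rightarrow> long_diagram \<Rightarrow> real \<times> real \<Rightarrow> real \<times> real \<Rightarrow> bool" where
  "same_crossing D D' c c' \<longleftrightarrow> passage D' (fst c') = passage D (fst c) \<and>
     sgn (vel_det D' (fst c') (snd c')) = sgn (vel_det D (fst c) (snd c))"

lemma same_crossing_swap:
  assumes "is_long_diagram D" "is_long_diagram D'" "double D s t" "double D' s' t'"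
    "same_crossing D D' (s, t) (s', t')"
  shows "same_crossing D D' (t, s) (t', s')"
proof -
  have "passage D' t' = passage D t"
    by (rule passage_cases[OF assms(1,3)]; rule passage_cases[OF assms(2,4)];
      use assms(5) in \<open>simp add: same_crossing_def\<close>)
  then show ?thesis
    using assms(5) by (simp add: same_crossing_def vel_det_swap[of D t] vel_det_swap[of D' t'] sgn_minus)
qed

text \<open>The arcs are listed in order of time, which allows the table of
  \<open>chi_triangle\<close>. The disjunction on virtual crossings is symmetric in the arcs and
  leaves out exactly the triangles with one virtual and two real crossings.\<close>

lemma diagram_poly_sorted_triangle:
  assumes lc: "local_change arcs D D'" and D: "is_long_diagram D" and D': "is_long_diagram D'"
    and arcs: "set arcs = {A1, A2, A3}" and sorted: "snd A1 < fst A2" "snd A2 < fst A3"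
    and self: "\<And>E p. E \<in> {D, D'} \<Longrightarrow> p \<in> {A1, A2, A3} \<Longrightarrow> meets E p p = {}"
    and mD: "meets D A1 A2 = {(x12, x21)}" "meets D A1 A3 = {(x13, x31)}" "meets D A2 A3 = {(x23, x32)}"
    and mD': "meets D' A1 A2 = {(y12, y21)}" "meets D' A1 A3 = {(y13, y31)}" "meets D' A2 A3 = {(y23, y32)}"
    and rev: "x12 < x13 \<longleftrightarrow> y13 < y12" "x21 < x23 \<longleftrightarrow> y23 < y21" "x31 < x32 \<longleftrightarrow> y32 < y31"
    and same: "same_crossing D D' (x12, x21) (y12, y21)" "same_crossing D D' (x13, x31) (y13, y31)"
      "same_crossing D D' (x23, x32) (y23, y32)"
    and virtual: "passage D x12 \<noteq> Virtual \<and> passage D x13 \<noteq> Virtual \<and> passage D x23 \<noteq> Virtual \<or>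
      passage D x12 = Virtual \<and> passage D x13 = Virtual \<or>
      passage D x12 = Virtual \<and> passage D x23 = Virtual \<or>
      passage D x13 = Virtual \<and> passage D x23 = Virtual"
  shows "diagram_poly G a b D' = diagram_poly G a b D"
proof -
  interpret local_move arcs D D' using lc D D' by unfold_locales
  have mem: "(x12, x21) \<in> meets D A1 A2" "(x13, x31) \<in> meets D A1 A3" "(x23, x32) \<in> meets D A2 A3"
    "(y12, y21) \<in> meets D' A1 A2" "(y13, y31) \<in> meets D' A1 A3" "(y23, y32) \<in> meets D' A2 A3"
    using mD mD' by auto
  have dbl: "double D x12 x21" "double D x13 x31" "double D x23 x32"
    "double D' y12 y21" "double D' y13 y31" "double D' y23 y32"
    using mem by (auto simp: meets_def)
  have pos: "x12 \<in> open_arc A1" "x13 \<in> open_arc A1" "x21 \<in> open_arc A2" "x23 \<in> open_arc A2"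
    "x31 \<in> open_arc A3" "x32 \<in> open_arc A3" "y12 \<in> open_arc A1" "y13 \<in> open_arc A1"
    "y21 \<in> open_arc A2" "y23 \<in> open_arc A2" "y31 \<in> open_arc A3" "y32 \<in> open_arc A3"
    using mem by (auto simp: meets_def)
  have ne: "x12 \<noteq> x13" "x21 \<noteq> x23" "x31 \<noteq> x32" "y12 \<noteq> y13" "y21 \<noteq> y23" "y31 \<noteq> y32"
  proof -
    have *: "s \<noteq> s'" if "is_long_diagram E" "double E s t" "double E s' t'" "t < t'" for E s s' t t'
      using long_diagramD(3)[OF that(1), of s t t'] that by auto
    show "x12 \<noteq> x13" "y12 \<noteq> y13" "x31 \<noteq> x32" "y31 \<noteq> y32"
      using *[OF D dbl(1,2)] *[OF D' dbl(4,5)] *[OF D, of x31 x13 x32 x23] *[OF D', of y31 y13 y32 y23]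
        dbl pos sorted arc_less arcs by (auto simp: open_arc_def double_sym)
    show "x21 \<noteq> x23" "y21 \<noteq> y23"
      using *[OF D, of x21 x12 x23 x32] *[OF D', of y21 y12 y23 y32]
        dbl pos sorted arc_less arcs by (auto simp: open_arc_def double_sym)
  qed
  have swap: "meets E q p = (\<lambda>(s, t). (t, s)) ` meets E p q" for E p q
    by (force simp: meets_def double_sym)
  have posl: "s < t" if "s \<in> open_arc p" "t \<in> open_arc q" "snd p < fst q" for s t p q
    using that by (auto simp: open_arc_def)
  have lt: "x12 < x21" "x13 < x31" "x23 < x32" "y12 < y21" "y13 < y31" "y23 < y32"
    using pos sorted arc_less[of A2] arcs by (auto simp: open_arc_def)
  have inn: "inner E = meets E A1 A2 \<union> meets E A1 A3 \<union> meets E A2 A3" if E: "E \<in> {D, D'}" for E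
  proof -
    have "(s, t) \<in> inner E \<longleftrightarrow> (s, t) \<in> meets E A1 A2 \<union> meets E A1 A3 \<union> meets E A2 A3" for s t
    proof -
      have "(s, t) \<in> meets E p q \<Longrightarrow> s < t" "(s, t) \<in> meets E q p \<Longrightarrow> t < s"
        if "(p, q) \<in> {(A1, A2), (A1, A3), (A2, A3)}" for p q
        using that sorted arc_less[of A2] arcs by (auto simp: meets_def open_arc_def)
      from this[of A1 A2] this[of A1 A3] this[of A2 A3]
      have "(s, t) \<in> meets E A1 A2 \<Longrightarrow> s < t" "(s, t) \<in> meets E A1 A3 \<Longrightarrow> s < t"
        "(s, t) \<in> meets E A2 A3 \<Longrightarrow> s < t" "(s, t) \<in> meets E A2 A1 \<Longrightarrow> t < s"
        "(s, t) \<in> meets E A3 A1 \<Longrightarrow> t < s" "(s, t) \<in> meets E A3 A2 \<Longrightarrow> t < s" by simp_all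
      moreover have "(s, t) \<notin> meets E A1 A1" "(s, t) \<notin> meets E A2 A2" "(s, t) \<notin> meets E A3 A3"
        using self[OF E] by simp_all
      ultimately show ?thesis
        unfolding inner_meets[OF E] arcs by (simp, meson less_asym)
    qed
    then show ?thesis by (intro set_eqI) (metis surj_pair)
  qed
  let ?xs = "{(x12, x21), (x13, x31), (x23, x32)}"
  let ?ys = "{(y12, y21), (y13, y31), (y23, y32)}"
  have innD: "inner D = ?xs" "inner D' = ?ys"
    using inn[of D] inn[of D'] mD mD' by auto
  have fs: "frame_sign D' (y12, y21) = frame_sign D (x12, x21)" "frame_sign D' (y13, y31) = frame_sign D (x13, x31)"
    "frame_sign D' (y23, y32) = frame_sign D (x23, x32)"
    using same by (auto simp: same_crossing_def frame_sign_def intro!: sign_of_cong)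
  have ps: "passage D' y12 = passage D x12" "passage D' y13 = passage D x13" "passage D' y23 = passage D x23"
    using same by (auto simp: same_crossing_def)
  let ?o1 = "(if x12 < x13 then 1 else -1) :: int" and ?o2 = "(if x21 < x23 then 1 else -1) :: int"
    and ?o3 = "(if x31 < x32 then 1 else -1) :: int"
  \<comment> \<open>Needed for two choices of \<open>Z\<close>: planarity speaks about all outer
    double points, the polynomial about the real ones.\<close>
  have loc: "triangle_move (fst A1) (snd A1) (fst A2) (snd A2) (fst A3) (snd A3)
     x12 x13 x21 x23 x31 x32 y12 y13 y21 y23 y31 y32 Z (frame_sign D) (frame_sign D') ?o1 ?o2 ?o3
     (frame_sign D (x12, x21)) (frame_sign D (x13, x31)) (frame_sign D (x23, x32))"
    if "Z \<subseteq> outer" for Z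
  proof unfold_locales
    show "finite Z" using that finite_outer by (rule finite_subset)
    show "(u \<le> fst A1 \<or> snd A1 \<le> u) \<and> (u \<le> fst A2 \<or> snd A2 \<le> u) \<and> (u \<le> fst A3 \<or> snd A3 \<le> u)"
      if "c \<in> Z" "u \<in> {fst c, snd c}" for c u
      using outer_gap[of c u] that \<open>Z \<subseteq> outer\<close> arcs by blast
    show "frame_sign D' c = frame_sign D c" if "c \<in> Z" for c
      using outer_data(1) that \<open>Z \<subseteq> outer\<close> by blast
  qed (use pos sorted ne rev fs in \<open>auto simp: open_arc_def\<close>)
  interpret all: triangle_move "fst A1" "snd A1" "fst A2" "snd A2" "fst A3" "snd A3"
     x12 x13 x21 x23 x31 x32 y12 y13 y21 y23 y31 y32 outer "frame_sign D" "frame_sign D'" ?o1 ?o2 ?o3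
     "frame_sign D (x12, x21)" "frame_sign D (x13, x31)" "frame_sign D (x23, x32)"
    by (rule loc) simp
  interpret re: triangle_move "fst A1" "snd A1" "fst A2" "snd A2" "fst A3" "snd A3"
     x12 x13 x21 x23 x31 x32 y12 y13 y21 y23 y31 y32 outer_real "frame_sign D" "frame_sign D'" ?o1 ?o2 ?o3
     "frame_sign D (x12, x21)" "frame_sign D (x13, x31)" "frame_sign D (x23, x32)"
    by (rule loc) (auto simp: outer_real_def)
  have dp: "double_points D = outer \<union> all.tri_x" "double_points D' = outer \<union> all.tri_y"
    using double_points_split innD by (auto simp: all.tri_x_def all.tri_y_def)
  \<comment> \<open>Here the plane enters: \<open>planar_index\<close> is applied to the three loops
    before and after the move, with the virtual double points among the chords.\<close>
  have closing: "frame_sign D (x13, x31) * ?o1 = frame_sign D (x23, x32) * ?o2"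
    "frame_sign D (x12, x21) * ?o1 = frame_sign D (x23, x32) * ?o3"
    "frame_sign D (x12, x21) * ?o2 = frame_sign D (x13, x31) * ?o3"
  proof -
    have A: "pairing (outer \<union> all.tri_x) (frame_sign D) (\<lambda>_. 2) (chi d) = 0" if "d \<in> all.tri_x" for d
    proof -
      have "fst d < snd d" "double D (fst d) (snd d)"
        using that dbl lt by (auto simp: all.tri_x_def)
      then interpret planar_loop D "fst d" "snd d" using D by unfold_locales
      show ?thesis using planar_index by (simp add: dp)
    qed
    have B: "pairing (outer \<union> all.tri_y) (frame_sign D') (\<lambda>_. 2) (chi d) = 0" if "d \<in> all.tri_y" for d
    proof -
      have "fst d < snd d" "double D' (fst d) (snd d)"
        using that dbl lt by (auto simp: all.tri_y_def)
      then interpret planar_loop D' "fst d" "snd d" using D' by unfold_locales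
      show ?thesis using planar_index by (simp add: dp)
    qed
    show "frame_sign D (x13, x31) * ?o1 = frame_sign D (x23, x32) * ?o2"
    "frame_sign D (x12, x21) * ?o1 = frame_sign D (x23, x32) * ?o3"
    "frame_sign D (x12, x21) * ?o2 = frame_sign D (x13, x31) * ?o3"
      by (rule all.closing_condition[OF A B]; assumption)+
  qed
  note RX = real_split[unfolded innD]
  show ?thesis
    using virtual
  proof (elim disjE)
    assume v: "passage D x12 \<noteq> Virtual \<and> passage D x13 \<noteq> Virtual \<and> passage D x23 \<noteq> Virtual"
    then have "real_crossings D = outer_real \<union> re.tri_x" "real_crossings D' = outer_real \<union> re.tri_y"
      using RX ps by (auto simp: re.tri_x_def re.tri_y_def)
    then show ?thesis
      unfolding diagram_poly_def
      by (simp only:, intro re.gauss_poly_triangle[OF closing])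
        (auto simp: over_first_def ps outer_real_def outer_data)
  next
    assume v: "passage D x12 = Virtual \<and> passage D x13 = Virtual"
    show ?thesis
    proof (cases "passage D x23 = Virtual")
      case True
      then have "real_crossings D = outer_real" "real_crossings D' = outer_real"
        using RX ps v by auto
      then show ?thesis by (simp add: diagram_poly_def gauss_poly_outer)
    next
      case False
      then have "real_crossings D = insert (x23, x32) outer_real" "real_crossings D' = insert (y23, y32) outer_real"
        using RX ps v by auto
      then show ?thesis
        by (intro diagram_poly_single_chord[of A2 A3 x23 y23 x32 y32])
          (use arcs pos sorted fs ps in \<open>auto simp: over_first_def\<close>)
    qed
  next
    assume v: "passage D x12 = Virtual \<and> passage D x23 = Virtual"
    show ?thesis
    proof (cases "passage D x13 = Virtual")
      case True
      then have "real_crossings D = outer_real" "real_crossings D' = outer_real"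
        using RX ps v by auto
      then show ?thesis by (simp add: diagram_poly_def gauss_poly_outer)
    next
      case False
      then have "real_crossings D = insert (x13, x31) outer_real" "real_crossings D' = insert (y13, y31) outer_real"
        using RX ps v by auto
      then show ?thesis
        by (intro diagram_poly_single_chord[of A1 A3 x13 y13 x31 y31])
          (use arcs pos sorted arc_less[of A2] fs ps in \<open>auto simp: over_first_def\<close>)
    qed
  next
    assume v: "passage D x13 = Virtual \<and> passage D x23 = Virtual"
    show ?thesis
    proof (cases "passage D x12 = Virtual")
      case True
      then have "real_crossings D = outer_real" "real_crossings D' = outer_real"
        using RX ps v by auto
      then show ?thesis by (simp add: diagram_poly_def gauss_poly_outer)
    next
      case False
      then have "real_crossings D = insert (x12, x21) outer_real" "real_crossings D' = insert (y12, y21) outer_real"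
        using RX ps v by auto
      then show ?thesis
        by (intro diagram_poly_single_chord[of A1 A2 x12 y12 x21 y21])
          (use arcs pos sorted fs ps in \<open>auto simp: over_first_def\<close>)
    qed
  qed
qed

lemma diagram_poly_move3:
  assumes m: "move3 D D'" and D: "is_long_diagram D" and D': "is_long_diagram D'"
  shows "diagram_poly G a b D' = diagram_poly G a b D"
proof -
  obtain p q r pq qp pr rp qr rq pq' qp' pr' rp' qr' rq' where lc: "local_change [p, q, r] D D'"
    and self0: "\<forall>E\<in>{D, D'}. meets E p p = {} \<and> meets E q q = {} \<and> meets E r r = {}"
    and mD: "meets D p q = {(pq, qp)}" "meets D p r = {(pr, rp)}" "meets D q r = {(qr, rq)}"
    and mD': "meets D' p q = {(pq', qp')}" "meets D' p r = {(pr', rp')}" "meets D' q r = {(qr', rq')}"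
    and rev: "pq < pr \<longleftrightarrow> pr' < pq'" "qp < qr \<longleftrightarrow> qr' < qp'" "rp < rq \<longleftrightarrow> rq' < rp'"
    and pas: "passage D' pq' = passage D pq" "passage D' pr' = passage D pr" "passage D' qr' = passage D qr"
    and sg: "sgn (vel_det D' pq' qp') = sgn (vel_det D pq qp)" "sgn (vel_det D' pr' rp') = sgn (vel_det D pr rp)"
      "sgn (vel_det D' qr' rq') = sgn (vel_det D qr rq)"
    and virt: "passage D pq = Virtual \<and> passage D pr = Virtual \<or>
         passage D pq = Over \<and> passage D pr = Over \<and> passage D qr \<noteq> Virtual"
    using m unfolding move3_def by (elim exE conjE) (rule that)
  interpret local_move "[p, q, r]" D D' using lc D D' by unfold_locales
  have self: "\<And>E x. E \<in> {D, D'} \<Longrightarrow> x \<in> {p, q, r} \<Longrightarrow> meets E x x = {}" using self0 by auto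
  have swap: "meets E y x = (\<lambda>(s, t). (t, s)) ` meets E x y" for E x y
    by (force simp: meets_def double_sym)
  have sD: "meets D q p = {(qp, pq)}" "meets D r p = {(rp, pr)}" "meets D r q = {(rq, qr)}"
    and sD': "meets D' q p = {(qp', pq')}" "meets D' r p = {(rp', pr')}" "meets D' r q = {(rq', qr')}"
    using swap[of D q p] swap[of D r p] swap[of D r q] swap[of D' q p] swap[of D' r p] swap[of D' r q]
      mD mD' by auto
  have mem: "(pq, qp) \<in> meets D p q" "(pr, rp) \<in> meets D p r" "(qr, rq) \<in> meets D q r"
    "(pq', qp') \<in> meets D' p q" "(pr', rp') \<in> meets D' p r" "(qr', rq') \<in> meets D' q r"
    using mD mD' by auto
  then have dbl: "double D pq qp" "double D pr rp" "double D qr rq"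
    "double D' pq' qp'" "double D' pr' rp'" "double D' qr' rq'"
    by (auto simp: meets_def)
  have pos: "qp \<in> open_arc q" "rp \<in> open_arc r" "rq \<in> open_arc r" "pq \<in> open_arc p" "pr \<in> open_arc p" "qr \<in> open_arc q"
    "qp' \<in> open_arc q" "rp' \<in> open_arc r" "rq' \<in> open_arc r" "pq' \<in> open_arc p" "pr' \<in> open_arc p" "qr' \<in> open_arc q"
    using mem by (auto simp: meets_def)
  have dis: "snd q < fst p \<or> snd p < fst q" "snd r < fst p \<or> snd p < fst r" "snd r < fst q \<or> snd q < fst r"
    using arcs_disjoint[of 1 0] arcs_disjoint[of 2 0] arcs_disjoint[of 2 1] by simp_all
  have al: "fst p < snd p" "fst q < snd q" "fst r < snd r" using arc_less by auto
  have ne: "qp \<noteq> rp" "qp \<noteq> rq" "pq \<noteq> rq" "pq \<noteq> qr" "pr \<noteq> qr" "rp \<noteq> qr"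
    "qp' \<noteq> rp'" "pq' \<noteq> rq'" "pr' \<noteq> qr'"
    using pos dis al by (auto simp: open_arc_def)
  have uq: "s \<noteq> s'" if "is_long_diagram E" "double E s t" "double E s' t'" "t \<noteq> t'" for E s s' t t'
    using long_diagramD(3)[OF that(1), of s t t'] that by auto
  have nn: "pq \<noteq> pr" "pq' \<noteq> pr'"
    using uq[OF D dbl(1,2)] uq[OF D' dbl(4,5)] ne by auto
  have nq: "qp \<noteq> qr" "qp' \<noteq> qr'"
    using uq[OF D, of qp pq qr rq] uq[OF D', of qp' pq' qr' rq'] dbl ne by (auto simp: double_sym)
  have nr: "rp \<noteq> rq" "rp' \<noteq> rq'"
    using uq[OF D, of rp pr rq qr] uq[OF D', of rp' pr' rq' qr'] dbl ne by (auto simp: double_sym)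
  have rev': "pr < pq \<longleftrightarrow> pq' < pr'" "qr < qp \<longleftrightarrow> qp' < qr'" "rq < rp \<longleftrightarrow> rp' < rq'"
    using rev nn nq nr by auto
  have same: "same_crossing D D' (pq, qp) (pq', qp')" "same_crossing D D' (pr, rp) (pr', rp')"
    "same_crossing D D' (qr, rq) (qr', rq')"
    using pas sg by (auto simp: same_crossing_def)
  have same': "same_crossing D D' (qp, pq) (qp', pq')" "same_crossing D D' (rp, pr) (rp', pr')"
    "same_crossing D D' (rq, qr) (rq', qr')"
    using same_crossing_swap[OF D D'] dbl same by blast+
  have vv: "passage D s = Virtual \<longleftrightarrow> passage D t = Virtual" if "double D s t" for s t
    using passage_cases[OF D that] by (metis passage.distinct(3,5))
  have virt': "(passage D qp = Virtual) = (passage D pq = Virtual)"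
      "(passage D rp = Virtual) = (passage D pr = Virtual)" "(passage D rq = Virtual) = (passage D qr = Virtual)"
    using vv dbl by blast+
  have virt: "passage D pq = Virtual \<and> passage D pr = Virtual \<or>
         passage D pq \<noteq> Virtual \<and> passage D pr \<noteq> Virtual \<and> passage D qr \<noteq> Virtual"
    using virt by auto
  note tri = diagram_poly_sorted_triangle[OF lc D D', where a=a and b=b and G=G]
  \<comment> \<open>The six possible orders of the arcs in time. Exchanging the two arcs of a
    crossing replaces \<open>mD\<close>, \<open>rev\<close> and \<open>same\<close> by their
    mirrored versions \<open>sD\<close>, \<open>rev'\<close> and \<open>same'\<close>.\<close>
  consider "snd p < fst q" "snd q < fst r" | "snd p < fst r" "snd r < fst q"
    | "snd q < fst p" "snd p < fst r" | "snd q < fst r" "snd r < fst p"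
    | "snd r < fst p" "snd p < fst q" | "snd r < fst q" "snd q < fst p"
    using dis by auto
  then show ?thesis
  proof cases
    case 1
    show ?thesis
      by (rule tri[OF _ 1 self mD(1,2,3) mD'(1,2,3) rev(1,2,3) same(1,2,3)]) (use virt virt' in auto)
  next
    case 2
    show ?thesis
      by (rule tri[OF _ 2 self mD(2,1) sD(3) mD'(2,1) sD'(3) rev'(1) rev(3,2) same(2,1) same'(3)])
        (use virt virt' in auto)
  next
    case 3
    show ?thesis
      by (rule tri[OF _ 3 self sD(1) mD(3,2) sD'(1) mD'(3,2) rev(2,1) rev'(3) same'(1) same(3,2)])
        (use virt virt' in auto)
  next
    case 4
    show ?thesis
      by (rule tri[OF _ 4 self mD(3) sD(1,2) mD'(3) sD'(1,2) rev'(2,3) rev(1) same(3) same'(1,2)])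
        (use virt virt' in auto)
  next
    case 5
    show ?thesis
      by (rule tri[OF _ 5 self sD(2,3) mD(1) sD'(2,3) mD'(1) rev(3) rev'(1,2) same'(2,3) same(1)])
        (use virt virt' in auto)
  next
    case 6
    show ?thesis
      by (rule tri[OF _ 6 self sD(3,2,1) sD'(3,2,1) rev'(3,2,1) same'(3,2,1)])
        (use virt virt' in auto)
  qed
qed

theorem diagram_poly_invariant:
  assumes K: "K \<in> long_virtual_knots" "D \<in> K" "D' \<in> K" and G: "admissible G"
  shows "diagram_poly G a b D' = diagram_poly G a b D"
proof -
  have step: "diagram_poly G a b E' = diagram_poly G a b E" if "(E, E') \<in> moves" for E E'
    using that diagram_poly_isotopic diagram_poly_move1[OF _ _ _ G] diagram_poly_move2 diagram_poly_move3
    unfolding moves_def by blast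
  have chain: "diagram_poly G a b E' = diagram_poly G a b E" if "(E, E') \<in> (moves \<union> moves\<inverse>)\<^sup>*" for E E'
    using that by induction (use step in force)+
  obtain E where "K = (moves \<union> moves\<inverse>)\<^sup>* `` {E}"
    using K(1) unfolding long_virtual_knots_def by (rule quotientE)
  then show ?thesis using chain K by (metis Image_singleton_iff)
qed

section \<open>Intersection numbers on surface realizations\<close>

lemma funpow_mod_period:
  assumes "(f ^^ n) d = d"
  shows "(f ^^ (k mod n)) d = (f ^^ k) d"
proof -
  have "(f ^^ (n * q)) d = d" for q
    by (induction q) (simp_all add: funpow_add assms)
  moreover have "(f ^^ k) d = (f ^^ (k mod n)) ((f ^^ (n * (k div n))) d)"
    by (metis comp_apply funpow_add mod_mult_div_eq)
  ultimately show ?thesis by simp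
qed

text \<open>With positions counted along the orbit of a fixed dart, a sector is cyclic betweenness;
  the three disjuncts are the three linear orders that represent one cyclic order.\<close>

lemma sector_iff:
  assumes n: "0 < n" "(rot S ^^ n) d = d" and inj: "inj_on (\<lambda>k. (rot S ^^ k) d) {..<n}"
    and uvx: "u < n" "v < n" "x < n" "u \<noteq> v"
  shows "(rot S ^^ x) d \<in> sector S ((rot S ^^ u) d) ((rot S ^^ v) d) \<longleftrightarrow>
    u < x \<and> x < v \<or> x < v \<and> v < u \<or> v < u \<and> u < x"
proof -
  \<comment> \<open>Number of turns from the position \<open>u\<close> to the position
    \<open>v\<close>.\<close>
  define m where "m = (if u < v then v - u else v + n - u)"
  have shift: "(rot S ^^ l) ((rot S ^^ u) d) = (rot S ^^ ((u + l) mod n)) d" for l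
    by (simp add: funpow_mod_period[OF n(2)] add.commute[of u] funpow_add)
  have eq: "(rot S ^^ a) d = (rot S ^^ b) d \<longleftrightarrow> a = b" if "a < n" "b < n" for a b
    using inj that by (auto simp: inj_on_def)
  have hit: "(rot S ^^ l) ((rot S ^^ u) d) = (rot S ^^ v) d \<longleftrightarrow> (u + l) mod n = v" for l
    unfolding shift using uvx n by (intro eq) auto
  have modl: "(u + l) mod n = (if u + l < n then u + l else u + l - n)" if "l < n" for l
    using that uvx by (auto simp: mod_if)
  have "m < n" "0 < m" using uvx by (auto simp: m_def)
  have free: "(\<forall>l\<in>{1..k}. (u + l) mod n \<noteq> v) \<longleftrightarrow> k < m" for k
  proof
    assume *: "\<forall>l\<in>{1..k}. (u + l) mod n \<noteq> v"
    have "(u + m) mod n = v" using uvx by (auto simp: m_def)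
    show "k < m"
    proof (rule ccontr)
      assume "\<not> k < m"
      then have "m \<in> {1..k}" using \<open>0 < m\<close> by simp
      then show False using * \<open>(u + m) mod n = v\<close> by blast
    qed
  next
    assume "k < m"
    then show "\<forall>l\<in>{1..k}. (u + l) mod n \<noteq> v"
      using \<open>m < n\<close> uvx by (auto simp: modl m_def split: if_splits)
  qed
  have "(rot S ^^ x) d \<in> sector S ((rot S ^^ u) d) ((rot S ^^ v) d) \<longleftrightarrow>
    (\<exists>k. 0 < k \<and> k < m \<and> x = (u + k) mod n)"
    unfolding sector_def hit free
    by (auto simp: shift eq[OF uvx(3)] n)
  also have "\<dots> \<longleftrightarrow> u < x \<and> x < v \<or> x < v \<and> v < u \<or> v < u \<and> u < x"
  proof
    assume "\<exists>k. 0 < k \<and> k < m \<and> x = (u + k) mod n"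
    then obtain k where "0 < k" "k < m" "x = (u + k) mod n" by blast
    then show "u < x \<and> x < v \<or> x < v \<and> v < u \<or> v < u \<and> u < x"
      using \<open>m < n\<close> uvx by (auto simp: modl m_def split: if_splits)
  next
    assume *: "u < x \<and> x < v \<or> x < v \<and> v < u \<or> v < u \<and> u < x"
    define k where "k = (if u < x then x - u else x + n - u)"
    have "0 < k \<and> k < m \<and> x = (u + k) mod n"
      using * uvx by (auto simp: k_def m_def)
    then show "\<exists>k. 0 < k \<and> k < m \<and> x = (u + k) mod n" by blast
  qed
  finally show ?thesis .
qed

lemma orbit_parametrization:
  assumes "f permutes A" "finite A"
  obtains n where "0 < n" "(f ^^ n) d = d" "inj_on (\<lambda>k. (f ^^ k) d) {..<n}"
    "\<And>e. e \<in> orbit f d \<longleftrightarrow> (\<exists>k<n. e = (f ^^ k) d)"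
proof -
  have "d \<in> orbit f d"
    using assms by (intro permutation_self_in_orbit permutation_permutes[THEN iffD2]) blast
  then have "\<exists>n>0. (f ^^ n) d = d" by (auto simp: orbit_altdef)
  define n where "n = (LEAST n. 0 < n \<and> (f ^^ n) d = d)"
  have n: "0 < n" "(f ^^ n) d = d"
    using LeastI_ex[OF \<open>\<exists>n>0. (f ^^ n) d = d\<close>] by (auto simp: n_def)
  have least: "n \<le> k" if "0 < k" "(f ^^ k) d = d" for k
    unfolding n_def using that by (intro Least_le) auto
  have inj: "inj f" using assms(1) by (rule permutes_inj)
  have "(f ^^ a) d \<noteq> (f ^^ b) d" if "a < b" "b < n" for a b
  proof
    assume "(f ^^ a) d = (f ^^ b) d"
    also have "\<dots> = (f ^^ a) ((f ^^ (b - a)) d)"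
      using that by (metis comp_apply funpow_add le_add_diff_inverse less_imp_le)
    finally have "(f ^^ (b - a)) d = d"
      using inj_fn[OF inj, of a] by (metis injD)
    then show False using least[of "b - a"] that by simp
  qed
  then have "inj_on (\<lambda>k. (f ^^ k) d) {..<n}"
    by (intro linorder_inj_onI) auto
  moreover have "e \<in> orbit f d \<longleftrightarrow> (\<exists>k<n. e = (f ^^ k) d)" for e
  proof
    assume "e \<in> orbit f d"
    then obtain k where "e = (f ^^ k) d" by (auto simp: orbit_altdef)
    then show "\<exists>k<n. e = (f ^^ k) d"
      using funpow_mod_period[OF n(2), of k] n(1) by (intro exI[of _ "k mod n"]) auto
  next
    assume "\<exists>k<n. e = (f ^^ k) d"
    then show "e \<in> orbit f d"
      using \<open>d \<in> orbit f d\<close> funpow_in_orbit by metis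
  qed
  ultimately show thesis using that n by blast
qed

lemma orbit_eq_of_mem:
  assumes "f permutes A" "finite A" "e \<in> orbit f d"
  shows "orbit f e = orbit f d"
  using assms permutation_permutes
  by (metis orbit_cyclic_eq3 cyclic_on_orbit)

lemma count_list_distinct_nth:
  assumes "\<And>k. k < length v \<Longrightarrow> v ! k = d \<longleftrightarrow> k = j"
  shows "count_list v d = (if j < length v then 1 else 0)"
proof -
  have "count_list v d = card {k. k < length v \<and> v ! k = d}"
    by (simp add: count_list_eq_length_filter length_filter_conv_card eq_commute)
  also have "{k. k < length v \<and> v ! k = d} = (if j < length v then {j} else {})"
    using assms by auto
  finally show ?thesis by simp
qed

section \<open>The neighbourhood of a crossing on a surface\<close>

locale realization =
  fixes S :: surface and C :: surface_curve
  assumes diagram: "surface_diagram S C"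
begin

definition "w = walk C"
definition "L = length w"
definition "inc k = incoming S w k"
definition "X = curve_crossings S C"
text \<open>Sign of the frame (earlier direction, later direction): it is positive if the later
  strand leaves to the left of the earlier one.\<close>

definition lam :: "nat \<times> nat \<Rightarrow> int" where
  "lam c = (if w ! snd c \<in> left_darts S w (fst c) then 1 else -1)"

lemma surf: "finite (darts S)" "rot S permutes darts S" "opp S permutes darts S"
  "d \<in> darts S \<Longrightarrow> opp S (opp S d) = d"
  using diagram by (auto simp: surface_diagram_def closed_surface_def)

lemma opp_opp: "opp S (opp S d) = d"
  using surf(3,4) by (cases "d \<in> darts S") (auto simp: permutes_def)

lemma walk: "0 < L" "set w \<subseteq> darts S" "i < L \<Longrightarrow> vertex S (opp S (w ! i)) = vertex S (w ! (Suc i mod L))"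
  using diagram by (auto simp: surface_diagram_def closed_walk_def w_def L_def)

lemma self_in_vertex: "d \<in> vertex S d"
  unfolding vertex_def using surf(1,2)
  by (intro permutation_self_in_orbit permutation_permutes[THEN iffD2]) blast

lemma vertex_eq: "e \<in> vertex S d \<Longrightarrow> vertex S e = vertex S d"
  unfolding vertex_def using orbit_eq_of_mem[OF surf(2,1)] .

lemma vertex_inc: "k < L \<Longrightarrow> vertex S (inc k) = vertex S (w ! k)"
  using walk(3)[of "(k + L - 1) mod L"] walk(1)
  by (simp add: inc_def incoming_def L_def mod_Suc_eq)

lemma inc_Suc: "0 < k \<Longrightarrow> k < L \<Longrightarrow> inc k = opp S (w ! (k - 1))"
  by (simp add: inc_def incoming_def L_def mod_if)

lemma left_darts_eq: "left_darts S w k = sector S (w ! k) (inc k)"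
  by (simp add: left_darts_def inc_def)

lemma inc_ne: "k < L \<Longrightarrow> w ! k \<noteq> inc k"
  using diagram by (simp add: surface_diagram_def w_def L_def inc_def)

lemma X_iff: "(i, j) \<in> X \<longleftrightarrow> i < j \<and> j < L \<and> vertex S (w ! i) = vertex S (w ! j)"
  by (simp add: X_def curve_crossings_def w_def L_def)

lemma crossing:
  assumes "(i, j) \<in> X"
  shows "0 < i" "i < j" "j < L" "vertex S (w ! i) = vertex S (w ! j)"
    "k < L \<Longrightarrow> vertex S (w ! k) = vertex S (w ! i) \<Longrightarrow> k = i \<or> k = j"
    "distinct [w ! i, inc i, w ! j, inc j]"
    "(w ! j \<in> left_darts S w i) \<noteq> (inc j \<in> left_darts S w i)"
    "(i \<in> over_times C) \<noteq> (j \<in> over_times C)"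
  using assms diagram unfolding X_iff surface_diagram_def X_def w_def L_def inc_def
  by (auto simp: curve_crossings_def)

lemma finite_X: "finite X"
  by (rule finite_subset[of _ "{..<L} \<times> {..<L}"]) (auto simp: X_iff)

lemma crossing_unique:
  assumes "(i, j) \<in> X" "(i', j') \<in> X" "{i, j} \<inter> {i', j'} \<noteq> {}"
  shows "i' = i" "j' = j"
proof -
  have "vertex S (w ! i') = vertex S (w ! i)" "vertex S (w ! j') = vertex S (w ! i)"
    using assms(3) crossing(4)[OF assms(1)] crossing(4)[OF assms(2)] by auto
  then have "i' = i \<or> i' = j" "j' = i \<or> j' = j"
    using crossing(5)[OF assms(1)] crossing(2,3)[OF assms(2)] by auto
  then show "i' = i" "j' = j" using crossing(2)[OF assms(1)] crossing(2)[OF assms(2)] by auto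
qed

text \<open>The four darts of the two strands alternate around the vertex, so their cyclic order is
  known from \<open>lam\<close>. The last two sectors are the left sides of the corners created by
  the smoothing: one loop arrives at time \<open>j\<close> and leaves at time \<open>i\<close>, the
  other one conversely.\<close>

lemma crossing_sectors:
  assumes ij: "(i, j) \<in> X" and d: "d \<in> {w ! i, inc i, w ! j, inc j}"
  shows "d \<in> sector S (w ! i) (inc i) \<longleftrightarrow> d = (if lam (i, j) = 1 then w ! j else inc j)"
    "d \<in> sector S (w ! j) (inc j) \<longleftrightarrow> d = (if lam (i, j) = 1 then inc i else w ! i)"
    "d \<in> sector S (w ! i) (inc j) \<longleftrightarrow> lam (i, j) = 1 \<and> d \<in> {w ! j, inc i}"
    "d \<in> sector S (w ! j) (inc i) \<longleftrightarrow> lam (i, j) \<noteq> 1 \<and> d \<in> {w ! i, inc j}"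
proof -
  obtain n where n: "0 < n" "(rot S ^^ n) (w ! i) = w ! i"
    "inj_on (\<lambda>k. (rot S ^^ k) (w ! i)) {..<n}"
    "\<And>e. e \<in> orbit (rot S) (w ! i) \<longleftrightarrow> (\<exists>k<n. e = (rot S ^^ k) (w ! i))"
    using orbit_parametrization[OF surf(2,1)] by metis
  note c = crossing[OF ij]
  have "w ! j \<in> vertex S (w ! i)" "inc i \<in> vertex S (w ! i)" "inc j \<in> vertex S (w ! i)"
    using self_in_vertex[of "w ! j"] self_in_vertex[of "inc i"] self_in_vertex[of "inc j"]
      vertex_inc[of i] vertex_inc[of j] c by auto
  then obtain x y z where x: "x < n" "w ! j = (rot S ^^ x) (w ! i)"
    and y: "y < n" "inc i = (rot S ^^ y) (w ! i)" and z: "z < n" "inc j = (rot S ^^ z) (w ! i)"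
    unfolding vertex_def n(4) by blast
  have o: "w ! i = (rot S ^^ 0) (w ! i)" by simp
  have ne: "x \<noteq> 0" "y \<noteq> 0" "z \<noteq> 0" "x \<noteq> y" "x \<noteq> z" "y \<noteq> z"
    using c(6) x(2) y(2) z(2) o by (auto intro: ccontr)
  note sec = sector_iff[OF n(1-3)]
  have mem: "(rot S ^^ a) (w ! i) \<in> sector S (w ! i) (inc i) \<longleftrightarrow> 0 < a \<and> a < y"
    "(rot S ^^ a) (w ! i) \<in> sector S (w ! j) (inc j) \<longleftrightarrow> x < a \<and> a < z \<or> a < z \<and> z < x \<or> z < x \<and> x < a"
    "(rot S ^^ a) (w ! i) \<in> sector S (w ! i) (inc j) \<longleftrightarrow> 0 < a \<and> a < z"
    "(rot S ^^ a) (w ! i) \<in> sector S (w ! j) (inc i) \<longleftrightarrow> x < a \<and> a < y \<or> a < y \<and> y < x \<or> y < x \<and> x < a"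
    if "a < n" for a
    using sec[of 0 y a] sec[of x z a] sec[of 0 z a] sec[of x y a] x y z ne n(1) that
    by simp_all
  have lam1: "lam (i, j) = 1 \<longleftrightarrow> x < y"
    using mem(1)[OF x(1)] ne x(2) by (simp add: lam_def left_darts_eq)
  have alt: "(x < y) \<noteq> (z < y)"
    using c(7) mem(1)[OF x(1)] mem(1)[OF z(1)] ne x(2) z(2) by (simp add: left_darts_eq)
  have eqs: "(rot S ^^ a) (w ! i) = (rot S ^^ b) (w ! i) \<longleftrightarrow> a = b" if "a < n" "b < n" for a b
    using n(3) that by (auto simp: inj_on_def)
  obtain a where a: "a < n" "d = (rot S ^^ a) (w ! i)" "a \<in> {0, y, x, z}"
    using d x y z n(1) by (metis insert_iff o singletonD)
  have dq: "d = w ! i \<longleftrightarrow> a = 0" "d = w ! j \<longleftrightarrow> a = x" "d = inc i \<longleftrightarrow> a = y" "d = inc j \<longleftrightarrow> a = z"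
    using eqs[OF a(1)] x y z n(1) a(2) by (metis o)+
  show "d \<in> sector S (w ! i) (inc i) \<longleftrightarrow> d = (if lam (i, j) = 1 then w ! j else inc j)"
    using a(3) ne alt unfolding a(2) mem[OF a(1)] unfolding a(2)[symmetric] lam1 by (auto simp: dq)
  show "d \<in> sector S (w ! j) (inc j) \<longleftrightarrow> d = (if lam (i, j) = 1 then inc i else w ! i)"
    using a(3) ne alt unfolding a(2) mem[OF a(1)] unfolding a(2)[symmetric] lam1 by (auto simp: dq)
  show "d \<in> sector S (w ! i) (inc j) \<longleftrightarrow> lam (i, j) = 1 \<and> d \<in> {w ! j, inc i}"
    using a(3) ne alt unfolding a(2) mem[OF a(1)] unfolding a(2)[symmetric] lam1 by (auto simp: dq)
  show "d \<in> sector S (w ! j) (inc i) \<longleftrightarrow> lam (i, j) \<noteq> 1 \<and> d \<in> {w ! i, inc j}"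
    using a(3) ne alt unfolding a(2) mem[OF a(1)] unfolding a(2)[symmetric] lam1 by (auto simp: dq)
qed

lemma sector_subset_vertex: "sector S d e \<subseteq> vertex S d"
  by (auto simp: sector_def vertex_def orbit_altdef)

lemma finite_sector: "finite (sector S d e)"
  using sector_subset_vertex
proof (rule finite_subset)
  show "finite (vertex S d)"
  proof -
    obtain n where "\<And>e. e \<in> orbit (rot S) d \<longleftrightarrow> (\<exists>k<n. e = (rot S ^^ k) d)"
      using orbit_parametrization[OF surf(2,1), of d] by metis
    then have "vertex S d = (\<lambda>k. (rot S ^^ k) d) ` {..<n}" by (auto simp: vertex_def)
    then show ?thesis by simp
  qed
qed

text \<open>The cell decomposition may contain edges off the curve. Flows of parts of the curve
  vanish there, so sums over sectors reduce to the darts of the curve.\<close>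

definition supported :: "(nat \<Rightarrow> int) \<Rightarrow> bool" where
  "supported f \<longleftrightarrow> (\<forall>d. f d \<noteq> 0 \<longrightarrow> d \<in> set w \<or> opp S d \<in> set w)"

lemma supported_at_vertex:
  assumes "supported f" "f d \<noteq> 0" "d \<in> vertex S (w ! k)"
  obtains l where "l < L" "vertex S (w ! l) = vertex S (w ! k)" "d = w ! l \<or> d = inc l"
proof -
  have v: "vertex S d = vertex S (w ! k)" using vertex_eq[OF assms(3)] .
  consider l where "l < L" "d = w ! l" | l where "l < L" "opp S d = w ! l"
    using assms(1,2) unfolding supported_def L_def by (metis in_set_conv_nth)
  then show thesis
  proof cases
    case 1
    then show ?thesis using that[of l] v by auto
  next
    case 2
    have "inc (Suc l mod L) = opp S (w ! l)"
    proof (cases "Suc l < L")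
      case True
      then show ?thesis using inc_Suc[of "Suc l"] by simp
    next
      case False
      then have "l = L - 1" using 2 by simp
      then show ?thesis using walk(1) by (simp add: inc_def incoming_def L_def)
    qed
    then have d: "d = inc (Suc l mod L)" using 2 opp_opp by metis
    show ?thesis using that[of "Suc l mod L"] d v vertex_inc[of "Suc l mod L"] walk(1) by simp
  qed
qed

text \<open>The only darts of the curve at this vertex are the ones along which it arrives and
  leaves; they bound the sector and do not belong to it.\<close>

lemma left_sum_noncrossing:
  assumes "supported f" "k < L" "\<And>e. e \<in> X \<Longrightarrow> k \<noteq> fst e \<and> k \<noteq> snd e"
  shows "(\<Sum>d\<in>left_darts S w k. f d) = 0"
proof (rule sum.neutral, rule ballI, rule ccontr)
  fix d assume d: "d \<in> left_darts S w k" "f d \<noteq> 0"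
  then have "d \<in> vertex S (w ! k)" using sector_subset_vertex by (auto simp: left_darts_eq)
  then obtain l where l: "l < L" "vertex S (w ! l) = vertex S (w ! k)" "d = w ! l \<or> d = inc l"
    using supported_at_vertex[OF assms(1) d(2)] by metis
  have "l = k"
  proof (rule ccontr)
    assume "l \<noteq> k"
    then have "(l, k) \<in> X \<or> (k, l) \<in> X" using l assms(2) by (auto simp: X_iff)
    then show False using assms(3) by force
  qed
  obtain n where n: "0 < n" "(rot S ^^ n) (w ! k) = w ! k"
    "inj_on (\<lambda>k'. (rot S ^^ k') (w ! k)) {..<n}"
    "\<And>e. e \<in> orbit (rot S) (w ! k) \<longleftrightarrow> (\<exists>k'<n. e = (rot S ^^ k') (w ! k))"
    using orbit_parametrization[OF surf(2,1)] by metis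
  have "inc k \<in> vertex S (w ! k)" using vertex_inc[OF assms(2)] self_in_vertex by metis
  then obtain y where y: "y < n" "inc k = (rot S ^^ y) (w ! k)" unfolding vertex_def n(4) by blast
  have y0: "0 \<noteq> y" using inc_ne[OF assms(2)] y by (intro notI) simp
  have "(rot S ^^ a) (w ! k) \<notin> left_darts S w k" if "a \<in> {0, y}" for a
    using sector_iff[OF n(1-3) n(1) y(1) _ y0, of a] that y n(1) by (auto simp: left_darts_eq)
  from this[of 0] this[of y] show False using l(3) d(1) y \<open>l = k\<close> by auto
qed

lemma sector_sum_crossing:
  assumes f: "supported f" and ij: "(i, j) \<in> X" and k: "k \<in> {i, j}"
  shows "(\<Sum>d\<in>sector S (w ! k) e. f d) =
    (\<Sum>d\<in>{w ! i, inc i, w ! j, inc j}. if d \<in> sector S (w ! k) e then f d else 0)"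
proof -
  have "f d = 0" if "d \<in> sector S (w ! k) e - {w ! i, inc i, w ! j, inc j}" for d
  proof (rule ccontr)
    assume *: "f d \<noteq> 0"
    have "d \<in> vertex S (w ! k)" using that sector_subset_vertex by blast
    then obtain l where l: "l < L" "vertex S (w ! l) = vertex S (w ! k)" "d = w ! l \<or> d = inc l"
      using supported_at_vertex[OF f *] by metis
    moreover have "vertex S (w ! k) = vertex S (w ! i)" using crossing(4)[OF ij] k by auto
    ultimately have "l = i \<or> l = j" using crossing(5)[OF ij, of l] by simp
    then show False using that l by auto
  qed
  then have "(\<Sum>d\<in>sector S (w ! k) e. f d) = (\<Sum>d\<in>sector S (w ! k) e \<inter> {w ! i, inc i, w ! j, inc j}. f d)"
    by (intro sum.mono_neutral_right finite_sector) auto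
  also have "\<dots> = (\<Sum>d\<in>{w ! i, inc i, w ! j, inc j} \<inter> {d. d \<in> sector S (w ! k) e}. f d)"
    by (rule sum.cong) auto
  also have "\<dots> = (\<Sum>d\<in>{w ! i, inc i, w ! j, inc j}. if d \<in> sector S (w ! k) e then f d else 0)"
    by (simp add: sum.inter_restrict)
  finally show ?thesis .
qed

lemma crossing_sums:
  assumes f: "supported f" and ij: "(i, j) \<in> X"
  shows "(\<Sum>d\<in>left_darts S w i. f d) = (if lam (i, j) = 1 then f (w ! j) else f (inc j))"
    "(\<Sum>d\<in>left_darts S w j. f d) = (if lam (i, j) = 1 then f (inc i) else f (w ! i))"
    "(\<Sum>d\<in>sector S (w ! i) (inc j). f d) = (if lam (i, j) = 1 then f (w ! j) + f (inc i) else 0)"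
    "(\<Sum>d\<in>sector S (w ! j) (inc i). f d) = (if lam (i, j) = 1 then 0 else f (w ! i) + f (inc j))"
proof -
  note s = sector_sum_crossing[OF f ij] and sec = crossing_sectors[OF ij]
  have dist: "w ! i \<noteq> inc i" "w ! i \<noteq> w ! j" "w ! i \<noteq> inc j" "inc i \<noteq> w ! j" "inc i \<noteq> inc j" "w ! j \<noteq> inc j"
    using crossing(6)[OF ij] by auto
  show "(\<Sum>d\<in>left_darts S w i. f d) = (if lam (i, j) = 1 then f (w ! j) else f (inc j))"
    "(\<Sum>d\<in>left_darts S w j. f d) = (if lam (i, j) = 1 then f (inc i) else f (w ! i))"
    "(\<Sum>d\<in>sector S (w ! i) (inc j). f d) = (if lam (i, j) = 1 then f (w ! j) + f (inc i) else 0)"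
    "(\<Sum>d\<in>sector S (w ! j) (inc i). f d) = (if lam (i, j) = 1 then 0 else f (w ! i) + f (inc j))"
    unfolding left_darts_eq s[OF insertI1] s[OF insertI2[OF singletonI]]
    using dist dist[symmetric] by (simp_all add: sec)
qed

lemma sum_over_times:
  fixes h :: "nat \<Rightarrow> int"
  assumes "\<And>k. k < L \<Longrightarrow> (\<And>e. e \<in> X \<Longrightarrow> k \<noteq> fst e \<and> k \<noteq> snd e) \<Longrightarrow> h k = 0"
  shows "(\<Sum>k<L. h k) = (\<Sum>e\<in>X. h (fst e) + h (snd e))"
proof -
  have uq: "fst e' = fst e \<and> snd e' = snd e"
    if "e \<in> X" "e' \<in> X" "{fst e, snd e} \<inter> {fst e', snd e'} \<noteq> {}" for e e'
  proof -
    have "(fst e, snd e) \<in> X" "(fst e', snd e') \<in> X" using that by simp_all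
    from crossing_unique[OF this that(3)] show ?thesis by simp
  qed
  have i1: "inj_on fst X"
  proof (rule inj_onI)
    fix e e' assume a: "e \<in> X" "e' \<in> X" "fst e = fst e'"
    show "e = e'" using uq[OF a(1,2)] a(3) by (simp add: prod_eq_iff)
  qed
  have i2: "inj_on snd X"
  proof (rule inj_onI)
    fix e e' assume a: "e \<in> X" "e' \<in> X" "snd e = snd e'"
    show "e = e'" using uq[OF a(1,2)] a(3) by (simp add: prod_eq_iff)
  qed
  have dj: "fst ` X \<inter> snd ` X = {}"
  proof -
    have "fst e \<noteq> snd e'" if "e \<in> X" "e' \<in> X" for e e'
    proof
      assume *: "fst e = snd e'"
      then have "fst e' = fst e" using uq[OF that] by auto
      have "(fst e', snd e') \<in> X" using that by simp
      from crossing(2)[OF this] show False using * \<open>fst e' = fst e\<close> by simp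
    qed
    then show ?thesis by blast
  qed
  have "(\<Sum>k<L. h k) = (\<Sum>k\<in>fst ` X \<union> snd ` X. h k)"
  proof (rule sum.mono_neutral_right)
    show "fst ` X \<union> snd ` X \<subseteq> {..<L}" using crossing(2,3) by fastforce
    show "\<forall>k\<in>{..<L} - (fst ` X \<union> snd ` X). h k = 0" by (intro ballI assms) auto
  qed simp
  also have "\<dots> = (\<Sum>k\<in>fst ` X. h k) + (\<Sum>k\<in>snd ` X. h k)"
    using dj finite_X by (intro sum.union_disjoint) auto
  also have "\<dots> = (\<Sum>e\<in>X. h (fst e) + h (snd e))"
    by (simp add: sum.reindex[OF i1] sum.reindex[OF i2] sum.distrib)
  finally show ?thesis .
qed

section \<open>Loops of the curve pushed off to their left\<close>

definition along :: "nat set \<Rightarrow> (nat \<Rightarrow> int) \<Rightarrow> int" where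
  "along A f = (\<Sum>k<L. if k \<in> A then \<Sum>d\<in>left_darts S w k. f d else 0)"

definition local_term :: "(nat \<Rightarrow> int) \<Rightarrow> nat set \<Rightarrow> nat \<times> nat \<Rightarrow> int" where
  "local_term f A e =
     (if fst e \<in> A then (if lam e = 1 then f (w ! snd e) else f (inc (snd e))) else 0) +
     (if snd e \<in> A then (if lam e = 1 then f (inc (fst e)) else f (w ! fst e)) else 0)"

lemma along_crossings:
  assumes "supported f"
  shows "along A f = (\<Sum>e\<in>X. local_term f A e)"
proof -
  have "along A f = (\<Sum>e\<in>X. (if fst e \<in> A then \<Sum>d\<in>left_darts S w (fst e). f d else 0) +
      (if snd e \<in> A then \<Sum>d\<in>left_darts S w (snd e). f d else 0))"
    unfolding along_def
    by (rule sum_over_times) (simp add: left_sum_noncrossing[OF assms])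
  also have "\<dots> = (\<Sum>e\<in>X. local_term f A e)"
    by (rule sum.cong) (auto simp: local_term_def crossing_sums(1,2)[OF assms])
  finally show ?thesis .
qed

text \<open>The loop turns like the whole curve at all its times except at its corner, where it
  arrives as the curve does at time \<open>j\<close> and leaves as at time \<open>i\<close>.\<close>

lemma intersection_alpha:
  assumes ij: "(i, j) \<in> X"
  shows "intersection S (alpha_cycle C (i, j)) v =
    along {i<..<j} (flow S v) + (\<Sum>d\<in>sector S (w ! i) (inc j). flow S v d)"
proof -
  note c = crossing[OF ij]
  define a where "a = alpha_cycle C (i, j)"
  have len: "length a = j - i" and nth: "\<And>k. k < j - i \<Longrightarrow> a ! k = w ! (i + k)"
    using c(2,3) by (auto simp: a_def alpha_cycle_def w_def L_def)
  have ld: "left_darts S a k = (if k = 0 then sector S (w ! i) (inc j) else left_darts S w (i + k))"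
    if k: "k < j - i" for k
  proof (cases "k = 0")
    case True
    have "incoming S a 0 = opp S (a ! (j - i - 1))" using c by (simp add: incoming_def len)
    also have "\<dots> = inc j" using c nth[of "j - i - 1"] by (simp add: inc_Suc)
    finally show ?thesis using True nth[OF k] by (simp add: left_darts_def)
  next
    case False
    then have "(k + (j - i) - 1) mod (j - i) = k - 1" using k by (simp add: mod_if)
    then have "incoming S a k = opp S (a ! (k - 1))" by (simp add: incoming_def len)
    also have "\<dots> = inc (i + k)" using c False k nth[of "k - 1"] by (simp add: inc_Suc)
    finally show ?thesis using False nth[OF k] by (simp add: left_darts_def inc_def)
  qed
  have "intersection S a v = (\<Sum>k<j - i. \<Sum>d\<in>left_darts S a k. flow S v d)"
    by (simp add: intersection_def len)
  also have "\<dots> = (\<Sum>d\<in>left_darts S a 0. flow S v d) + (\<Sum>k\<in>{1..<j - i}. \<Sum>d\<in>left_darts S a k. flow S v d)"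
    using c(2) by (subst lessThan_atLeast0, subst sum.atLeast_Suc_lessThan) auto
  also have "(\<Sum>k\<in>{1..<j - i}. \<Sum>d\<in>left_darts S a k. flow S v d) = (\<Sum>k\<in>{i<..<j}. \<Sum>d\<in>left_darts S w k. flow S v d)"
    by (rule sum.reindex_bij_witness[of _ "\<lambda>k. k - i" "\<lambda>k. i + k"]) (auto simp: ld)
  also have "\<dots> = along {i<..<j} (flow S v)"
    unfolding along_def using c
    by (subst sum.inter_restrict[symmetric]) (auto intro!: sum.cong)
  finally show ?thesis using c ld[of 0] by (simp add: a_def)
qed

lemma intersection_beta:
  assumes ij: "(i, j) \<in> X"
  shows "intersection S (beta_cycle C (i, j)) v =
    along (- {i..j}) (flow S v) + (\<Sum>d\<in>sector S (w ! j) (inc i). flow S v d)"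
proof -
  note c = crossing[OF ij]
  define b where "b = beta_cycle C (i, j)"
  have len: "length b = L - j + i" and nth: "\<And>k. k < L - j + i \<Longrightarrow> b ! k = w ! (if j + k < L then j + k else j + k - L)"
    using c(2,3) by (auto simp: b_def beta_cycle_def w_def L_def nth_append add.commute)
  have ld: "left_darts S b k = (if k = 0 then sector S (w ! j) (inc i)
      else left_darts S w (if j + k < L then j + k else j + k - L))"
    if k: "k < L - j + i" for k
  proof (cases "k = 0")
    case True
    have "incoming S b 0 = opp S (b ! (L - j + i - 1))" using c by (simp add: incoming_def len)
    also have "b ! (L - j + i - 1) = w ! (i - 1)"
    proof -
      have k: "L - j + i - 1 < L - j + i" "\<not> j + (L - j + i - 1) < L" "j + (L - j + i - 1) - L = i - 1"
        using c(1-3) by linarith+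
      show ?thesis unfolding nth[OF k(1)] by (simp only: k(2,3) if_False)
    qed
    also have "opp S (w ! (i - 1)) = inc i" using c(1-3) by (simp add: inc_Suc)
    finally show ?thesis using True nth[OF k] c by (simp add: left_darts_def)
  next
    case False
    then have "(k + (L - j + i) - 1) mod (L - j + i) = k - 1" using k by (simp add: mod_if)
    then have "incoming S b k = opp S (b ! (k - 1))" by (simp add: incoming_def len)
    also have "\<dots> = inc (if j + k < L then j + k else j + k - L)"
    \<comment> \<open>The loop through the basepoint wraps around; in the case of equality it stands
      at time 0 and has arrived along the last dart of the walk.\<close>
    proof (cases "j + k = L")
      case True
      have k': "k - 1 < L - j + i" "j + (k - 1) < L" "j + (k - 1) = L - 1"
        using True False k c(1-3) by linarith+
      have "b ! (k - 1) = w ! (L - 1)" unfolding nth[OF k'(1)] by (simp only: k'(2) if_True) (simp only: k'(3))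
      then show ?thesis using True walk(1) by (simp add: inc_def incoming_def L_def)
    next
      case neq: False
      have k': "k - 1 < L - j + i" "j + (k - 1) < L \<longleftrightarrow> j + k < L"
        "L < j + k \<Longrightarrow> j + (k - 1) - L = j + k - L - 1" "j + (k - 1) = j + k - 1"
        using neq False k c(2,3) by (cases k; auto)+
      have "0 < j + k" "j + k < L \<or> L < j + k" "j + k - L < L" using c(1-3) neq k by auto
      then show ?thesis unfolding nth[OF k'(1)] k'(2)
        using k'(3,4) by (auto simp: inc_Suc)
    qed
    finally show ?thesis using False nth[OF k] by (simp add: left_darts_def inc_def)
  qed
  have "intersection S b v = (\<Sum>k<L - j + i. \<Sum>d\<in>left_darts S b k. flow S v d)"
    by (simp add: intersection_def len)
  also have "\<dots> = (\<Sum>d\<in>left_darts S b 0. flow S v d) + (\<Sum>k\<in>{1..<L - j + i}. \<Sum>d\<in>left_darts S b k. flow S v d)"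
    using c by (subst lessThan_atLeast0, subst sum.atLeast_Suc_lessThan) auto
  also have "(\<Sum>k\<in>{1..<L - j + i}. \<Sum>d\<in>left_darts S b k. flow S v d) =
      (\<Sum>k\<in>{..<L} \<inter> - {i..j}. \<Sum>d\<in>left_darts S w k. flow S v d)"
    by (rule sum.reindex_bij_witness[of _ "\<lambda>k. if j < k then k - j else k + L - j"
          "\<lambda>k. if j + k < L then j + k else j + k - L"]) (use c(1-3) in \<open>auto simp: ld\<close>)
  also have "\<dots> = along (- {i..j}) (flow S v)"
    unfolding along_def by (subst sum.inter_restrict) auto
  finally show ?thesis using c ld[of 0] by (simp add: b_def)
qed

text \<open>The left sides of the two corners together contain the same darts of the curve as those
  of the two straight passages, so smoothing loses nothing.\<close>

lemma alpha_beta_total: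
  assumes ij: "(i, j) \<in> X" and f: "supported f"
  shows "along {i<..<j} f + (\<Sum>d\<in>sector S (w ! i) (inc j). f d) +
    (along (- {i..j}) f + (\<Sum>d\<in>sector S (w ! j) (inc i). f d)) = along UNIV f"
proof -
  note c = crossing[OF ij]
  let ?g = "\<lambda>k. \<Sum>d\<in>left_darts S w k. f d"
  have "along UNIV f = (\<Sum>k<L. (if k \<in> {i<..<j} then ?g k else 0) + (if k \<in> - {i..j} then ?g k else 0) +
      (if k = i then ?g k else 0) + (if k = j then ?g k else 0))"
    unfolding along_def using c(2) by (intro sum.cong) auto
  also have "\<dots> = along {i<..<j} f + along (- {i..j}) f + ?g i + ?g j"
    using c(2,3) by (simp add: sum.distrib along_def)
  finally show ?thesis using crossing_sums[OF f ij] by auto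
qed

lemma supported_flow: "set v \<subseteq> set w \<Longrightarrow> supported (flow S v)"
  by (auto simp: supported_def flow_def) (metis count_list_0_iff subsetD of_nat_0)

lemma walk_visit:
  assumes ij: "(i, j) \<in> X" and k: "k \<in> {i, j}" and l: "l < L"
  shows "w ! l = w ! k \<longleftrightarrow> l = k" "w ! l \<noteq> inc k" "opp S (w ! l) = inc k \<longleftrightarrow> l = k - 1"
proof -
  note c = crossing[OF ij]
  have kL: "k < L" "0 < k" using c k by auto
  have vk: "vertex S (w ! k) = vertex S (w ! i)" using c k by auto
  show 1: "w ! l = w ! k \<longleftrightarrow> l = k"
  proof
    assume *: "w ! l = w ! k"
    then have "l = i \<or> l = j" using c(5)[OF l] vk by simp
    then show "l = k" using * c(6) k by auto
  qed simp
  show "w ! l \<noteq> inc k"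
  proof
    assume "w ! l = inc k"
    then have "vertex S (w ! l) = vertex S (w ! i)" using vertex_inc[OF kL(1)] vk by simp
    then show False using c(5)[OF l] c(6) k \<open>w ! l = inc k\<close> by auto
  qed
  show "opp S (w ! l) = inc k \<longleftrightarrow> l = k - 1"
  proof
    assume *: "opp S (w ! l) = inc k"
    have inc: "inc (Suc l mod L) = opp S (w ! l)"
    proof (cases "Suc l < L")
      case True
      then show ?thesis using inc_Suc[of "Suc l"] by simp
    next
      case False
      then have "l = L - 1" using l by simp
      then show ?thesis using walk(1) by (simp add: inc_def incoming_def L_def)
    qed
    have "vertex S (w ! (Suc l mod L)) = vertex S (w ! i)"
      using vertex_inc[of "Suc l mod L"] vertex_inc[OF kL(1)] inc * vk walk(1) by simp
    then have "Suc l mod L = i \<or> Suc l mod L = j" using c(5)[of "Suc l mod L"] walk(1) by simp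
    then have "Suc l mod L = k" using inc * c(6) k by auto
    then show "l = k - 1" using kL l by (auto simp: mod_if split: if_splits)
  next
    assume "l = k - 1"
    then show "opp S (w ! l) = inc k" using inc_Suc kL by simp
  qed
qed

lemma count_alpha:
  assumes "a \<le> b" "b \<le> L" and u: "\<And>l. l < L \<Longrightarrow> w ! l = d \<longleftrightarrow> l = k"
  shows "count_list (take (b - a) (drop a w)) d = (if a \<le> k \<and> k < b then 1 else 0)"
proof (cases "a \<le> k")
  case True
  have "count_list (take (b - a) (drop a w)) d = (if k - a < length (take (b - a) (drop a w)) then 1 else 0)"
  proof (rule count_list_distinct_nth)
    fix l assume "l < length (take (b - a) (drop a w))"
    then have "l < b - a" "a + l < L" using assms by (auto simp: L_def)
    then show "take (b - a) (drop a w) ! l = d \<longleftrightarrow> l = k - a"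
      using u[of "a + l"] True by (auto simp: L_def)
  qed
  then show ?thesis using assms True by (auto simp: L_def)
next
  case False
  have "take (b - a) (drop a w) ! l \<noteq> d" if "l < length (take (b - a) (drop a w))" for l
  proof -
    have "a + l < L" "a + l \<noteq> k" using that False by (auto simp: L_def)
    then have "w ! (a + l) \<noteq> d" using u by simp
    then show ?thesis using that assms(1,2) by (simp add: L_def)
  qed
  then have "d \<notin> set (take (b - a) (drop a w))" by (metis in_set_conv_nth)
  then show ?thesis using False by (simp add: count_list_0_iff)
qed

text \<open>At its first time a segment only leaves, and at its last time it only arrives; hence the
  two different half-open intervals. The average of both cases is the origin of the half weight of
  \<open>chi\<close> at the ends of a chord.\<close>

lemma flow_segment:
  assumes ab: "a \<le> b" "b \<le> L" and ij: "(i, j) \<in> X" and k: "k \<in> {i, j}"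
  shows "flow S (take (b - a) (drop a w)) (w ! k) = (if a \<le> k \<and> k < b then 1 else 0)"
    "flow S (take (b - a) (drop a w)) (inc k) = - (if a < k \<and> k \<le> b then 1 else 0)"
proof -
  note v = walk_visit[OF ij k]
  have k0: "0 < k" "k < L" using crossing[OF ij] k by auto
  let ?a = "take (b - a) (drop a w)"
  have in_w: "x \<in> set w" if "x \<in> set ?a" for x using that by (meson in_set_takeD in_set_dropD)
  have "opp S (w ! k) \<notin> set ?a"
  proof
    assume "opp S (w ! k) \<in> set ?a"
    then obtain l where l: "l < L" "w ! l = opp S (w ! k)" using in_w unfolding L_def by (metis in_set_conv_nth)
    have "inc (Suc l mod L) = w ! k"
    proof (cases "Suc l < L")
      case True
      then show ?thesis using inc_Suc[of "Suc l"] l opp_opp by simp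
    next
      case False
      then have "l = L - 1" using l by simp
      then show ?thesis using walk(1) l opp_opp by (simp add: inc_def incoming_def L_def)
    qed
    moreover have "Suc l mod L < L" using walk(1) by simp
    ultimately have "vertex S (w ! (Suc l mod L)) = vertex S (w ! i)"
      using vertex_inc[of "Suc l mod L"] crossing(4)[OF ij] k by auto
    then have "Suc l mod L = i \<or> Suc l mod L = j" using crossing(5)[OF ij] \<open>Suc l mod L < L\<close> by blast
    then show False using \<open>inc (Suc l mod L) = w ! k\<close> crossing(6)[OF ij] k by auto
  qed
  then show "flow S (take (b - a) (drop a w)) (w ! k) = (if a \<le> k \<and> k < b then 1 else 0)"
    unfolding flow_def using count_alpha[of a b "w ! k" k] v(1) ab
    by (simp add: count_list_0_iff)
  have "inc k \<notin> set ?a"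
    using v(2) in_w unfolding L_def by (metis in_set_conv_nth)
  moreover have "count_list ?a (opp S (inc k)) = (if a \<le> k - 1 \<and> k - 1 < b then 1 else 0)"
    using v(3) ab by (intro count_alpha) (auto simp: opp_opp, (metis opp_opp)+)
  ultimately show "flow S (take (b - a) (drop a w)) (inc k) = - (if a < k \<and> k \<le> b then 1 else 0)"
    unfolding flow_def using k0 by (auto simp: count_list_0_iff)
qed

lemma alpha_segment: "alpha_cycle C (a, b) = take (b - a) (drop a w)"
  by (simp add: alpha_cycle_def w_def)

lemma flow_beta:
  assumes "(a, b) \<in> X"
  shows "flow S (beta_cycle C (a, b)) d = flow S w d - flow S (alpha_cycle C (a, b)) d"
proof -
  have "a \<le> b" "b \<le> L" using crossing(2,3)[OF assms] by auto
  then have "w = take a w @ take (b - a) (drop a w) @ drop b w"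
    by (metis append_take_drop_id drop_drop le_add_diff_inverse2)
  then have "count_list w e = count_list (take a w) e + count_list (take (b - a) (drop a w)) e + count_list (drop b w) e" for e
    by (metis count_list_append add.assoc)
  then show ?thesis
    by (simp add: flow_def alpha_segment) (simp add: beta_cycle_def w_def)
qed

lemma supported_alpha: "supported (flow S (alpha_cycle C c))"
  by (intro supported_flow) (auto simp: alpha_cycle_def w_def split: prod.splits dest: in_set_takeD in_set_dropD)

lemma supported_walk: "supported (flow S w)"
  by (intro supported_flow) auto

lemma flow_walk:
  assumes "(i, j) \<in> X" "k \<in> {i, j}"
  shows "flow S w (w ! k) = 1" "flow S w (inc k) = - 1"
  using flow_segment[of 0 L i j k] crossing(1-3)[OF assms(1)] assms by (auto simp: L_def)

lemma flow_alpha: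
  assumes "(a, b) \<in> X" "(i, j) \<in> X" "k \<in> {i, j}"
  shows "flow S (alpha_cycle C (a, b)) (w ! k) = (if a \<le> k \<and> k < b then 1 else 0)"
    "flow S (alpha_cycle C (a, b)) (inc k) = - (if a < k \<and> k \<le> b then 1 else 0)"
  using flow_segment[of a b i j k] crossing(2,3)[OF assms(1)] assms by (auto simp: alpha_segment)

lemma flow_alpha_self:
  assumes "(a, b) \<in> X"
  shows "flow S (alpha_cycle C (a, b)) (w ! a) = 1" "flow S (alpha_cycle C (a, b)) (w ! b) = 0"
    "flow S (alpha_cycle C (a, b)) (inc a) = 0" "flow S (alpha_cycle C (a, b)) (inc b) = - 1"
  using flow_alpha[OF assms assms, of a] flow_alpha[OF assms assms, of b] crossing(2)[OF assms] by auto

lemma crossing_times_distinct: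
  assumes "(a, b) \<in> X" "(i, j) \<in> X" "(i, j) \<noteq> (a, b)"
  shows "i \<noteq> a" "i \<noteq> b" "j \<noteq> a" "j \<noteq> b"
proof -
  have "{a, b} \<inter> {i, j} = {}" using crossing_unique[OF assms(1,2)] assms(3) by blast
  then show "i \<noteq> a" "i \<noteq> b" "j \<noteq> a" "j \<noteq> b" by auto
qed

lemma flow_alpha_chi:
  assumes "(a, b) \<in> X" "(i, j) \<in> X" "(i, j) \<noteq> (a, b)" "k \<in> {i, j}"
  shows "chi (a, b) k = 2 * flow S (alpha_cycle C (a, b)) (w ! k)"
    "2 * flow S (alpha_cycle C (a, b)) (inc k) = - (2 * flow S (alpha_cycle C (a, b)) (w ! k))"
proof -
  have "k \<noteq> a" "k \<noteq> b" using crossing_times_distinct[OF assms(1-3)] assms(4) by auto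
  then show "chi (a, b) k = 2 * flow S (alpha_cycle C (a, b)) (w ! k)"
    "2 * flow S (alpha_cycle C (a, b)) (inc k) = - (2 * flow S (alpha_cycle C (a, b)) (w ! k))"
    unfolding flow_alpha[OF assms(1,2,4)] by (auto simp: chi_def)
qed

lemma chi_interval:
  "k \<noteq> i \<Longrightarrow> k \<noteq> j \<Longrightarrow> chi (i, j) k = (if k \<in> {i<..<j} then 2 else 0)"
  by (simp add: chi_def)

lemma chi_ends: "chi (i, j) i = 1" "chi (i, j) j = 1"
  by (simp_all add: chi_def)

lemma lam_unit: "lam e = 1 \<or> lam e = -1"
  by (simp add: lam_def)

lemma along_walk_total: "along UNIV (flow S w) = 0"
proof -
  have "local_term (flow S w) UNIV e = 0" if "e \<in> X" for e
    using flow_walk[of "fst e" "snd e"] that by (simp add: local_term_def)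
  then show ?thesis by (simp add: along_crossings[OF supported_walk])
qed

lemma along_alpha_total:
  assumes d: "d \<in> X"
  shows "4 * along UNIV (flow S (alpha_cycle C d)) = pairing X lam (\<lambda>_. 2) (chi d)"
proof -
  obtain a b where ab: "d = (a, b)" "(a, b) \<in> X" using d by (cases d) auto
  have "4 * local_term (flow S (alpha_cycle C d)) UNIV e =
      lam e * (2 * chi d (snd e) - 2 * chi d (fst e))" if e: "e \<in> X" for e
  proof -
    obtain i j where ij: "e = (i, j)" "(i, j) \<in> X" using e by (cases e) auto
    show ?thesis
    proof (cases "e = d")
      case True
      then show ?thesis using flow_alpha_self[OF ab(2)] ab(1) by (simp add: local_term_def chi_ends)
    next
      case False
      then have ne: "(i, j) \<noteq> (a, b)" using ij ab by simp
      show ?thesis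
        using lam_unit[of e] flow_alpha_chi[OF ab(2) ij(2) ne, of i] flow_alpha_chi[OF ab(2) ij(2) ne, of j]
        unfolding ab(1) ij(1) by (elim disjE) (simp_all add: local_term_def)
    qed
  qed
  then show ?thesis
    by (simp add: along_crossings[OF supported_alpha] sum_distrib_left pairing_def)
qed

lemma intersection_alpha_walk:
  assumes c: "(i, j) \<in> X"
  shows "4 * (along {i<..<j} (flow S w) + (\<Sum>d\<in>sector S (w ! i) (inc j). flow S w d)) =
    pairing X lam (chi (i, j)) (\<lambda>_. 2)"
proof -
  have corner: "(\<Sum>d\<in>sector S (w ! i) (inc j). flow S w d) = 0"
    using flow_walk[OF c] by (simp add: crossing_sums(3)[OF supported_walk c])
  have "4 * local_term (flow S w) {i<..<j} e = lam e * (chi (i, j) (fst e) * 2 - chi (i, j) (snd e) * 2)"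
    if e: "e \<in> X" for e
  proof -
    obtain a b where ab: "e = (a, b)" "(a, b) \<in> X" using e by (cases e) auto
    note fw = flow_walk[OF ab(2), of a] flow_walk[OF ab(2), of b]
    show ?thesis
    proof (cases "e = (i, j)")
      case True
      then show ?thesis by (simp add: local_term_def chi_ends)
    next
      case False
      then have ne: "(a, b) \<noteq> (i, j)" using ab by simp
      note d = crossing_times_distinct[OF c ab(2) ne]
      show ?thesis
        using lam_unit[of e] fw chi_interval[OF d(1,2)] chi_interval[OF d(3,4)]
        unfolding ab(1) by (elim disjE) (simp_all add: local_term_def)
    qed
  qed
  then show ?thesis
    by (simp add: corner along_crossings[OF supported_walk] sum_distrib_left pairing_def)
qed

text \<open>Away from \<open>c\<close> and \<open>d\<close> the left push-off gives the determinants
  crossing by crossing. At \<open>c\<close> and \<open>d\<close> the push-off is not symmetric, so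
  there the terms differ individually and agree only in their sum, in which the corner of the first
  loop is included.\<close>

lemma intersection_alpha_alpha:
  assumes c: "c \<in> X" and d: "d \<in> X"
  shows "4 * intersection S (alpha_cycle C c) (alpha_cycle C d) = pairing X lam (chi c) (chi d)"
proof -
  obtain i j where ij: "c = (i, j)" "(i, j) \<in> X" using c by (cases c) auto
  obtain a b where ab: "d = (a, b)" "(a, b) \<in> X" using d by (cases d) auto
  let ?f = "flow S (alpha_cycle C d)"
  let ?n = "\<lambda>e. lam e * (chi c (fst e) * chi d (snd e) - chi c (snd e) * chi d (fst e))"
  define corner where "corner = (\<Sum>d\<in>sector S (w ! i) (inc j). ?f d)"
  have corner: "corner = (if lam c = 1 then ?f (w ! j) + ?f (inc i) else 0)"
    unfolding corner_def ij(1) by (rule crossing_sums(3)[OF supported_alpha ij(2)])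
  note lt = crossing(2)[OF ij(2)] crossing(2)[OF ab(2)]
  have gen: "4 * local_term ?f {i<..<j} e = ?n e" if e: "e \<in> X" "e \<noteq> c" "e \<noteq> d" for e
  proof -
    obtain k l where kl: "e = (k, l)" "(k, l) \<in> X" using e(1) by (cases e) auto
    have ne: "(k, l) \<noteq> (i, j)" "(k, l) \<noteq> (a, b)" using e kl ij ab by auto
    note d = crossing_times_distinct[OF ij(2) kl(2) ne(1)]
    show ?thesis
      using lam_unit[of e] flow_alpha_chi[OF ab(2) kl(2) ne(2), of k] flow_alpha_chi[OF ab(2) kl(2) ne(2), of l]
        chi_interval[OF d(1,2)] chi_interval[OF d(3,4)]
      unfolding kl(1) ij(1) ab(1) by (elim disjE) (simp_all add: local_term_def)
  qed
  have c0: "local_term ?f {i<..<j} c = 0" by (simp add: local_term_def ij(1))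
  have "4 * ((\<Sum>e\<in>X. local_term ?f {i<..<j} e) + corner) = (\<Sum>e\<in>X. ?n e)"
  proof (cases "c = d")
    case True
    have "4 * (\<Sum>e\<in>X. local_term ?f {i<..<j} e) = (\<Sum>e\<in>X. ?n e)"
      unfolding sum_distrib_left using gen c0 True by (intro sum.cong refl) (metis diff_self mult.commute mult_zero_right)
    moreover have "corner = 0"
      using flow_alpha[OF ab(2) ij(2), of j] flow_alpha[OF ab(2) ij(2), of i] True ij ab lt
      by (simp add: corner)
    ultimately show ?thesis by simp
  next
    case False
    have X2: "X = insert c (insert d (X - {c, d}))" using c d by auto
    have split: "(\<Sum>e\<in>X. g e) = g c + g d + (\<Sum>e\<in>X - {c, d}. g e)" for g :: "nat \<times> nat \<Rightarrow> int"
      by (subst X2) (use finite_X False in simp)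
    have ne: "(i, j) \<noteq> (a, b)" "(a, b) \<noteq> (i, j)" using False ij ab by auto
    note da = crossing_times_distinct[OF ij(2) ab(2) ne(2)]
    have "4 * (\<Sum>e\<in>X - {c, d}. local_term ?f {i<..<j} e) = (\<Sum>e\<in>X - {c, d}. ?n e)"
      unfolding sum_distrib_left using gen by (intro sum.cong refl) auto
    moreover have "4 * (local_term ?f {i<..<j} d + corner) = ?n c + ?n d"
    proof -
      \<comment> \<open>Whether two chords interleave is a symmetric relation: if the ends of
        \<open>c\<close> are separated by \<open>d\<close>, then those of \<open>d\<close> are
        separated by \<open>c\<close>, and the differences correspond with the right sign.\<close>
      have link: "chi (a, b) j - chi (a, b) i + chi (i, j) b - chi (i, j) a = 0"
        using lt da by (auto simp: chi_def)
      have ch: "chi (i, j) a = (if a \<in> {i<..<j} then 2 else 0)" "chi (i, j) b = (if b \<in> {i<..<j} then 2 else 0)"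
        by (rule chi_interval[OF da(1,2)], rule chi_interval[OF da(3,4)])
      have "4 * local_term ?f {i<..<j} d = (if lam d = 1 then 0 else 2 * (chi c b - chi c a))"
        using flow_alpha_self[OF ab(2)] by (simp add: local_term_def ab(1) ij(1) ch)
      moreover have "4 * corner = (if lam c = 1 then 2 * (chi d j - chi d i) else 0)"
        using flow_alpha_chi[OF ab(2) ij(2) ne(1), of i] flow_alpha_chi[OF ab(2) ij(2) ne(1), of j]
        by (simp add: corner ab(1))
      ultimately show ?thesis
        using lam_unit[of c] lam_unit[of d] link unfolding ij(1) ab(1)
        by (elim disjE) (simp_all add: chi_ends)
    qed
    ultimately show ?thesis unfolding split c0 by simp
  qed
  then show ?thesis
    unfolding pairing_def
    by (simp add: ij(1) intersection_alpha[OF ij(2)] along_crossings[OF supported_alpha]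
        corner_def[unfolded ij(1)])
qed

lemma total_index_along: "d \<in> X \<Longrightarrow> along UNIV (flow S (alpha_cycle C d)) = total_index X lam d"
  using along_alpha_total by (simp add: total_index_def flip: along_alpha_total)

lemma intersection_alpha_alpha_index:
  assumes "c \<in> X" "d \<in> X"
  shows "intersection S (alpha_cycle C c) (alpha_cycle C d) = chord_index X lam c d"
  using intersection_alpha_alpha[OF assms] by (simp add: chord_index_def flip: intersection_alpha_alpha[OF assms])

lemma along_diff: "along A (\<lambda>d. f d - g d) = along A f - along A g"
  unfolding along_def sum_subtractf[symmetric] by (rule sum.cong) (auto simp: sum_subtractf)

lemma intersection_alpha_beta:
  assumes c: "c \<in> X"
  shows "intersection S (alpha_cycle C c) (beta_cycle C c) = - total_index X lam c"
proof -
  obtain i j where ij: "c = (i, j)" "(i, j) \<in> X" using c by (cases c) auto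
  have "flow S (beta_cycle C c) = (\<lambda>d. flow S w d - flow S (alpha_cycle C c) d)"
    using flow_beta[OF ij(2)] ij(1) by auto
  then have "intersection S (alpha_cycle C c) (beta_cycle C c) =
    (along {i<..<j} (flow S w) + (\<Sum>d\<in>sector S (w ! i) (inc j). flow S w d)) -
    intersection S (alpha_cycle C c) (alpha_cycle C c)"
    unfolding ij(1) intersection_alpha[OF ij(2)] by (simp add: along_diff sum_subtractf)
  then have "4 * intersection S (alpha_cycle C c) (beta_cycle C c) = pairing X lam (chi c) (\<lambda>_. 2)"
    using intersection_alpha_walk[OF ij(2)] intersection_alpha_alpha[OF c c] ij(1) by simp
  also have "\<dots> = - (4 * total_index X lam c)"
    using along_alpha_total[OF c] total_index_along[OF c] by (simp add: pairing_swap[of X lam "chi c"])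
  finally show ?thesis by simp
qed

text \<open>Bilinearity: with the whole curve \<open>w\<close>, this is (\<open>w\<close> -
  \<alpha>) \<cdot> (\<open>w\<close> - \<alpha>') for the two loops, where \<open>w\<close> has
  intersection number 0 with itself.\<close>

lemma intersection_beta_beta:
  assumes c: "c \<in> X" and d: "d \<in> X"
  shows "intersection S (beta_cycle C c) (beta_cycle C d) =
    chord_index X lam c d + total_index X lam c - total_index X lam d"
proof -
  obtain i j where ij: "c = (i, j)" "(i, j) \<in> X" using c by (cases c) auto
  obtain a b where ab: "d = (a, b)" "(a, b) \<in> X" using d by (cases d) auto
  let ?B = "\<lambda>f. along (- {i..j}) f + (\<Sum>d\<in>sector S (w ! j) (inc i). f d)"
  let ?A = "\<lambda>f. along {i<..<j} f + (\<Sum>d\<in>sector S (w ! i) (inc j). f d)"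
  have fb: "flow S (beta_cycle C d) = (\<lambda>e. flow S w e - flow S (alpha_cycle C d) e)"
    using flow_beta[OF ab(2)] ab(1) by auto
  have "intersection S (beta_cycle C c) (beta_cycle C d) = ?B (flow S w) - ?B (flow S (alpha_cycle C d))"
    unfolding ij(1) intersection_beta[OF ij(2)] fb by (simp add: along_diff sum_subtractf)
  also have "?B (flow S w) = - ?A (flow S w)"
    using alpha_beta_total[OF ij(2) supported_walk] along_walk_total by simp
  also have "?B (flow S (alpha_cycle C d)) = total_index X lam d - chord_index X lam c d"
    using alpha_beta_total[OF ij(2) supported_alpha[of d]] total_index_along[OF d]
      intersection_alpha_alpha_index[OF c d] unfolding ij(1) intersection_alpha[OF ij(2)] by simp
  also have "?A (flow S w) = - total_index X lam c"
  proof -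
    have "4 * ?A (flow S w) = pairing X lam (chi c) (\<lambda>_. 2)"
      using intersection_alpha_walk[OF ij(2)] unfolding ij(1) .
    also have "\<dots> = - (4 * total_index X lam c)"
      using along_alpha_total[OF c] total_index_along[OF c] by (simp add: pairing_swap[of X lam "chi c"])
    finally have "4 * ?A (flow S w) = - (4 * total_index X lam c)" .
    then show ?thesis by simp
  qed
  finally show ?thesis by simp
qed

definition ov :: "nat \<times> nat \<Rightarrow> bool" where "ov c \<longleftrightarrow> fst c \<in> over_times C"

lemma crossings_of_type_eq: "crossings_of_type S C a = of_type X ov a"
  by (auto simp: crossings_of_type_def of_type_def X_def ov_def)

lemma surf_sign_eq: "surf_sign S C c = chord_sign lam ov c"
  by (cases c) (simp add: surf_sign_def chord_sign_def lam_def ov_def w_def)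

end

text \<open>With \<open>n\<close> the intersection number of two loops and \<open>x\<close>, \<open>y\<close> those of the whole curve with
  them, these are the contributions of a pair of crossings; in the second one, the exponent is
  that of the complementary loops and the other terms come from the corrections by \<open>W\<close>.\<close>

definition F_kernel :: "int \<Rightarrow> int \<Rightarrow> int \<Rightarrow> laurent" where
  "F_kernel n x y = t_pow n - 1"

definition H_kernel :: "int \<Rightarrow> int \<Rightarrow> int \<Rightarrow> laurent" where
  "H_kernel n x y = t_pow (n + x - y) - t_pow x - t_pow (- y) + 1"

section \<open>Inversion of the variable\<close>

lemma t_pow_0: "t_pow 0 = 1"
  by (simp add: t_pow_def)

lemma admissible_kernels: "admissible F_kernel" "admissible H_kernel"
  by (simp_all add: admissible_def F_kernel_def H_kernel_def t_pow_0)

lemma lookup_t_inverse: "Poly_Mapping.lookup (t_inverse f) k = Poly_Mapping.lookup f (- k)"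
  unfolding t_inverse_def by (subst map_key.rep_eq) (auto simp: inj_def)

lemma t_inverse_add: "t_inverse (f + g) = t_inverse f + t_inverse g"
  by (rule poly_mapping_eqI) (simp add: lookup_t_inverse lookup_add)

lemma t_inverse_diff: "t_inverse (f - g) = t_inverse f - t_inverse g"
  by (rule poly_mapping_eqI) (simp add: lookup_t_inverse lookup_minus)

lemma t_inverse_0: "t_inverse 0 = 0"
  by (rule poly_mapping_eqI) (simp add: lookup_t_inverse)

lemma t_inverse_sum: "t_inverse (\<Sum>i\<in>A. f i) = (\<Sum>i\<in>A. t_inverse (f i))"
  by (induction A rule: infinite_finite_induct) (simp_all add: t_inverse_0 t_inverse_add)

lemma t_inverse_t_pow: "t_inverse (t_pow k) = t_pow (- k)"
  by (rule poly_mapping_eqI) (auto simp: lookup_t_inverse t_pow_def lookup_single when_def)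

lemma t_inverse_1: "t_inverse 1 = 1"
  using t_inverse_t_pow[of 0] by (simp add: t_pow_0)

lemma t_inverse_uminus: "t_inverse (- f) = - t_inverse f"
  using t_inverse_diff[of 0 f] by (simp add: t_inverse_0)

lemma t_inverse_of_int_mult: "t_inverse (of_int n * f) = of_int n * t_inverse f"
proof -
  have nat: "t_inverse (of_nat k * f) = of_nat k * t_inverse f" for k
    by (induction k) (simp_all add: t_inverse_0 t_inverse_add algebra_simps)
  show ?thesis
    by (cases n rule: int_cases2) (simp_all add: nat t_inverse_uminus)
qed

context realization
begin

lemma F_diagram_gauss_poly: "F_diagram a b S C = gauss_poly F_kernel a b X lam ov"
proof -
  have "c \<in> X" if "c \<in> of_type X ov a" for a c using that by (simp add: of_type_def)
  then show ?thesis
    unfolding F_diagram_def gauss_poly_def crossings_of_type_eq surf_sign_eq F_kernel_def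
    by (intro sum.cong refl) (simp add: intersection_alpha_alpha_index)
qed

lemma H_diagram_gauss_poly: "H_diagram a b S C = gauss_poly H_kernel a b X lam ov"
proof -
  have sub: "c \<in> X" if "c \<in> of_type X ov a" for a c using that by (simp add: of_type_def)
  let ?e = "\<lambda>c. of_int (chord_sign lam ov c) :: laurent"
  let ?m = "total_index X lam"
  have W: "W_diagram a S C = (\<Sum>c\<in>of_type X ov a. ?e c * (t_pow (- ?m c) - 1))" for a
    unfolding W_diagram_def crossings_of_type_eq surf_sign_eq
    by (intro sum.cong refl) (simp add: intersection_alpha_beta sub)
  have o: "of_int (omega S C a) = (\<Sum>c\<in>of_type X ov a. ?e c)" for a
    by (simp add: omega_def crossings_of_type_eq surf_sign_eq)
  have tW: "t_inverse (W_diagram a S C) = (\<Sum>c\<in>of_type X ov a. ?e c * (t_pow (?m c) - 1))"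
    unfolding W t_inverse_sum t_inverse_of_int_mult t_inverse_diff t_inverse_t_pow t_inverse_1 by simp
  have "H_diagram a b S C = (\<Sum>c\<in>of_type X ov a. \<Sum>d\<in>of_type X ov b.
      ?e c * ?e d * (t_pow (chord_index X lam c d + ?m c - ?m d) - 1) -
      ?e c * (?e d * (t_pow (- ?m d) - 1)) - ?e d * (?e c * (t_pow (?m c) - 1)))"
    unfolding H_diagram_def crossings_of_type_eq surf_sign_eq o tW unfolding W
    unfolding sum_subtractf sum_product
    \<comment> \<open>The last correction is a sum over the crossings of type \<open>b\<close> times
      one over those of type \<open>a\<close>; its order of summation has to be exchanged to match
      the other terms.\<close>
    by (subst (3) sum.swap)
      (simp add: intersection_beta_beta sub cong: sum.cong)
  also have "\<dots> = gauss_poly H_kernel a b X lam ov"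
    unfolding gauss_poly_def H_kernel_def
    by (intro sum.cong refl) (simp add: algebra_simps)
  finally show ?thesis .
qed

end

section \<open>Every long virtual knot diagram has a surface realization\<close>

lemma permutes_if_inverse:
  assumes "\<And>x. g (f x) = x" "\<And>x. f (g x) = x" "\<And>x. x \<notin> A \<Longrightarrow> f x = x"
  shows "f permutes A"
  unfolding permutes_def
proof (intro conjI allI impI)
  show "f x = x" if "x \<notin> A" for x using assms(3) that .
  show "\<exists>!x. f x = y" for y using assms(1,2) by (intro ex1I[of _ "g y"]) auto
qed

text \<open>The cell decomposition is read off the Gauss diagram: at time \<open>k\<close> the curve leaves along
  the dart \<open>2 * k\<close> after arriving on the reverse of \<open>2 * k + 1\<close>; \<open>par\<close> pairs the two times of a
  crossing and fixes the base time 0, and \<open>pos k\<close> says that the other strand crosses from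
  right to left at time \<open>k\<close>.\<close>

locale paired_times =
  fixes L :: nat and par :: "nat \<Rightarrow> nat" and pos :: "nat \<Rightarrow> bool"
  assumes L: "0 < L" and par0: "par 0 = 0" "\<not> pos 0"
    and par: "\<And>k. k < L \<Longrightarrow> par k < L" "\<And>k. k < L \<Longrightarrow> par (par k) = k"
      "\<And>k. 0 < k \<Longrightarrow> k < L \<Longrightarrow> par k \<noteq> k"
    and pos: "\<And>k. 0 < k \<Longrightarrow> k < L \<Longrightarrow> pos (par k) \<longleftrightarrow> \<not> pos k"
begin

text \<open>If \<open>pos k\<close>, the counterclockwise order at the crossing is
  \<open>2 * k\<close>, \<open>2 * par k\<close>, \<open>2 * k + 1\<close>,
  \<open>2 * par k + 1\<close>, so that the two strands alternate. At the base time the two darts 0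
  and 1 just exchange places, which gives a vertex of degree 2.\<close>

definition turn :: "nat \<Rightarrow> nat" where
  "turn d = (if d < 2 * L then 2 * par (d div 2) + (if even d = pos (d div 2) then 0 else 1) else d)"

definition flip :: "nat \<Rightarrow> nat" where
  "flip d = (if d < 2 * L then (if even d then 2 * ((d div 2 + 1) mod L) + 1
     else 2 * ((d div 2 + L - 1) mod L)) else d)"

definition "surf = Surface {..<2 * L} turn flip"
definition "route = map (\<lambda>k. 2 * k) [0..<L]"

lemma turn_simps:
  assumes "k < L"
  shows "pos k \<Longrightarrow> turn (2 * k) = 2 * par k" "pos k \<Longrightarrow> turn (2 * k + 1) = 2 * par k + 1"
    "\<not> pos k \<Longrightarrow> turn (2 * k) = 2 * par k + 1" "\<not> pos k \<Longrightarrow> turn (2 * k + 1) = 2 * par k"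
  using assms by (auto simp: turn_def)

lemma turn_turn:
  assumes "0 < k" "k < L"
  shows "turn (turn (2 * k)) = 2 * k + 1" "turn (turn (2 * k + 1)) = 2 * k"
  using assms turn_simps[OF assms(2)] turn_simps[OF par(1)[OF assms(2)]] par(2)[OF assms(2)] pos[OF assms]
  by (cases "pos k"; simp)+

lemma turn_0: "turn 0 = 1" "turn 1 = 0"
  using turn_simps(3,4)[of 0] L par0 by auto

lemma dart_cases:
  assumes "d < 2 * L"
  obtains k where "k < L" "d = 2 * k" | k where "k < L" "d = 2 * k + 1"
proof (cases "even d")
  case True
  then obtain k where "d = 2 * k" by (elim evenE)
  then show ?thesis using that(1)[of k] assms by simp
next
  case False
  then obtain k where "d = 2 * k + 1" by (elim oddE)
  then show ?thesis using that(2)[of k] assms by simp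
qed

lemma turn4: "turn (turn (turn (turn d))) = d"
proof (cases "d < 2 * L")
  case True
  then show ?thesis
  proof (cases rule: dart_cases)
    case (1 k)
    then show ?thesis using turn_turn[of k] turn_0 by (cases "k = 0") auto
  next
    case (2 k)
    then show ?thesis using turn_turn[of k] turn_0 by (cases "k = 0") auto
  qed
qed (simp add: turn_def)

lemma turn_less: "d < 2 * L \<Longrightarrow> turn d < 2 * L" "d < 2 * L \<Longrightarrow> turn d div 2 = par (d div 2)"
proof -
  assume d: "d < 2 * L"
  then have "d div 2 < L" by simp
  from par(1)[OF this] d show "turn d < 2 * L" "turn d div 2 = par (d div 2)"
    by (simp_all add: turn_def)
qed

lemma flip_simps: "k < L \<Longrightarrow> flip (2 * k) = 2 * (Suc k mod L) + 1"
  "k < L \<Longrightarrow> flip (2 * k + 1) = 2 * ((k + L - 1) mod L)"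
  by (auto simp: flip_def)

lemma flip_flip: "flip (flip d) = d"
proof (cases "d < 2 * L")
  case True
  then show ?thesis
  proof (cases rule: dart_cases)
    case (1 k)
    then have "flip (flip d) = 2 * ((Suc k mod L + L - 1) mod L)"
      using L by (simp add: flip_simps del: One_nat_def)
    also have "(Suc k mod L + L - 1) mod L = k" using 1 L by (cases "Suc k = L") auto
    finally show ?thesis using 1 by simp
  next
    case (2 k)
    then have "flip (flip d) = 2 * (Suc ((k + L - 1) mod L) mod L) + 1"
      using L by (simp add: flip_simps del: One_nat_def)
    also have "Suc ((k + L - 1) mod L) mod L = k" using 2 L by (simp add: mod_Suc_eq)
    finally show ?thesis using 2 by simp
  qed
qed (simp add: flip_def)

lemma flip_ne: "d < 2 * L \<Longrightarrow> flip d \<noteq> d"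
proof (erule dart_cases)
  have odd: "2 * a + 1 \<noteq> 2 * b" for a b :: nat by presburger
  show "flip d \<noteq> d" if "k < L" "d = 2 * k" for k
    unfolding that(2) flip_simps(1)[OF that(1)] by (rule odd)
  show "flip d \<noteq> d" if "k < L" "d = 2 * k + 1" for k
    unfolding that(2) flip_simps(2)[OF that(1)] by (rule odd[symmetric])
qed

lemma turn_permutes: "turn permutes {..<2 * L}"
  by (rule permutes_if_inverse[of "turn \<circ> turn \<circ> turn"]) (simp_all add: turn4, simp add: turn_def)

lemma flip_permutes: "flip permutes {..<2 * L}"
  by (rule permutes_if_inverse[of flip]) (simp_all add: flip_flip, simp add: flip_def)

lemma reach_even_odd:
  assumes "k < L" "turn \<in> F"
  shows "(2 * k + 1, 2 * k) \<in> (\<Union>f\<in>F. {(x, f x) |x. True})\<^sup>*"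
proof -
  let ?R = "\<Union>f\<in>F. {(x, f x) |x. True}"
  have step: "(x, turn x) \<in> ?R" for x using assms by auto
  have "(2 * k + 1, turn (2 * k + 1)) \<in> ?R\<^sup>*" "(turn (2 * k + 1), turn (turn (2 * k + 1))) \<in> ?R\<^sup>*"
    using step by blast+
  then show ?thesis using turn_turn[of k] turn_0 assms by (cases "k = 0") auto
qed

text \<open>The curve itself passes every vertex; at each vertex, turning leads from the arriving
  dart to the departing one.\<close>

lemma connected_darts:
  assumes "d < 2 * L" "e < 2 * L"
  shows "(d, e) \<in> ({(x, turn x) |x. True} \<union> {(x, flip x) |x. True})\<^sup>*"
proof -
  let ?R = "{(x, turn x) |x. True} \<union> {(x, flip x) |x. True}"
  have R: "?R = (\<Union>f\<in>{turn, flip}. {(x, f x) |x. True})" by auto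
  have odd: "(2 * k + 1, 2 * k) \<in> ?R\<^sup>*" if "k < L" for k
    unfolding R using that by (rule reach_even_odd) simp
  have nxt: "(2 * k, 2 * (Suc k mod L) + 1) \<in> ?R\<^sup>*" if "k < L" for k
    using flip_simps(1)[OF that] by (intro r_into_rtrancl) auto
  have nxt': "(2 * k, 2 * Suc k) \<in> ?R\<^sup>*" if "Suc k < L" for k
    using rtrancl_trans[OF nxt[of k], of "2 * Suc k"] odd[of "Suc k"] that by simp
  have up: "(0, 2 * k) \<in> ?R\<^sup>*" if "k < L" for k
    using that by (induction k) (use nxt' in \<open>force intro: rtrancl_trans\<close>)+
  have upodd: "(0, 2 * k + 1) \<in> ?R\<^sup>*" if "k < L" for k
  proof (cases k)
    case 0
    then show ?thesis using up[of "L - 1"] nxt[of "L - 1"] L by (auto intro: rtrancl_trans)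
  next
    case (Suc m)
    then show ?thesis using up[of m] nxt[of m] that by (auto intro: rtrancl_trans)
  qed
  have down: "(2 * (L - 1 - k), 0) \<in> ?R\<^sup>*" for k
  proof (induction k)
    case 0
    then show ?case using nxt[of "L - 1"] odd[of 0] L by (auto intro: rtrancl_trans)
  next
    case (Suc k)
    show ?case
    proof (cases "Suc k \<le> L - 1")
      case True
      then have "Suc (L - 1 - Suc k) = L - 1 - k" by simp
      then have "(2 * (L - 1 - Suc k), 2 * (L - 1 - k)) \<in> ?R\<^sup>*"
        using nxt'[of "L - 1 - Suc k"] L by simp
      then show ?thesis using Suc by (rule rtrancl_trans)
    next
      case False
      then show ?thesis by simp
    qed
  qed
  have fro: "(2 * k, 0) \<in> ?R\<^sup>*" if "k < L" for k
    using down[of "L - 1 - k"] that by simp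
  have "(d, 0) \<in> ?R\<^sup>*"
    using assms(1) by (cases rule: dart_cases) (use fro odd in \<open>blast intro: rtrancl_trans\<close>)+
  moreover have "(0, e) \<in> ?R\<^sup>*"
    using assms(2) by (cases rule: dart_cases) (use up upodd in auto)
  ultimately show ?thesis by (rule rtrancl_trans)
qed

lemma closed_surf: "closed_surface surf"
  unfolding closed_surface_def surf_def
  using turn_permutes flip_permutes flip_ne flip_flip connected_darts L
  by (auto simp: lessThan_empty_iff)

lemma route_nth: "k < L \<Longrightarrow> route ! k = 2 * k" "length route = L"
  by (auto simp: route_def)

lemma incoming_route: "k < L \<Longrightarrow> incoming surf route k = 2 * k + 1"
proof -
  assume k: "k < L"
  have "(k + L - 1) mod L < L" using L by simp
  then have "incoming surf route k = flip (2 * ((k + L - 1) mod L))"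
    by (simp add: incoming_def route_nth surf_def)
  also have "\<dots> = 2 * (Suc ((k + L - 1) mod L) mod L) + 1" using L by (simp add: flip_simps)
  also have "Suc ((k + L - 1) mod L) mod L = k" using k L by (simp add: mod_Suc_eq)
  finally show ?thesis .
qed

lemma vertex_surf_eq:
  assumes "k < L" "l < L"
  shows "vertex surf (2 * k) = vertex surf (2 * l) \<longleftrightarrow> l = k \<or> l = par k"
    and "vertex surf (2 * k + 1) = vertex surf (2 * k)"
proof -
  have self: "d \<in> orbit turn d" for d
    using turn_permutes by (intro permutation_self_in_orbit permutation_permutes[THEN iffD2]) blast
  have eqI: "orbit turn e = orbit turn d" if "e \<in> orbit turn d" for d e
    using that by (rule orbit_eq_of_mem[OF turn_permutes finite_lessThan])
  have inv: "e div 2 \<in> {a div 2, par (a div 2)} \<and> e < 2 * L" if "e \<in> orbit turn a" "a < 2 * L" for a e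
    using that
  proof (induction rule: orbit.induct)
    case base
    then show ?case using turn_less[of a] by simp
  next
    case (step e)
    then have e: "e < 2 * L" "e div 2 = a div 2 \<or> e div 2 = par (a div 2)" by auto
    have "a div 2 < L" using step by simp
    then show ?case using e par(2)[of "a div 2"] turn_less[OF e(1)] by auto
  qed
  show odd: "vertex surf (2 * k + 1) = vertex surf (2 * k)"
  proof (cases "k = 0")
    case True
    have "turn 0 \<in> orbit turn 0" by (rule orbit.base)
    then show ?thesis using True turn_0 eqI by (simp add: vertex_def surf_def)
  next
    case False
    have "turn (turn (2 * k)) \<in> orbit turn (2 * k)" by (intro orbit.intros)
    then show ?thesis using turn_turn[of k] False assms eqI by (simp add: vertex_def surf_def)
  qed
  have parv: "vertex surf (2 * par k) = vertex surf (2 * k)"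
  proof (cases "pos k")
    case True
    have "turn (2 * k) \<in> orbit turn (2 * k)" by (rule orbit.base)
    then show ?thesis using True turn_simps(1)[OF assms(1)] eqI by (simp add: vertex_def surf_def)
  next
    case False
    have "turn (2 * k + 1) \<in> orbit turn (2 * k + 1)" by (rule orbit.base)
    then have "vertex surf (2 * par k) = vertex surf (2 * k + 1)"
      using False turn_simps(4)[OF assms(1)] eqI by (simp add: vertex_def surf_def)
    then show ?thesis using odd by simp
  qed
  show "vertex surf (2 * k) = vertex surf (2 * l) \<longleftrightarrow> l = k \<or> l = par k"
  proof
    assume "vertex surf (2 * k) = vertex surf (2 * l)"
    then have "2 * l \<in> orbit turn (2 * k)" using self by (simp add: vertex_def surf_def)
    from inv[OF this] show "l = k \<or> l = par k" using assms by auto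
  next
    assume "l = k \<or> l = par k"
    then show "vertex surf (2 * k) = vertex surf (2 * l)" using parv by auto
  qed
qed

lemma left_darts_route:
  assumes "0 < k" "k < L"
  shows "left_darts surf route k = {if pos k then 2 * par k else 2 * par k + 1}"
proof -
  have *: "sector surf d (turn (turn d)) = {turn d}" if "turn d \<noteq> turn (turn d)" for d
  proof -
    have "k = Suc 0" if "0 < k" "\<forall>l\<in>{Suc 0..k}. (turn ^^ l) d \<noteq> turn (turn d)" for k
    proof (rule ccontr)
      assume "k \<noteq> Suc 0"
      then have "(turn ^^ 2) d \<noteq> turn (turn d)" using that by (intro that(2)[rule_format]) auto
      then show False by (simp add: numeral_2_eq_2)
    qed
    then have "0 < k \<and> (\<forall>l\<in>{1..k}. (turn ^^ l) d \<noteq> turn (turn d)) \<longleftrightarrow> k = Suc 0" for k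
      using that by auto
    then show ?thesis by (simp add: sector_def surf_def)
  qed
  have t: "turn (2 * k) = (if pos k then 2 * par k else 2 * par k + 1)"
    using turn_simps[OF assms(2)] by simp
  have "turn (2 * k) \<noteq> 2 * k + 1" unfolding t using par(3)[OF assms] by auto
  then show ?thesis using *[of "2 * k"] turn_turn[OF assms] t assms
    by (simp add: left_darts_def route_nth incoming_route)
qed

lemma crossings_route:
  "curve_crossings surf (Surface_Curve route ov) = {(i, j). i < j \<and> j < L \<and> j = par i}"
proof -
  have "vertex surf (2 * i) = vertex surf (2 * j) \<longleftrightarrow> j = par i" if "i < j" "j < L" for i j
    using vertex_surf_eq(1)[of i j] that by simp
  then have "i < j \<and> j < L \<and> vertex surf (2 * i) = vertex surf (2 * j) \<longleftrightarrow> i < j \<and> j < L \<and> j = par i" for i j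
    by blast
  then show ?thesis by (simp add: curve_crossings_def route_nth cong: conj_cong)
qed

lemma surface_diagram_route:
  assumes "\<And>k. 0 < k \<Longrightarrow> k < L \<Longrightarrow> (k \<in> ov) \<noteq> (par k \<in> ov)"
  shows "surface_diagram surf (Surface_Curve route ov)"
proof -
  have "closed_walk surf route"
    unfolding closed_walk_def
  proof (intro conjI allI impI)
    show "route \<noteq> []" using L by (simp add: route_def)
    show "set route \<subseteq> darts surf" by (auto simp: route_def surf_def)
    fix i assume "i < length route"
    then have i: "i < L" by (simp add: route_nth)
    then have "opp surf (route ! i) = 2 * (Suc i mod L) + 1" by (simp add: route_nth surf_def flip_simps)
    then show "vertex surf (opp surf (route ! i)) = vertex surf (route ! (Suc i mod length route))"
      using vertex_surf_eq(2)[of "Suc i mod L"] L by (simp add: route_nth)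
  qed
  moreover have "0 < i \<and> (\<forall>k<L. vertex surf (route ! k) = vertex surf (route ! i) \<longrightarrow> k \<in> {i, j}) \<and>
        distinct [route ! i, incoming surf route i, route ! j, incoming surf route j] \<and>
        (route ! j \<in> left_darts surf route i) \<noteq> (incoming surf route j \<in> left_darts surf route i) \<and>
        (i \<in> ov) \<noteq> (j \<in> ov)" if ij: "i < j" "j < L" "j = par i" for i j
  proof -
    have i: "0 < i" "i < L" using ij par0 by (auto intro: ccontr)
    have "k \<in> {i, j}" if "k < L" "vertex surf (route ! k) = vertex surf (route ! i)" for k
      using vertex_surf_eq(1)[of i k] that i ij by (auto simp: route_nth)
    moreover have "distinct [2 * i, 2 * i + 1, 2 * j, 2 * j + 1]"
      using ij(1) by simp
    ultimately show ?thesis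
      using i ij assms[OF i] left_darts_route[OF i] by (auto simp: route_nth incoming_route)
  qed
  ultimately show ?thesis
    unfolding surface_diagram_def using closed_surf incoming_route
    by (auto simp: crossings_route route_nth)
qed

lemma surf_sign_route:
  assumes "i < j" "j < L" "j = par i"
  shows "surf_sign surf (Surface_Curve route ov) (i, j) =
    (if i \<in> ov then 1 else - 1) * (if pos i then 1 else - 1)"
proof -
  have i: "0 < i" "i < L" using assms par0 by (auto intro: ccontr)
  show ?thesis using left_darts_route[OF i] assms by (simp add: surf_sign_def route_nth)
qed

end

lemma rank_bij:
  fixes T :: "'a::linorder set"
  assumes "finite T"
  defines "r \<equiv> \<lambda>t. card {u \<in> T. u \<le> t}"
  shows "strict_mono_on T r" "bij_betw r T {1..card T}"
proof -
  show m: "strict_mono_on T r"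
  proof (rule strict_mono_onI)
    fix s t assume st: "s \<in> T" "t \<in> T" "s < t"
    have "{u \<in> T. u \<le> s} \<subset> {u \<in> T. u \<le> t}" using st by (auto simp: psubset_eq set_eq_iff intro!: exI[of _ t])
    then show "r s < r t" unfolding r_def using assms by (intro psubset_card_mono) auto
  qed
  then have inj: "inj_on r T" by (rule strict_mono_on_imp_inj_on)
  have "r ` T \<subseteq> {1..card T}"
  proof (intro image_subsetI)
    fix t assume "t \<in> T"
    then have "{u \<in> T. u \<le> t} \<noteq> {}" by auto
    then show "r t \<in> {1..card T}"
      unfolding r_def using assms by (auto intro!: card_mono simp: Suc_le_eq card_gt_0_iff)
  qed
  then have "r ` T = {1..card T}" using inj by (intro card_subset_eq) (auto simp: card_image)
  then show "bij_betw r T {1..card T}" using inj by (simp add: bij_betw_def)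
qed

text \<open>Times are the ranks of the parameters of real crossings, and \<open>pos\<close> is read
  off the sign of the determinant of velocities. Virtual crossings are dropped.\<close>

theorem realization_exists:
  assumes D: "is_long_diagram D"
  shows "\<exists>S C. realizes S C D"
proof -
  let ?X = "real_crossings D"
  define T where "T = fst ` ?X \<union> snd ` ?X"
  define mate where "mate s = (THE t. double D s t)" for s
  have mate: "mate s = t" if "double D s t" for s t
    unfolding mate_def using that long_diagramD(3)[OF D] by blast
  have T: "finite T" using finite_real_crossings[OF D] by (simp add: T_def)
  define r where "r = (\<lambda>t. card {u \<in> T. u \<le> t})"
  have mono: "strict_mono_on T r" and bij: "bij_betw r T {1..card T}"
    unfolding r_def using rank_bij[OF T] by auto
  define q where "q = inv_into T r"
  have qr: "q (r t) = t" if "t \<in> T" for t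
    using bij that by (simp add: q_def bij_betw_def)
  have rq: "r (q k) = k" "q k \<in> T" if "k \<in> {1..card T}" for k
    using bij that unfolding q_def bij_betw_def by (metis f_inv_into_f inv_into_into)+
  have rT: "r t \<in> {1..card T}" if "t \<in> T" for t using bij that by (auto simp: bij_betw_def)
  have dT: "double D t (mate t) \<and> mate t \<in> T \<and> mate (mate t) = t \<and> passage D t \<noteq> Virtual" if t: "t \<in> T" for t
  proof -
    obtain s u where su: "(s, u) \<in> ?X" "t = s \<or> t = u" using t by (force simp: T_def)
    then have d: "double D s u" "double D u s" "s < u" "passage D s \<noteq> Virtual"
      by (auto simp: real_crossings_def double_sym)
    have "passage D u \<noteq> Virtual"
      by (rule passage_cases[OF D d(1)]) (use d in auto)
    moreover have "s \<in> T" "u \<in> T" using su by (force simp: T_def)+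
    ultimately show ?thesis using su(2) d mate[OF d(1)] mate[OF d(2)] by auto
  qed
  have X: "(s, t) \<in> ?X \<longleftrightarrow> s < t \<and> s \<in> T \<and> t = mate s" for s t
  proof
    assume st: "(s, t) \<in> ?X"
    then have "s \<in> T" by (force simp: T_def)
    then show "s < t \<and> s \<in> T \<and> t = mate s" using st mate[of s t] by (auto simp: real_crossings_def)
  next
    assume "s < t \<and> s \<in> T \<and> t = mate s"
    then show "(s, t) \<in> ?X" using dT[of s] by (auto simp: real_crossings_def)
  qed
  define par where "par k = (if k \<in> {1..card T} then r (mate (q k)) else k)" for k
  define pos where "pos k \<longleftrightarrow> k \<in> {1..card T} \<and> 0 < vel_det D (q k) (mate (q k))" for k
  have park: "par k \<in> {1..card T} \<and> q (par k) = mate (q k) \<and> par (par k) = k \<and> par k \<noteq> k" if k: "k \<in> {1..card T}" for k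
  proof -
    note d = dT[OF rq(2)[OF k]]
    have p: "par k = r (mate (q k))" using k by (simp add: par_def)
    have *: "par k \<in> {1..card T}" "q (par k) = mate (q k)" using d rT qr by (auto simp: p)
    moreover have "par (par k) = k"
      using *(1) d rq[OF k] by (subst par_def) (simp add: *(2))
    moreover have "par k \<noteq> k"
    proof
      assume "par k = k"
      then have "mate (q k) = q k" using *(2) by simp
      then show False using d by (simp add: double_def)
    qed
    ultimately show ?thesis by simp
  qed
  \<comment> \<open>One time more than there are crossing parameters: the ranks start at 1 and leave
    time 0 to the basepoint, which also handles a diagram without real crossings.\<close>
  interpret paired_times "Suc (card T)" par pos
  proof unfold_locales
    show "par 0 = 0" "\<not> pos 0" by (auto simp: par_def pos_def)
    fix k
    show "k < Suc (card T) \<Longrightarrow> par k < Suc (card T)"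
      using park[of k] by (cases "k = 0") (auto simp: par_def)
    show "k < Suc (card T) \<Longrightarrow> par (par k) = k"
      using park[of k] by (cases "k = 0") (auto simp: par_def)
    show "0 < k \<Longrightarrow> k < Suc (card T) \<Longrightarrow> par k \<noteq> k" using park[of k] by auto
    assume "0 < k" "k < Suc (card T)"
    then have k: "k \<in> {1..card T}" by simp
    have "vel_det D (q k) (mate (q k)) \<noteq> 0"
      using dT[OF rq(2)[OF k]] long_diagramD(5)[OF D] by blast
    then show "pos (par k) \<longleftrightarrow> \<not> pos k"
      using park[OF k] k dT[OF rq(2)[OF k]] vel_det_swap[of D "mate (q k)" "q k"] by (auto simp: pos_def)
  qed simp
  define ov where "ov = r ` {t \<in> T. passage D t = Over}"
  have ov: "r t \<in> ov \<longleftrightarrow> passage D t = Over" if "t \<in> T" for t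
    using that qr by (auto simp: ov_def) (metis qr)
  have sd: "surface_diagram surf (Surface_Curve route ov)"
  proof (rule surface_diagram_route)
    fix k assume "0 < k" "k < Suc (card T)"
    then have k: "k \<in> {1..card T}" by simp
    note d = dT[OF rq(2)[OF k]]
    have "k \<in> ov \<longleftrightarrow> passage D (q k) = Over" using ov[OF rq(2)[OF k]] rq(1)[OF k] by simp
    moreover have "par k \<in> ov \<longleftrightarrow> passage D (mate (q k)) = Over"
      using ov[of "mate (q k)"] d k by (simp add: par_def)
    moreover have "(passage D (q k) = Over) \<noteq> (passage D (mate (q k)) = Over)"
      by (rule passage_cases[OF D conjunct1[OF d]]) (use d in auto)
    ultimately show "(k \<in> ov) \<noteq> (par k \<in> ov)" by simp
  qed
  have lt: "r s < r t \<longleftrightarrow> s < t" if "s \<in> T" "t \<in> T" for s t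
    using mono that by (simp add: strict_mono_on_less)
  have "map_prod r r ` ?X = {(i, j). i < j \<and> j < Suc (card T) \<and> j = par i}"
  proof (intro set_eqI iffI)
    fix c assume "c \<in> map_prod r r ` ?X"
    then obtain s t where st: "(s, t) \<in> ?X" "c = (r s, r t)" by auto
    then have "s \<in> T" "t \<in> T" "s < t" "t = mate s" using X dT by auto
    then show "c \<in> {(i, j). i < j \<and> j < Suc (card T) \<and> j = par i}"
      using st lt rT[of s] rT[of t] qr[of s] by (auto simp: par_def)
  next
    fix c assume "c \<in> {(i, j). i < j \<and> j < Suc (card T) \<and> j = par i}"
    then obtain i where c: "c = (i, par i)" "i < par i" "par i < Suc (card T)" by auto
    then have i: "i \<in> {1..card T}" by (cases "i = 0") (auto simp: par_def)
    have p: "par i = r (mate (q i))" using i by (simp add: par_def)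
    have "q i < mate (q i)"
      using c(2) p lt[OF rq(2)[OF i], of "mate (q i)"] dT[OF rq(2)[OF i]] rq(1)[OF i] by simp
    then have "(q i, mate (q i)) \<in> ?X" using X rq(2)[OF i] by simp
    then have "map_prod r r (q i, mate (q i)) \<in> map_prod r r ` ?X" by (rule imageI)
    then show "c \<in> map_prod r r ` ?X" using c p rq(1)[OF i] by simp
  qed
  moreover have "(passage D s = Over \<longleftrightarrow> r s \<in> ov) \<and>
     crossing_sign D (s, t) = surf_sign surf (Surface_Curve route ov) (r s, r t)"
    if "(s, t) \<in> ?X" for s t
  proof -
    have st: "s \<in> T" "t \<in> T" "s < t" "t = mate s" using that X dT by auto
    have "surf_sign surf (Surface_Curve route ov) (r s, r t) =
      (if r s \<in> ov then 1 else - 1) * (if pos (r s) then 1 else - 1)"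
      using st lt[of s t] rT qr by (intro surf_sign_route) (auto simp: par_def less_Suc_eq_le)
    moreover have "vel_det D s t \<noteq> 0" using st dT[of s] long_diagramD(5)[OF D] by blast
    ultimately show ?thesis
      using st ov[of s] qr[of s] rT[of s] vel_det_swap[of D t s]
      by (auto simp: crossing_sign_def sign_of_def pos_def)
  qed
  moreover have "strict_mono_on (fst ` ?X \<union> snd ` ?X) r" using mono by (simp add: T_def)
  ultimately have "realizes surf (Surface_Curve route ov) D"
    unfolding realizes_def crossings_route using sd
    by (intro conjI exI[of _ r]) auto
  then show ?thesis by blast
qed

section \<open>Planar diagrams with prescribed crossings\<close>

text \<open>The line through the points of the parabola with abscissas \<open>a\<close> and
  \<open>b\<close>. Its slope is \<open>a + b\<close>, which turns comparisons of directions into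
  comparisons of sums.\<close>

definition on_chord :: "real \<Rightarrow> real \<Rightarrow> real \<times> real \<Rightarrow> bool" where
  "on_chord a b z \<longleftrightarrow> snd z = (a + b) * fst z - a * b"

lemma on_chord_parabola: "on_chord a b (c, c\<^sup>2) \<longleftrightarrow> c = a \<or> c = b"
proof -
  have "on_chord a b (c, c\<^sup>2) \<longleftrightarrow> (c - a) * (c - b) = 0"
    by (auto simp: on_chord_def power2_eq_square algebra_simps)
  then show ?thesis by auto
qed

lemma on_chord_commute: "on_chord a b z \<longleftrightarrow> on_chord b a z"
  by (simp add: on_chord_def add.commute mult.commute)

text \<open>Parallel lines with a common point coincide, and a line has at most two points in common
  with the parabola.\<close>

lemma chord_sums_differ:
  assumes "on_chord a b z" "on_chord c d z" "c \<noteq> a" "c \<noteq> b"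
  shows "a + b \<noteq> c + d"
proof
  assume e: "a + b = c + d"
  have "a * b = c * d" using assms(1,2) e by (simp add: on_chord_def)
  have "(c - a) * (c - b) = c * c - (a + b) * c + a * b" by (simp add: algebra_simps)
  also have "\<dots> = 0" unfolding e \<open>a * b = c * d\<close> by (simp add: algebra_simps)
  finally have "(c - a) * (c - b) = 0" .
  then show False using assms by auto
qed

lemma on_two_chords_unique:
  assumes "on_chord a b z" "on_chord c d z" "on_chord a b y" "on_chord c d y" "c \<noteq> a" "c \<noteq> b"
  shows "y = z"
proof -
  have "(a + b - (c + d)) * (fst y - fst z) = 0"
    using assms(1-4) unfolding on_chord_def by (simp add: algebra_simps)
  then have "fst y = fst z" using chord_sums_differ[OF assms(1,2,5,6)] by auto
  then show ?thesis using assms(1,3) by (auto simp: on_chord_def prod_eq_iff)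
qed

definition concurrent :: "real \<Rightarrow> real \<Rightarrow> real \<Rightarrow> real \<Rightarrow> real \<Rightarrow> real \<Rightarrow> bool" where
  "concurrent a b c d e f \<longleftrightarrow> (\<exists>z. on_chord a b z \<and> on_chord c d z \<and> on_chord e f z)"

text \<open>The first two chords determine the point, and the line from there through the parabola
  point of \<open>e\<close> meets the parabola only once more. Therefore a new abscissa has to avoid
  only finitely many values.\<close>

lemma concurrent_unique:
  assumes "concurrent a b c d e f" "concurrent a b c d e f'" "distinct [a, b, c, d, e]"
  shows "f = f'"
proof -
  obtain z where z: "on_chord a b z" "on_chord c d z" "on_chord e f z"
    using assms(1) by (auto simp: concurrent_def)
  obtain y where y: "on_chord a b y" "on_chord c d y" "on_chord e f' y"
    using assms(2) by (auto simp: concurrent_def)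
  have "y = z" using on_two_chords_unique[OF z(1,2) y(1,2)] assms(3) by auto
  then have eq: "f * (fst z - e) = f' * (fst z - e)"
    using z(3) y(3) by (simp add: on_chord_def algebra_simps)
  have "fst z \<noteq> e"
  proof
    assume e: "fst z = e"
    then have "z = (e, e\<^sup>2)" using z(3) by (simp add: on_chord_def prod_eq_iff power2_eq_square algebra_simps)
    then show False using z(1) assms(3) by (auto simp: on_chord_parabola)
  qed
  then show ?thesis using eq by simp
qed

definition generic :: "real set \<Rightarrow> bool" where
  "generic A \<longleftrightarrow> (\<forall>a\<in>A. \<forall>b\<in>A. \<forall>c\<in>A. \<forall>d\<in>A. \<forall>e\<in>A. \<forall>f\<in>A.
     distinct [a, b, c, d, e, f] \<longrightarrow> \<not> concurrent a b c d e f)"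

lemma concurrent_commute: "concurrent a b c d e f \<Longrightarrow> concurrent b a c d e f"
  "concurrent a b c d e f \<Longrightarrow> concurrent c d a b e f"
  "concurrent a b c d e f \<Longrightarrow> concurrent e f c d a b"
  "concurrent a b c d e f \<Longrightarrow> concurrent a b c d f e"
  unfolding concurrent_def using on_chord_commute by metis+

lemma generic_insert:
  assumes A: "finite A" "generic A" and I: "infinite I"
  shows "\<exists>x\<in>I. x \<notin> A \<and> generic (insert x A)"
proof -
  define bad where "bad = (\<Union>(a, b, c, d, e)\<in>{(a, b, c, d, e). {a, b, c, d, e} \<subseteq> A \<and> distinct [a, b, c, d, e]}.
      {f. concurrent a b c d e f})"
  have "{(a, b, c, d, e). {a, b, c, d, e} \<subseteq> A \<and> distinct [a, b, c, d, e]} \<subseteq> A \<times> A \<times> A \<times> A \<times> A"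
    by auto
  then have "finite {(a, b, c, d, e). {a, b, c, d, e} \<subseteq> A \<and> distinct [a, b, c, d, e]}"
    by (rule finite_subset) (use A(1) in simp)
  moreover have "finite {f. concurrent a b c d e f}" if "distinct [a, b, c, d, e]" for a b c d e
  proof (cases "\<exists>f. concurrent a b c d e f")
    case True
    then obtain f where "concurrent a b c d e f" by blast
    then have "{f. concurrent a b c d e f} \<subseteq> {f}" using concurrent_unique that by blast
    then show ?thesis using finite_subset by blast
  qed simp
  ultimately have "finite bad" unfolding bad_def by (intro finite_UN_I) auto
  then have "infinite (I - (bad \<union> A))" using I A(1) by simp
  then obtain x where x: "x \<in> I" "x \<notin> bad" "x \<notin> A" by (metis Diff_iff UnCI finite.emptyI ex_in_conv)
  have new: "\<not> concurrent a b c d e x" if "{a, b, c, d, e} \<subseteq> A" "distinct [a, b, c, d, e]" for a b c d e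
  proof
    assume "concurrent a b c d e x"
    then have "x \<in> bad" unfolding bad_def
      by (intro UN_I[of "(a, b, c, d, e)"]) (use that in auto)
    then show False using x(2) by simp
  qed
  have "generic (insert x A)"
    unfolding generic_def
  proof (intro ballI impI notI)
    fix a b c d e f
    assume m: "a \<in> insert x A" "b \<in> insert x A" "c \<in> insert x A" "d \<in> insert x A" "e \<in> insert x A" "f \<in> insert x A"
      and dist: "distinct [a, b, c, d, e, f]" and conc: "concurrent a b c d e f"
    \<comment> \<open>At most one of the six is the new point; the symmetries of concurrency move it
      to the last place, where \<open>new\<close> applies.\<close>
    consider "x \<notin> {a, b, c, d, e, f}" | "f = x" | "e = x" | "c = x" | "d = x" | "a = x" | "b = x" by blast
    then show False
    proof cases
      case 1
      then show ?thesis using A(2) m dist conc unfolding generic_def by blast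
    next
      case 2
      then show ?thesis using new[of a b c d e] m dist conc by auto
    next
      case 3
      then show ?thesis using new[of a b c d f] m dist concurrent_commute(4)[OF conc] by auto
    next
      case 4
      then show ?thesis
        using new[of a b e f d] m dist
          concurrent_commute(4)[OF concurrent_commute(2)[OF concurrent_commute(3)[OF concurrent_commute(2)[OF conc]]]]
        by auto
    next
      case 5
      then show ?thesis
        using new[of a b e f c] m dist
          concurrent_commute(2)[OF concurrent_commute(3)[OF concurrent_commute(2)[OF conc]]]
        by auto
    next
      case 6
      then show ?thesis
        using new[of e f c d b] m dist concurrent_commute(3)[OF concurrent_commute(1)[OF conc]]
        by auto
    next
      case 7
      then show ?thesis using new[of e f c d a] m dist concurrent_commute(3)[OF conc] by auto
    qed
  qed
  then show ?thesis using x by blast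
qed

text \<open>Points are added one after the other to the right of the previous ones. The bound 1
  leaves an interval with infinitely many candidates at each step.\<close>

lemma generic_sequence:
  "\<exists>x :: nat \<Rightarrow> real. x 0 = 0 \<and> (\<forall>i j. i < j \<longrightarrow> j \<le> n \<longrightarrow> x i < x j) \<and> (\<forall>i\<le>n. x i < 1) \<and> generic (x ` {..n})"
proof (induction n)
  case 0
  show ?case by (rule exI[of _ "\<lambda>_. 0"]) (auto simp: generic_def)
next
  case (Suc n)
  then obtain x where x: "x 0 = (0::real)" "\<And>i j. i < j \<Longrightarrow> j \<le> n \<Longrightarrow> x i < x j" "\<And>i. i \<le> n \<Longrightarrow> x i < 1"
    "generic (x ` {..n})" by blast
  obtain y where y: "y \<in> {x n<..<1}" "y \<notin> x ` {..n}" "generic (insert y (x ` {..n}))"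
    using generic_insert[OF _ x(4), of "{x n<..<1}"] x(3)[of n] by (auto simp: infinite_Ioo)
  have "(x(Suc n := y)) ` {..Suc n} = insert y (x ` {..n})" by (auto simp: atMost_Suc)
  moreover have "(x(Suc n := y)) i < (x(Suc n := y)) j" if "i < j" "j \<le> Suc n" for i j
  proof (cases "j = Suc n")
    case True
    then have "x i \<le> x n" using that x(2)[of i n] by (cases "i = n") auto
    then show ?thesis using True that y(1) by auto
  qed (use x(2) that in auto)
  ultimately show ?case using x(1,3) y
    by (intro exI[of _ "x(Suc n := y)"]) (auto simp: le_Suc_eq)
qed

lemma chords_cross:
  fixes a b c d :: real
  assumes "a < c" "c < b" "b < d"
  obtains u v where "0 < u" "u < 1" "0 < v" "v < 1"
    "a + u * (b - a) = c + v * (d - c)" "a\<^sup>2 + u * (b\<^sup>2 - a\<^sup>2) = c\<^sup>2 + v * (d\<^sup>2 - c\<^sup>2)"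
proof -
  \<comment> \<open>Difference of the slopes of the two chords; \<open>u\<close> and
    \<open>v\<close> solve the linear system for the point of intersection.\<close>
  define D where "D = c + d - a - b"
  have D: "0 < D" using assms by (simp add: D_def)
  define u where "u = (c - a) * (d - a) / (D * (b - a))"
  define v where "v = (c - a) * (b - c) / (D * (d - c))"
  have uX: "u * (b - a) = (c - a) * (d - a) / D" and vX: "v * (d - c) = (c - a) * (b - c) / D"
    using assms D by (auto simp: u_def v_def)
  have 1: "a + u * (b - a) = c + v * (d - c)"
  proof -
    have "(c - a) * (d - a) = (c - a) * D + (c - a) * (b - c)" by (simp add: D_def algebra_simps)
    then have "(c - a) * (d - a) / D = (c - a) + (c - a) * (b - c) / D"
      using D by (simp add: add_divide_distrib)
    then show ?thesis unfolding uX vX by simp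
  qed
  have 2: "a\<^sup>2 + u * (b\<^sup>2 - a\<^sup>2) = c\<^sup>2 + v * (d\<^sup>2 - c\<^sup>2)"
  proof -
    define U where "U = u * (b - a)"
    have "U * D = (c - a) * (d - a)" using D by (simp add: U_def uX)
    then have "a\<^sup>2 + U * (a + b) = c\<^sup>2 + (a - c + U) * (c + d)"
      unfolding D_def by (simp add: power2_eq_square algebra_simps)
    moreover have "v * (d - c) = a - c + U" using 1 by (simp add: U_def)
    moreover have "u * (b\<^sup>2 - a\<^sup>2) = U * (a + b)" "v * (d\<^sup>2 - c\<^sup>2) = v * (d - c) * (c + d)"
      by (simp_all add: U_def power2_eq_square algebra_simps)
    ultimately show ?thesis by simp
  qed
  have "0 < u" "0 < v" unfolding u_def v_def using assms D by (auto intro!: divide_pos_pos mult_pos_pos)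
  moreover have "u < 1"
  proof -
    have "0 < (b - c) * (d - b)" using assms by simp
    then have "(c - a) * (d - a) < D * (b - a)" by (simp add: D_def algebra_simps)
    then show ?thesis using assms D by (simp add: u_def)
  qed
  moreover have "v < 1"
  proof -
    have "0 < (d - b) * (d - a)" using assms by simp
    then have "(c - a) * (b - c) < D * (d - c)" by (simp add: D_def algebra_simps)
    then show ?thesis using assms D by (simp add: v_def)
  qed
  ultimately show thesis using 1 2 that by blast
qed

section \<open>Polygons inscribed in a parabola\<close>

text \<open>The vertices \<open>0, \<dots>, m\<close> of a polygon lie on the parabola with abscissas \<open>x\<close>, starting at
  the origin and ending at the rightmost one; the last edge returns to the real axis at \<open>m + 1\<close>.
  Vertices on a parabola are in general position except for concurrent chords.\<close>

locale parabola_polygon =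
  fixes m :: nat and x :: "nat \<Rightarrow> real"
  assumes m: "0 < m" and inj: "inj_on x {..m}" and x0: "x 0 = 0"
    and x_pos: "\<And>i. 0 < i \<Longrightarrow> i \<le> m \<Longrightarrow> 0 < x i" and x_max: "\<And>i. i < m \<Longrightarrow> x i < x m" and x1: "x m < 1"
    and gen: "generic (x ` {..m})"
begin

text \<open>Beyond the polygon the corners are the integers on the axis, so that the same linear
  interpolation also produces the two unbounded ends.\<close>

definition corner :: "int \<Rightarrow> complex" where
  "corner k = (if 0 \<le> k \<and> k \<le> int m then Complex (x (nat k)) ((x (nat k))\<^sup>2) else of_int k)"

definition poly_curve :: "real \<Rightarrow> complex" where
  "poly_curve t = corner \<lfloor>t\<rfloor> + frac t *\<^sub>R (corner (\<lfloor>t\<rfloor> + 1) - corner \<lfloor>t\<rfloor>)"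

lemma poly_curve_edge:
  assumes "of_int k \<le> t" "t \<le> of_int k + 1"
  shows "poly_curve t = corner k + (t - of_int k) *\<^sub>R (corner (k + 1) - corner k)"
proof (cases "t = of_int k + 1")
  case True
  then have "\<lfloor>t\<rfloor> = k + 1" by simp
  then show ?thesis using True by (simp add: poly_curve_def frac_def)
next
  case False
  then have "\<lfloor>t\<rfloor> = k" using assms by (simp add: floor_unique)
  then show ?thesis by (simp add: poly_curve_def frac_def)
qed

lemma continuous_poly_curve: "continuous_on UNIV poly_curve"
proof -
  have edge: "continuous_on {of_int k..of_int k + 1} poly_curve" for k
    by (subst continuous_on_cong[OF refl poly_curve_edge]) (auto intro!: continuous_intros)
  have "isCont poly_curve t" for t
  proof -
    let ?k = "\<lfloor>t\<rfloor>"
    have "continuous_on ({of_int (?k - 1)..of_int (?k - 1) + 1} \<union> {of_int ?k..of_int ?k + 1}) poly_curve"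
      by (intro continuous_on_closed_Un edge) auto
    then have "continuous_on {of_int ?k - 1<..<of_int ?k + 1} poly_curve"
      by (rule continuous_on_subset) auto
    moreover have "t \<in> {of_int ?k - 1<..<of_int ?k + 1}" by (simp, linarith)
    ultimately show ?thesis by (simp add: continuous_on_eq_continuous_at)
  qed
  then show ?thesis by (simp add: continuous_on_eq_continuous_at)
qed

lemma corner_axis: "k \<le> 0 \<or> int m < k \<Longrightarrow> corner k = of_int k"
  by (auto simp: corner_def x0 complex_eq_iff)

lemma poly_curve_axis:
  assumes "t \<le> 0 \<or> real m + 1 \<le> t"
  shows "poly_curve t = of_real t"
proof (cases "t = 0")
  case True
  then show ?thesis using corner_axis[of 0] by (simp add: poly_curve_def)
next
  case False
  have "\<lfloor>t\<rfloor> < 0 \<or> int m < \<lfloor>t\<rfloor>"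
    using assms False by (auto simp: less_floor_iff floor_less_iff)
  then have "corner \<lfloor>t\<rfloor> = of_int \<lfloor>t\<rfloor>" "corner (\<lfloor>t\<rfloor> + 1) = of_int (\<lfloor>t\<rfloor> + 1)"
    by (intro corner_axis; linarith)+
  then show ?thesis
    by (simp add: poly_curve_def frac_def complex_eq_iff)
qed

definition edge :: "real \<Rightarrow> nat" where "edge t = nat \<lfloor>t\<rfloor>"

lemma Re_poly_curve:
  assumes "0 \<le> t" "t < real m"
  shows "poly_curve t = Complex (x (edge t) + frac t * (x (Suc (edge t)) - x (edge t)))
     ((x (edge t))\<^sup>2 + frac t * ((x (Suc (edge t)))\<^sup>2 - (x (edge t))\<^sup>2))" "edge t < m"
proof -
  have f: "0 \<le> \<lfloor>t\<rfloor>" "\<lfloor>t\<rfloor> < int m" using assms by (auto simp: floor_less_iff)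
  then show "edge t < m" using m by (simp add: edge_def nat_less_iff)
  have "nat (\<lfloor>t\<rfloor> + 1) = Suc (edge t)" using f(1) by (simp only: edge_def nat_add_distrib)
  then show "poly_curve t = Complex (x (edge t) + frac t * (x (Suc (edge t)) - x (edge t)))
     ((x (edge t))\<^sup>2 + frac t * ((x (Suc (edge t)))\<^sup>2 - (x (edge t))\<^sup>2))"
    using f by (auto simp: poly_curve_def corner_def edge_def complex_eq_iff)
qed

lemma x_inj: "i \<le> m \<Longrightarrow> j \<le> m \<Longrightarrow> x i = x j \<longleftrightarrow> i = j"
  using inj by (auto simp: inj_on_def)

lemma x_nonneg: "i \<le> m \<Longrightarrow> 0 \<le> x i"
  using x_pos[of i] x0 by (cases "i = 0") auto

lemma convex_combination_bounds:
  fixes a b c f :: real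
  assumes "0 \<le> f" "f < 1"
  shows "a < c \<Longrightarrow> b \<le> c \<Longrightarrow> a + f * (b - a) < c" "c \<le> a \<Longrightarrow> c \<le> b \<Longrightarrow> c \<le> a + f * (b - a)"
proof -
  have e: "a + f * (b - a) = (1 - f) * a + f * b" by (simp add: algebra_simps)
  show "a + f * (b - a) < c" if "a < c" "b \<le> c"
  proof -
    have "(1 - f) * a < (1 - f) * c" "f * b \<le> f * c"
      using that assms by (auto intro!: mult_strict_left_mono mult_left_mono)
    then show ?thesis unfolding e by (simp add: algebra_simps)
  qed
  show "c \<le> a + f * (b - a)" if "c \<le> a" "c \<le> b"
  proof -
    have "(1 - f) * c \<le> (1 - f) * a" "f * c \<le> f * b"
      using that assms by (auto intro!: mult_left_mono)
    then show ?thesis unfolding e by (simp add: algebra_simps)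
  qed
qed

lemma Re_body:
  assumes "0 \<le> t" "t < real m"
  shows "0 \<le> Re (poly_curve t)" "Re (poly_curve t) < x m"
proof -
  note r = Re_poly_curve[OF assms]
  have f: "0 \<le> frac t" "frac t < 1" by (simp_all add: frac_lt_1)
  show "0 \<le> Re (poly_curve t)" unfolding r(1)
    using r(2) x_nonneg by (auto intro!: convex_combination_bounds(2)[OF f])
  have "x (Suc (edge t)) \<le> x m" using r(2) x_max[of "Suc (edge t)"] by (cases "Suc (edge t) = m") auto
  then show "Re (poly_curve t) < x m" unfolding r(1)
    using x_max[OF r(2)] by (auto intro!: convex_combination_bounds(1)[OF f])
qed

lemma Re_tail:
  assumes "real m \<le> t"
  shows "x m \<le> Re (poly_curve t)" "t < t' \<Longrightarrow> Re (poly_curve t) < Re (poly_curve t')"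
proof -
  have last: "Re (poly_curve u) = x m + (u - real m) * (real m + 1 - x m)" if "real m \<le> u" "u \<le> real m + 1" for u
    using arg_cong[OF poly_curve_edge[of "int m" u], of Re] that corner_axis[of "int m + 1"]
    by (simp add: corner_def)
  have axis: "Re (poly_curve u) = u" if "real m + 1 \<le> u" for u
    using poly_curve_axis[of u] that by simp
  have pos: "0 < real m + 1 - x m" using x1 by linarith
  show "x m \<le> Re (poly_curve t)"
    using last[of t] axis[of t] assms pos by (cases "t \<le> real m + 1") auto
  show "Re (poly_curve t) < Re (poly_curve t')" if "t < t'"
  proof -
    consider "t' \<le> real m + 1" | "t \<le> real m + 1" "real m + 1 < t'" | "real m + 1 < t" by linarith
    then show ?thesis
    proof cases
      case 1
      then show ?thesis using last[of t] last[of t'] assms that pos by (simp add: mult_strict_right_mono)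
    next
      case 2
      have "(t - real m) * (real m + 1 - x m) \<le> 1 * (real m + 1 - x m)"
        using 2 pos by (intro mult_right_mono) auto
      then show ?thesis using last[of t] axis[of t'] assms 2 by simp
    next
      case 3
      then show ?thesis using axis[of t] axis[of t'] that by simp
    qed
  qed
qed

text \<open>Real parts separate the three portions of the curve: they are negative on the left end,
  lie in \<open>[0, x m)\<close> on the body and increase strictly from \<open>x m\<close>
  on.\<close>

lemma double_in_body:
  assumes "poly_curve s = poly_curve t" "s < t"
  shows "0 \<le> s" "t < real m"
proof -
  have Re_nonneg: "0 \<le> Re (poly_curve u)" if "0 \<le> u" for u
    using Re_body(1)[of u] Re_tail(1)[of u] that x_nonneg[of m] by (cases "u < real m") auto
  show s: "0 \<le> s"
  proof (rule ccontr)
    assume "\<not> 0 \<le> s"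
    then have "Re (poly_curve s) = s" using poly_curve_axis by simp
    moreover have "Re (poly_curve t) = t \<or> 0 \<le> Re (poly_curve t)"
      using Re_nonneg[of t] poly_curve_axis[of t] by (cases "0 \<le> t") auto
    ultimately show False using assms \<open>\<not> 0 \<le> s\<close> by auto
  qed
  show "t < real m"
  proof (rule ccontr)
    assume t: "\<not> t < real m"
    show False
    proof (cases "real m \<le> s")
      case True
      then show ?thesis using Re_tail(2)[of s t] assms by simp
    next
      case False
      then show ?thesis using Re_body(2)[of s] Re_tail(1)[of t] s t assms by simp
    qed
  qed
qed

lemma body_on_chord:
  assumes "0 \<le> t" "t < real m"
  shows "on_chord (x (edge t)) (x (Suc (edge t))) (Re (poly_curve t), Im (poly_curve t))"
  using Re_poly_curve(1)[OF assms] by (simp add: on_chord_def power2_eq_square algebra_simps)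

lemma frac_of_edge:
  assumes "0 \<le> t" shows "t = real (edge t) + frac t"
  using assms by (simp add: edge_def frac_def)

lemma body_on_parabola:
  assumes t: "0 \<le> t" "t < real m" and c: "poly_curve t = Complex c (c\<^sup>2)"
  shows "frac t = 0 \<and> c = x (edge t)"
proof -
  have "on_chord (x (edge t)) (x (Suc (edge t))) (c, c\<^sup>2)"
    using body_on_chord[OF t] c by simp
  then have cc: "c = x (edge t) \<or> c = x (Suc (edge t))" by (simp add: on_chord_parabola)
  have e: "edge t < m" using Re_poly_curve(2)[OF t] .
  have ne: "x (Suc (edge t)) - x (edge t) \<noteq> 0" using x_inj[of "Suc (edge t)" "edge t"] e by auto
  have re: "c = x (edge t) + frac t * (x (Suc (edge t)) - x (edge t))"
    using Re_poly_curve(1)[OF t] c by simp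
  show ?thesis
  proof (cases "c = x (edge t)")
    case True
    then show ?thesis using re ne by simp
  next
    case False
    then have "(1 - frac t) * (x (Suc (edge t)) - x (edge t)) = 0" using cc re by (simp add: algebra_simps)
    then show ?thesis using ne frac_lt_1[of t] by simp
  qed
qed

text \<open>Points of one edge are distinct, and adjacent edges lie on lines that meet only in the
  common vertex, which by the half-open parametrization belongs to the later edge alone. Vertices
  themselves are not double, as an edge meets the parabola only in its own vertices.\<close>

lemma double_edges:
  assumes eq: "poly_curve s = poly_curve t" and st: "s \<noteq> t"
  shows "0 \<le> s" "s < real m" "0 \<le> t" "t < real m"
    "distinct [edge s, Suc (edge s), edge t, Suc (edge t)]" "0 < frac s" "0 < frac t"
proof -
  show b: "0 \<le> s" "s < real m" "0 \<le> t" "t < real m"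
    using double_in_body[of s t] double_in_body[of t s] eq st by (cases "s < t"; auto)+
  note es = Re_poly_curve[OF b(1,2)] and et = Re_poly_curve[OF b(3,4)]
  have ne: "edge s \<noteq> edge t"
  proof
    assume e: "edge s = edge t"
    have "frac s * (x (Suc (edge s)) - x (edge s)) = frac t * (x (Suc (edge s)) - x (edge s))"
      using es(1) et(1) eq e by auto
    moreover have "x (Suc (edge s)) - x (edge s) \<noteq> 0" using x_inj[of "Suc (edge s)" "edge s"] es(2) by auto
    ultimately have "frac s = frac t" by simp
    then show False using frac_of_edge[OF b(1)] frac_of_edge[OF b(3)] e st by simp
  qed
  have adj: False if "edge u = Suc (edge v)" "poly_curve u = poly_curve v"
      "0 \<le> u" "u < real m" "0 \<le> v" "v < real m" for u v
  proof -
    note eu = Re_poly_curve(2)[OF that(3,4)] and ev = Re_poly_curve(2)[OF that(5,6)]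
    let ?a = "x (edge v)" and ?b = "x (Suc (edge v))" and ?c = "x (Suc (Suc (edge v)))"
    have o: "on_chord ?a ?b (Re (poly_curve v), Im (poly_curve v))"
      "on_chord ?b ?c (Re (poly_curve v), Im (poly_curve v))"
      using body_on_chord[OF that(5,6)] body_on_chord[OF that(3,4)] that(1,2) by auto
    have ob: "on_chord ?a ?b (?b, ?b\<^sup>2)" "on_chord ?b ?c (?b, ?b\<^sup>2)" by (simp_all add: on_chord_parabola)
    have "?c \<noteq> ?a" "?c \<noteq> ?b" using x_inj[of "Suc (Suc (edge v))" "edge v"]
        x_inj[of "Suc (Suc (edge v))" "Suc (edge v)"] eu that(1) by auto
    then have "(Re (poly_curve v), Im (poly_curve v)) = (?b, ?b\<^sup>2)"
      using on_two_chords_unique[OF ob(1) ob(2)[unfolded on_chord_commute[of ?b]] o(1) o(2)[unfolded on_chord_commute[of ?b]]]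
      by simp
    then have "poly_curve v = Complex ?b (?b\<^sup>2)" by (simp add: complex_eq_iff)
    then have "?b = x (edge v)" using body_on_parabola[OF that(5,6)] by blast
    then show False using x_inj[of "Suc (edge v)" "edge v"] ev by simp
  qed
  show d: "distinct [edge s, Suc (edge s), edge t, Suc (edge t)]"
    using ne adj[of s t] adj[of t s] eq b by auto
  have fr: "0 < frac u" if "poly_curve u = poly_curve v" "0 \<le> u" "u < real m" "0 \<le> v" "v < real m"
    "edge u \<noteq> edge v" "edge u \<noteq> Suc (edge v)" for u v
  proof (rule ccontr)
    assume "\<not> 0 < frac u"
    then have "frac u = 0" using frac_ge_0[of u] by linarith
    then have "poly_curve v = Complex (x (edge u)) ((x (edge u))\<^sup>2)" using Re_poly_curve(1)[OF that(2,3)] that(1) by simp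
    then have "x (edge u) = x (edge v)" using body_on_parabola[OF that(4,5)] by blast
    then show False using x_inj Re_poly_curve(2)[OF that(2,3)] Re_poly_curve(2)[OF that(4,5)] that(6)
      by (metis less_imp_le)
  qed
  show "0 < frac s" "0 < frac t" using fr[of s t] fr[of t s] d eq b by auto
qed

lemma double_determined:
  assumes eq: "poly_curve s = poly_curve t" "s \<noteq> t" "poly_curve s' = poly_curve t'" "s' \<noteq> t'"
    and e: "edge s = edge s'" "edge t = edge t'"
  shows "s = s'"
proof -
  note d = double_edges[OF eq(1,2)] and d' = double_edges[OF eq(3,4)]
  note es = Re_poly_curve[OF d(1,2)] and es' = Re_poly_curve[OF d'(1,2)] and et = Re_poly_curve(2)[OF d(3,4)]
  have "x (edge t) \<noteq> x (edge s)" "x (edge t) \<noteq> x (Suc (edge s))"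
    using x_inj d(5) es(2) et by (metis Suc_leI distinct_length_2_or_more less_imp_le)+
  then have "(Re (poly_curve s'), Im (poly_curve s')) = (Re (poly_curve s), Im (poly_curve s))"
    using on_two_chords_unique[of "x (edge s)" "x (Suc (edge s))" "(Re (poly_curve s), Im (poly_curve s))"
        "x (edge t)" "x (Suc (edge t))" "(Re (poly_curve s'), Im (poly_curve s'))"]
      body_on_chord[OF d(1,2)] body_on_chord[OF d(3,4)] body_on_chord[OF d'(1,2)] body_on_chord[OF d'(3,4)] eq e
    by simp
  then have "frac s * (x (Suc (edge s)) - x (edge s)) = frac s' * (x (Suc (edge s)) - x (edge s))"
    using es(1) es'(1) e by auto
  moreover have "x (Suc (edge s)) - x (edge s) \<noteq> 0" using x_inj[of "Suc (edge s)" "edge s"] es(2) by auto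
  ultimately have "frac s = frac s'" by simp
  then show ?thesis using frac_of_edge[OF d(1)] frac_of_edge[OF d'(1)] e by simp
qed

lemma finite_doubles: "finite {(s, t). s \<noteq> t \<and> poly_curve s = poly_curve t}"
proof (rule finite_imageD)
  show "finite (map_prod edge edge ` {(s, t). s \<noteq> t \<and> poly_curve s = poly_curve t})"
  proof (rule finite_subset)
    show "map_prod edge edge ` {(s, t). s \<noteq> t \<and> poly_curve s = poly_curve t} \<subseteq> {..<m} \<times> {..<m}"
      using double_edges(1-4) Re_poly_curve(2) by auto
  qed auto
  show "inj_on (map_prod edge edge) {(s, t). s \<noteq> t \<and> poly_curve s = poly_curve t}"
    using double_determined by (auto simp: inj_on_def; metis)
qed

text \<open>A triple point would give three edges without common vertices whose lines are
  concurrent, against the generic choice of the abscissas.\<close>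

lemma double_unique:
  assumes "poly_curve s = poly_curve t" "s \<noteq> t" "poly_curve s = poly_curve u" "s \<noteq> u"
  shows "t = u"
proof (rule ccontr)
  assume "t \<noteq> u"
  then have tu: "poly_curve t = poly_curve u" "t \<noteq> u" using assms by auto
  note a = double_edges[OF assms(1,2)] and b = double_edges[OF assms(3,4)] and c = double_edges[OF tu]
  note e = Re_poly_curve(2)[OF a(1,2)] Re_poly_curve(2)[OF a(3,4)] Re_poly_curve(2)[OF c(3,4)]
  let ?z = "(Re (poly_curve s), Im (poly_curve s))"
  have "concurrent (x (edge s)) (x (Suc (edge s))) (x (edge t)) (x (Suc (edge t))) (x (edge u)) (x (Suc (edge u)))"
    unfolding concurrent_def
    using body_on_chord[OF a(1,2)] body_on_chord[OF a(3,4)] body_on_chord[OF c(3,4)] assms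
    by (intro exI[of _ ?z]) auto
  moreover have "distinct [x (edge s), x (Suc (edge s)), x (edge t), x (Suc (edge t)), x (edge u), x (Suc (edge u))]"
  proof -
    have "distinct [edge s, Suc (edge s), edge t, Suc (edge t), edge u, Suc (edge u)]"
      using a(5) b(5) c(5) by auto
    moreover have "set [edge s, Suc (edge s), edge t, Suc (edge t), edge u, Suc (edge u)] \<subseteq> {..m}"
      using e by auto
    ultimately have "distinct (map x [edge s, Suc (edge s), edge t, Suc (edge t), edge u, Suc (edge u)])"
      unfolding distinct_map using inj by (meson inj_on_subset)
    then show ?thesis by simp
  qed
  ultimately show False using gen e unfolding generic_def by (auto simp: Suc_le_eq)
qed

definition velocity :: "nat \<Rightarrow> complex" where
  "velocity k = Complex (x (Suc k) - x k) ((x (Suc k))\<^sup>2 - (x k)\<^sup>2)"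

lemma poly_curve_derivative:
  assumes t: "0 \<le> t" "t < real m" "0 < frac t"
  shows "(poly_curve has_vector_derivative velocity (edge t)) (at t)"
proof -
  let ?k = "\<lfloor>t\<rfloor>"
  have f: "0 \<le> ?k" "?k < int m" using t by (auto simp: floor_less_iff)
  have "velocity (edge t) = corner (?k + 1) - corner ?k"
    using f by (simp add: velocity_def corner_def edge_def complex_eq_iff nat_add_distrib)
  moreover have "((\<lambda>u. corner ?k + (u - of_int ?k) *\<^sub>R (corner (?k + 1) - corner ?k)) has_vector_derivative
      corner (?k + 1) - corner ?k) (at t)"
    by (auto intro!: derivative_eq_intros)
  moreover have "t \<in> {of_int ?k<..<of_int ?k + 1}" using t(3) by (simp add: frac_def)
  moreover have "corner ?k + (u - of_int ?k) *\<^sub>R (corner (?k + 1) - corner ?k) = poly_curve u"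
    if "u \<in> {of_int ?k<..<of_int ?k + 1}" for u
    using poly_curve_edge[of ?k u] that by simp
  ultimately show ?thesis
    by (metis (no_types, lifting) has_vector_derivative_transform_within_open open_greaterThanLessThan)
qed

text \<open>Product of the two widths and the difference of the slopes. If both edges run to the
  right, the frame is decided by the slopes alone.\<close>

lemma velocity_det:
  "Im (cnj (velocity k) * velocity l) = (x (Suc k) - x k) * (x (Suc l) - x l) * (x l + x (Suc l) - x k - x (Suc k))"
  by (simp add: velocity_def power2_eq_square algebra_simps)

lemma is_long_diagram_poly_curve:
  assumes pas: "\<And>s t. s \<noteq> t \<Longrightarrow> poly_curve s = poly_curve t \<Longrightarrow>
      (P s, P t) \<in> {(Over, Under), (Under, Over), (Virtual, Virtual)}"
  shows "is_long_diagram (Long_Diagram poly_curve P)"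
proof -
  let ?D = "Long_Diagram poly_curve P"
  have d: "double ?D s t \<longleftrightarrow> s \<noteq> t \<and> poly_curve s = poly_curve t" for s t by (simp add: double_def)
  have "\<exists>R>0. \<forall>t. R \<le> \<bar>t\<bar> \<longrightarrow> poly_curve t = of_real t"
    by (intro exI[of _ "real m + 1"]) (auto intro!: poly_curve_axis)
  moreover have "\<exists>e>0. inj_on poly_curve {t - e<..<t + e}" for t
  proof -
    have "inj_on poly_curve {t - 1 / 2<..<t + 1 / 2}"
    proof (rule inj_onI, rule ccontr)
      fix u v assume u: "u \<in> {t - 1 / 2<..<t + 1 / 2}" "v \<in> {t - 1 / 2<..<t + 1 / 2}"
        "poly_curve u = poly_curve v" "u \<noteq> v"
      note e = double_edges[OF u(3,4)]
      have "\<bar>u - v\<bar> < 1" using u(1,2) by (auto simp: abs_less_iff)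
      then have "\<bar>real (edge u) - real (edge v)\<bar> < 2"
        using frac_of_edge[OF e(1)] frac_of_edge[OF e(3)] frac_lt_1[of u] frac_lt_1[of v] e(6,7) by linarith
      then show False using e(5) by auto
    qed
    then show ?thesis by (intro exI[of _ "1 / 2"]) simp
  qed
  moreover have "poly_curve differentiable (at s) \<and> vel_det ?D s t \<noteq> 0"
    if "s \<noteq> t" "poly_curve s = poly_curve t" for s t
  proof -
    note e = double_edges[OF that(2,1)]
    note ds = poly_curve_derivative[OF e(1,2,6)] and dt = poly_curve_derivative[OF e(3,4,7)]
    note es = Re_poly_curve(2)[OF e(1,2)] and et = Re_poly_curve(2)[OF e(3,4)]
    have ne: "x (edge t) \<noteq> x (edge s)" "x (edge t) \<noteq> x (Suc (edge s))" "x (Suc (edge s)) \<noteq> x (edge s)"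
      "x (Suc (edge t)) \<noteq> x (edge t)"
      using x_inj e(5) es et by (metis Suc_leI distinct_length_2_or_more less_imp_le n_not_Suc_n)+
    have "x (edge s) + x (Suc (edge s)) \<noteq> x (edge t) + x (Suc (edge t))"
      using chord_sums_differ[OF body_on_chord[OF e(1,2)] _ ne(1,2)] body_on_chord[OF e(3,4)] that(2) by simp
    then have "Im (cnj (velocity (edge s)) * velocity (edge t)) \<noteq> 0"
      unfolding velocity_det using ne by simp
    then have "vel_det ?D s t \<noteq> 0"
      using ds dt by (simp add: vel_det_def vector_derivative_at)
    then show ?thesis using ds by (auto simp: differentiableI_vector)
  qed
  ultimately have dd: "\<exists>R>0. \<forall>t. R \<le> \<bar>t\<bar> \<longrightarrow> poly_curve t = of_real t"
    "\<And>t. \<exists>e>0. inj_on poly_curve {t - e<..<t + e}"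
    "\<And>s t. s \<noteq> t \<Longrightarrow> poly_curve s = poly_curve t \<Longrightarrow> poly_curve differentiable (at s) \<and> vel_det ?D s t \<noteq> 0"
    by blast+
  show ?thesis
    unfolding is_long_diagram_def
  proof (intro conjI allI impI)
    show "continuous_on UNIV (curve ?D)" using continuous_poly_curve by simp
    show "\<exists>R>0. \<forall>t. R \<le> \<bar>t\<bar> \<longrightarrow> curve ?D t = of_real t" using dd(1) by simp
    show "\<exists>e>0. inj_on (curve ?D) {t - e<..<t + e}" for t using dd(2) by simp
    show "finite {(s, t). double ?D s t}" using finite_doubles by (simp add: d)
    show "t = u" if "double ?D s t \<and> double ?D s u" for s t u
      using that double_unique[of s t u] unfolding d by blast
    show "curve ?D differentiable (at s)" "vel_det ?D s t \<noteq> 0"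
      "(passage ?D s, passage ?D t) \<in> {(Over, Under), (Under, Over), (Virtual, Virtual)}"
      if "double ?D s t" for s t
      using that dd(3)[of s t] pas[of s t] by (simp_all add: d)
  qed
qed

lemma edges_cross:
  assumes k: "k < m" "l < m" and ord: "x k < x l" "x l < x (Suc k)" "x (Suc k) < x (Suc l)"
  shows "\<exists>s t. edge s = k \<and> edge t = l \<and> poly_curve s = poly_curve t \<and> s \<noteq> t"
proof -
  obtain u v where uv: "0 < u" "u < 1" "0 < v" "v < 1"
    "x k + u * (x (Suc k) - x k) = x l + v * (x (Suc l) - x l)"
    "(x k)\<^sup>2 + u * ((x (Suc k))\<^sup>2 - (x k)\<^sup>2) = (x l)\<^sup>2 + v * ((x (Suc l))\<^sup>2 - (x l)\<^sup>2)"
    using chords_cross[OF ord] by blast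
  have fl: "\<lfloor>real i + a\<rfloor> = int i" "frac (real i + a) = a" if "0 < a" "a < 1" for i :: nat and a :: real
    using that by (auto simp: floor_unique frac_def)
  have *: "edge (real i + a) = i"
    "poly_curve (real i + a) = Complex (x i + a * (x (Suc i) - x i)) ((x i)\<^sup>2 + a * ((x (Suc i))\<^sup>2 - (x i)\<^sup>2))"
    if "0 < a" "a < 1" "i < m" for i a
  proof -
    show e: "edge (real i + a) = i" using fl[OF that(1,2)] by (simp add: edge_def)
    have "real i + 1 \<le> real m" using that(3) by linarith
    then show "poly_curve (real i + a) = Complex (x i + a * (x (Suc i) - x i)) ((x i)\<^sup>2 + a * ((x (Suc i))\<^sup>2 - (x i)\<^sup>2))"
      using Re_poly_curve(1)[of "real i + a"] that fl[OF that(1,2)] e by simp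
  qed
  have "k \<noteq> l" using ord by auto
  then have "real k + u \<noteq> real l + v" using *(1)[OF uv(1,2) k(1)] *(1)[OF uv(3,4) k(2)] by metis
  then show ?thesis
    using *[OF uv(1,2) k(1)] *[OF uv(3,4) k(2)] uv(5,6)
    by (intro exI[of _ "real k + u"] exI[of _ "real l + v"]) simp
qed

end

lemma generic_subset: "A \<subseteq> B \<Longrightarrow> generic B \<Longrightarrow> generic A"
  unfolding generic_def by (meson subsetD)

section \<open>A polygon with a given Gauss diagram\<close>

context realization
begin

definition par :: "nat \<Rightarrow> nat" where
  "par k = (if \<exists>j. (k, j) \<in> X \<or> (j, k) \<in> X then SOME j. (k, j) \<in> X \<or> (j, k) \<in> X else k)"

lemma par_crossing: "(i, j) \<in> X \<Longrightarrow> par i = j" "(i, j) \<in> X \<Longrightarrow> par j = i"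
proof -
  assume ij: "(i, j) \<in> X"
  have uq: "p = (if k = i then j else i)" if "(k, p) \<in> X \<or> (p, k) \<in> X" "k = i \<or> k = j" for k p
    using that(1)
  proof
    assume kp: "(k, p) \<in> X"
    have "{i, j} \<inter> {k, p} \<noteq> {}" using that(2) by blast
    note u = crossing_unique[OF ij kp this]
    show ?thesis unfolding u by simp
  next
    assume kp: "(p, k) \<in> X"
    have "{i, j} \<inter> {p, k} \<noteq> {}" using that(2) by blast
    note u = crossing_unique[OF ij kp this]
    show ?thesis unfolding u using crossing(2)[OF ij] by simp
  qed
  have "(i, par i) \<in> X \<or> (par i, i) \<in> X"
    unfolding par_def using someI_ex[of "\<lambda>l. (i, l) \<in> X \<or> (l, i) \<in> X"] ij by auto
  from uq[OF this] show "par i = j" by simp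
  have "(j, par j) \<in> X \<or> (par j, j) \<in> X"
    unfolding par_def using someI_ex[of "\<lambda>l. (j, l) \<in> X \<or> (l, j) \<in> X"] ij by auto
  from uq[OF this] show "par j = i" using crossing(2)[OF ij] by simp
qed

lemma par_noncrossing: "(k, par k) \<notin> X \<Longrightarrow> (par k, k) \<notin> X \<Longrightarrow> par k = k"
  using par_crossing by (metis par_def)

lemma crossing_par: "par k \<noteq> k \<Longrightarrow> (min k (par k), max k (par k)) \<in> X"
proof -
  assume "par k \<noteq> k"
  then consider "(k, par k) \<in> X" | "(par k, k) \<in> X" using par_noncrossing by blast
  then show ?thesis
    by cases (use crossing(2) in \<open>simp_all add: min_absorb1 max_absorb2 min_absorb2 max_absorb1 less_imp_le_nat\<close>)
qed

lemma par_par: "par (par k) = k"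
proof (cases "par k = k")
  case False
  then show ?thesis using par_crossing[OF crossing_par[OF False]] by (auto simp: min_def max_def split: if_splits)
qed simp

definition base :: "nat \<Rightarrow> nat" where "base k = min k (par k)"

text \<open>Marks which strand of a crossing becomes the right one of the two interleaving chords.
  The right chord is the steeper one, so for a positive frame it has to be the later strand.\<close>

definition side :: "nat \<Rightarrow> nat" where
  "side k = (if k < par k \<and> lam (k, par k) \<noteq> 1 \<or> par k < k \<and> lam (par k, k) = 1 then 1 else 0)"

lemma side_par: "par k \<noteq> k \<Longrightarrow> side (par k) = 1 - side k"
  by (auto simp: side_def par_par)

lemma side_crossing: "(i, j) \<in> X \<Longrightarrow> lam (i, j) = 1 \<Longrightarrow> side i = 0 \<and> side j = 1"
  "(i, j) \<in> X \<Longrightarrow> lam (i, j) \<noteq> 1 \<Longrightarrow> side i = 1 \<and> side j = 0"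
  using crossing(2)[of i j] par_crossing[of i j] by (auto simp: side_def)

lemma base_eq: "base k = base l \<Longrightarrow> l = k \<or> l = par k"
  unfolding base_def by (metis min_def par_par)

text \<open>The strand at time \<open>k\<close> becomes the chord from vertex \<open>2 k + 1\<close> to vertex \<open>2 k + 2\<close> of a
  polygon with vertices on a parabola, ordered by the following ranks. Two chords cross if their
  end points interleave, and the frame is determined by which of them comes first.\<close>

definition rank :: "nat \<Rightarrow> nat" where
  "rank v = (if v = 0 then 0 else if v = 2 * L + 1 then 4 * L + 1
     else 4 * base ((v - 1) div 2) + 1 + side ((v - 1) div 2) + 2 * ((v - 1) mod 2))"

text \<open>Each \<open>base\<close> owns a block of four consecutive ranks, starting at
  \<open>4 * base k + 1\<close>. In this block the two starting points come first and the two end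
  points follow in the same order, so the chords of a crossing interleave and both run to the
  right.\<close>

lemma rank_strand: "k < L \<Longrightarrow> rank (2 * k + 1) = 4 * base k + 1 + side k"
  "k < L \<Longrightarrow> rank (2 * k + 2) = 4 * base k + 3 + side k"
proof -
  assume k: "k < L"
  have e: "(2 * k + 1 - 1) div 2 = k" "(2 * k + 1 - 1) mod 2 = 0" "(2 * k + 2 - 1) div 2 = k" "(2 * k + 2 - 1) mod 2 = 1"
    by simp_all
  have n: "2 * k + 1 \<noteq> 2 * L + 1" "2 * k + 2 \<noteq> 2 * L + 1" using k by presburger+
  show "rank (2 * k + 1) = 4 * base k + 1 + side k" unfolding rank_def e using n(1) by simp
  show "rank (2 * k + 2) = 4 * base k + 3 + side k" unfolding rank_def e using n(2) by simp
qed

lemma side_le: "side k \<le> 1" by (simp add: side_def)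

lemma base_less: "k < L \<Longrightarrow> base k < L"
  by (simp add: base_def)

lemma vertex_cases:
  assumes "v \<le> 2 * L + 1"
  obtains "v = 0" | "v = 2 * L + 1" | k where "k < L" "v = 2 * k + 1" | k where "k < L" "v = 2 * k + 2"
proof -
  have "v = 0 \<or> v = 2 * L + 1 \<or> (\<exists>k<L. v = 2 * k + 1) \<or> (\<exists>k<L. v = 2 * k + 2)"
    using assms by presburger
  then show thesis using that by blast
qed

lemma rank_interior: "0 < v \<Longrightarrow> v < 2 * L + 1 \<Longrightarrow> 0 < rank v \<and> rank v < 4 * L + 1"
proof -
  assume v: "0 < v" "v < 2 * L + 1"
  then have "v \<le> 2 * L + 1" by simp
  then show ?thesis
  proof (cases rule: vertex_cases)
    case (3 k)
    then show ?thesis using rank_strand(1)[of k] base_less[of k] side_le[of k] by simp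
  next
    case (4 k)
    then show ?thesis using rank_strand(2)[of k] base_less[of k] side_le[of k] by simp
  qed (use v in auto)
qed

lemma rank_ends: "rank 0 = 0" "rank (2 * L + 1) = 4 * L + 1"
  by (simp_all add: rank_def)

lemma strand_determined:
  assumes "base k = base l" "side k = side l" shows "k = l"
proof (rule ccontr)
  assume "k \<noteq> l"
  then have "l = par k" "par k \<noteq> k" using base_eq[OF assms(1)] by auto
  then have "side k = 1 - side k" using side_par[of k] assms(2) by simp
  then show False by presburger
qed

lemma rank_inj: "inj_on rank {..2 * L + 1}"
proof -
  have ne: False if v: "v \<le> 2 * L + 1" "v' \<le> 2 * L + 1" "rank v = rank v'" "v < v'" for v v'
  proof -
    have v0: "v \<noteq> 0"
    proof
      assume "v = 0"
      then show False using rank_interior[of v'] rank_ends v by (cases "v' = 2 * L + 1") auto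
    qed
    have v1: "v' \<noteq> 2 * L + 1"
    proof
      assume "v' = 2 * L + 1"
      then show False using rank_interior[of v] rank_ends v v0 by auto
    qed
    have "\<exists>k a. k < L \<and> u = 2 * k + 1 + a \<and> a \<in> {0, 1}" if "0 < u" "u < 2 * L + 1" for u
    proof -
      have "(u - 1) div 2 < L" "u = 2 * ((u - 1) div 2) + 1 + (u - 1) mod 2" "(u - 1) mod 2 = 0 \<or> (u - 1) mod 2 = 1"
        using that by presburger+
      then show ?thesis
        by (intro exI[of _ "(u - 1) div 2"] exI[of _ "(u - 1) mod 2"]) auto
    qed
    note parts = this
    have "0 < v" "v < 2 * L + 1" "0 < v'" "v' < 2 * L + 1" using v v0 v1 by simp_all
    obtain k a where k1: "k < L" "v = 2 * k + 1 + a" "a \<in> {0, 1}"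
      using parts[OF \<open>0 < v\<close> \<open>v < 2 * L + 1\<close>] by blast
    obtain k' a' where "k' < L" "v' = 2 * k' + 1 + a'" "a' \<in> {0, 1}"
      using parts[OF \<open>0 < v'\<close> \<open>v' < 2 * L + 1\<close>] by blast
    note k = k1 this
    have "rank v = 4 * base k + 1 + side k + 2 * a" "rank v' = 4 * base k' + 1 + side k' + 2 * a'"
      using k rank_strand by auto
    then have e: "4 * base k + side k + 2 * a = 4 * base k' + side k' + 2 * a'" using v(3) by simp
    have "base k = base k'" "side k = side k'" "a = a'"
    proof -
      have "a \<le> 1" "a' \<le> 1" using k(3,6) by auto
      then show "base k = base k'" "side k = side k'" "a = a'"
        using e side_le[of k] side_le[of k'] by presburger+
    qed
    then show False using strand_determined[of k k'] k v(4) by simp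
  qed
  show ?thesis
  proof (rule inj_onI)
    fix v v' assume "v \<in> {..2 * L + 1}" "v' \<in> {..2 * L + 1}" "rank v = rank v'"
    then show "v = v'" using ne[of v v'] ne[of v' v] by (cases v v' rule: linorder_cases) auto
  qed
qed

text \<open>The wanted crossings are those between the two chords of a common block. All other
  double points of the polygon, which no choice of vertices could prevent in general, are declared
  virtual.\<close>

theorem planar_diagram_exists: "\<exists>D. is_long_diagram D \<and> realizes S C D"
proof -
  obtain xi :: "nat \<Rightarrow> real" where xi: "xi 0 = 0" "\<And>i j. i < j \<Longrightarrow> j \<le> 4 * L + 1 \<Longrightarrow> xi i < xi j"
    "\<And>i. i \<le> 4 * L + 1 \<Longrightarrow> xi i < 1" "generic (xi ` {..4 * L + 1})"
    using generic_sequence[of "4 * L + 1"] by blast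
  define x where "x v = xi (rank v)" for v
  have rank_le: "rank v \<le> 4 * L + 1" if "v \<le> 2 * L + 1" for v
    using rank_interior[of v] rank_ends that by (cases "v = 0 \<or> v = 2 * L + 1") auto
  have xi_inj: "inj_on xi {..4 * L + 1}"
    by (rule inj_onI) (metis atMost_iff linorder_neqE_nat order_less_irrefl xi(2))
  interpret P: parabola_polygon "2 * L + 1" x
  proof
    show "0 < 2 * L + 1" by simp
    show "inj_on x {..2 * L + 1}"
      unfolding x_def
    proof (rule comp_inj_on[OF rank_inj, of xi, unfolded comp_def])
      show "inj_on xi (rank ` {..2 * L + 1})"
        by (rule inj_on_subset[OF xi_inj]) (use rank_le in auto)
    qed
    show "x 0 = 0" "x (2 * L + 1) < 1" using rank_ends xi by (simp_all add: x_def)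
    show "0 < x i" if "0 < i" "i \<le> 2 * L + 1" for i
      using xi(2)[of 0 "rank i"] rank_interior[of i] rank_le[of i] rank_ends(2) xi(1) that
      by (cases "i = 2 * L + 1") (auto simp: x_def)
    show "x i < x (2 * L + 1)" if "i < 2 * L + 1" for i
      using xi(2)[of "rank i" "4 * L + 1"] rank_interior[of i] rank_ends that
      by (cases "i = 0") (auto simp: x_def)
    have "x ` {..2 * L + 1} \<subseteq> xi ` {..4 * L + 1}" using rank_le by (auto simp: x_def)
    then show "generic (x ` {..2 * L + 1})" using generic_subset xi(4) by blast
  qed
  have x_strand: "x (2 * k + 1) = xi (4 * base k + 1 + side k)" "x (Suc (2 * k + 1)) = xi (4 * base k + 3 + side k)"
    if "k < L" for k
    using rank_strand[OF that] by (simp_all add: x_def)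
  have x_order: "x (2 * i + 1) < x (2 * j + 1) \<and> x (2 * j + 1) < x (Suc (2 * i + 1)) \<and> x (Suc (2 * i + 1)) < x (Suc (2 * j + 1))"
    if "i < L" "j < L" "base i = base j" "side i = 0" "side j = 1" for i j
    unfolding x_strand[OF that(1)] x_strand[OF that(2)]
    using base_less[OF that(2)] that(3-5) by (simp add: xi(2))
  have base_crossing: "base i = base j" if "(i, j) \<in> X" for i j
    using par_crossing[OF that] by (simp add: base_def)
  have x_up: "x (2 * i + 1) < x (Suc (2 * i + 1))" if "i < L" for i
    unfolding x_strand[OF that] using base_less[OF that] side_le[of i] by (simp add: xi(2))
  let ?c = P.poly_curve and ?e = P.edge
  \<comment> \<open>Edge \<open>2 * k + 1\<close> is the strand at time \<open>k\<close>; the edges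
    with even number only connect consecutive strands.\<close>
  define tm where "tm t = ?e t div 2" for t
  define crosses where "crosses t \<longleftrightarrow> odd (?e t) \<and> par (tm t) \<noteq> tm t \<and>
    (\<exists>s. s \<noteq> t \<and> ?c s = ?c t \<and> ?e s = 2 * par (tm t) + 1)" for t
  define Pa where "Pa t = (if crosses t then if tm t \<in> over_times C then Over else Under else Virtual)" for t
  define D where "D = Long_Diagram ?c Pa"
  have partner: "?e s = 2 * par (tm t) + 1 \<and> ?e t = 2 * tm t + 1 \<and> tm s = par (tm t) \<and> par (tm t) \<noteq> tm t \<and> crosses s"
    if st: "s \<noteq> t" "?c s = ?c t" and c: "crosses t" for s t
  proof -
    obtain u where u: "u \<noteq> t" "?c u = ?c t" "?e u = 2 * par (tm t) + 1" using c by (auto simp: crosses_def)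
    have "s = u" using P.double_unique[of t s u] st u by auto
    then have "?e s = 2 * par (tm t) + 1" using u(3) by blast
    moreover have "odd (?e t)" "par (tm t) \<noteq> tm t" using c unfolding crosses_def by blast+
    moreover have "?e t = 2 * tm t + 1" using calculation(2) unfolding tm_def by presburger
    ultimately have e: "?e s = 2 * par (tm t) + 1" "?e t = 2 * tm t + 1" "par (tm t) \<noteq> tm t" by blast+
    have "tm s = par (tm t)" unfolding tm_def[of s] e(1) by simp
    moreover have "crosses s"
      unfolding crosses_def calculation par_par
    proof (intro conjI exI[of _ t])
      show "odd (?e s)" using e(1) by simp
    qed (use st e in auto)
    ultimately show ?thesis using e by blast
  qed
  have opp: "(par k \<in> over_times C) \<noteq> (k \<in> over_times C)" if "par k \<noteq> k" for k
    using crossing(8)[OF crossing_par[OF that]] by (auto simp: min_def max_def split: if_splits)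
  have long: "is_long_diagram D"
    unfolding D_def
  proof (rule P.is_long_diagram_poly_curve)
    fix s t assume st: "s \<noteq> t" "?c s = ?c t"
    show "(Pa s, Pa t) \<in> {(Over, Under), (Under, Over), (Virtual, Virtual)}"
    proof (cases "crosses t")
      case True
      then show ?thesis using partner[OF st] opp[of "tm t"] by (auto simp: Pa_def)
    next
      case False
      then have "\<not> crosses s" using partner[of t s] st by auto
      then show ?thesis using False by (simp add: Pa_def)
    qed
  qed
  have double_D: "double D s t \<longleftrightarrow> s \<noteq> t \<and> ?c s = ?c t" for s t
    by (simp add: double_def D_def)
  have pos: "0 \<le> s" "s < real (2 * L + 1)" "0 < frac s" if "s \<noteq> t" "?c s = ?c t" for s t
    using P.double_edges[OF that(2,1)] by auto
  have edge_mono: "?e s \<le> ?e t" if "s \<le> t" for s t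
    unfolding P.edge_def using that by (intro nat_mono floor_mono)
  have crosses_sym: "crosses s \<longleftrightarrow> crosses t" if "s \<noteq> t" "?c s = ?c t" for s t
    using partner[OF that] partner[OF that[symmetric]] by blast
  have "passage D s \<noteq> Virtual \<longleftrightarrow> crosses s" for s by (simp add: D_def Pa_def)
  then have rc: "(s, t) \<in> real_crossings D \<longleftrightarrow> s < t \<and> ?c s = ?c t \<and> crosses t" for s t
    unfolding real_crossings_def double_D using crosses_sym[of s t] by auto
  have rcD: "(tm s, tm t) \<in> X \<and> ?e s = 2 * tm s + 1 \<and> ?e t = 2 * tm t + 1 \<and> s \<noteq> t \<and> ?c s = ?c t"
    if "(s, t) \<in> real_crossings D" for s t
  proof -
    have st: "s < t" "?c s = ?c t" "crosses t" using that rc by auto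
    then have p: "?e s = 2 * par (tm t) + 1" "?e t = 2 * tm t + 1" "tm s = par (tm t)" "par (tm t) \<noteq> tm t"
      using partner[OF less_imp_neq[OF st(1)] st(2,3)] by blast+
    have "tm s \<le> tm t" unfolding tm_def using edge_mono[of s t] st(1) by (simp add: div_le_mono)
    then have "(tm s, tm t) \<in> X" using crossing_par[OF p(4)] p(3,4) by (auto simp: min_def max_def split: if_splits)
    moreover have "?e s = 2 * tm s + 1" unfolding p(3) by (rule p(1))
    ultimately show ?thesis using p(2) st by blast
  qed
  have crosses_rc: "\<exists>u. u \<noteq> t \<and> ?c u = ?c t \<and> crosses t \<and> ?e u = 2 * par (tm t) + 1 \<and> ?e t = 2 * tm t + 1"
    if mem: "t \<in> fst ` real_crossings D \<union> snd ` real_crossings D" for t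
  proof -
    obtain s' t' where st: "(s', t') \<in> real_crossings D" "t = s' \<or> t = t'" using mem by force
    then have *: "s' \<noteq> t'" "?c s' = ?c t'" "crosses t'" using rc by blast+
    then have "crosses s'" using crosses_sym by blast
    then show ?thesis using st(2) * partner[OF *] partner[OF *(1,2)[symmetric]] by metis
  qed
  have mono: "strict_mono_on (fst ` real_crossings D \<union> snd ` real_crossings D) tm"
  proof (rule strict_mono_onI)
    fix s t assume s: "s \<in> fst ` real_crossings D \<union> snd ` real_crossings D"
      and t: "t \<in> fst ` real_crossings D \<union> snd ` real_crossings D" and st: "s < t"
    obtain u where u: "u \<noteq> s" "?c u = ?c s" "?e u = 2 * par (tm s) + 1" "?e s = 2 * tm s + 1" using crosses_rc[OF s] by blast
    obtain v where v: "v \<noteq> t" "?c v = ?c t" "?e v = 2 * par (tm t) + 1" "?e t = 2 * tm t + 1" using crosses_rc[OF t] by blast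
    have "tm s \<noteq> tm t"
    proof
      assume "tm s = tm t"
      then have "s = t" using P.double_determined[of s u t v] u v by metis
      then show False using st by simp
    qed
    moreover have "tm s \<le> tm t" unfolding tm_def using edge_mono[of s t] st by (simp add: div_le_mono)
    ultimately show "tm s < tm t" by simp
  qed
  have image: "map_prod tm tm ` real_crossings D = X"
  proof (intro equalityI subsetI)
    fix c assume "c \<in> map_prod tm tm ` real_crossings D"
    then show "c \<in> X" using rcD by auto
  next
    fix c assume c: "c \<in> X"
    then obtain i j where ij: "c = (i, j)" "(i, j) \<in> X" by (cases c) auto
    have L: "i < L" "j < L" "i < j" using crossing[OF ij(2)] by auto
    have "\<exists>s t. ?e s = 2 * i + 1 \<and> ?e t = 2 * j + 1 \<and> ?c s = ?c t \<and> s \<noteq> t"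
    proof (cases "lam (i, j) = 1")
      case True
      then show ?thesis
        using P.edges_cross[of "2 * i + 1" "2 * j + 1"] x_order[OF L(1,2) base_crossing[OF ij(2)]] side_crossing(1)[OF ij(2)] L
        by simp
    next
      case False
      then have "\<exists>t s. ?e t = 2 * j + 1 \<and> ?e s = 2 * i + 1 \<and> ?c t = ?c s \<and> t \<noteq> s"
        using P.edges_cross[of "2 * j + 1" "2 * i + 1"] x_order[OF L(2,1) base_crossing[OF ij(2), symmetric]] side_crossing(2)[OF ij(2)] L
        by simp
      then show ?thesis by metis
    qed
    then obtain s t where st: "?e s = 2 * i + 1" "?e t = 2 * j + 1" "?c s = ?c t" "s \<noteq> t" by blast
    have tms: "tm s = i" "tm t = j" using st by (simp_all add: tm_def)
    have "s < t" using edge_mono[of t s] st L by (cases s t rule: linorder_cases) auto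
    moreover have "crosses t"
      unfolding crosses_def tms using st par_crossing[OF ij(2)] L by (auto intro!: exI[of _ s])
    ultimately have "(s, t) \<in> real_crossings D" using rc st by simp
    then show "c \<in> map_prod tm tm ` real_crossings D" using tms ij by force
  qed
  have vel: "vel_det D s t = Im (cnj (P.velocity (?e s)) * P.velocity (?e t))" if "s \<noteq> t" "?c s = ?c t" for s t
    using P.poly_curve_derivative[OF pos[OF that]] P.poly_curve_derivative[of t] pos[of t s] that
    by (simp add: vel_det_def D_def vector_derivative_at)
  have sign: "sign_of (vel_det D s t) = lam (tm s, tm t) \<and> sign_of (vel_det D t s) = - lam (tm s, tm t)"
    if "(s, t) \<in> real_crossings D" for s t
  proof -
    note r = rcD[OF that]
    define i j where "i = tm s" "j = tm t"
    have ij: "(i, j) \<in> X" "?e s = 2 * i + 1" "?e t = 2 * j + 1" using r by (simp_all add: i_j_def)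
    have L: "i < L" "j < L" using crossing[OF ij(1)] by auto
    \<comment> \<open>\<open>q\<close> is the product of the widths, which are positive as both
      chords run to the right, and \<open>d\<close> is the difference of the slopes, whose sign is
      prescribed by \<open>side\<close>.\<close>
    define q where "q = (x (Suc (2 * i + 1)) - x (2 * i + 1)) * (x (Suc (2 * j + 1)) - x (2 * j + 1))"
    have q: "0 < q" using x_up[OF L(1)] x_up[OF L(2)] by (simp add: q_def)
    define d where "d = x (2 * j + 1) + x (Suc (2 * j + 1)) - x (2 * i + 1) - x (Suc (2 * i + 1))"
    have 1: "vel_det D s t = q * d" "vel_det D t s = - (q * d)"
      using vel[of s t] vel[of t s] r unfolding P.velocity_det ij(2,3) q_def d_def by (auto simp: algebra_simps)
    show ?thesis
    proof (cases "lam (i, j) = 1")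
      case True
      then have "0 < d"
        using x_order[OF L base_crossing[OF ij(1)]] side_crossing(1)[OF ij(1)] by (simp add: d_def)
      then show ?thesis using 1 q True by (simp add: sign_of_def i_j_def zero_less_mult_iff mult_less_0_iff)
    next
      case False
      then have "d < 0"
        using x_order[OF L(2,1) base_crossing[OF ij(1), symmetric]] side_crossing(2)[OF ij(1)] by (simp add: d_def)
      then show ?thesis using 1 q False lam_unit[of "(i, j)"] by (simp add: sign_of_def i_j_def zero_less_mult_iff mult_less_0_iff)
    qed
  qed
  have "realizes S C D"
    unfolding realizes_def
  proof (intro conjI exI[of _ tm] ballI)
    show "surface_diagram S C" by (rule diagram)
    show "strict_mono_on (fst ` real_crossings D \<union> snd ` real_crossings D) tm" by (rule mono)
    show "map_prod tm tm ` real_crossings D = curve_crossings S C" using image by (simp add: X_def)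
    fix c assume c: "c \<in> real_crossings D"
    obtain s t where st: "c = (s, t)" by (cases c)
    have "crosses s" using c rc[of s t] crosses_sym[of s t] by (auto simp: st)
    then have over: "passage D s = Over \<longleftrightarrow> tm s \<in> over_times C" by (simp add: D_def Pa_def)
    have "crossing_sign D (s, t) = surf_sign S C (tm s, tm t)"
      using sign[of s t] c over unfolding surf_sign_eq st
      by (simp add: crossing_sign_def chord_sign_def ov_def)
    then show "case c of (s, t) \<Rightarrow> (passage D s = Over \<longleftrightarrow> tm s \<in> over_times C) \<and>
        crossing_sign D (s, t) = surf_sign S C (tm s, tm t)"
      using over by (simp add: st)
  qed
  then show ?thesis using long by blast
qed

end

section \<open>The polynomials of a long virtual knot\<close>

lemma long_virtual_knotsD:
  assumes "K \<in> long_virtual_knots"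
  shows "\<exists>D. D \<in> K" "D \<in> K \<Longrightarrow> is_long_diagram D"
proof -
  obtain E where E: "is_long_diagram E" "K = (moves \<union> moves\<inverse>)\<^sup>* `` {E}"
    using assms unfolding long_virtual_knots_def by (auto elim: quotientE)
  have "is_long_diagram D" if "(E, D) \<in> (moves \<union> moves\<inverse>)\<^sup>*" for D
    using that E(1) by induction (auto simp: moves_def)
  then show "\<exists>D. D \<in> K" "D \<in> K \<Longrightarrow> is_long_diagram D" using E(2) by auto
qed

lemma long_virtual_knot_of_diagram:
  assumes "is_long_diagram D"
  obtains K where "K \<in> long_virtual_knots" "D \<in> K"
proof
  show "(moves \<union> moves\<inverse>)\<^sup>* `` {D} \<in> long_virtual_knots"
    unfolding long_virtual_knots_def by (rule quotientI) (simp add: assms)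
qed simp

text \<open>Crossing sign and over/under information together determine the frame sign, so a
  realization has the Gauss diagram of \<open>D\<close> up to an increasing change of times.\<close>

lemma realizes_diagram_poly:
  assumes D: "is_long_diagram D" and R: "realizes S C D"
  shows "F_diagram a b S C = diagram_poly F_kernel a b D" "H_diagram a b S C = diagram_poly H_kernel a b D"
proof -
  interpret realization S C by unfold_locales (use R in \<open>simp add: realizes_def\<close>)
  obtain h where h: "strict_mono_on (fst ` real_crossings D \<union> snd ` real_crossings D) h"
    "map_prod h h ` real_crossings D = curve_crossings S C"
    "\<And>s t. (s, t) \<in> real_crossings D \<Longrightarrow> (passage D s = Over \<longleftrightarrow> h s \<in> over_times C) \<and>
       crossing_sign D (s, t) = surf_sign S C (h s, h t)"
    using R unfolding realizes_def by blast
  have ov: "ov (map_prod h h c) = over_first D c" if "c \<in> real_crossings D" for c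
    using h(3)[of "fst c" "snd c"] that by (simp add: ov_def over_first_def)
  have sgn: "lam (map_prod h h c) = frame_sign D c" if c: "c \<in> real_crossings D" for c
  proof -
    obtain s t where st: "c = (s, t)" by (cases c)
    then have "double D s t" using c by (simp add: real_crossings_def)
    then have v: "vel_det D s t \<noteq> 0" by (rule long_diagramD(5)[OF D])
    have "sign_of (vel_det D t s) = - sign_of (vel_det D s t)"
      using v by (simp add: vel_det_swap[of D t s] sign_of_def)
    moreover have "crossing_sign D (s, t) = chord_sign lam ov (h s, h t)"
      using h(3) c st by (simp add: surf_sign_eq)
    ultimately show ?thesis
      using h(3)[of s t] c st
      by (auto simp: crossing_sign_def chord_sign_def ov_def frame_sign_def split: if_splits)
  qed
  have "gauss_poly G a b X lam ov = diagram_poly G a b D" for G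
    unfolding diagram_poly_def
    by (rule gauss_poly_order_iso[OF h(1) order_refl])
      (simp_all add: X_def h(2) ov sgn)
  then show "F_diagram a b S C = diagram_poly F_kernel a b D" "H_diagram a b S C = diagram_poly H_kernel a b D"
    by (simp_all add: F_diagram_gauss_poly H_diagram_gauss_poly)
qed

text \<open>Invariance shows that the definite descriptions are well defined, so that any
  realization may be used to compute the polynomials.\<close>

lemma polynomials_of_realization:
  assumes K: "K \<in> long_virtual_knots" and R: "surface_realization K S C"
  shows "F_poly a b K = F_diagram a b S C" "H_poly a b K = H_diagram a b S C"
proof -
  obtain D where D: "D \<in> K" "realizes S C D" using R by (auto simp: surface_realization_def)
  have "F_diagram a b S' C' = F_diagram a b S C \<and> H_diagram a b S' C' = H_diagram a b S C"
    if R': "surface_realization K S' C'" for S' C'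
  proof -
    obtain D' where D': "D' \<in> K" "realizes S' C' D'" using R' by (auto simp: surface_realization_def)
    show ?thesis
      using realizes_diagram_poly[OF long_virtual_knotsD(2)[OF K D(1)] D(2)]
        realizes_diagram_poly[OF long_virtual_knotsD(2)[OF K D'(1)] D'(2)]
        diagram_poly_invariant[OF K D(1) D'(1)] admissible_kernels by simp
  qed
  then show "F_poly a b K = F_diagram a b S C" "H_poly a b K = H_diagram a b S C"
    unfolding F_poly_def H_poly_def using R by (intro the_equality; blast)+
qed

lemma realization_of_knot:
  assumes "K \<in> long_virtual_knots"
  obtains S C where "surface_realization K S C" "surface_diagram S C"
proof -
  obtain D where D: "D \<in> K" "is_long_diagram D" using long_virtual_knotsD[OF assms] by blast
  then obtain S C where "realizes S C D" using realization_exists by blast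
  then show thesis using that D(1) by (auto simp: surface_realization_def realizes_def)
qed

lemma knot_of_surface_diagram:
  assumes "surface_diagram S C" "has_genus S g"
  obtains K where "K \<in> long_virtual_knots" "surface_realization K S C" "sg1 K \<le> g"
proof -
  interpret realization S C by unfold_locales (rule assms)
  obtain D where D: "is_long_diagram D" "realizes S C D" using planar_diagram_exists by blast
  obtain K where K: "K \<in> long_virtual_knots" "D \<in> K" using long_virtual_knot_of_diagram[OF D(1)] .
  then have "surface_realization K S C" using D by (auto simp: surface_realization_def)
  moreover from this have "sg1 K \<le> g" unfolding sg1_def using assms(2) by (intro Least_le) blast
  ultimately show thesis using that K(1) by blast
qed

section \<open>Palindromic Laurent polynomials\<close>

lemma eval_one_superset:
  assumes "finite A" "Poly_Mapping.keys f \<subseteq> A"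
  shows "eval_one f = (\<Sum>k\<in>A. Poly_Mapping.lookup f k)"
  unfolding eval_one_def by (rule sum.mono_neutral_left[OF assms]) (auto simp: in_keys_iff)

lemma eval_one_add: "eval_one (f + g) = eval_one f + eval_one g"
proof -
  let ?A = "Poly_Mapping.keys f \<union> Poly_Mapping.keys g"
  show ?thesis
    using eval_one_superset[of ?A f] eval_one_superset[of ?A g]
      eval_one_superset[of ?A "f + g"] Poly_Mapping.keys_add[of f g]
    by (simp add: lookup_add sum.distrib)
qed

lemma eval_one_0: "eval_one 0 = 0" by (simp add: eval_one_def)

lemma eval_one_uminus: "eval_one (- f) = - eval_one f"
  using eval_one_add[of f "- f"] by (simp add: eval_one_0)

lemma eval_one_diff: "eval_one (f - g) = eval_one f - eval_one g"
  using eval_one_add[of f "- g"] by (simp add: eval_one_uminus)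

lemma eval_one_t_pow: "eval_one (t_pow k) = 1" by (simp add: eval_one_def t_pow_def)

lemma eval_one_1: "eval_one 1 = 1" using eval_one_t_pow[of 0] by (simp add: t_pow_0)

lemma eval_one_sum: "eval_one (\<Sum>i\<in>A. f i) = (\<Sum>i\<in>A. eval_one (f i))"
  by (induction A rule: infinite_finite_induct) (simp_all add: eval_one_0 eval_one_add)

lemma eval_one_of_int_mult: "eval_one (of_int n * f) = n * eval_one f"
proof -
  have nat: "eval_one (of_nat k * f) = int k * eval_one f" for k
    by (induction k) (simp_all add: eval_one_0 eval_one_add algebra_simps)
  show ?thesis
    by (cases n rule: int_cases2) (simp_all add: nat eval_one_uminus)
qed

lemma lookup_of_int_mult: "Poly_Mapping.lookup (of_int n * f :: laurent) k = n * Poly_Mapping.lookup f k"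
proof -
  have nat: "Poly_Mapping.lookup (of_nat m * f) k = int m * Poly_Mapping.lookup f k" for m
    by (induction m) (simp_all add: lookup_add algebra_simps)
  show ?thesis
    by (cases n rule: int_cases2) (simp_all add: nat)
qed

lemma eval_one_gauss_poly:
  assumes "\<And>n x y. eval_one (G n x y) = 0"
  shows "eval_one (gauss_poly G a b X l ov) = 0"
  unfolding gauss_poly_def by (simp add: eval_one_sum eval_one_of_int_mult assms del: of_int_mult)

context realization
begin

text \<open>Antisymmetry of the pairing does not pass through \<open>div\<close> by itself; the
  divisibility by 4 comes from the intersection numbers on the surface.\<close>

lemma chord_index_swap: "c \<in> X \<Longrightarrow> d \<in> X \<Longrightarrow> chord_index X lam d c = - chord_index X lam c d"
  using intersection_alpha_alpha[of c d] intersection_alpha_alpha[of d c] pairing_swap[of X lam "chi d" "chi c"]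
  by (simp flip: intersection_alpha_alpha_index)

text \<open>Both crossings run over the same type, so inverting \<open>t\<close> amounts to
  exchanging the two summation variables.\<close>

lemma t_inverse_gauss_poly:
  assumes G: "\<And>n x y. t_inverse (G n x y) = G (- n) y x"
  shows "t_inverse (gauss_poly G a a X lam ov) = gauss_poly G a a X lam ov"
proof -
  let ?e = "chord_sign lam ov" and ?m = "total_index X lam"
  have "t_inverse (gauss_poly G a a X lam ov) =
    (\<Sum>c\<in>of_type X ov a. \<Sum>d\<in>of_type X ov a. of_int (?e c * ?e d) * G (- chord_index X lam c d) (?m d) (?m c))"
    unfolding gauss_poly_def by (simp add: t_inverse_sum t_inverse_of_int_mult G del: of_int_mult)
  also have "\<dots> = (\<Sum>c\<in>of_type X ov a. \<Sum>d\<in>of_type X ov a. of_int (?e d * ?e c) * G (chord_index X lam d c) (?m d) (?m c))"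
  proof (intro sum.cong refl)
    fix c d assume "c \<in> of_type X ov a" "d \<in> of_type X ov a"
    then have "chord_index X lam d c = - chord_index X lam c d" by (simp add: chord_index_swap[of c d] of_type_def)
    then show "of_int (?e c * ?e d) * G (- chord_index X lam c d) (?m d) (?m c) =
        of_int (?e d * ?e c) * G (chord_index X lam d c) (?m d) (?m c)"
      by (simp add: mult.commute)
  qed
  also have "\<dots> = gauss_poly G a a X lam ov"
    unfolding gauss_poly_def by (rule sum.swap)
  finally show ?thesis .
qed

lemma diagram_polynomials_symmetric:
  "eval_one (F_diagram a a S C) = 0" "t_inverse (F_diagram a a S C) = F_diagram a a S C"
  "eval_one (H_diagram a a S C) = 0" "t_inverse (H_diagram a a S C) = H_diagram a a S C"
  unfolding F_diagram_gauss_poly H_diagram_gauss_poly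
  by (intro eval_one_gauss_poly t_inverse_gauss_poly,
      simp add: F_kernel_def H_kernel_def eval_one_diff eval_one_add eval_one_t_pow eval_one_1
        t_inverse_diff t_inverse_add t_inverse_t_pow t_inverse_1 algebra_simps)+

end

definition palindrome :: "int \<Rightarrow> laurent" where "palindrome k = t_pow k + t_pow (- k) - 2"

lemma palindrome_0: "palindrome 0 = 0"
  by (simp add: palindrome_def t_pow_0)

text \<open>By symmetry the coefficients at nonzero exponents agree with those of the sum; the
  constant term is then forced by the value at 1.\<close>

lemma palindromic_expansion:
  assumes f: "eval_one f = 0" "f = t_inverse f" and n: "Poly_Mapping.keys f \<subseteq> {- int n..int n}"
  shows "f = (\<Sum>k=1..n. of_int (Poly_Mapping.lookup f (int k)) * palindrome (int k))"
proof -
  define g where "g = (\<Sum>k=1..n. of_int (Poly_Mapping.lookup f (int k)) * palindrome (int k))"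
  have "2 = (of_int 2 * t_pow 0 :: laurent)" by (simp add: t_pow_0)
  then have two: "Poly_Mapping.lookup (2 :: laurent) z = (if z = 0 then 2 else 0)" for z
    by (simp only: lookup_of_int_mult) (simp add: lookup_one t_pow_def lookup_single when_def)
  have pal: "Poly_Mapping.lookup (palindrome k) z = (if z = k \<or> z = - k then 1 else 0)" if "z \<noteq> 0" for k z
    using that by (auto simp: palindrome_def lookup_add lookup_minus two t_pow_def lookup_single when_def)
  have sym: "Poly_Mapping.lookup f (- z) = Poly_Mapping.lookup f z" for z
    using lookup_t_inverse[of f z] f(2) by simp
  have lg: "Poly_Mapping.lookup g z = Poly_Mapping.lookup f z" if z: "z \<noteq> 0" for z
  proof -
    have "Poly_Mapping.lookup g z = (\<Sum>k=1..n. if k = nat \<bar>z\<bar> then Poly_Mapping.lookup f (int k) else 0)"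
      unfolding g_def lookup_sum lookup_of_int_mult using z by (intro sum.cong refl) (auto simp: pal)
    also have "\<dots> = (if nat \<bar>z\<bar> \<in> {1..n} then Poly_Mapping.lookup f \<bar>z\<bar> else 0)" by simp
    also have "\<dots> = Poly_Mapping.lookup f \<bar>z\<bar>"
    proof -
      have "Poly_Mapping.lookup f \<bar>z\<bar> = 0" if "nat \<bar>z\<bar> \<notin> {1..n}"
        using that z n by (auto simp: in_keys_iff subset_iff)
      then show ?thesis by simp
    qed
    also have "\<dots> = Poly_Mapping.lookup f z" using sym[of z] by (simp add: abs_if)
    finally show ?thesis .
  qed
  have "eval_one g = 0"
    by (simp add: g_def eval_one_sum eval_one_of_int_mult palindrome_def eval_one_diff eval_one_add eval_one_t_pow
        eval_one_superset[of "{0}" 2] two subset_iff in_keys_iff)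
  then have "eval_one (f - g) = 0" using f(1) by (simp add: eval_one_diff)
  moreover have "eval_one (f - g) = Poly_Mapping.lookup (f - g) 0"
  proof (subst eval_one_superset[of "{0}"])
    show "Poly_Mapping.keys (f - g) \<subseteq> {0}" using lg by (force simp: in_keys_iff lookup_minus)
  qed auto
  ultimately have "Poly_Mapping.lookup (f - g) z = 0" for z
    using lg[of z] by (cases "z = 0") (auto simp: lookup_minus)
  then have "f - g = 0" by (intro poly_mapping_eqI) simp
  then show ?thesis by (simp add: g_def)
qed

context realization
begin

text \<open>In F only the pairs of \<open>d\<close> with some \<open>c\<close> survive, once for
  each order, which gives the two powers of a palindrome. In H such a pair yields
  \<open>palindrome (B - ht c) - palindrome B\<close>, and the pair of \<open>d\<close> with itself
  yields \<open>- palindrome B\<close>.\<close>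

lemma polynomials_of_star:
  assumes T: "of_type X ov a = insert d A" "finite A" "d \<notin> A" and lam_d: "lam d = 1"
    and AA: "\<And>c c'. c \<in> A \<Longrightarrow> c' \<in> A \<Longrightarrow> chord_index X lam c c' = 0"
    and Ad: "\<And>c. c \<in> A \<Longrightarrow> chord_index X lam c d = ht c"
    and m: "\<And>c. c \<in> A \<Longrightarrow> total_index X lam c = 0" "total_index X lam d = B"
  shows "F_diagram a a S C = (\<Sum>c\<in>A. of_int (lam c) * palindrome (ht c))"
    "H_diagram a a S C = (\<Sum>c\<in>A. of_int (lam c) * palindrome (B - ht c)) -
       of_int ((\<Sum>c\<in>A. lam c) + 1) * palindrome B"
proof -
  have X: "c \<in> X" if "c \<in> insert d A" for c using that T(1) by (auto simp: of_type_def)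
  have dA: "chord_index X lam d c = - ht c" if "c \<in> A" for c
    using chord_index_swap[of c d] X Ad that by simp
  have dd: "chord_index X lam d d = 0" by (simp add: chord_index_def pairing_self)
  \<comment> \<open>All selected crossings have the same type, so the sign by which
    \<open>chord_sign\<close> differs from \<open>lam\<close> is common to them and cancels in
    products. The result is the same for both types.\<close>
  have sgn: "of_int (chord_sign lam ov c * chord_sign lam ov c') = (of_int (lam c * lam c') :: laurent)"
    if "c \<in> insert d A" "c' \<in> insert d A" for c c'
    using that unfolding T(1)[symmetric] by (auto simp: of_type_def chord_sign_def split: if_splits)
  have G: "gauss_poly G a a X lam ov =
      (\<Sum>c\<in>A. of_int (lam c) * (G (ht c) 0 B + G (- ht c) B 0)) + G 0 B B" if "G 0 0 0 = 0" for G
  proof -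
    have "gauss_poly G a a X lam ov = (\<Sum>c\<in>insert d A. \<Sum>c'\<in>insert d A. of_int (lam c * lam c') *
        G (chord_index X lam c c') (total_index X lam c) (total_index X lam c'))"
      unfolding gauss_poly_def T(1) by (intro sum.cong refl) (simp only: sgn)
    also have "\<dots> = (\<Sum>c\<in>A. of_int (lam c) * G (ht c) 0 B) + ((\<Sum>c\<in>A. of_int (lam c) * G (- ht c) B 0) + G 0 B B)"
      using T(2,3) by (simp add: AA Ad dA dd m that lam_d sum.distrib add.commute)
    finally show ?thesis by (simp add: sum.distrib algebra_simps)
  qed
  show "F_diagram a a S C = (\<Sum>c\<in>A. of_int (lam c) * palindrome (ht c))"
    unfolding F_diagram_gauss_poly
    by (subst G) (simp_all add: F_kernel_def palindrome_def t_pow_0 algebra_simps)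
  have HB: "H_kernel 0 B B = - palindrome B"
    by (simp add: H_kernel_def palindrome_def t_pow_0)
  have "H_kernel (ht c) 0 B + H_kernel (- ht c) B 0 = palindrome (B - ht c) - palindrome B" for c
    by (simp add: H_kernel_def palindrome_def t_pow_0 algebra_simps)
  then have "H_diagram a a S C = (\<Sum>c\<in>A. of_int (lam c) * (palindrome (B - ht c) - palindrome B)) - palindrome B"
    unfolding H_diagram_gauss_poly by (subst G) (simp_all add: HB, simp add: H_kernel_def t_pow_0)
  then show "H_diagram a a S C = (\<Sum>c\<in>A. of_int (lam c) * palindrome (B - ht c)) -
       of_int ((\<Sum>c\<in>A. lam c) + 1) * palindrome B"
    by (simp add: right_diff_distrib sum_subtractf distrib_right sum_distrib_right)
qed

end

section \<open>Circulant tori\<close>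

text \<open>The square grid on the quotient of the plane by the lattice of all \<open>(a, b)\<close> with
  \<open>a + s * b\<close> divisible by \<open>M\<close>: the vertices are the residues modulo \<open>M\<close>, a step east adds 1 and
  a step north adds \<open>s\<close>. Directions are numbered counterclockwise from east.\<close>

locale circulant_torus =
  fixes M s :: int
  assumes M: "0 < M" and s: "0 \<le> s"
begin

definition step :: "nat \<Rightarrow> int" where
  "step d = (if d = 0 then 1 else if d = 1 then s else if d = 2 then - 1 else - s)"

definition dart :: "int \<Rightarrow> nat \<Rightarrow> nat" where "dart y d = 4 * nat (y mod M) + d"

definition turn :: "nat \<Rightarrow> nat" where
  "turn n = (if n < 4 * nat M then dart (int (n div 4)) ((n mod 4 + 1) mod 4) else n)"

definition flip :: "nat \<Rightarrow> nat" where
  "flip n = (if n < 4 * nat M then dart (int (n div 4) + step (n mod 4)) ((n mod 4 + 2) mod 4) else n)"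

definition "torus = Surface {..<4 * nat M} turn flip"

lemma dart_less: "d < 4 \<Longrightarrow> dart y d < 4 * nat M"
proof -
  assume "d < 4"
  moreover have "nat (y mod M) < nat M" using M by simp
  ultimately show ?thesis unfolding dart_def by linarith
qed

lemma dart_div_mod: "d < 4 \<Longrightarrow> dart y d div 4 = nat (y mod M)" "d < 4 \<Longrightarrow> dart y d mod 4 = d"
  by (simp_all add: dart_def)

lemma dart_mod [simp]: "dart (y mod M) d = dart y d"
  by (simp add: dart_def)

lemma dart_mod_add: "dart (y mod M + z) d = dart (y + z) d"
  by (simp add: dart_def mod_simps)

lemma dart_eq_iff: "d < 4 \<Longrightarrow> e < 4 \<Longrightarrow> dart y d = dart z e \<longleftrightarrow> y mod M = z mod M \<and> d = e"
proof -
  assume "d < 4" "e < 4"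
  then have "dart y d = dart z e \<longleftrightarrow> nat (y mod M) = nat (z mod M) \<and> d = e"
    using dart_div_mod by (metis dart_def)
  then show ?thesis using M by (simp add: eq_nat_nat_iff)
qed

lemma is_dart:
  assumes "n < 4 * nat M"
  obtains y d where "d < 4" "n = dart y d"
proof
  show "n mod 4 < 4" by simp
  have "int (n div 4) < M" using assms M by (simp add: zdiv_int)
  then show "n = dart (int (n div 4)) (n mod 4)" by (simp add: dart_def)
qed

lemma turn_dart: "d < 4 \<Longrightarrow> turn (dart y d) = dart y ((d + 1) mod 4)"
  using dart_less[of d y] M by (simp add: turn_def dart_div_mod)

lemma flip_dart: "d < 4 \<Longrightarrow> flip (dart y d) = dart (y + step d) ((d + 2) mod 4)"
  using dart_less[of d y] M by (simp add: flip_def dart_div_mod dart_mod_add)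

lemma turn_simps [simp]: "turn (dart y 0) = dart y (Suc 0)" "turn (dart y (Suc 0)) = dart y 2"
  "turn (dart y 2) = dart y 3" "turn (dart y 3) = dart y 0"
proof -
  have m: "(0 + 1) mod 4 = Suc 0" "(Suc 0 + 1) mod 4 = (2::nat)" "(2 + 1) mod 4 = (3::nat)" "(3 + 1) mod 4 = (0::nat)"
    by simp_all
  show "turn (dart y 0) = dart y (Suc 0)" "turn (dart y (Suc 0)) = dart y 2"
    "turn (dart y 2) = dart y 3" "turn (dart y 3) = dart y 0"
    using turn_dart[of 0 y, unfolded m] turn_dart[of "Suc 0" y, unfolded m]
      turn_dart[of 2 y, unfolded m] turn_dart[of 3 y, unfolded m] by simp_all
qed

lemma flip_simps [simp]: "flip (dart y 0) = dart (y + 1) 2" "flip (dart y (Suc 0)) = dart (y + s) 3"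
  "flip (dart y 2) = dart (y - 1) 0" "flip (dart y 3) = dart (y - s) (Suc 0)"
proof -
  have "0 + 2 = (2::nat)" "Suc 0 + 2 = (3::nat)" "(2::nat) + 2 = 4" "(3::nat) + 2 = 5" by simp_all
  from this[THEN arg_cong[of _ _ "\<lambda>n. n mod 4"]]
  have m: "(0 + 2) mod 4 = (2::nat)" "(Suc 0 + 2) mod 4 = (3::nat)" "(2 + 2) mod 4 = (0::nat)" "(3 + 2) mod 4 = Suc 0"
    by simp_all
  show "flip (dart y 0) = dart (y + 1) 2" "flip (dart y (Suc 0)) = dart (y + s) 3"
    "flip (dart y 2) = dart (y - 1) 0" "flip (dart y 3) = dart (y - s) (Suc 0)"
    using flip_dart[of 0 y, unfolded m] flip_dart[of "Suc 0" y, unfolded m]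
      flip_dart[of 2 y, unfolded m] flip_dart[of 3 y, unfolded m]
    by (simp_all add: step_def)
qed

lemma dart_cases:
  assumes "n < 4 * nat M"
  obtains y where "n = dart y 0" | y where "n = dart y (Suc 0)" | y where "n = dart y 2" | y where "n = dart y 3"
proof -
  obtain y d where d: "d < 4" "n = dart y d" using assms by (rule is_dart)
  then have "d = 0 \<or> d = Suc 0 \<or> d = 2 \<or> d = 3" by linarith
  then show thesis using d that by auto
qed

lemma flip_flip: "flip (flip n) = n"
proof (cases "n < 4 * nat M")
  case True
  then show ?thesis by (cases rule: dart_cases) simp_all
qed (simp add: flip_def)

lemma turn4: "turn (turn (turn (turn n))) = n"
proof (cases "n < 4 * nat M")
  case True
  then show ?thesis by (cases rule: dart_cases) simp_all
qed (simp add: turn_def)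

lemma turn_permutes: "turn permutes {..<4 * nat M}"
  by (rule permutes_if_inverse[of "turn \<circ> turn \<circ> turn"]) (simp_all add: turn4, simp add: turn_def)

lemma flip_permutes: "flip permutes {..<4 * nat M}"
  by (rule permutes_if_inverse[of flip]) (simp_all add: flip_flip, simp add: flip_def)

lemma funpow_turn: "d < 4 \<Longrightarrow> (turn ^^ k) (dart y d) = dart y ((d + k) mod 4)"
proof (induction k)
  case (Suc k)
  then have "(turn ^^ Suc k) (dart y d) = dart y (((d + k) mod 4 + 1) mod 4)" by (simp add: turn_dart)
  also have "((d + k) mod 4 + 1) mod 4 = (d + Suc k) mod 4" by presburger
  finally show ?case .
qed simp

lemma connected_darts:
  assumes "m < 4 * nat M" "n < 4 * nat M"
  shows "(m, n) \<in> ({(x, turn x) |x. True} \<union> {(x, flip x) |x. True})\<^sup>*"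
proof -
  let ?R = "{(x, turn x) |x. True} \<union> {(x, flip x) |x. True}"
  have spin: "(dart y d, dart y ((d + k) mod 4)) \<in> ?R\<^sup>*" if "d < 4" for y d k
  proof (induction k)
    case 0
    then show ?case using that by simp
  next
    case (Suc k)
    have "turn (dart y ((d + k) mod 4)) = dart y (((d + k) mod 4 + 1) mod 4)" by (simp add: turn_dart)
    also have "((d + k) mod 4 + 1) mod 4 = (d + Suc k) mod 4" by presburger
    finally have "(dart y ((d + k) mod 4), dart y ((d + Suc k) mod 4)) \<in> ?R" by force
    then show ?case using Suc by (rule rtrancl_into_rtrancl[rotated])
  qed
  have spin': "(dart y d, dart y e) \<in> ?R\<^sup>*" if "d < 4" "e < 4" for y d e
  proof -
    have "(d + (e + 4 - d)) mod 4 = e" using that by simp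
    then show ?thesis using spin[OF that(1), of y "e + 4 - d"] by simp
  qed
  have east: "(dart y 0, dart (y + int k) 0) \<in> ?R\<^sup>*" for y k
  proof (induction k)
    case (Suc k)
    have "flip (dart (y + int k) 0) = dart (y + int (Suc k)) 2" by (simp add: algebra_simps)
    then have "(dart (y + int k) 0, dart (y + int (Suc k)) 2) \<in> ?R" by force
    with Suc have "(dart y 0, dart (y + int (Suc k)) 2) \<in> ?R\<^sup>*" by (rule rtrancl_into_rtrancl)
    then show ?case using spin'[of 2 0 "y + int (Suc k)"] by (meson rtrancl_trans zero_less_numeral numeral_less_iff semiring_norm(76,78))
  qed simp
  obtain y d where y: "d < 4" "m = dart y d" using assms(1) by (rule is_dart)
  obtain z e where z: "e < 4" "n = dart z e" using assms(2) by (rule is_dart)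
  have "y mod M + int (nat (z mod M + M - y mod M)) = z mod M + M"
  proof -
    have "y mod M \<le> z mod M + M" using pos_mod_sign[OF M, of z] pos_mod_bound[OF M, of y] by linarith
    then show ?thesis by simp
  qed
  then have "dart (y mod M + int (nat (z mod M + M - y mod M))) 0 = dart z 0"
    by (simp add: dart_def)
  then have "(dart y 0, dart z 0) \<in> ?R\<^sup>*"
    using east[of "y mod M" "nat (z mod M + M - y mod M)"] by simp
  then show ?thesis using spin'[OF y(1), of 0 y] spin'[OF _ z(1), of 0 z] y z by (meson rtrancl_trans zero_less_numeral)
qed

lemma closed_torus: "closed_surface torus"
proof -
  have "flip n \<noteq> n" if n: "n < 4 * nat M" for n
    using n by (cases rule: dart_cases) (simp_all add: dart_eq_iff)
  then show ?thesis
    unfolding closed_surface_def torus_def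
    using turn_permutes flip_permutes flip_flip connected_darts M by (auto simp: lessThan_empty_iff)
qed

lemma orbit_finite_order:
  assumes "0 < k" "(f ^^ k) x = x"
  shows "orbit f x = (\<lambda>i. (f ^^ i) x) ` {..<k}"
proof -
  have "(f ^^ i) x \<in> (\<lambda>i. (f ^^ i) x) ` {..<k}" for i
    using funpow_mod_period[OF assms(2), of i] assms(1) by (intro image_eqI[of _ _ "i mod k"]) auto
  moreover have "(f ^^ i) x \<in> orbit f x" for i
  proof (cases "i = 0")
    case True
    have "(f ^^ k) x \<in> orbit f x" using assms(1) unfolding orbit_altdef by blast
    then show ?thesis using True assms(2) by simp
  qed (auto simp: orbit_altdef)
  ultimately show ?thesis by (auto simp: orbit_altdef)
qed

lemma card_orbits:
  assumes f: "f permutes A" "finite A" and k: "0 < k"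
    and per: "\<And>x. x \<in> A \<Longrightarrow> (f ^^ k) x = x \<and> inj_on (\<lambda>i. (f ^^ i) x) {..<k}"
  shows "k * card (orbit f ` A) = card A"
proof -
  have mem: "x \<in> orbit f x" if "x \<in> A" for x
    using orbit_finite_order[OF k, of f x] per[OF that] k by (auto intro!: image_eqI[of _ _ 0])
  have "\<Union> (orbit f ` A) = A"
    using mem permutes_orbit_subset[OF f(1)] by blast
  moreover have "k * card (orbit f ` A) = card (\<Union> (orbit f ` A))"
  proof (rule card_partition)
    show "finite (orbit f ` A)" using f(2) by simp
    show "finite (\<Union> (orbit f ` A))" using calculation f(2) by simp
    show "card c = k" if "c \<in> orbit f ` A" for c
    proof -
      obtain x where x: "x \<in> A" "c = orbit f x" using \<open>c \<in> orbit f ` A\<close> by blast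
      show ?thesis unfolding x(2) using per[OF x(1)] orbit_finite_order[OF k, of f x] by (simp add: card_image)
    qed
    show "c1 \<inter> c2 = {}" if "c1 \<in> orbit f ` A" "c2 \<in> orbit f ` A" "c1 \<noteq> c2" for c1 c2
      using that orbit_eq_of_mem[OF f] by blast
  qed
  ultimately show ?thesis by simp
qed

lemma inj_on_4: "distinct [g 0, g 1, g 2, g 3] \<Longrightarrow> inj_on g {..<4::nat}"
proof -
  assume *: "distinct [g 0, g 1, g 2, g 3]"
  have "{..<4::nat} = {0, 1, 2, 3}" by auto
  then show ?thesis using * by auto
qed

text \<open>With \<open>M\<close> vertices, \<open>2 * M\<close> edges and \<open>M\<close> square
  faces the Euler characteristic is 0.\<close>

lemma genus_torus: "has_genus torus 1"
proof -
  let ?A = "{..<4 * nat M}"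
  have A: "finite ?A" "card ?A = 4 * nat M" by auto
  have four: "(f ^^ 0) x = x" "(f ^^ 1) x = f x" "(f ^^ 2) x = f (f x)" "(f ^^ 3) x = f (f (f x))"
    "(f ^^ 4) x = f (f (f (f x)))" for f :: "nat \<Rightarrow> nat" and x
    by (simp_all add: numeral_2_eq_2 numeral_3_eq_3 eval_nat_numeral)
  have "4 * card (orbit turn ` ?A) = card ?A"
  proof (rule card_orbits[OF turn_permutes A(1)])
    fix x assume "x \<in> ?A"
    then have "x < 4 * nat M" by simp
    then show "(turn ^^ 4) x = x \<and> inj_on (\<lambda>i. (turn ^^ i) x) {..<4}"
      by (cases rule: dart_cases; intro conjI inj_on_4; unfold four; simp add: dart_eq_iff)
  qed simp
  moreover have "2 * card (orbit flip ` ?A) = card ?A"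
  proof (rule card_orbits[OF flip_permutes A(1)])
    fix x assume "x \<in> ?A"
    then have "flip x \<noteq> x" using closed_torus by (auto simp: closed_surface_def torus_def)
    moreover have "{..<2::nat} = {0, 1}" by auto
    ultimately show "(flip ^^ 2) x = x \<and> inj_on (\<lambda>i. (flip ^^ i) x) {..<2}"
      by (auto simp: flip_flip numeral_2_eq_2)
  qed simp
  moreover have "4 * card (orbit (turn \<circ> flip) ` ?A) = card ?A"
  proof (rule card_orbits[OF permutes_compose[OF flip_permutes turn_permutes] A(1)])
    fix x assume "x \<in> ?A"
    then have "x < 4 * nat M" by simp
    then show "((turn \<circ> flip) ^^ 4) x = x \<and> inj_on (\<lambda>i. ((turn \<circ> flip) ^^ i) x) {..<4}"
      by (cases rule: dart_cases; intro conjI inj_on_4; unfold four comp_apply; simp add: dart_eq_iff)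
  qed simp
  ultimately show ?thesis
    unfolding has_genus_def euler_char_def torus_def A(2) by simp
qed

lemma vertex_dart: "d < 4 \<Longrightarrow> vertex torus (dart y d) = dart y ` {..<4}"
proof -
  assume d: "d < 4"
  have "orbit turn (dart y d) = (\<lambda>i. (turn ^^ i) (dart y d)) ` {..<4}"
    by (rule orbit_finite_order) (use d in \<open>simp_all add: funpow_turn\<close>)
  also have "\<dots> = dart y ` ((\<lambda>i. (d + i) mod 4) ` {..<4})" using d by (simp add: funpow_turn image_image)
  also have "(\<lambda>i. (d + i) mod 4) ` {..<4} = {..<4}"
  proof -
    have "e \<in> (\<lambda>i. (d + i) mod 4) ` {..<4}" if "e < 4" for e
      using d that by (intro image_eqI[of _ _ "(e + 4 - d) mod 4"]) (auto simp: mod_simps)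
    then show ?thesis by auto
  qed
  finally show ?thesis by (simp add: vertex_def torus_def)
qed

lemma vertex_dart_eq: "d < 4 \<Longrightarrow> e < 4 \<Longrightarrow> vertex torus (dart y d) = vertex torus (dart z e) \<longleftrightarrow> y mod M = z mod M"
proof -
  assume de: "d < 4" "e < 4"
  have "dart y 0 \<in> dart z ` {..<4} \<longleftrightarrow> y mod M = z mod M"
    by (auto simp: dart_eq_iff intro!: image_eqI[of _ _ 0])
  moreover have "dart y ` {..<4} = dart z ` {..<4}" if "y mod M = z mod M"
    using that by (auto simp: dart_def)
  ultimately show ?thesis using de by (auto simp: vertex_dart)
qed

text \<open>The sector from a dart to itself is a full turn and contains the three other darts,
  hence the exceptional value 4.\<close>

lemma sector_dart:
  assumes "a < 4" "e < 4"
  shows "sector torus (dart y a) (dart y e) = (\<lambda>k. dart y ((a + k) mod 4)) ` {k. 0 < k \<and> k < (if e = a then 4 else (e + 4 - a) mod 4)}"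
proof -
  let ?m = "if e = a then 4 else (e + 4 - a) mod 4"
  have hit: "(a + l) mod 4 = e \<longleftrightarrow> l = ?m" if "0 < l" "l \<le> ?m" for l
  proof -
    have "a \<in> {0, 1, 2, 3}" "e \<in> {0, 1, 2, 3}" using assms by auto
    moreover have "?m \<le> 4" by simp
    then have "l \<in> {1, 2, 3, 4}" using that by auto
    ultimately show ?thesis using that by (elim insertE emptyE; simp)
  qed
  have m: "0 < ?m"
  proof -
    have "a \<in> {0, 1, 2, 3}" "e \<in> {0, 1, 2, 3}" using assms by auto
    then show ?thesis by (elim insertE emptyE; simp)
  qed
  have "(\<forall>l\<in>{1..k}. (a + l) mod 4 \<noteq> e) \<longleftrightarrow> k < ?m" for k
  proof
    assume *: "\<forall>l\<in>{1..k}. (a + l) mod 4 \<noteq> e"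
    show "k < ?m"
    proof (rule ccontr)
      assume "\<not> k < ?m"
      then have "?m \<in> {1..k}" using m by simp
      then show False using * hit[of ?m] m by blast
    qed
  next
    assume "k < ?m"
    then show "\<forall>l\<in>{1..k}. (a + l) mod 4 \<noteq> e"
    proof (intro ballI)
      fix l assume "l \<in> {1..k}"
      then show "(a + l) mod 4 \<noteq> e" using hit[of l] \<open>k < ?m\<close> by auto
    qed
  qed
  moreover have "dart y ((a + l) mod 4) \<noteq> dart y e \<longleftrightarrow> (a + l) mod 4 \<noteq> e" for l
    using assms by (simp add: dart_eq_iff)
  ultimately show ?thesis
    using assms by (auto simp: sector_def torus_def funpow_turn image_def)
qed

end

section \<open>Intersection numbers of walks on the torus\<close>

lemma count_list_map_upt:
  "int (count_list (map f [i..<j]) x) = (\<Sum>t\<in>{i..<j}. if f t = x then 1 else 0)"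
proof (induction j)
  case (Suc j)
  then show ?case by (cases "i \<le> j") (auto simp: atLeastLessThanSuc)
qed simp

lemma int_primitive:
  fixes f :: "int \<Rightarrow> int"
  shows "\<exists>g. \<forall>y. g y - g (y - 1) = f y"
proof -
  define g where "g y = (if 0 \<le> y then \<Sum>x\<in>{1..y}. f x else - (\<Sum>x\<in>{y + 1..0}. f x))" for y
  have "g y - g (y - 1) = f y" for y
  proof -
    consider "1 \<le> y" | "y = 0" | "y < 0" by linarith
    then show ?thesis
    proof cases
      case 1
      then have "{1..y} = insert y {1..y - 1}" by auto
      then show ?thesis using 1 by (simp add: g_def)
    next
      case 2
      then show ?thesis by (simp add: g_def)
    next
      case 3
      then have "{y..0} = insert y {y + 1..0}" by auto
      then show ?thesis using 3 by (simp add: g_def)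
    qed
  qed
  then show ?thesis by blast
qed

lemma div_diff_one: "0 < (m::int) \<Longrightarrow> z div m - (z - 1) div m = (if m dvd z then 1 else 0)"
proof -
  assume m: "0 < m"
  define q r where "q = z div m" "r = z mod m"
  have z: "z = m * q + r" "0 \<le> r" "r < m" using m by (auto simp: q_r_def)
  show ?thesis
  proof (cases "r = 0")
    case True
    have "z - 1 = m * (q - 1) + (m - 1)" using z(1) True by (simp add: algebra_simps)
    then have "(z - 1) div m = q - 1" using m int_div_pos_eq[of "z - 1" m "q - 1" "m - 1"] by simp
    moreover have "m dvd z" using z(1) True by simp
    ultimately show ?thesis by (simp add: q_r_def)
  next
    case False
    have "z - 1 = m * q + (r - 1)" using z(1) by simp
    then have "(z - 1) div m = q" using z(2,3) False int_div_pos_eq[of "z - 1" m q "r - 1"] by simp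
    moreover have "\<not> m dvd z" using False by (simp add: q_r_def dvd_eq_mod_eq_0)
    ultimately show ?thesis by (simp add: q_r_def)
  qed
qed

text \<open>\<open>pos\<close> is the image of a lift to the plane under the map from
  \<open>(a, b)\<close> to \<open>a + s * b\<close>. If it changes by \<open>M * om\<close> and the
  walk rises by \<open>north\<close>, then \<open>om\<close> and \<open>north\<close> are the
  coordinates of the homology class in the lattice basis \<open>(M, 0)\<close>,
  \<open>(- s, 1)\<close>.\<close>

locale lifted_walk = circulant_torus +
  fixes pos :: "nat \<Rightarrow> int" and dir :: "nat \<Rightarrow> nat" and len :: nat
  assumes dir4: "\<And>t. t < len \<Longrightarrow> dir t < 4"
    and pos_Suc: "\<And>t. t < len \<Longrightarrow> pos (Suc t) = pos t + step (dir t)"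
begin

definition seg :: "nat \<Rightarrow> nat \<Rightarrow> nat list" where
  "seg i j = map (\<lambda>t. dart (pos t) (dir t)) [i..<j]"

definition north :: "nat \<Rightarrow> nat \<Rightarrow> int" where
  "north i j = (\<Sum>t\<in>{i..<j}. if dir t = 1 then 1 else if dir t = 3 then - 1 else 0)"

definition hit :: "int \<Rightarrow> int \<Rightarrow> int" where "hit p y = (if p mod M = y mod M then 1 else 0)"

lemma dir_cases: "t < len \<Longrightarrow> dir t = 0 \<or> dir t = 1 \<or> dir t = 2 \<or> dir t = 3"
  using dir4[of t] by linarith

lemma flip_seg: "t < len \<Longrightarrow> flip (dart (pos t) (dir t)) = dart (pos (Suc t)) ((dir t + 2) mod 4)"
  using flip_dart[OF dir4] pos_Suc by simp

lemma flow_seg: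
  assumes "j \<le> len" "d < 4"
  shows "flow torus (seg i j) (dart y d) = (\<Sum>t\<in>{i..<j}. (if dir t = d then hit (pos t) y else 0) -
     (if (dir t + 2) mod 4 = d then hit (pos (Suc t)) y else 0))"
proof -
  have 1: "(if dart (pos t) (dir t) = dart y d then 1 else 0) = (if dir t = d then hit (pos t) y else 0)"
    if "t \<in> {i..<j}" for t
    using that assms dir4[of t] by (auto simp: dart_eq_iff hit_def)
  have 2: "(if dart (pos t) (dir t) = flip (dart y d) then 1 else 0) =
      (if (dir t + 2) mod 4 = d then hit (pos (Suc t)) y else 0)" if "t \<in> {i..<j}" for t
  proof -
    have "dart (pos t) (dir t) = flip (dart y d) \<longleftrightarrow> flip (dart (pos t) (dir t)) = dart y d"
      using flip_flip by metis
    also have "\<dots> \<longleftrightarrow> pos (Suc t) mod M = y mod M \<and> (dir t + 2) mod 4 = d"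
      using that assms flip_seg[of t] by (simp add: dart_eq_iff)
    finally show ?thesis by (auto simp: hit_def)
  qed
  have "flow torus (seg i j) (dart y d) =
    (\<Sum>t\<in>{i..<j}. if dart (pos t) (dir t) = dart y d then 1 else 0) -
    (\<Sum>t\<in>{i..<j}. if dart (pos t) (dir t) = flip (dart y d) then 1 else 0)"
    unfolding flow_def seg_def count_list_map_upt by (simp add: torus_def)
  also have "\<dots> = (\<Sum>t\<in>{i..<j}. (if dir t = d then hit (pos t) y else 0) -
     (if (dir t + 2) mod 4 = d then hit (pos (Suc t)) y else 0))"
    unfolding sum_subtractf using 1 2 by (intro arg_cong2[of _ _ _ _ "(-)"] sum.cong) auto
  finally show ?thesis .
qed

lemma flow_east_north:
  assumes "j \<le> len"
  shows "flow torus (seg i j) (dart y 0) =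
      (\<Sum>t\<in>{i..<j}. if dir t = 0 then hit (pos t) y else if dir t = 2 then - hit (pos (Suc t)) y else 0)"
    "flow torus (seg i j) (dart y 1) =
      (\<Sum>t\<in>{i..<j}. if dir t = 1 then hit (pos t) y else if dir t = 3 then - hit (pos (Suc t)) y else 0)"
proof -
  have "dir t = 0 \<or> dir t = 1 \<or> dir t = 2 \<or> dir t = 3" if "t \<in> {i..<j}" for t
    using dir_cases[of t] that assms by auto
  then show "flow torus (seg i j) (dart y 0) =
      (\<Sum>t\<in>{i..<j}. if dir t = 0 then hit (pos t) y else if dir t = 2 then - hit (pos (Suc t)) y else 0)"
    "flow torus (seg i j) (dart y 1) =
      (\<Sum>t\<in>{i..<j}. if dir t = 1 then hit (pos t) y else if dir t = 3 then - hit (pos (Suc t)) y else 0)"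
    using assms by (subst flow_seg; force intro!: sum.cong)+
qed

lemma hit_shift: "hit p (y - z) = hit (p + z) y"
  by (auto simp: hit_def mod_eq_dvd_iff algebra_simps)

text \<open>Up to a constant, \<open>(p - 1 - y) div M\<close> counts the integers below
  \<open>p\<close> that are congruent to \<open>y\<close>.\<close>

lemma threshold_one: "(p + 1 - 1 - y) div M - (p - 1 - y) div M = hit p y"
  using div_diff_one[OF M, of "p - y"] by (simp add: hit_def mod_eq_dvd_iff algebra_simps)

lemma threshold: "(p + int n - 1 - y) div M - (p - 1 - y) div M = (\<Sum>k<n. hit p (y - int k))"
proof (induction n)
  case (Suc n)
  have "(p + int (Suc n) - 1 - y) div M - (p + int n - 1 - y) div M = hit p (y - int n)"
    using threshold_one[of "p + int n" y] unfolding hit_shift by (simp add: algebra_simps)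
  then show ?case using Suc by simp
qed simp

text \<open>The flux through the cut along a vertical edge and the \<open>s\<close> horizontal edges before it is
  the winding number: every lift of the walk crosses the thresholds congruent to \<open>y\<close>.\<close>

lemma flux:
  assumes j: "i \<le> j" "j \<le> len" and om: "pos j = pos i + M * om"
  shows "flow torus (seg i j) (dart y 0) + (\<Sum>k<nat s. flow torus (seg i j) (dart (y - int k) 1)) = om"
proof -
  let ?c = "\<lambda>p. (p - 1 - y) div M"
  have stp: "(if dir t = 0 then hit (pos t) y else if dir t = 2 then - hit (pos (Suc t)) y else 0) +
     (\<Sum>k<nat s. if dir t = 1 then hit (pos t) (y - int k) else if dir t = 3 then - hit (pos (Suc t)) (y - int k) else 0) =
     ?c (pos (Suc t)) - ?c (pos t)" if t: "t \<in> {i..<j}" for t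
  proof -
    have P: "pos (Suc t) = pos t + step (dir t)" using pos_Suc t j by simp
    consider "dir t = 0" | "dir t = 1" | "dir t = 2" | "dir t = 3" using dir_cases[of t] t j by auto
    then show ?thesis
    proof cases
      case 1
      then show ?thesis using threshold_one[of "pos t" y] P by (simp add: step_def)
    next
      case 2
      then show ?thesis using threshold[of "pos t" "nat s" y] P s by (simp add: step_def)
    next
      case 3
      then show ?thesis using threshold_one[of "pos (Suc t)" y] P by (simp add: step_def)
    next
      case 4
      then show ?thesis using threshold[of "pos (Suc t)" "nat s" y] P s by (simp add: step_def sum_negf)
    qed
  qed
  have "flow torus (seg i j) (dart y 0) + (\<Sum>k<nat s. flow torus (seg i j) (dart (y - int k) 1)) =
    (\<Sum>t\<in>{i..<j}. ?c (pos (Suc t)) - ?c (pos t))"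
    unfolding flow_east_north[OF j(2)]
    by (subst sum.swap, subst sum.distrib[symmetric]) (use stp in \<open>auto intro!: sum.cong\<close>)
  also have "\<dots> = ?c (pos j) - ?c (pos i)" by (rule sum_Suc_diff'[OF j(1)])
  also have "\<dots> = om"
  proof -
    have e: "pos j - 1 - y = pos i - 1 - y + M * om" using om by simp
    show ?thesis unfolding e using M by simp
  qed
  finally show ?thesis .
qed

lemma hit_period: "(\<Sum>k<nat M. hit p (z + int k)) = 1"
proof -
  have "hit p (z + int k) = (if k = nat ((p - z) mod M) then 1 else 0)" if "k < nat M" for k
  proof -
    have k: "int k mod M = int k" using that M by simp
    have "p mod M = (z + int k) mod M \<longleftrightarrow> (p - z) mod M = int k mod M"
      by (simp add: mod_eq_dvd_iff algebra_simps)
    also have "\<dots> \<longleftrightarrow> k = nat ((p - z) mod M)" unfolding k using M by auto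
    finally show ?thesis by (simp add: hit_def)
  qed
  then have "(\<Sum>k<nat M. hit p (z + int k)) = (\<Sum>k<nat M. if k = nat ((p - z) mod M) then 1 else 0)"
    by (intro sum.cong) auto
  also have "\<dots> = 1" using M by simp
  finally show ?thesis .
qed

text \<open>A line of \<open>M\<close> steps to the east closes up and cuts the edges going north
  from all residues, so the flux through it counts the steps to the north.\<close>

lemma flux_period:
  assumes "j \<le> len"
  shows "(\<Sum>k<nat M. flow torus (seg i j) (dart (z + int k) 1)) = north i j"
proof -
  have "(\<Sum>k<nat M. flow torus (seg i j) (dart (z + int k) 1)) =
    (\<Sum>t\<in>{i..<j}. \<Sum>k<nat M. if dir t = 1 then hit (pos t) (z + int k) else if dir t = 3 then - hit (pos (Suc t)) (z + int k) else 0)"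
    unfolding flow_east_north[OF assms] by (rule sum.swap)
  also have "\<dots> = north i j"
    unfolding north_def by (rule sum.cong) (auto simp: hit_period sum_negf)
  finally show ?thesis .
qed

text \<open>\<open>Psi d\<close> is the value of a potential on the face that follows the direction
  \<open>d\<close> counterclockwise, and \<open>F\<close> is its difference across a dart. The sum
  over a sector telescopes.\<close>

lemma sum_sector:
  fixes F :: "nat \<Rightarrow> int" and Psi :: "nat \<Rightarrow> int"
  assumes F: "\<And>d. d < 4 \<Longrightarrow> F (dart y d) = Psi ((d + 3) mod 4) - Psi d" and ae: "a < 4" "e < 4"
  shows "(\<Sum>d\<in>sector torus (dart y a) (dart y e). F d) = Psi a - Psi ((e + 3) mod 4)"
proof -
  have F4: "F (dart y 0) = Psi 3 - Psi 0" "F (dart y (Suc 0)) = Psi 0 - Psi (Suc 0)"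
    "F (dart y 2) = Psi (Suc 0) - Psi 2" "F (dart y 3) = Psi 2 - Psi 3"
    using F[of 0] F[of 1] F[of 2] F[of 3] by simp_all
  have F2: "F (dart y (Suc (Suc 0))) = Psi (Suc 0) - Psi 2" using F4(3) by (simp add: numeral_2_eq_2)
  have I: "{k. 0 < k \<and> k < Suc 0} = {}" "{k. 0 < k \<and> k < (2::nat)} = {1}" "{k. 0 < k \<and> k < (3::nat)} = {1, 2}"
    "{k. 0 < k \<and> k < (4::nat)} = {1, 2, 3}"
    "{k. k = 0 \<and> 0 < (k::nat)} = {}" by auto
  have "a \<in> {0, 1, 2, 3}" "e \<in> {0, 1, 2, 3}" using ae by auto
  then show ?thesis
    unfolding sector_dart[OF ae]
    by (elim insertE emptyE; simp add: I F4 F2 dart_eq_iff)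
qed

text \<open>The determinant of the two homology classes in the basis \<open>(M, 0)\<close>,
  \<open>(- s, 1)\<close>. The flow of the second walk is the difference of a potential on the
  lifted faces; summing it along the left side of the first walk telescopes, and only the periods of
  the potential remain.\<close>

theorem intersection_seg:
  assumes v: "i < j" "j \<le> len" "pos j = pos i + M * om" and w: "i' \<le> j'" "j' \<le> len" "pos j' = pos i' + M * om'"
  shows "intersection torus (seg i j) (seg i' j') = om * north i' j' - om' * north i j"
proof -
  let ?F = "flow torus (seg i' j')"
  \<comment> \<open>The potential on the face to the upper right of \<open>y\<close>. It is fixed by
    the flow through the edges going north, up to a constant that does not matter.\<close>
  obtain psi :: "int \<Rightarrow> int" where psi: "\<And>y. psi y - psi (y - 1) = ?F (dart y 1)"
    using int_primitive[of "\<lambda>y. ?F (dart y 1)"] by blast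
  have psi_n: "psi y - psi (y - int n) = (\<Sum>k<n. ?F (dart (y - int k) 1))" for y n
  proof (induction n)
    case (Suc n)
    then show ?case using psi[of "y - int n"] by (simp add: algebra_simps)
  qed simp
  have psi_s: "psi y - psi (y - s) = om' - ?F (dart y 0)" for y
    using psi_n[of y "nat s"] flux[OF w, of y] s by simp
  let ?Q = "north i' j'"
  have psi_M: "psi (y + M) = psi y + ?Q" for y
  proof -
    have "psi (y + int n) - psi y = (\<Sum>k<n. ?F (dart (y + 1 + int k) 1))" for n
    proof (induction n)
      case (Suc n)
      then show ?case using psi[of "y + 1 + int n"] by (simp add: algebra_simps)
    qed simp
    from this[of "nat M"] show ?thesis using flux_period[OF w(2), of i' "y + 1"] M by simp
  qed
  have psi_mult: "psi (y + M * z) = psi y + ?Q * z" for y z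
  proof (induction z arbitrary: y rule: int_induct[of _ 0])
    case (step1 z)
    then show ?case using psi_M[of "y + M * z"] by (simp add: algebra_simps)
  next
    case (step2 z)
    then show ?case using psi_M[of "y + M * (z - 1)"] by (simp add: algebra_simps)
  qed simp
  \<comment> \<open>The potential on the four faces around \<open>y\<close>, counterclockwise from
    the upper right. By \<open>psi_s\<close> a function of \<open>y\<close> alone fails by the
    winding number \<open>om'\<close> across horizontal edges, which is added for the two lower
    faces.\<close>
  define Psi where "Psi y d = (if d = 0 then psi y else if d = 1 then psi (y - 1)
      else if d = 2 then psi (y - 1 - s) + om' else psi (y - s) + om')" for y and d :: nat
  have Fopp: "?F (flip d) = - ?F d" for d
    by (simp add: flow_def torus_def flip_flip)
  have F: "?F (dart y d) = Psi y ((d + 3) mod 4) - Psi y d" if "d < 4" for y d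
  proof -
    have "?F (dart y 0) = psi (y - s) + om' - psi y" using psi_s[of y] by simp
    moreover have "?F (dart y (Suc 0)) = psi y - psi (y - 1)" using psi[of y] by simp
    moreover have "?F (dart y 2) = psi (y - 1) - (psi (y - 1 - s) + om')"
      using Fopp[of "dart (y - 1) 0"] psi_s[of "y - 1"] by simp
    moreover have "?F (dart y 3) = psi (y - 1 - s) - psi (y - s)"
      using Fopp[of "dart (y - s) 1"] psi[of "y - s"] by (simp add: algebra_simps)
    moreover have "d = 0 \<or> d = Suc 0 \<or> d = 2 \<or> d = 3" using that by linarith
    ultimately show ?thesis by (auto simp: Psi_def)
  qed
  have Psi_mult: "Psi (y + M * z) d = Psi y d + ?Q * z" for y z d
    using psi_mult[of y z] psi_mult[of "y - 1" z] psi_mult[of "y - 1 - s" z] psi_mult[of "y - s" z]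
    by (simp add: Psi_def algebra_simps)
  define v where "v = seg i j"
  define n where "n = j - i"
  have n: "0 < n" "i + n = j" using v by (auto simp: n_def)
  have len_v: "length v = n" and nth: "\<And>k. k < n \<Longrightarrow> v ! k = dart (pos (i + k)) (dir (i + k))"
    by (auto simp: v_def seg_def n_def)
  \<comment> \<open>Direction of arrival; the walk closes up, so the first vertex is reached by the
    last step.\<close>
  define arr where "arr k = (if k = 0 then dir (j - 1) else dir (i + k - 1))" for k
  have arr4: "arr k < 4" if "k < n" for k
    using that v n by (auto simp: arr_def intro!: dir4)
  have inc: "incoming torus v k = dart (pos (i + k)) ((arr k + 2) mod 4)" if k: "k < n" for k
  proof (cases "k = 0")
    case True
    have "incoming torus v k = flip (v ! (n - 1))" using True n by (simp add: incoming_def len_v torus_def)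
    also have "\<dots> = flip (dart (pos (j - 1)) (dir (j - 1)))" using nth[of "n - 1"] n by simp
    also have "\<dots> = dart (pos j) ((dir (j - 1) + 2) mod 4)" using flip_seg[of "j - 1"] v by simp
    also have "\<dots> = dart (pos i) ((dir (j - 1) + 2) mod 4)" using v(3) by (simp add: dart_def)
    finally show ?thesis using True by (simp add: arr_def)
  next
    case False
    then have "(k + n - 1) mod n = k - 1" using k by (simp add: mod_if)
    then have "incoming torus v k = flip (v ! (k - 1))" by (simp add: incoming_def len_v torus_def)
    also have "\<dots> = flip (dart (pos (i + k - 1)) (dir (i + k - 1)))" using nth[of "k - 1"] k False by simp
    also have "\<dots> = dart (pos (i + k)) ((dir (i + k - 1) + 2) mod 4)" using flip_seg[of "i + k - 1"] k False v n by simp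
    finally show ?thesis using False by (simp add: arr_def)
  qed
  have left: "(\<Sum>d\<in>left_darts torus v k. ?F d) = Psi (pos (i + k)) (dir (i + k)) - Psi (pos (i + k)) ((arr k + 1) mod 4)"
    if k: "k < n" for k
  proof -
    have d4: "dir (i + k) < 4" using k v n by (intro dir4) simp
    have "((arr k + 2) mod 4 + 3) mod 4 = (arr k + 1) mod 4" by presburger
    then show ?thesis
      unfolding left_darts_def nth[OF k] inc[OF k]
      using sum_sector[of ?F "pos (i + k)" "Psi (pos (i + k))" "dir (i + k)" "(arr k + 2) mod 4"] F d4 by simp
  qed
  \<comment> \<open>Reindexes the faces by the step that arrives at them. The closing step ends at
    the lift \<open>pos j\<close> instead of \<open>pos i\<close>, which costs one period for each
    winding.\<close>
  have shift: "(\<Sum>k<n. Psi (pos (i + k)) ((arr k + 1) mod 4)) =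
      (\<Sum>k<n. Psi (pos (Suc (i + k))) ((dir (i + k) + 1) mod 4)) - ?Q * om"
  proof -
    obtain n' where n': "n = Suc n'" using n(1) by (cases n) auto
    have "(\<Sum>k<n. Psi (pos (i + k)) ((arr k + 1) mod 4)) =
       Psi (pos i) ((dir (j - 1) + 1) mod 4) + (\<Sum>k<n'. Psi (pos (Suc (i + k))) ((dir (i + k) + 1) mod 4))"
      unfolding n' sum.lessThan_Suc_shift by (simp add: arr_def)
    moreover have "(\<Sum>k<n. Psi (pos (Suc (i + k))) ((dir (i + k) + 1) mod 4)) =
      (\<Sum>k<n'. Psi (pos (Suc (i + k))) ((dir (i + k) + 1) mod 4)) + Psi (pos j) ((dir (j - 1) + 1) mod 4)"
    proof -
      have "j - 1 = i + n'" using n n' by simp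
      then show ?thesis using n n' by simp
    qed
    moreover have "Psi (pos j) ((dir (j - 1) + 1) mod 4) = Psi (pos i) ((dir (j - 1) + 1) mod 4) + ?Q * om"
      unfolding v(3) by (rule Psi_mult)
    ultimately show ?thesis by simp
  qed
  \<comment> \<open>The face ahead on the left at time \<open>t\<close> is the face behind on the
    left at time \<open>t + 1\<close>. Its two values differ only for vertical steps, by the
    correction \<open>om'\<close>.\<close>
  have per: "Psi (pos t) (dir t) - Psi (pos (Suc t)) ((dir t + 1) mod 4) =
      - om' * (if dir t = 1 then 1 else if dir t = 3 then - 1 else 0)" if "t < len" for t
    using dir_cases[OF that] pos_Suc[OF that] by (auto simp: Psi_def step_def)
  have "intersection torus v (seg i' j') = (\<Sum>k<n. \<Sum>d\<in>left_darts torus v k. ?F d)"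
    by (simp add: intersection_def len_v)
  also have "\<dots> = (\<Sum>k<n. Psi (pos (i + k)) (dir (i + k)) - Psi (pos (Suc (i + k))) ((dir (i + k) + 1) mod 4)) + ?Q * om"
    using left shift by (simp add: sum_subtractf)
  also have "(\<Sum>k<n. Psi (pos (i + k)) (dir (i + k)) - Psi (pos (Suc (i + k))) ((dir (i + k) + 1) mod 4)) =
      (\<Sum>k<n. - om' * (if dir (i + k) = 1 then 1 else if dir (i + k) = 3 then - 1 else 0))"
    using v n by (intro sum.cong per) auto
  also have "\<dots> = - om' * north i j"
    unfolding sum_distrib_left[symmetric] north_def n_def
    by (intro arg_cong2[of _ _ _ _ "(*)"] refl sum.reindex_bij_witness[of _ "\<lambda>t. t - i" "\<lambda>k. i + k"]) (use v in auto)
  finally show ?thesis by (simp add: v_def algebra_simps)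
qed

lemma closed_walk_seg:
  assumes "0 < len" "pos len mod M = pos 0 mod M"
  shows "closed_walk torus (seg 0 len)"
  unfolding closed_walk_def
proof (intro conjI allI impI)
  show "seg 0 len \<noteq> []" using assms by (simp add: seg_def)
  show "set (seg 0 len) \<subseteq> darts torus" using dir4 dart_less by (auto simp: seg_def torus_def)
  fix i assume "i < length (seg 0 len)"
  then have i: "i < len" by (simp add: seg_def)
  have o: "opp torus (seg 0 len ! i) = dart (pos (Suc i)) ((dir i + 2) mod 4)"
    using i flip_seg[OF i] by (simp add: seg_def torus_def)
  have nx: "seg 0 len ! (Suc i mod length (seg 0 len)) = dart (pos (Suc i mod len)) (dir (Suc i mod len))"
    using i by (simp add: seg_def)
  have "pos (Suc i mod len) mod M = pos (Suc i) mod M"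
    using i assms by (cases "Suc i = len") auto
  then show "vertex torus (opp torus (seg 0 len ! i)) = vertex torus (seg 0 len ! (Suc i mod length (seg 0 len)))"
    unfolding o nx using i dir4[of "Suc i mod len"] by (subst vertex_dart_eq) auto
qed

definition before :: "nat \<Rightarrow> nat" where "before t = dir (if t = 0 then len - 1 else t - 1)"

lemma incoming_seg:
  assumes "pos len mod M = pos 0 mod M" "t < len"
  shows "incoming torus (seg 0 len) t = dart (pos t) ((before t + 2) mod 4)"
proof -
  have "(t + len - 1) mod len = (if t = 0 then len - 1 else t - 1)" using assms(2) by (auto simp: mod_if)
  then have "incoming torus (seg 0 len) t = flip (dart (pos (if t = 0 then len - 1 else t - 1)) (before t))"
    using assms(2) nth_upt[of 0 "t - 1" len]
    by (cases "t = 0") (simp_all add: incoming_def seg_def torus_def before_def)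
  also have "\<dots> = dart (if t = 0 then pos len else pos t) ((before t + 2) mod 4)"
    using flip_seg[of "if t = 0 then len - 1 else t - 1"] assms(2) by (auto simp: before_def)
  finally show ?thesis using assms(1) by (auto simp: dart_def)
qed

section \<open>Diagrams on the grid of the torus\<close>

definition horizontal :: "nat \<Rightarrow> bool" where "horizontal t \<longleftrightarrow> even (dir t) \<or> even (before t)"
definition vertical :: "nat \<Rightarrow> bool" where "vertical t \<longleftrightarrow> odd (dir t) \<or> odd (before t)"

end

text \<open>A vertex may be used once horizontally and once vertically, and a corner uses up both.
  So all coincidences are transversal crossings of straight passages, and the basepoint, being a
  corner, is not one of them.\<close>

locale grid_diagram = lifted_walk +
  assumes closed: "0 < len" "pos len mod M = pos 0 mod M"
    and straight: "\<And>t. t < len \<Longrightarrow> even (dir t) = even (before t) \<Longrightarrow> dir t = before t"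
    and hor: "\<And>t t'. t < len \<Longrightarrow> t' < len \<Longrightarrow> horizontal t \<Longrightarrow> horizontal t' \<Longrightarrow> pos t mod M = pos t' mod M \<Longrightarrow> t = t'"
    and ver: "\<And>t t'. t < len \<Longrightarrow> t' < len \<Longrightarrow> vertical t \<Longrightarrow> vertical t' \<Longrightarrow> pos t mod M = pos t' mod M \<Longrightarrow> t = t'"
    and corner: "horizontal 0" "vertical 0"
begin

lemma surface_diagram_seg:
  assumes ov: "\<forall>i j. i < j \<longrightarrow> j < len \<longrightarrow> pos i mod M = pos j mod M \<longrightarrow> (i \<in> ov) \<noteq> (j \<in> ov)"
  shows "surface_diagram torus (Surface_Curve (seg 0 len) ov)"
    and "curve_crossings torus (Surface_Curve (seg 0 len) ov) =
      {(i, j). i < j \<and> j < len \<and> pos i mod M = pos j mod M}"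
    and "i < j \<Longrightarrow> j < len \<Longrightarrow> pos i mod M = pos j mod M \<Longrightarrow>
      seg 0 len ! j \<in> left_darts torus (seg 0 len) i \<longleftrightarrow> dir j = (dir i + 1) mod 4"
proof -
  let ?w = "seg 0 len"
  have nth: "?w ! t = dart (pos t) (dir t)" if "t < len" for t using that by (simp add: seg_def)
  have lenw: "length ?w = len" by (simp add: seg_def)
  have b4: "before t < 4" if "t < len" for t using that by (auto simp: before_def intro!: dir4)
  have vert: "vertex torus (?w ! i) = vertex torus (?w ! j) \<longleftrightarrow> pos i mod M = pos j mod M"
    if "i < len" "j < len" for i j
    using that dir4 by (simp add: nth vertex_dart_eq)
  show cc: "curve_crossings torus (Surface_Curve ?w ov) = {(i, j). i < j \<and> j < len \<and> pos i mod M = pos j mod M}"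
  proof -
    have "i < j \<and> j < len \<and> vertex torus (?w ! i) = vertex torus (?w ! j) \<longleftrightarrow>
      i < j \<and> j < len \<and> pos i mod M = pos j mod M" for i j
      using vert[of i j] by (cases "i < j \<and> j < len") auto
    then show ?thesis unfolding curve_crossings_def surface_curve.sel lenw by simp
  qed
  have either: "horizontal t \<or> vertical t" for t by (auto simp: horizontal_def vertical_def)
  have excl: "(even (dir i) \<and> even (before i) \<and> odd (dir j) \<and> odd (before j) \<or>
      odd (dir i) \<and> odd (before i) \<and> even (dir j) \<and> even (before j)) \<and> dir i = before i \<and> dir j = before j"
    if "i \<noteq> j" "i < len" "j < len" "pos i mod M = pos j mod M" for i j
  proof -
    have "\<not> (horizontal i \<and> horizontal j)" "\<not> (vertical i \<and> vertical j)"
      using hor[of i j] ver[of i j] that by auto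
    then show ?thesis
      using straight[of i] straight[of j] that either[of i] either[of j]
      by (auto simp: horizontal_def vertical_def)
  qed
  have ld: "left_darts torus ?w i = {dart (pos i) ((dir i + 1) mod 4)}"
    if i: "i < len" and b: "before i = dir i" for i
  proof -
    have "dir i \<in> {0, 1, 2, 3}" using dir_cases[OF i] by auto
    moreover have "{k. 0 < k \<and> k < (2::nat)} = {1}" by auto
    moreover have "((dir i + 2) mod 4 + 4 - dir i) mod 4 = 2" "(dir i + 2) mod 4 \<noteq> dir i"
      using calculation(1) by auto
    ultimately show ?thesis
      unfolding left_darts_def nth[OF i] incoming_seg[OF closed(2) i] b
      using sector_dart[of "dir i" "(dir i + 2) mod 4" "pos i"] dir4[OF i] by simp
  qed
  have par: "odd (a + b) \<Longrightarrow> a < 4 \<Longrightarrow> b < 4 \<Longrightarrow>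
      distinct [a, (a + 2) mod 4, b, (b + 2) mod 4] \<and> (b = (a + 1) mod 4) \<noteq> ((b + 2) mod 4 = (a + 1) mod 4)" for a b :: nat
  proof -
    assume *: "odd (a + b)" "a < 4" "b < 4"
    then have "a \<in> {0, 1, 2, 3}" "b \<in> {0, 1, 2, 3}" by auto
    then show ?thesis using *(1) by (elim insertE emptyE; simp)
  qed
  have left: "?w ! j \<in> left_darts torus ?w i \<longleftrightarrow> dir j = (dir i + 1) mod 4"
    "incoming torus ?w j \<in> left_darts torus ?w i \<longleftrightarrow> (dir j + 2) mod 4 = (dir i + 1) mod 4"
    "odd (dir i + dir j)"
    if ij: "i < j" "j < len" "pos i mod M = pos j mod M" for i j
  proof -
    have b: "before i = dir i" "before j = dir j" "odd (dir i + dir j)"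
      using excl[of i j] ij by auto
    then show "?w ! j \<in> left_darts torus ?w i \<longleftrightarrow> dir j = (dir i + 1) mod 4"
      "incoming torus ?w j \<in> left_darts torus ?w i \<longleftrightarrow> (dir j + 2) mod 4 = (dir i + 1) mod 4"
      "odd (dir i + dir j)"
      using ij ld[of i] dir4[of j] by (simp_all add: nth incoming_seg[OF closed(2)] dart_eq_iff)
  qed
  show "?w ! j \<in> left_darts torus ?w i \<longleftrightarrow> dir j = (dir i + 1) mod 4"
    if "i < j" "j < len" "pos i mod M = pos j mod M" for i j using left(1)[OF that] .
  have "?w ! i \<noteq> incoming torus ?w i" if i: "i < len" for i
  proof -
    have "dir i \<noteq> (before i + 2) mod 4"
    proof
      assume *: "dir i = (before i + 2) mod 4"
      then have "even (dir i) = even (before i)" by presburger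
      then have "before i = (before i + 2) mod 4" using * straight[OF i] by simp
      then show False using b4[OF i] by presburger
    qed
    then show ?thesis using i dir4[OF i] by (simp add: nth incoming_seg[OF closed(2)] dart_eq_iff)
  qed
  moreover have "0 < i \<and> (\<forall>k<len. vertex torus (?w ! k) = vertex torus (?w ! i) \<longrightarrow> k \<in> {i, j}) \<and>
      distinct [?w ! i, incoming torus ?w i, ?w ! j, incoming torus ?w j] \<and>
      (?w ! j \<in> left_darts torus ?w i) \<noteq> (incoming torus ?w j \<in> left_darts torus ?w i) \<and> (i \<in> ov) \<noteq> (j \<in> ov)"
    if ij: "i < j" "j < len" "pos i mod M = pos j mod M" for i j
  proof -
    have e: "before i = dir i" "before j = dir j" using excl[of i j] ij by auto
    have i0: "0 < i"
      using excl[of i j] ij corner by (cases "i = 0") (auto simp: horizontal_def vertical_def)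
    have "k \<in> {i, j}" if k: "k < len" "pos k mod M = pos i mod M" for k
    proof (rule ccontr)
      assume "k \<notin> {i, j}"
      then show False using excl[of k i] excl[of k j] excl[of i j] ij k by auto
    qed
    moreover have "distinct [?w ! i, incoming torus ?w i, ?w ! j, incoming torus ?w j]"
      using par[OF left(3)[OF ij]] dir4[of i] dir4[of j] ij
      by (simp add: nth incoming_seg[OF closed(2)] dart_eq_iff e)
    ultimately show ?thesis
      using i0 ov[rule_format, OF ij] par[OF left(3)[OF ij]] dir4[of i] dir4[of j] ij left[OF ij]
      by (auto simp: vert)
  qed
  ultimately show "surface_diagram torus (Surface_Curve ?w ov)"
    unfolding surface_diagram_def cc using closed_torus closed_walk_seg[OF closed]
    by (auto simp: lenw)
qed

end

context grid_diagram
begin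

text \<open>Each time belongs to at most one crossing, so the over strands can be chosen
  independently. The frames and the intersection numbers do not depend on this choice.\<close>

lemma crossing_over_choice:
  assumes a: "a = 0 \<or> a = (1::nat)" and Sel: "Sel \<subseteq> {(i, j). i < j \<and> j < len \<and> pos i mod M = pos j mod M}"
  obtains ov where "\<forall>i j. i < j \<longrightarrow> j < len \<longrightarrow> pos i mod M = pos j mod M \<longrightarrow> (i \<in> ov) \<noteq> (j \<in> ov)"
    "crossings_of_type torus (Surface_Curve (seg 0 len) ov) a = Sel"
proof -
  define Y where "Y = {(i, j). i < j \<and> j < len \<and> pos i mod M = pos j mod M}"
  have either: "horizontal t \<or> vertical t" for t by (auto simp: horizontal_def vertical_def)
  \<comment> \<open>Of three passages at one vertex two would be horizontal or two vertical.\<close>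
  have two: "t1 = t2 \<or> t1 = t3 \<or> t2 = t3"
    if "t1 < len" "t2 < len" "t3 < len" "pos t1 mod M = pos t2 mod M" "pos t1 mod M = pos t3 mod M" for t1 t2 t3
    using either[of t1] either[of t2] either[of t3] hor ver that by metis
  have uq: "c = c'" if "c \<in> Y" "c' \<in> Y" "{fst c, snd c} \<inter> {fst c', snd c'} \<noteq> {}" for c c'
  proof -
    obtain i j i' j' where c: "c = (i, j)" "c' = (i', j')" by (cases c, cases c')
    have *: "i < j" "j < len" "pos i mod M = pos j mod M" "i' < j'" "j' < len" "pos i' mod M = pos j' mod M"
      using that(1,2) by (auto simp: Y_def c)
    have e: "pos i mod M = pos i' mod M" using that(3) * by (auto simp: c)
    have "i' \<in> {i, j}" "j' \<in> {i, j}"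
      using two[of i j i'] two[of i j j'] * e by auto
    then show ?thesis using * by (auto simp: c)
  qed
  \<comment> \<open>For type 0 the selected crossings are passed over first and all others under
    first; for type 1 the complement is taken.\<close>
  define u where "u = {t. \<exists>c\<in>Y. if c \<in> Sel then t = fst c else t = snd c}"
  have u: "(fst c \<in> u \<longleftrightarrow> c \<in> Sel) \<and> (snd c \<in> u \<longleftrightarrow> c \<notin> Sel)" if c: "c \<in> Y" for c
  proof -
    have fs: "fst c \<noteq> snd c" using c by (auto simp: Y_def)
    have "t \<in> u \<longleftrightarrow> (if c \<in> Sel then t = fst c else t = snd c)" if t: "t \<in> {fst c, snd c}" for t
    proof
      assume "t \<in> u"
      then obtain c' where c': "c' \<in> Y" "if c' \<in> Sel then t = fst c' else t = snd c'" by (auto simp: u_def)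
      then have "{fst c, snd c} \<inter> {fst c', snd c'} \<noteq> {}" using t by (auto split: if_splits)
      then have "c' = c" using uq[OF c c'(1)] by blast
      then show "if c \<in> Sel then t = fst c else t = snd c" using c'(2) by simp
    next
      assume "if c \<in> Sel then t = fst c else t = snd c"
      then show "t \<in> u" using c unfolding u_def by blast
    qed
    from this[of "fst c"] this[of "snd c"] show ?thesis using fs by auto
  qed
  define ov where "ov = (if a = 0 then u else - u)"
  have ovY: "(fst c \<in> ov \<longleftrightarrow> (c \<in> Sel \<longleftrightarrow> a = 0)) \<and> (snd c \<in> ov \<longleftrightarrow> (c \<notin> Sel \<longleftrightarrow> a = 0))" if "c \<in> Y" for c
    using u[OF that] by (auto simp: ov_def)
  have diff: "\<forall>i j. i < j \<longrightarrow> j < len \<longrightarrow> pos i mod M = pos j mod M \<longrightarrow> (i \<in> ov) \<noteq> (j \<in> ov)"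
    using ovY by (fastforce simp: Y_def)
  note sd = surface_diagram_seg[OF diff]
  have cc: "curve_crossings torus (Surface_Curve (seg 0 len) ov) = Y" unfolding Y_def by (rule sd(2))
  have "crossings_of_type torus (Surface_Curve (seg 0 len) ov) a = {c \<in> Y. (if fst c \<in> ov then 0 else 1) = a}"
    unfolding crossings_of_type_def cc by simp
  also have "\<dots> = Sel"
    using ovY Sel a unfolding Y_def[symmetric] by (auto split: if_splits)
  finally show thesis using that diff by blast
qed

end

section \<open>Diagrams on the torus with prescribed polynomials\<close>

locale zigzag =
  fixes p B :: nat
  assumes p: "1 \<le> p" and B: "1 \<le> B"
begin

text \<open>The constants are tuned to give \<open>M = run + 4 * p + 3 + s\<close>, so that the
  integers from \<open>- s\<close> to \<open>run + 4 * p + 2\<close> represent every residue once;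
  each stretch of the walk has representatives there. As \<open>s\<close> exceeds
  \<open>4 * p + 3\<close>, the columns from -1 to \<open>4 * p + 2\<close> of different rows are
  disjoint. With \<open>run = B * s + 1\<close> the walk ends \<open>B * s\<close> east and
  \<open>B\<close> south of its start, a vector of the lattice, and every strip crosses the run once
  in each of the rows 1 to \<open>B\<close>.\<close>

definition "s = 6 * int p + 6"
definition "M = (int B + 2) * s - 2 * int p - 2"
definition "run = B * (6 * p + 6) + 1"
definition "r = B + 2"
definition "t0 = run + 2 * p * r"
definition "t1 = t0 + r"
definition "t2 = t1 + 2 * p + 1"
definition "len = t2 + 2 * B + 2"

text \<open>The closed walk goes east from the origin (\<open>run\<close> steps), south and north in turn (\<open>2 p\<close>
  strips of \<open>B + 1\<close> steps, each followed by a step east), north (\<open>r\<close> steps), west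
  (\<open>2 p + 1\<close> steps) and south; \<open>height\<close> and \<open>east\<close> are the coordinates of its lift to the plane.
  Modulo the lattice, only the way north shifts it: \<open>east + s * height\<close> passes \<open>M\<close>.\<close>

definition row :: "nat \<Rightarrow> nat \<Rightarrow> nat" where "row q k = (if even q then k else B + 1 - k)"

definition dir :: "nat \<Rightarrow> nat" where
  "dir t = (if t < run then 0
    else if t < t0 then (if (t - run) mod r = B + 1 then 0 else if even ((t - run) div r) then 3 else 1)
    else if t < t1 then 1 else if t < t2 then 2 else 3)"

definition height :: "nat \<Rightarrow> int" where
  "height t = (if t < run then 0 else if t < t0 then - int (row ((t - run) div r) ((t - run) mod r))
    else if t < t1 then int (t - t0) else if t < t2 then int B + 2 else int B + 2 - int (t - t2))"

definition east :: "nat \<Rightarrow> int" where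
  "east t = (if t < run then int t else if t < t0 then int run + int ((t - run) div r)
    else if t < t1 then int run + 2 * int p else if t < t2 then int run + 2 * int p - int (t - t1)
    else int run - 1)"

definition pos :: "nat \<Rightarrow> int" where "pos t = east t + s * height t"

definition "strip q k = run + q * r + k"

lemma run: "int run = int B * s + 1" by (simp add: run_def s_def)

lemma run_pos: "0 < run" "s < int run"
proof -
  show "0 < run" by (simp add: run_def)
  have "1 * s \<le> int B * s" using B by (intro mult_right_mono) (auto simp: s_def)
  then show "s < int run" by (simp add: run)
qed

lemma times: "run < t0" "t0 < t1" "t1 < t2" "t2 < len"
proof -
  show "run < t0" using p by (simp add: t0_def r_def)
qed (simp_all add: t1_def t2_def len_def r_def)

lemma strip_less: "q < 2 * p \<Longrightarrow> k \<le> B + 1 \<Longrightarrow> strip q k < t0"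
proof -
  assume "q < 2 * p" "k \<le> B + 1"
  then have "(q + 1) * r \<le> 2 * p * r" "k < r" by (intro mult_right_mono; simp) (use \<open>k \<le> B + 1\<close> in \<open>simp add: r_def\<close>)
  then show ?thesis by (simp add: strip_def t0_def)
qed

lemma strip_data:
  assumes "q < 2 * p" "k \<le> B + 1"
  shows "dir (strip q k) = (if k = B + 1 then 0 else if even q then 3 else 1)"
    "height (strip q k) = - int (row q k)" "east (strip q k) = int run + int q"
proof -
  have "k < r" "0 < r" "strip q k - run = k + q * r" "\<not> strip q k < run"
    using assms(2) by (simp_all add: r_def strip_def)
  then have "(strip q k - run) div r = q" "(strip q k - run) mod r = k" "\<not> strip q k < run"
    by simp_all
  then show "dir (strip q k) = (if k = B + 1 then 0 else if even q then 3 else 1)"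
    "height (strip q k) = - int (row q k)" "east (strip q k) = int run + int q"
    using strip_less[OF assms] by (simp_all add: dir_def height_def east_def)
qed

lemma run_data: "t < run \<Longrightarrow> dir t = 0 \<and> height t = 0 \<and> east t = int t"
  by (simp add: dir_def height_def east_def)

lemma up_data: "k < r \<Longrightarrow> dir (t0 + k) = 1 \<and> height (t0 + k) = int k \<and> east (t0 + k) = int run + 2 * int p"
  using times by (simp add: dir_def height_def east_def t1_def)

lemma west_data: "k \<le> 2 * p \<Longrightarrow> dir (t1 + k) = 2 \<and> height (t1 + k) = int B + 2 \<and> east (t1 + k) = int run + 2 * int p - int k"
  using times by (simp add: dir_def height_def east_def t2_def)

lemma down_data: "dir (t2 + k) = 3 \<and> height (t2 + k) = int B + 2 - int k \<and> east (t2 + k) = int run - 1"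
  using times by (simp add: dir_def height_def east_def)

lemma time_cases:
  assumes "t < len"
  obtains "t < run" | q k where "q < 2 * p" "k \<le> B + 1" "t = strip q k" | k where "k < r" "t = t0 + k"
    | k where "k \<le> 2 * p" "t = t1 + k" | k where "k < 2 * B + 2" "t = t2 + k"
proof -
  consider "t < run" | "run \<le> t" "t < t0" | "t0 \<le> t" "t < t1" | "t1 \<le> t" "t < t2" | "t2 \<le> t" by linarith
  then show thesis
  proof cases
    case 1
    then show ?thesis using that by blast
  next
    case 2
    have "t - run < 2 * p * r" using 2 by (simp add: t0_def)
    then have "(t - run) div r < 2 * p" by (simp add: less_mult_imp_div_less)
    moreover have "(t - run) mod r \<le> B + 1" using mod_less_divisor[of r "t - run"] by (simp add: r_def)
    moreover have "t = strip ((t - run) div r) ((t - run) mod r)" using 2 by (simp add: strip_def)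
    ultimately show ?thesis using that by blast
  next
    case 3
    then show ?thesis using that(3)[of "t - t0"] by (simp add: t1_def)
  next
    case 4
    then show ?thesis using that(4)[of "t - t1"] by (simp add: t2_def)
  next
    case 5
    then show ?thesis using that(5)[of "t - t2"] assms by (simp add: len_def)
  qed
qed

lemma strip_Suc: "strip q (B + 1) + 1 = strip (q + 1) 0" "strip (2 * p) 0 = t0" "strip 0 0 = run"
  by (simp_all add: strip_def r_def t0_def)

lemma Suc_data:
  assumes "t < len"
  shows "east (t + 1) = east t + (if dir t = 0 then 1 else if dir t = 2 then - 1 else 0) \<and>
    height (t + 1) = height t + (if dir t = 1 then 1 else if dir t = 3 then - 1 else 0)"
  using assms
proof (cases rule: time_cases)
  case 1
  show ?thesis
  proof (cases "t + 1 = run")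
    case True
    then show ?thesis
      using 1 run_data[of t] strip_data[of 0 0] p unfolding strip_Suc by (simp add: row_def)
  next
    case False
    then show ?thesis using 1 run_data[of t] run_data[of "t + 1"] by simp
  qed
next
  case (2 q k)
  note here = strip_data[OF 2(1,2)]
  show ?thesis
  proof (cases "k = B + 1")
    case True
    then have t: "t + 1 = strip (q + 1) 0" using 2(3) strip_Suc(1) by simp
    show ?thesis
    proof (cases "q + 1 < 2 * p")
      case True
      then show ?thesis
        unfolding t using strip_data[OF True, of 0] here \<open>k = B + 1\<close> 2(3) by (auto simp: row_def)
    next
      case False
      then have q: "q + 1 = 2 * p" using 2(1) by simp
      then have "odd q" by presburger
      moreover have "t + 1 = t0 + 0" using t q strip_Suc(2) by simp
      ultimately show ?thesis
        using up_data[of 0] here \<open>k = B + 1\<close> 2(3) q by (auto simp: row_def r_def)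
    qed
  next
    case False
    then have k: "k + 1 \<le> B + 1" using 2(2) by simp
    have "t + 1 = strip q (k + 1)" using 2(3) by (simp add: strip_def)
    then show ?thesis using strip_data[OF 2(1) k] here 2 False by (auto simp: row_def of_nat_diff)
  qed
next
  case (3 k)
  show ?thesis
  proof (cases "k + 1 = r")
    case True
    then have "t + 1 = t1 + 0" using 3 by (simp add: t1_def)
    then show ?thesis using 3 True up_data[of k] west_data[of 0] by (simp add: r_def)
  next
    case False
    then have "k + 1 < r" "t + 1 = t0 + (k + 1)" using 3 by simp_all
    then show ?thesis using 3 up_data[of k] up_data[of "k + 1"] by simp
  qed
next
  case (4 k)
  show ?thesis
  proof (cases "k = 2 * p")
    case True
    then have "t + 1 = t2 + 0" using 4 by (simp add: t2_def)
    then show ?thesis using 4 True west_data[of k] down_data[of 0] by simp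
  next
    case False
    then have "k + 1 \<le> 2 * p" "t + 1 = t1 + (k + 1)" using 4 by simp_all
    then show ?thesis using 4 west_data[of k] west_data[of "k + 1"] by simp
  qed
next
  case (5 k)
  then have "t + 1 = t2 + (k + 1)" by simp
  then show ?thesis using 5 down_data[of k] down_data[of "k + 1"] by simp
qed

lemma M_pos: "0 < M" "M = int run + 4 * int p + 3 + s"
  by (simp_all add: M_def run s_def algebra_simps) (smt (verit) of_nat_0_le_iff mult_nonneg_nonneg)

lemma dir_less: "dir t < 4" by (simp add: dir_def)

sublocale lifted_walk M s pos dir len
proof
  show "0 < M" "0 \<le> s" using M_pos by (simp_all add: s_def)
  show "dir t < 4" for t by (rule dir_less)
  interpret circulant_torus M s by unfold_locales (use M_pos in \<open>simp_all add: s_def\<close>)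
  show "pos (Suc t) = pos t + step (dir t)" if "t < len" for t
    using Suc_data[OF that] dir_less[of t] by (auto simp: pos_def step_def algebra_simps)
qed

lemma north_height: "i \<le> j \<Longrightarrow> j \<le> len \<Longrightarrow> north i j = height j - height i"
proof -
  assume ij: "i \<le> j" "j \<le> len"
  have "north i j = (\<Sum>t\<in>{i..<j}. height (Suc t) - height t)"
    unfolding north_def
  proof (rule sum.cong)
    fix t assume "t \<in> {i..<j}"
    then have "t < len" using ij by simp
    then show "(if dir t = 1 then 1 else if dir t = 3 then - 1 else 0) = height (Suc t) - height t"
      using Suc_data[of t] by simp
  qed simp
  also have "\<dots> = height j - height i" by (rule sum_Suc_diff'[OF ij(1)])
  finally show ?thesis .
qed

lemma pos_ends: "pos 0 = 0" "pos len = 0" "height 0 = 0" "height len = - int B"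
  using run_data[of 0] run_pos down_data[of "2 * B + 2"]
  by (simp_all add: pos_def len_def run algebra_simps)

lemma before_data:
  "before 0 = 3" "0 < t \<Longrightarrow> t < run \<Longrightarrow> before t = 0"
  "q < 2 * p \<Longrightarrow> before (strip q 0) = 0"
  "q < 2 * p \<Longrightarrow> k \<le> B \<Longrightarrow> before (strip q (Suc k)) = (if even q then 3 else 1)"
  "before t0 = 0" "k < r \<Longrightarrow> 0 < k \<Longrightarrow> before (t0 + k) = 1"
  "before t1 = 1" "k \<le> 2 * p \<Longrightarrow> 0 < k \<Longrightarrow> before (t1 + k) = 2"
  "before t2 = 2" "0 < k \<Longrightarrow> before (t2 + k) = 3"
proof -
  have bS: "before (Suc t) = dir t" for t by (simp add: before_def)
  have "len - 1 = t2 + (2 * B + 1)" by (simp add: len_def)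
  then have "before 0 = dir (t2 + (2 * B + 1))" unfolding before_def by simp
  then show "before 0 = 3" using down_data[of "2 * B + 1"] by simp
  show "before t = 0" if "0 < t" "t < run" using that run_data[of "t - 1"] bS[of "t - 1"] by simp
  have strip0: "before (strip (Suc q) 0) = 0" if "q < 2 * p" for q
    using bS[of "strip q (B + 1)"] strip_Suc(1)[of q] strip_data(1)[OF that, of "B + 1"] by simp
  show "before (strip q 0) = 0" if "q < 2 * p"
  proof (cases q)
    case 0
    then show ?thesis using run_data[of "run - 1"] run_pos bS[of "run - 1"] by (simp add: strip_Suc)
  next
    case (Suc q')
    then show ?thesis using strip0[of q'] that by simp
  qed
  show "before t0 = 0" using strip0[of "2 * p - 1"] p strip_Suc(2) by simp
  show "before (strip q (Suc k)) = (if even q then 3 else 1)" if "q < 2 * p" "k \<le> B"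
    using bS[of "strip q k"] strip_data(1)[OF that(1), of k] that(2) by (simp add: strip_def)
  show up: "before (t0 + k) = 1" if "k < r" "0 < k" using that bS[of "t0 + (k - 1)"] up_data[of "k - 1"] by simp
  show "before t1 = 1" using bS[of "t0 + (r - 1)"] up_data[of "r - 1"] by (simp add: t1_def r_def)
  show "before (t1 + k) = 2" if "k \<le> 2 * p" "0 < k" using that bS[of "t1 + (k - 1)"] west_data[of "k - 1"] by simp
  show "before t2 = 2" using bS[of "t1 + 2 * p"] west_data[of "2 * p"] by (simp add: t2_def)
  show "before (t2 + k) = 3" if "0 < k" using that bS[of "t2 + (k - 1)"] down_data[of "k - 1"] by simp
qed

lemma zigzag_straight:
  assumes "t < len" "even (dir t) = even (before t)" shows "dir t = before t"
  using assms(1)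
proof (cases rule: time_cases)
  case 1
  then show ?thesis using assms(2) run_data[of t] before_data(1,2) by (cases "t = 0") auto
next
  case (2 q k)
  then show ?thesis
    using assms(2) strip_data(1)[OF 2(1,2)] before_data(3,4)[OF 2(1)] by (cases k) (auto split: if_splits)
next
  case (3 k)
  then show ?thesis using assms(2) up_data[of k] before_data(5,6) by (cases "k = 0") auto
next
  case (4 k)
  then show ?thesis using assms(2) west_data[of k] before_data(7,8) by (cases "k = 0") auto
next
  case (5 k)
  then show ?thesis using assms(2) down_data[of k] before_data(9,10) by (cases "k = 0") auto
qed

text \<open>Injectivity is shown by an explicit inverse on the window of representatives. In
  increasing order of \<open>v\<close> these are the lower turns of the strips, the run, their upper
  turns, and the way west, which is met one period later.\<close>

definition htime :: "int \<Rightarrow> nat" where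
  "htime v = (if v < 0 then strip (nat (v + s - 1)) (if even (nat (v + s - 1)) then B + 1 else 0)
    else if v < int run then nat v
    else if v \<le> int run + 2 * int p then strip (nat (v - int run)) (if even (nat (v - int run)) then 0 else B + 1)
    else t1 + nat (int run + 4 * int p + 2 - v))"

text \<open>The inverse for column \<open>i\<close> and row \<open>j\<close> below the run. Column
  -1 is the lower part of the final descent, followed by the strips, the corner at
  \<open>t0\<close>, the upper part of the descent in column \<open>2 * p + 1\<close> and the way
  north in column \<open>4 * p + 2\<close>. Time 0 stands for the end of the descent.\<close>

definition vtime :: "int \<Rightarrow> int \<Rightarrow> nat" where
  "vtime i j = (if i = - 1 then (if j = int B then 0 else t2 + B + 2 + nat j)
    else if i < 2 * int p then strip (nat i) (row (nat i) (nat j))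
    else if i = 2 * int p then t0 else if i = 2 * int p + 1 then t2 + nat j
    else t0 + B + 2 - nat j)"

lemma pos_up: "k < r \<Longrightarrow> pos (t0 + k) = int run + 2 * int p + s * int k"
  using up_data[of k] by (simp add: pos_def)

text \<open>Climbing \<open>B + 2\<close> rows amounts to one period and a shift by
  \<open>2 * p + 2\<close> columns. This carries column \<open>2 * p\<close> of the way north to
  \<open>4 * p + 2\<close> and column -1 of the descent to \<open>2 * p + 1\<close>.\<close>

lemma lap: "s * (int B + 2) = M + 2 * int p + 2" by (simp add: M_def)

lemma htime:
  assumes t: "t < len" "horizontal t"
  shows "\<exists>v k. - s \<le> v \<and> v \<le> int run + 4 * int p + 2 \<and> pos t = v + M * k \<and> t = htime v"
  using t(1)
proof (cases rule: time_cases)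
  case 1
  then show ?thesis
    using run_data[of t] by (intro exI[of _ "int t"] exI[of _ 0]) (auto simp: htime_def pos_def s_def)
next
  case (2 q k)
  have "k = 0 \<or> k = B + 1"
  proof (rule ccontr)
    assume *: "\<not> ?thesis"
    then obtain k' where "k = Suc k'" "k' \<le> B" using 2(2) by (cases k) auto
    then show False
      using t(2) * strip_data(1)[OF 2(1,2)] before_data(4)[OF 2(1), of k'] 2(3) by (auto simp: horizontal_def split: if_splits)
  qed
  show ?thesis
  proof (cases "row q k = 0")
    case True
    then have k: "k = (if even q then 0 else B + 1)" using \<open>k = 0 \<or> k = B + 1\<close> by (auto simp: row_def split: if_splits)
    show ?thesis
      using 2 True strip_data[OF 2(1,2)] k run_pos
      by (intro exI[of _ "int run + int q"] exI[of _ 0]) (auto simp: htime_def pos_def s_def)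
  next
    case False
    then have k: "k = (if even q then B + 1 else 0)" "row q k = B + 1"
      using \<open>k = 0 \<or> k = B + 1\<close> by (auto simp: row_def split: if_splits)
    have "height t = - (int B + 1)" "east t = int B * s + 1 + int q"
      using strip_data(2,3)[OF 2(1,2)] 2(3) k(2) run by simp_all
    then have P: "pos t = 1 + int q - s" unfolding pos_def by (simp only:) (simp add: algebra_simps)
    have q: "1 + int q - s < 0" "nat (1 + int q - s + s - 1) = q" using 2(1) by (simp_all add: s_def)
    have "t = htime (1 + int q - s)"
      unfolding htime_def q(2) using q(1) 2(3) k(1) by simp
    then show ?thesis
      using P q run_pos by (intro exI[of _ "1 + int q - s"] exI[of _ 0]) simp
  qed
next
  case (3 k)
  then have "k = 0" using t(2) up_data[of k] before_data(6)[of k] by (cases "k = 0") (auto simp: horizontal_def)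
  have "t = htime (int run + 2 * int p)"
    using 3 \<open>k = 0\<close> run_pos strip_Suc(2) by (simp add: htime_def nat_mult_distrib)
  then show ?thesis
    using 3 \<open>k = 0\<close> pos_up[of 0] by (intro exI[of _ "int run + 2 * int p"] exI[of _ 0]) (simp add: s_def)
next
  case (4 k)
  have "pos t = int run + 4 * int p + 2 - int k + M * 1"
    using 4 west_data[of k] lap by (simp add: pos_def algebra_simps)
  moreover have "t = htime (int run + 4 * int p + 2 - int k)"
    using 4 run_pos by (auto simp: htime_def)
  ultimately show ?thesis
    using 4 by (intro exI[of _ "int run + 4 * int p + 2 - int k"] exI[of _ 1]) (simp add: s_def)
next
  case (5 k)
  then have "k = 0" using t(2) down_data[of k] before_data(10)[of k] by (cases "k = 0") (auto simp: horizontal_def)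
  have "pos t = int run + 2 * int p + 1 + M * 1"
    using 5 \<open>k = 0\<close> down_data[of k] lap by (simp add: pos_def algebra_simps)
  moreover have "t = htime (int run + 2 * int p + 1)"
    using 5 \<open>k = 0\<close> run_pos by (auto simp: htime_def t2_def nat_add_distrib)
  ultimately show ?thesis
    by (intro exI[of _ "int run + 2 * int p + 1"] exI[of _ 1]) (simp add: s_def)
qed

lemma row_row: "k \<le> B + 1 \<Longrightarrow> row q (row q k) = k" "k \<le> B + 1 \<Longrightarrow> row q k \<le> B + 1"
  by (auto simp: row_def)

lemma vtime:
  assumes t: "t < len" "vertical t"
  shows "\<exists>i j k. - 1 \<le> i \<and> i \<le> 4 * int p + 2 \<and> 0 \<le> j \<and> j \<le> int B + 1 \<and>
    pos t = int run + i - j * s + M * k \<and> t = vtime i j"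
  using t(1)
proof (cases rule: time_cases)
  case 1
  then have "t = 0" using t(2) run_data[of t] before_data(2)[of t] by (cases "t = 0") (auto simp: vertical_def)
  then show ?thesis
    using pos_ends run by (intro exI[of _ "- 1"] exI[of _ "int B"] exI[of _ 0]) (simp add: vtime_def)
next
  case (2 q k)
  have "pos t = int run + int q - int (row q k) * s"
    using strip_data[OF 2(1,2)] 2(3) by (simp add: pos_def)
  moreover have "t = vtime (int q) (int (row q k))"
    using 2 row_row(1)[OF 2(2)] by (simp add: vtime_def)
  ultimately show ?thesis
    using 2(1) row_row(2)[OF 2(2), of q]
    by (intro exI[of _ "int q"] exI[of _ "int (row q k)"] exI[of _ 0]) simp
next
  case (3 k)
  show ?thesis
  proof (cases "k = 0")
    case True
    then show ?thesis
      using 3 pos_up[of 0] by (intro exI[of _ "2 * int p"] exI[of _ 0] exI[of _ 0]) (simp add: vtime_def)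
  next
    case False
    have "pos t = int run + (4 * int p + 2) - (int B + 2 - int k) * s + M * 1"
      using 3 pos_up[of k] lap by (simp add: algebra_simps)
    moreover have "t = vtime (4 * int p + 2) (int B + 2 - int k)"
      using 3 by (auto simp: vtime_def r_def nat_diff_distrib)
    ultimately show ?thesis
      using 3 False by (intro exI[of _ "4 * int p + 2"] exI[of _ "int B + 2 - int k"] exI[of _ 1]) (simp add: r_def)
  qed
next
  case (4 k)
  then have "k = 0" using t(2) west_data[of k] before_data(8)[of k] by (cases "k = 0") (auto simp: vertical_def)
  have "pos t = int run + (4 * int p + 2) - 0 * s + M * 1"
    using 4 \<open>k = 0\<close> west_data[of k] lap by (simp add: pos_def algebra_simps)
  moreover have "t = vtime (4 * int p + 2) 0"
    using 4 \<open>k = 0\<close> by (auto simp: vtime_def r_def t1_def)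
  ultimately show ?thesis
    by (intro exI[of _ "4 * int p + 2"] exI[of _ 0] exI[of _ 1]) simp
next
  case (5 k)
  have P: "pos t = int run - 1 + s * (int B + 2 - int k)" using 5 down_data[of k] by (simp add: pos_def)
  show ?thesis
  proof (cases "k \<le> B + 1")
    case True
    have "pos t = int run + (2 * int p + 1) - int k * s + M * 1"
      unfolding P using lap by (simp add: algebra_simps)
    moreover have "t = vtime (2 * int p + 1) (int k)"
      using 5 by (auto simp: vtime_def)
    ultimately show ?thesis
      using True by (intro exI[of _ "2 * int p + 1"] exI[of _ "int k"] exI[of _ 1]) simp
  next
    case False
    have "pos t = int run + - 1 - (int k - int B - 2) * s + M * 0"
      unfolding P by (simp add: algebra_simps)
    moreover have "t = vtime (- 1) (int k - int B - 2)"
      using 5 False by (auto simp: vtime_def nat_diff_distrib)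
    ultimately show ?thesis
      using 5 False by (intro exI[of _ "- 1"] exI[of _ "int k - int B - 2"] exI[of _ 0]) simp
  qed
qed

text \<open>The window consists of exactly \<open>M\<close> consecutive integers.\<close>

lemma window_unique:
  assumes "- s \<le> v" "v \<le> int run + 4 * int p + 2" "- s \<le> v'" "v' \<le> int run + 4 * int p + 2"
    and "(v + M * k) mod M = (v' + M * k') mod M"
  shows "v = v'"
proof -
  have "M dvd v - v'" using assms(5) by (simp add: mod_eq_dvd_iff)
  moreover have "\<bar>v - v'\<bar> < M" using assms(1-4) M_pos(2) by linarith
  ultimately show ?thesis using dvd_imp_le_int[of "v - v'" M] by force
qed

lemma zigzag_horizontal:
  assumes "t < len" "t' < len" "horizontal t" "horizontal t'" "pos t mod M = pos t' mod M"
  shows "t = t'"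
  using htime[OF assms(1,3)] htime[OF assms(2,4)] window_unique assms(5) by metis

lemma zigzag_vertical:
  assumes "t < len" "t' < len" "vertical t" "vertical t'" "pos t mod M = pos t' mod M"
  shows "t = t'"
proof -
  obtain i j k where 1: "- 1 \<le> i" "i \<le> 4 * int p + 2" "0 \<le> j" "j \<le> int B + 1"
    "pos t = int run + i - j * s + M * k" "t = vtime i j"
    using vtime[OF assms(1,3)] by blast
  obtain i' j' k' where 2: "- 1 \<le> i'" "i' \<le> 4 * int p + 2" "0 \<le> j'" "j' \<le> int B + 1"
    "pos t' = int run + i' - j' * s + M * k'" "t' = vtime i' j'"
    using vtime[OF assms(2,4)] by blast
  have win: "- s \<le> int run + i - j * s \<and> int run + i - j * s \<le> int run + 4 * int p + 2"
    if "- 1 \<le> i" "i \<le> 4 * int p + 2" "0 \<le> j" "j \<le> int B + 1" for i j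
  proof -
    have "j * s \<le> (int B + 1) * s" "0 \<le> j * s" using that by (auto intro!: mult_right_mono simp: s_def)
    then show ?thesis using that(1,2) by (simp add: run algebra_simps)
  qed
  have "int run + i - j * s = int run + i' - j' * s"
    using window_unique[of "int run + i - j * s" "int run + i' - j' * s" k k'] win[OF 1(1-4)] win[OF 2(1-4)]
      assms(5) 1(5) 2(5) by simp
  \<comment> \<open>Columns differ by less than \<open>s\<close>, so a difference that is a multiple
    of \<open>s\<close> vanishes, and then the rows agree too.\<close>
  then have e: "i - i' = (j - j') * s" by (simp add: algebra_simps)
  then have "s dvd i - i'" by simp
  moreover have "\<bar>i - i'\<bar> < s" using 1 2 by (simp add: s_def)
  ultimately have "i - i' = 0" using dvd_imp_le_int[of "i - i'" s] by force
  then have "i = i'" "j = j'" using e by (auto simp: s_def)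
  then show ?thesis using 1 2 by simp
qed

sublocale grid_diagram M s pos dir len
proof
  show "horizontal 0" "vertical 0"
    using run_data[of 0] run_pos before_data(1) by (simp_all add: horizontal_def vertical_def)
  show "0 < len" "pos len mod M = pos 0 mod M" using times pos_ends by simp_all
qed (fact zigzag_straight zigzag_horizontal zigzag_vertical)+

end

lemma (in lifted_walk) take_drop_seg: "i \<le> j \<Longrightarrow> j \<le> len \<Longrightarrow> take (j - i) (drop i (seg 0 len)) = seg i j"
  by (simp add: seg_def drop_map take_map)

text \<open>For \<open>z > 0\<close> the selected strips are \<open>z\<close> ones going north, for \<open>z < 0\<close> they are \<open>- z\<close>
  ones going south.\<close>

definition strips :: "int \<Rightarrow> nat set" where
  "strips z = {q. if odd q then int q < 2 * z else int q < - 2 * z}"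

lemma strips_eq: "strips z = (\<lambda>k. 2 * k + 1) ` {..<nat z} \<union> (\<lambda>k. 2 * k) ` {..<nat (- z)}"
proof (rule set_eqI)
  fix q
  show "q \<in> strips z \<longleftrightarrow> q \<in> (\<lambda>k. 2 * k + 1) ` {..<nat z} \<union> (\<lambda>k. 2 * k) ` {..<nat (- z)}"
  proof (cases "odd q")
    case True
    then obtain k where "q = 2 * k + 1" by (elim oddE)
    then show ?thesis by (auto simp: strips_def image_iff) presburger+
  next
    case False
    then obtain k where "q = 2 * k" by (auto elim: evenE)
    then show ?thesis by (auto simp: strips_def image_iff) presburger+
  qed
qed

lemma strips_sum: "(\<Sum>q\<in>strips z. if odd q then 1 else - 1 :: int) = z"
proof -
  have "(\<Sum>q\<in>strips z. if odd q then 1 else - 1 :: int) =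
    (\<Sum>q\<in>(\<lambda>k. 2 * k + 1) ` {..<nat z}. if odd q then 1 else - 1) +
    (\<Sum>q\<in>(\<lambda>k. 2 * k) ` {..<nat (- z)}. if odd q then 1 else - 1)"
    unfolding strips_eq
  proof (rule sum.union_disjoint)
    show "(\<lambda>k. 2 * k + 1) ` {..<nat z} \<inter> (\<lambda>k. 2 * k) ` {..<nat (- z)} = {}" by auto
  qed auto
  also have "\<dots> = int (nat z) - int (nat (- z))"
    by (subst (1 2) sum.reindex) (auto simp: inj_on_def)
  finally show ?thesis by simp
qed

lemma strips_less: "q \<in> strips z \<Longrightarrow> \<bar>z\<bar> \<le> int p \<Longrightarrow> q < 2 * p"
  by (auto simp: strips_def split: if_splits)

lemma finite_strips: "finite (strips z)" by (simp add: strips_eq)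

context zigzag
begin

text \<open>The chord \<open>(j, q)\<close> is the crossing of the initial run with the strip \<open>q\<close> in row \<open>j\<close>, whose
  loop is closed in the strip, and \<open>hub\<close> is that of the run with the way north, whose loop winds
  once around the torus.\<close>

definition chord :: "nat \<Rightarrow> nat \<Rightarrow> nat \<times> nat" where
  "chord j q = (nat (int run + int q - int j * s), strip q (row q j))"

definition "hub = (nat (int run + 4 * int p + 2 - s), t0 + (B + 1))"

lemma chord_data:
  assumes "q < 2 * p" "1 \<le> j" "j \<le> B"
  shows "fst (chord j q) < snd (chord j q)" "snd (chord j q) < len"
    "pos (snd (chord j q)) = pos (fst (chord j q)) + M * 0"
    "north (fst (chord j q)) (snd (chord j q)) = - int j"
    "dir (fst (chord j q)) = 0" "dir (snd (chord j q)) = (if odd q then 1 else 3)"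
    "int (fst (chord j q)) = int run + int q - int j * s"
proof -
  have js: "s \<le> int j * s" "int j * s \<le> int B * s"
    using assms mult_right_mono[of 1 "int j" s] mult_right_mono[of "int j" "int B" s] by (simp_all add: s_def)
  have "0 \<le> int run + int q - int j * s" "int run + int q - int j * s < int run"
  proof -
    have "int q < s" using assms(1) by (simp add: s_def)
    then show "0 \<le> int run + int q - int j * s" "int run + int q - int j * s < int run"
      using js run by linarith+
  qed
  then have fr: "fst (chord j q) < run" and f: "int (fst (chord j q)) = int run + int q - int j * s"
    by (simp_all add: chord_def)
  show "int (fst (chord j q)) = int run + int q - int j * s" by (rule f)
  have r: "row q j \<le> B" "row q (row q j) = j" using assms row_row(1)[of j q] by (auto simp: row_def)
  note d = strip_data[OF assms(1), of "row q j"] and e = run_data[OF fr]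
  show "dir (fst (chord j q)) = 0" using e by simp
  show "dir (snd (chord j q)) = (if odd q then 1 else 3)" using d r by (simp add: chord_def)
  show "pos (snd (chord j q)) = pos (fst (chord j q)) + M * 0"
    using d r e f by (simp add: pos_def chord_def)
  show lt: "fst (chord j q) < snd (chord j q)" using fr by (simp add: chord_def strip_def)
  show len: "snd (chord j q) < len"
    using strip_less[OF assms(1), of "row q j"] r times by (simp add: chord_def)
  show "north (fst (chord j q)) (snd (chord j q)) = - int j"
    using lt len d r e by (simp add: north_height) (simp add: chord_def)
qed

lemma hub_data:
  "fst hub < snd hub" "snd hub < len" "pos (snd hub) = pos (fst hub) + M * 1" "dir (fst hub) = 0" "dir (snd hub) = 1"
proof -
  have "0 \<le> int run + 4 * int p + 2 - s" "int run + 4 * int p + 2 - s < int run"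
    using run_pos(2) by (simp, simp add: s_def)
  then have f: "int (fst hub) = int run + 4 * int p + 2 - s" and fr: "fst hub < run" by (simp_all add: hub_def)
  note e = run_data[OF fr]
  have u: "dir (t0 + (B + 1)) = 1" using up_data[of "B + 1"] by (simp add: r_def)
  show "dir (fst hub) = 0" using e by simp
  show "dir (snd hub) = 1" using u by (simp add: hub_def)
  show "fst hub < snd hub" using fr times(1) by (simp add: hub_def)
  show "snd hub < len" using times by (simp add: hub_def t1_def r_def)
  have "pos (fst hub) = int run + 4 * int p + 2 - s" using e f by (simp add: pos_def)
  moreover have "pos (snd hub) = int run + 2 * int p + s * (int B + 1)"
    using pos_up[of "B + 1"] by (simp add: hub_def r_def)
  ultimately show "pos (snd hub) = pos (fst hub) + M * 1" using lap by (simp add: algebra_simps)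
qed

lemma chord_inj:
  assumes "q < 2 * p" "1 \<le> j" "j \<le> B" "q' < 2 * p" "1 \<le> j'" "j' \<le> B" "chord j q = chord j' q'"
  shows "j = j' \<and> q = q'"
proof -
  have e: "int q - int q' = (int j - int j') * s"
    using chord_data(7)[OF assms(1-3)] chord_data(7)[OF assms(4-6)] assms(7) by (simp add: algebra_simps)
  then have "s dvd int q - int q'" by simp
  moreover have "\<bar>int q - int q'\<bar> < s" using assms by (simp add: s_def)
  ultimately have "int q - int q' = 0" using dvd_imp_le_int[of "int q - int q'" s] by force
  then show ?thesis using e by (auto simp: s_def)
qed

text \<open>\<open>n j\<close> is the signed number of strips selected in row \<open>j\<close>:
  strips with odd number go north and cross the run positively, the others go south and cross it
  negatively. The bound by \<open>p\<close> ensures that there are enough strips of each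
  kind.\<close>

lemma knot_on_torus:
  assumes a: "a = 0 \<or> a = (1::nat)" and n: "\<forall>j\<in>{1..B}. \<bar>n j\<bar> \<le> int p"
  obtains K where "K \<in> long_virtual_knots" "sg1 K \<le> 1"
    "F_poly a a K = (\<Sum>j=1..B. of_int (n j) * palindrome (int j))"
    "H_poly a a K = (\<Sum>j=1..B. of_int (n j) * palindrome (int B - int j)) -
       of_int ((\<Sum>j=1..B. n j) + 1) * palindrome (int B)"
proof -
  define I where "I = (SIGMA j:{1..B}. strips (n j))"
  define A where "A = (\<lambda>(j, q). chord j q) ` I"
  have I: "q < 2 * p \<and> 1 \<le> j \<and> j \<le> B" if "(j, q) \<in> I" for j q
    using that strips_less[of q "n j" p] n by (auto simp: I_def)
  have injI: "inj_on (\<lambda>(j, q). chord j q) I"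
  proof (rule inj_onI)
    fix x y assume xy: "x \<in> I" "y \<in> I" "(\<lambda>(j, q). chord j q) x = (\<lambda>(j, q). chord j q) y"
    obtain j q j' q' where "x = (j, q)" "y = (j', q')" by (cases x, cases y)
    then show "x = y" using xy chord_inj[of q j q' j'] I[of j q] I[of j' q'] by simp
  qed
  have finI: "finite I" by (auto simp: I_def finite_strips)
  have A: "c \<in> A \<Longrightarrow> \<exists>j q. (j, q) \<in> I \<and> c = chord j q" for c by (auto simp: A_def)
  have Sel: "insert hub A \<subseteq> {(i, j). i < j \<and> j < len \<and> pos i mod M = pos j mod M}"
  proof
    fix c assume c: "c \<in> insert hub A"
    have "fst c < snd c \<and> snd c < len \<and> (\<exists>k. pos (snd c) = pos (fst c) + M * k)"
    proof (cases "c = hub")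
      case True
      then show ?thesis using hub_data by blast
    next
      case False
      then obtain j q where jq: "(j, q) \<in> I" "c = chord j q" using A c by blast
      have "q < 2 * p" "1 \<le> j" "j \<le> B" using I[OF jq(1)] by auto
      from chord_data(1-3)[OF this] show ?thesis using jq(2) by blast
    qed
    then show "c \<in> {(i, j). i < j \<and> j < len \<and> pos i mod M = pos j mod M}"
      by (auto simp: case_prod_beta)
  qed
  obtain ov where cross: "\<forall>i j. i < j \<longrightarrow> j < len \<longrightarrow> pos i mod M = pos j mod M \<longrightarrow> (i \<in> ov) \<noteq> (j \<in> ov)"
    and sel: "crossings_of_type torus (Surface_Curve (seg 0 len) ov) a = insert hub A"
    by (rule crossing_over_choice[OF a Sel])
  note sd = surface_diagram_seg[OF cross]
  let ?C = "Surface_Curve (seg 0 len) ov"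
  interpret R: realization torus ?C by unfold_locales (rule sd(1))
  have X: "R.X = {(i, j). i < j \<and> j < len \<and> pos i mod M = pos j mod M}"
    unfolding R.X_def by (rule sd(2))
  have lam: "R.lam c = (if dir (snd c) = (dir (fst c) + 1) mod 4 then 1 else - 1)" if "c \<in> R.X" for c
  proof -
    have "fst c < snd c" "snd c < len" "pos (fst c) mod M = pos (snd c) mod M" using that by (auto simp: X)
    from sd(3)[OF this] show ?thesis by (simp add: R.lam_def R.w_def)
  qed
  have alpha: "alpha_cycle ?C c = seg (fst c) (snd c)" if "c \<in> R.X" for c
    using take_drop_seg[of "fst c" "snd c"] that by (auto simp: alpha_cycle_def X)
  have idx: "chord_index R.X R.lam c d = oc * north (fst d) (snd d) - od * north (fst c) (snd c)"
    if "c \<in> R.X" "d \<in> R.X" "pos (snd c) = pos (fst c) + M * oc" "pos (snd d) = pos (fst d) + M * od" for c d oc od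
    using that intersection_seg[of "fst c" "snd c" oc "fst d" "snd d" od]
      R.intersection_alpha_alpha_index[OF that(1,2)] alpha[OF that(1)] alpha[OF that(2)] by (auto simp: X)
  \<comment> \<open>The whole curve has displacement 0 in \<open>pos\<close> and descends by
    \<open>B\<close>, so its intersection number with a loop is \<open>B\<close> times the winding
    of the loop.\<close>
  have tot: "total_index R.X R.lam c = oc * int B"
    if c: "c \<in> R.X" "pos (snd c) = pos (fst c) + M * oc" for c oc
  proof -
    have "(fst c, snd c) \<in> R.X" using c(1) by simp
    from R.flow_beta[OF this] have fb: "flow torus (beta_cycle ?C c) d = flow torus R.w d - flow torus (alpha_cycle ?C c) d" for d
      by simp
    have "intersection torus (alpha_cycle ?C c) (beta_cycle ?C c) =
      intersection torus (alpha_cycle ?C c) R.w - intersection torus (alpha_cycle ?C c) (alpha_cycle ?C c)"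
      unfolding intersection_def fb sum_subtractf ..
    moreover have "intersection torus (alpha_cycle ?C c) (alpha_cycle ?C c) = 0"
      using R.intersection_alpha_alpha_index[OF c(1) c(1)] by (simp add: chord_index_def pairing_self)
    moreover have "intersection torus (alpha_cycle ?C c) R.w = - oc * int B"
      using intersection_seg[of "fst c" "snd c" oc 0 len 0] c alpha[OF c(1)] pos_ends north_height[of 0 len]
      by (auto simp: X R.w_def)
    ultimately show ?thesis using R.intersection_alpha_beta[OF c(1)] by simp
  qed
  have inX: "c \<in> R.X" if "c \<in> insert hub A" for c using Sel that unfolding X by blast
  have hubA: "hub \<notin> A"
  proof
    assume "hub \<in> A"
    then obtain j q where jq: "(j, q) \<in> I" "hub = chord j q" using A by blast
    have "q < 2 * p" "1 \<le> j" "j \<le> B" using I[OF jq(1)] by auto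
    from chord_data(3)[OF this] show False using hub_data(3) jq(2) M_pos(1) by simp
  qed
  define ht where "ht c = - north (fst c) (snd c)" for c
  have chA: "pos (snd c) = pos (fst c) + M * 0" if c: "c \<in> A" for c
  proof -
    obtain j q where jq: "(j, q) \<in> I" "c = chord j q" using A[OF c] by blast
    have "q < 2 * p" "1 \<le> j" "j \<le> B" using I[OF jq(1)] by auto
    from chord_data(3)[OF this] show ?thesis using jq(2) by simp
  qed
  have type: "of_type R.X R.ov a = insert hub A" using sel R.crossings_of_type_eq by simp
  have polys: "F_diagram a a torus ?C = (\<Sum>c\<in>A. of_int (R.lam c) * palindrome (ht c))"
    "H_diagram a a torus ?C = (\<Sum>c\<in>A. of_int (R.lam c) * palindrome (int B - ht c)) -
       of_int ((\<Sum>c\<in>A. R.lam c) + 1) * palindrome (int B)"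
  proof -
    have 1: "finite A" using finI by (simp add: A_def)
    have 2: "R.lam hub = 1" using lam[OF inX] hub_data by simp
    have 3: "chord_index R.X R.lam c c' = 0" if "c \<in> A" "c' \<in> A" for c c'
      using idx[OF _ _ chA[OF that(1)] chA[OF that(2)]] inX that by simp
    have 4: "chord_index R.X R.lam c hub = ht c" if "c \<in> A" for c
      using idx[OF _ _ chA[OF that] hub_data(3)] inX that by (simp add: ht_def)
    have 5: "total_index R.X R.lam c = 0" if "c \<in> A" for c using tot[OF _ chA[OF that]] inX that by simp
    have 6: "total_index R.X R.lam hub = int B" using tot[OF _ hub_data(3)] inX by simp
    show "F_diagram a a torus ?C = (\<Sum>c\<in>A. of_int (R.lam c) * palindrome (ht c))"
      "H_diagram a a torus ?C = (\<Sum>c\<in>A. of_int (R.lam c) * palindrome (int B - ht c)) -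
       of_int ((\<Sum>c\<in>A. R.lam c) + 1) * palindrome (int B)"
      using R.polynomials_of_star[OF type 1 hubA 2 3 4 5 6] by blast+
  qed
  have per: "R.lam (chord j q) = (if odd q then 1 else - 1) \<and> ht (chord j q) = int j" if "(j, q) \<in> I" for j q
  proof -
    have jq: "q < 2 * p" "1 \<le> j" "j \<le> B" using I[OF that] by auto
    have "chord j q \<in> insert hub A" using that by (auto simp: A_def)
    from lam[OF inX[OF this]] show ?thesis using chord_data(4-6)[OF jq] by (simp add: ht_def)
  qed
  have sums: "(\<Sum>c\<in>A. of_int (R.lam c) * g (ht c)) = (\<Sum>j=1..B. of_int (n j) * g (int j))" for g :: "int \<Rightarrow> 'b::comm_ring_1"
  proof -
    have "(\<Sum>c\<in>A. of_int (R.lam c) * g (ht c)) = (\<Sum>(j, q)\<in>I. of_int (if odd q then 1 else - 1) * g (int j))"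
      unfolding A_def by (subst sum.reindex[OF injI]) (use per in \<open>auto intro!: sum.cong\<close>)
    also have "\<dots> = (\<Sum>j=1..B. \<Sum>q\<in>strips (n j). of_int (if odd q then 1 else - 1) * g (int j))"
      unfolding I_def by (rule sum.Sigma[symmetric]) (auto simp: finite_strips)
    also have "\<dots> = (\<Sum>j=1..B. of_int (n j) * g (int j))"
      by (intro sum.cong refl) (simp only: sum_distrib_right[symmetric] of_int_sum[symmetric] strips_sum)
    finally show ?thesis .
  qed
  obtain K where K: "K \<in> long_virtual_knots" "surface_realization K torus ?C" "sg1 K \<le> 1"
    using knot_of_surface_diagram[OF sd(1) genus_torus] .
  have "(\<Sum>c\<in>A. R.lam c) = (\<Sum>j=1..B. n j)" using sums[of "\<lambda>_. 1 :: int"] by simp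
  then show thesis
    using that[OF K(1,3)] polynomials_of_realization[OF K(1,2)] polys
      sums[of palindrome] sums[of "\<lambda>k. palindrome (int B - k)"] by simp
qed

end

text \<open>For F the coefficients of \<open>f\<close> are used directly as the numbers of selected
  strips. For H they are used in reverse order of the rows, with one further row for a
  correction.\<close>

lemma palindromic_realizable:
  assumes a: "a = 0 \<or> a = (1::nat)" and f: "eval_one f = 0" "f = t_inverse f"
  shows "\<exists>K\<in>long_virtual_knots. F_poly a a K = f \<and> sg1 K \<le> 1"
    "\<exists>K\<in>long_virtual_knots. H_poly a a K = f \<and> sg1 K \<le> 1"
proof -
  obtain N where N: "\<And>k. k \<in> Poly_Mapping.keys f \<Longrightarrow> nat \<bar>k\<bar> \<le> N"
    using finite_imageI[OF finite_keys, of "\<lambda>k. nat \<bar>k\<bar>" f] unfolding finite_nat_set_iff_bounded_le by blast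
  \<comment> \<open>The increment makes \<open>m\<close> positive, as a zigzag requires, even for a
    constant \<open>f\<close>.\<close>
  define m where "m = N + 1"
  have "Poly_Mapping.keys f \<subseteq> {- int m..int m}" using N by (force simp: m_def)
  from palindromic_expansion[OF f this]
  have ex: "f = (\<Sum>k=1..m. of_int (Poly_Mapping.lookup f (int k)) * palindrome (int k))" .
  define c where "c k = Poly_Mapping.lookup f (int k)" for k :: nat
  \<comment> \<open>Large enough for each coefficient and also for the number \<open>-1\<close>
    minus the sum of all of them, which H needs in its additional row.\<close>
  define p where "p = nat (1 + (\<Sum>k=1..m. \<bar>c k\<bar>))"
  have S: "0 \<le> (\<Sum>k=1..m. \<bar>c k\<bar>)" by (rule sum_nonneg) simp
  have c: "\<bar>c k\<bar> \<le> int p" if "k \<in> {1..m}" for k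
    using member_le_sum[of k "{1..m}" "\<lambda>k. \<bar>c k\<bar>"] that S by (simp add: p_def)
  have total: "\<bar>- 1 - (\<Sum>k=1..m. c k)\<bar> \<le> int p"
  proof -
    have "\<bar>\<Sum>k=1..m. c k\<bar> \<le> (\<Sum>k=1..m. \<bar>c k\<bar>)" by (rule sum_abs)
    then have "\<bar>- 1 - (\<Sum>k=1..m. c k)\<bar> \<le> 1 + (\<Sum>k=1..m. \<bar>c k\<bar>)" by linarith
    also have "\<dots> = int p" using S by (simp add: p_def)
    finally show ?thesis .
  qed
  have "int p = 1 + (\<Sum>k=1..m. \<bar>c k\<bar>)" using S by (simp add: p_def)
  then have p: "1 \<le> p" using S by linarith
  interpret F: zigzag p m by unfold_locales (use p in \<open>simp_all add: m_def\<close>)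
  show "\<exists>K\<in>long_virtual_knots. F_poly a a K = f \<and> sg1 K \<le> 1"
    using F.knot_on_torus[OF a, of c] c ex unfolding c_def by metis
  interpret H: zigzag p "m + 1" by unfold_locales (use p in simp_all)
  \<comment> \<open>Row \<open>j\<close> contributes palindromes of exponent
    \<open>m + 1 - j\<close>, so the coefficients are reversed. The row \<open>m + 1\<close>
    contributes palindromes of exponent 0, which vanish; its number makes the sum of all signs equal
    to -1 and thereby removes the term with \<open>palindrome (m + 1)\<close>.\<close>
  define n where "n j = (if j = m + 1 then - 1 - (\<Sum>k=1..m. c k) else c (m + 1 - j))" for j
  have n: "\<bar>n j\<bar> \<le> int p" if "j \<in> {1..m + 1}" for j
  proof (cases "j = m + 1")
    case True
    then show ?thesis using total by (simp add: n_def)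
  next
    case False
    then have "m + 1 - j \<in> {1..m}" using that by auto
    then show ?thesis using c False by (simp add: n_def)
  qed
  obtain K where K: "K \<in> long_virtual_knots" "sg1 K \<le> 1"
    "H_poly a a K = (\<Sum>j=1..m + 1. of_int (n j) * palindrome (int (m + 1) - int j)) -
       of_int ((\<Sum>j=1..m + 1. n j) + 1) * palindrome (int (m + 1))"
    using H.knot_on_torus[OF a, of n] n by blast
  have rev: "(\<Sum>j=1..m. g (m + 1 - j)) = (\<Sum>k=1..m. g k)" for g :: "nat \<Rightarrow> 'b::comm_monoid_add"
    by (rule sum.reindex_bij_witness[of _ "\<lambda>k. m + 1 - k" "\<lambda>j. m + 1 - j"]) auto
  have "(\<Sum>j=1..m. n j) = (\<Sum>j=1..m. c (m + 1 - j))"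
    by (intro sum.cong) (auto simp: n_def)
  then have "(\<Sum>j=1..m + 1. n j) = - 1" using rev[of c] by (simp add: n_def)
  moreover have "(\<Sum>j=1..m + 1. of_int (n j) * palindrome (int (m + 1) - int j)) =
      (\<Sum>j=1..m. of_int (n j) * palindrome (int (m + 1) - int j))"
    by (simp add: palindrome_0)
  moreover have "\<dots> = (\<Sum>j=1..m. of_int (c (m + 1 - j)) * palindrome (int (m + 1 - j)))"
    by (intro sum.cong refl) (simp add: n_def of_nat_diff)
  moreover have "\<dots> = f" using rev[of "\<lambda>k. of_int (c k) * palindrome (int k)"] ex by (simp add: c_def)
  ultimately have "H_poly a a K = f" using K(3) by simp
  then show "\<exists>K\<in>long_virtual_knots. H_poly a a K = f \<and> sg1 K \<le> 1" using K by blast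
qed

lemma knot_polynomials_symmetric:
  assumes "K \<in> long_virtual_knots"
  shows "eval_one (F_poly a a K) = 0 \<and> F_poly a a K = t_inverse (F_poly a a K)"
    "eval_one (H_poly a a K) = 0 \<and> H_poly a a K = t_inverse (H_poly a a K)"
proof -
  obtain S C where "surface_realization K S C" "surface_diagram S C" using realization_of_knot[OF assms] .
  then interpret realization S C by unfold_locales
  show "eval_one (F_poly a a K) = 0 \<and> F_poly a a K = t_inverse (F_poly a a K)"
    "eval_one (H_poly a a K) = 0 \<and> H_poly a a K = t_inverse (H_poly a a K)"
    using polynomials_of_realization[OF assms \<open>surface_realization K S C\<close>] diagram_polynomials_symmetric by simp_all
qed

theorem theorem7p1:
  fixes f :: laurent
  shows "\<forall>P\<in>{F_poly 0 0, F_poly 1 1, H_poly 0 0, H_poly 1 1}.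
    ((\<exists>K\<in>long_virtual_knots. P K = f) \<longleftrightarrow>
     (\<exists>K'\<in>long_virtual_knots. P K' = f \<and> sg1 K' \<le> 1)) \<and>
    ((\<exists>K\<in>long_virtual_knots. P K = f) \<longleftrightarrow>
     eval_one f = 0 \<and> f = t_inverse f)"
proof
  fix P assume P: "P \<in> {F_poly 0 0, F_poly 1 1, H_poly 0 0, H_poly 1 1}"
  have "eval_one (P K) = 0 \<and> P K = t_inverse (P K)" if "K \<in> long_virtual_knots" for K
    using P knot_polynomials_symmetric[OF that] by blast
  moreover have "\<exists>K\<in>long_virtual_knots. P K = f \<and> sg1 K \<le> 1" if "eval_one f = 0 \<and> f = t_inverse f"
    using P palindromic_realizable[of 0 f] palindromic_realizable[of 1 f] that by auto
  ultimately show "((\<exists>K\<in>long_virtual_knots. P K = f) \<longleftrightarrow>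
     (\<exists>K'\<in>long_virtual_knots. P K' = f \<and> sg1 K' \<le> 1)) \<and>
    ((\<exists>K\<in>long_virtual_knots. P K = f) \<longleftrightarrow> eval_one f = 0 \<and> f = t_inverse f)"
    by blast
qed

end
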